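(* Let $X\subseteq \mathbb{P}=\mathbb{P}^N_{\mathbb{C}}$ be a smooth complex projective variety of dimension $2n$, embedded via a complete linear system, and assume that its dual variety $X^{\vee}\subseteq \mathbb{P}^{\vee}$ is a hypersurface. Let $H\in X^{\vee}$ be such that the singular locus $\Delta:=\mathrm{Sing}(X\cap H)$ consists of exactly $\delta$ points, all of which are ordinary double points (nodes) of $X\cap H$. Assume that $\Delta$ imposes independent conditions on the linear system of hyperplane sections of $X$, that is, $$H^1(X,\mathcal{I}_{\Delta,X}(1))=0 .$$ Then for every sufficiently small ball $B\subseteq \mathbb{P}^{\vee}$ containing $H$: (1) $B\cap X^{\vee}$ is a divisor of $B$ with normal crossings; (2) for every integer $r$ with $1\le r\leq\delta$, $B\cap X^{\vee}_r$ is non-empty and smooth of pure dimension $N-r$. In particular, $X^{\vee}_{\delta}$ is smooth and has the expected dimension at $H$.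
   Context: Points of the dual projective space $\mathbb{P}^{\vee}$ are hyperplanes of $\mathbb{P}$. The dual variety $X^{\vee}\subseteq\mathbb{P}^{\vee}$ is the set of hyperplanes $H$ containing the embedded tangent space $TX_p$ for some $p\in X$, equivalently the set of $H$ such that $X\cap H$ is singular. $\mathcal{I}_{\Delta,X}\subset\mathcal{O}_X$ is the ideal sheaf of the reduced finite set $\Delta$ in $X$, and $\mathcal{I}_{\Delta,X}(1)=\mathcal{I}_{\Delta,X}\otimes\mathcal{O}_X(1)$, where $\mathcal{O}_X(1)$ is the hyperplane bundle; embedded via a complete linear system means that $X\subseteq\mathbb{P}$ is the embedding given by the complete linear system of $\mathcal{O}_X(1)$. For an integer $r\le N$, $X^{\vee}_r\subseteq X^{\vee}$ denotes the locally closed Zariski subset consisting of all hyperplanes $H$ such that $\mathrm{Sing}(X\cap H)$ consists of exactly $r$ ordinary double points (nodes). An irreducible component of $X^{\vee}_r$ has the expected dimension if its dimension is $N-r$. For $H\in X^{\vee}_r$, one says that $X^{\vee}_r$ has the expected dimension at $H$ if $H$ belongs to a component of $X^\vee_r$ having the expected dimension and to no component of bigger dimension. Balls are in the classical (analytic) topology. *)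

theory Defs
  imports "HOL-Analysis.Analysis" "HOL-Library.Extended_Nat"
begin

section \<open>Complex projective space\<close>

text \<open>
  A point of \<open>'n proj\<close>, complex projective space of dimension \<open>N = CARD('n)\<close>, is a line through
  the origin of \<open>\<complex>\<^sup>N\<^sup>+\<^sup>1\<close>; the \<open>N + 1\<close> homogeneous coordinates are indexed by \<open>'n option\<close>.
  The dual projective space is the same type: a hyperplane is represented by the line spanned by
  its coefficient vector.
\<close>

typedef ('n::finite) proj =
  "{L :: (complex ^ 'n option) set. \<exists>v. v \<noteq> 0 \<and> L = range (\<lambda>c. c *s v)}"
  morphisms line Abs_proj
proof -
  have "(axis None 1 :: complex ^ 'n option) \<noteq> 0"
    by (simp add: axis_eq_0_iff)
  then show ?thesis by blast
qed

text \<open>Meaningful for nonzero vectors only.\<close>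

definition proj_point :: "complex ^ ('n::finite) option \<Rightarrow> 'n proj" where
  "proj_point v = Abs_proj (range (\<lambda>c. c *s v))"

text \<open>The set of nonzero vectors over a set of points.\<close>

definition cone :: "('n::finite) proj set \<Rightarrow> (complex ^ 'n option) set" where
  "cone S = {v. v \<noteq> 0 \<and> proj_point v \<in> S}"

text \<open>
  The type class topology on projective space is the classical one, i.e. the quotient topology.
\<close>

instantiation proj :: (finite) topological_space
begin

definition open_proj :: "'a proj set \<Rightarrow> bool" where
  "open_proj U \<longleftrightarrow> open (cone U)"

instance
proof
  have "cone (UNIV :: 'a proj set) = - {0}"
    by (auto simp: cone_def)
  then show "open (UNIV :: 'a proj set)"
    by (simp add: open_proj_def open_Compl)
next
  fix S T :: "'a proj set"
  assume "open S" "open T"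
  moreover have "cone (S \<inter> T) = cone S \<inter> cone T"
    by (auto simp: cone_def)
  ultimately show "open (S \<inter> T)"
    by (simp add: open_proj_def open_Int)
next
  fix K :: "'a proj set set"
  assume "\<forall>S\<in>K. open S"
  moreover have "cone (\<Union>K) = (\<Union>S\<in>K. cone S)"
    by (auto simp: cone_def)
  ultimately show "open (\<Union>K)"
    by (auto simp: open_proj_def intro!: open_UN)
qed

end

text \<open>The linear hyperplane of \<open>\<complex>\<^sup>N\<^sup>+\<^sup>1\<close> whose coefficient vector spans \<open>line H\<close>.\<close>

definition hyp :: "('n::finite) proj \<Rightarrow> (complex ^ 'n option) set" where
  "hyp H = {w. \<forall>h\<in>line H. (\<Sum>i\<in>UNIV. h $ i * w $ i) = 0}"


section \<open>Zariski topology and dimension\<close>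

text \<open>
  Homogeneous polynomials of degree \<open>d\<close>, as functions (the field is infinite). The exponent
  vectors \<open>\<alpha>\<close> of total degree \<open>d\<close> form a finite set.
\<close>

definition forms :: "nat \<Rightarrow> (complex ^ ('m::finite) \<Rightarrow> complex) set" where
  "forms d = {f. \<exists>c. f = (\<lambda>x. \<Sum>\<alpha> | (\<Sum>i\<in>UNIV. \<alpha> i) = d. c \<alpha> * (\<Prod>i\<in>UNIV. x $ i ^ \<alpha> i))}"

definition zeros :: "(complex ^ ('n::finite) option \<Rightarrow> complex) \<Rightarrow> 'n proj set" where
  "zeros f = {p. \<forall>v\<in>line p - {0}. f v = 0}"

definition zariski :: "('n::finite) proj topology" where
  "zariski = topology_generated_by {- zeros f | f d. f \<in> forms d}"

definition irreducible_in :: "'a topology \<Rightarrow> 'a set \<Rightarrow> bool" where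
  "irreducible_in T Z \<longleftrightarrow> Z \<noteq> {} \<and> Z \<subseteq> topspace T \<and>
     (\<forall>A B. closedin T A \<and> closedin T B \<and> Z \<subseteq> A \<union> B \<longrightarrow> Z \<subseteq> A \<or> Z \<subseteq> B)"

definition irreducible_components :: "'a topology \<Rightarrow> 'a set \<Rightarrow> 'a set set" where
  "irreducible_components T S = {Z. Z \<subseteq> S \<and> irreducible_in T Z \<and>
     (\<forall>Z'. Z' \<subseteq> S \<and> irreducible_in T Z' \<and> Z \<subseteq> Z' \<longrightarrow> Z' = Z)}"

text \<open>
  Krull dimension: the supremum of the lengths of chains of irreducible relatively closed subsets.
  The supremum of the empty set being \<open>0\<close> in \<^typ>\<open>enat\<close>, the value for \<open>S = {}\<close> is meaningless.
\<close>

definition krull_dim :: "'a topology \<Rightarrow> 'a set \<Rightarrow> enat" where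
  "krull_dim T S = Sup {enat k | k. \<exists>Z :: nat \<Rightarrow> 'a set.
     (\<forall>i\<le>k. irreducible_in T (Z i) \<and> closedin (subtopology T S) (Z i)) \<and>
     (\<forall>i<k. Z i \<subset> Z (Suc i))}"

definition hypersurface :: "('n::finite) proj set \<Rightarrow> bool" where
  "hypersurface S \<longleftrightarrow> (\<exists>d f. 1 \<le> d \<and> f \<in> forms d \<and> f \<noteq> (\<lambda>_. 0) \<and> S = zeros f)"


section \<open>Smooth projective varieties, hyperplane sections and the dual variety\<close>

text \<open>
  The linear subspace of \<open>\<complex>\<^sup>N\<^sup>+\<^sup>1\<close> whose projectivization is the embedded tangent space of \<open>X\<close> at
  \<open>p\<close>; its dimension is one more than that of the Zariski tangent space.
\<close>

definition tangent :: "('n::finite) proj set \<Rightarrow> 'n proj \<Rightarrow> (complex ^ 'n option) set" where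
  "tangent X p = {w. \<forall>d. \<forall>f\<in>forms d. X \<subseteq> zeros f \<longrightarrow>
     (\<forall>v\<in>line p - {0}. frechet_derivative f (at v) w = 0)}"

definition projective_variety :: "('n::finite) proj set \<Rightarrow> bool" where
  "projective_variety X \<longleftrightarrow> closedin zariski X \<and> irreducible_in zariski X"

definition smooth_projective_variety :: "('n::finite) proj set \<Rightarrow> bool" where
  "smooth_projective_variety X \<longleftrightarrow> projective_variety X \<and>
     (\<forall>p\<in>X. enat (vec.dim (tangent X p)) = krull_dim zariski X + 1)"

definition dual_variety :: "('n::finite) proj set \<Rightarrow> 'n proj set" where
  "dual_variety X = {H. \<exists>p\<in>X. tangent X p \<subseteq> hyp H}"

text \<open>
  Singular points of the hyperplane section \<open>X \<inter> H\<close>, regarded as a scheme: its embedded tangent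
  space at \<open>p\<close> is cut out by \<open>H\<close> in that of \<open>X\<close>, and \<open>p\<close> is singular if this has dimension greater
  than \<open>dim X - 1\<close>, the dimension of \<open>X \<inter> H\<close> (for \<open>X\<close> not contained in \<open>H\<close>). The linear
  subspace measured here has one dimension more.
\<close>

definition sing_section :: "('n::finite) proj set \<Rightarrow> 'n proj \<Rightarrow> 'n proj set" where
  "sing_section X H =
     {p\<in>X. line p \<subseteq> hyp H \<and> krull_dim zariski X < enat (vec.dim (tangent X p \<inter> hyp H))}"


section \<open>Local analytic geometry of projective space\<close>

text \<open>Holomorphic maps in several variables; used for open sets \<open>V\<close>.\<close>

definition holo_on :: "(complex ^ ('a::finite) \<Rightarrow> complex ^ ('b::finite)) \<Rightarrow> (complex ^ 'a) set \<Rightarrow> bool"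
  where "holo_on f V \<longleftrightarrow>
     (\<forall>x\<in>V. \<exists>A. (f has_derivative A) (at x) \<and> (\<forall>c w. A (c *s w) = c *s A w))"

text \<open>
  Biholomorphic coordinates \<open>z\<close> from the open set \<open>U\<close> onto an open subset of \<open>\<complex>\<^sup>N\<close>. The inverse is
  given by a holomorphic lift \<open>s\<close> to nonzero vectors of \<open>\<complex>\<^sup>N\<^sup>+\<^sup>1\<close>; such a lift always exists after
  shrinking \<open>U\<close>.
\<close>

definition coord_chart ::
  "('n::finite) proj set \<Rightarrow> ('n proj \<Rightarrow> complex ^ 'n) \<Rightarrow> (complex ^ 'n \<Rightarrow> complex ^ 'n option) \<Rightarrow> bool"
  where "coord_chart U z s \<longleftrightarrow>
     open U \<and> open (z ` U) \<and>
     holo_on (\<lambda>v. z (proj_point v)) (cone U) \<and>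
     holo_on s (z ` U) \<and>
     (\<forall>p\<in>U. s (z p) \<noteq> 0 \<and> proj_point (s (z p)) = p)"

definition coordinate_ball :: "('n::finite) proj set \<Rightarrow> bool" where
  "coordinate_ball B \<longleftrightarrow> (\<exists>U z s c \<rho>. coord_chart U z s \<and> 0 < \<rho> \<and> ball c \<rho> \<subseteq> z ` U \<and>
     B = {p\<in>U. z p \<in> ball c \<rho>})"

text \<open>In the coordinates \<open>z\<close>, the set \<open>S\<close> is the coordinate subspace with free coordinates \<open>I\<close>.\<close>

definition adapted_chart ::
  "('n::finite) proj set \<Rightarrow> 'n proj set \<Rightarrow> ('n proj \<Rightarrow> complex ^ 'n) \<Rightarrow>
   (complex ^ 'n \<Rightarrow> complex ^ 'n option) \<Rightarrow> 'n set \<Rightarrow> bool"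
  where "adapted_chart S U z s I \<longleftrightarrow>
     coord_chart U z s \<and> S \<inter> U = {q\<in>U. \<forall>i. i \<notin> I \<longrightarrow> z q $ i = 0}"

text \<open>\<open>S\<close> is a complex submanifold of dimension \<open>d\<close> near \<open>q\<close>.\<close>

definition smooth_at :: "('n::finite) proj set \<Rightarrow> nat \<Rightarrow> 'n proj \<Rightarrow> bool" where
  "smooth_at S d q \<longleftrightarrow> q \<in> S \<and> (\<exists>U z s I. adapted_chart S U z s I \<and> q \<in> U \<and> card I = d)"

definition smooth_of_pure_dim :: "('n::finite) proj set \<Rightarrow> nat \<Rightarrow> bool" where
  "smooth_of_pure_dim S d \<longleftrightarrow> (\<forall>q\<in>S. smooth_at S d q)"

text \<open>
  Around every point \<open>q\<close> of \<open>B\<close> there are coordinates centred at \<open>q\<close> in which \<open>D\<close> is the union of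
  the coordinate hyperplanes with index in \<open>J\<close>. The case \<open>J = {}\<close> occurs exactly off \<open>D\<close>, so that
  \<open>D\<close> is closed in \<open>B\<close>.
\<close>

definition normal_crossings_divisor :: "('n::finite) proj set \<Rightarrow> 'n proj set \<Rightarrow> bool" where
  "normal_crossings_divisor B D \<longleftrightarrow> D \<subseteq> B \<and>
     (\<forall>q\<in>B. \<exists>U z s J. coord_chart U z s \<and> q \<in> U \<and> U \<subseteq> B \<and> z q = 0 \<and>
        D \<inter> U = {p\<in>U. \<exists>j\<in>J. z p $ j = 0})"

definition hessian :: "(complex ^ ('m::finite) \<Rightarrow> complex) \<Rightarrow> complex ^ 'm \<Rightarrow> complex ^ 'm \<Rightarrow> complex ^ 'm \<Rightarrow> complex"
  where "hessian g x u v = frechet_derivative (\<lambda>y. frechet_derivative g (at y) u) (at x) v"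

text \<open>
  Ordinary double points of \<open>X \<inter> H\<close>: singular points at which the local equation \<open>g\<close> of the
  hyperplane section, in local coordinates \<open>(z\<^sub>i)\<close>, \<open>i \<in> I\<close>, of \<open>X\<close>, has nondegenerate Hessian.
\<close>

definition node :: "('n::finite) proj set \<Rightarrow> 'n proj \<Rightarrow> 'n proj \<Rightarrow> bool" where
  "node X H p \<longleftrightarrow> p \<in> sing_section X H \<and>
     (\<exists>U z s I. adapted_chart X U z s I \<and> p \<in> U \<and>
       (\<forall>h\<in>line H - {0}.
          let g = (\<lambda>x. \<Sum>i\<in>UNIV. h $ i * s x $ i);
              E = {u. \<forall>i. i \<notin> I \<longrightarrow> u $ i = 0}
          in \<forall>u\<in>E - {0}. \<exists>v\<in>E. hessian g (z p) u v \<noteq> 0))"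

text \<open>The locus of hyperplanes \<open>H\<close> such that \<open>Sing (X \<inter> H)\<close> consists of exactly \<open>r\<close> nodes.\<close>

definition nodal_locus :: "('n::finite) proj set \<Rightarrow> nat \<Rightarrow> 'n proj set" where
  "nodal_locus X r = {H \<in> dual_variety X.
     finite (sing_section X H) \<and> card (sing_section X H) = r \<and> (\<forall>p\<in>sing_section X H. node X H p)}"

definition expected_dimension_at :: "('n::finite) proj set \<Rightarrow> nat \<Rightarrow> 'n proj \<Rightarrow> bool" where
  "expected_dimension_at X r H \<longleftrightarrow>
     (\<exists>Z\<in>irreducible_components zariski (nodal_locus X r).
        H \<in> Z \<and> krull_dim zariski Z = enat (CARD('n) - r)) \<and>
     (\<forall>Z\<in>irreducible_components zariski (nodal_locus X r).
        H \<in> Z \<longrightarrow> krull_dim zariski Z \<le> enat (CARD('n) - r))"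


section \<open>Twisting sheaves and Cech cohomology\<close>

text \<open>
  Sections of \<open>\<O>\<^sub>X(k)\<close> over a Zariski open subset \<open>W\<close> of \<open>X\<close>, as functions on the cone over \<open>W\<close>
  that are locally quotients of forms whose degrees differ by \<open>k\<close>. They are extended by \<open>0\<close>
  outside the cone, so that equal sections are equal functions. In particular \<open>k = 0\<close> gives the
  structure sheaf.
\<close>

definition twisted_sections ::
  "('n::finite) proj set \<Rightarrow> nat \<Rightarrow> 'n proj set \<Rightarrow> (complex ^ 'n option \<Rightarrow> complex) set"
  where "twisted_sections X k W = {\<sigma>. (\<forall>v. v \<notin> cone W \<longrightarrow> \<sigma> v = 0) \<and>
     (\<forall>p\<in>W. \<exists>W' d. \<exists>F\<in>forms (d + k). \<exists>G\<in>forms d.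
        openin (subtopology zariski X) W' \<and> p \<in> W' \<and> W' \<subseteq> W \<and>
        (\<forall>v\<in>cone W'. G v \<noteq> 0 \<and> \<sigma> v = F v / G v))}"

text \<open>The embedding is given by all sections: restriction from \<open>H\<^sup>0(\<P>, \<O>(1))\<close> to
  \<open>H\<^sup>0(X, \<O>\<^sub>X(1))\<close> is an isomorphism.\<close>

definition complete_linear_system :: "('n::finite) proj set \<Rightarrow> bool" where
  "complete_linear_system X \<longleftrightarrow>
     bij_betw (\<lambda>l v. if v \<in> cone X then l v else 0) (forms 1) (twisted_sections X 1 X)"

definition ideal_sections ::
  "('n::finite) proj set \<Rightarrow> 'n proj set \<Rightarrow> 'n proj set \<Rightarrow> (complex ^ 'n option \<Rightarrow> complex) set"
  where "ideal_sections X \<Delta> W = {a\<in>twisted_sections X 0 W. \<forall>v\<in>cone (W \<inter> \<Delta>). a v = 0}"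

text \<open>
  \<open>\<I>\<^sub>\<Delta>\<^sub>,\<^sub>X \<otimes> \<O>\<^sub>X(k)\<close>, realized as the subsheaf of \<open>\<O>\<^sub>X(k)\<close> of local products: \<open>\<O>\<^sub>X(k)\<close> being invertible,
  multiplication is injective on the tensor product and every local section is a single product.
\<close>

definition twisted_ideal_sections ::
  "('n::finite) proj set \<Rightarrow> 'n proj set \<Rightarrow> nat \<Rightarrow> 'n proj set \<Rightarrow> (complex ^ 'n option \<Rightarrow> complex) set"
  where "twisted_ideal_sections X \<Delta> k W = {\<sigma>. (\<forall>v. v \<notin> cone W \<longrightarrow> \<sigma> v = 0) \<and>
     (\<forall>p\<in>W. \<exists>W'. openin (subtopology zariski X) W' \<and> p \<in> W' \<and> W' \<subseteq> W \<and>
        (\<exists>a\<in>ideal_sections X \<Delta> W'. \<exists>t\<in>twisted_sections X k W'. \<forall>v\<in>cone W'. \<sigma> v = a v * t v))}"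

definition zariski_cover :: "('n::finite) proj set \<Rightarrow> 'n proj set set \<Rightarrow> bool" where
  "zariski_cover X \<U> \<longleftrightarrow> (\<forall>A\<in>\<U>. openin (subtopology zariski X) A) \<and> \<Union>\<U> = X"

text \<open>Cech cochains of a sheaf \<open>F\<close> of functions on cones, for covers indexed by themselves.\<close>

definition cech_cocycle ::
  "('n::finite proj set \<Rightarrow> (complex ^ 'n option \<Rightarrow> complex) set) \<Rightarrow> 'n proj set set \<Rightarrow>
   ('n proj set \<Rightarrow> 'n proj set \<Rightarrow> complex ^ 'n option \<Rightarrow> complex) \<Rightarrow> bool"
  where "cech_cocycle F \<U> c \<longleftrightarrow> (\<forall>A\<in>\<U>. \<forall>B\<in>\<U>. c A B \<in> F (A \<inter> B)) \<and>
     (\<forall>A\<in>\<U>. \<forall>B\<in>\<U>. \<forall>C\<in>\<U>. \<forall>v\<in>cone (A \<inter> B \<inter> C). c B C v - c A C v + c A B v = 0)"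

text \<open>
  \<open>H\<^sup>1(X, F) = 0\<close>. The first Cech cohomology is the direct limit of the groups of the covers (and
  agrees with the derived functor), so it vanishes iff every cocycle \<open>c\<close> becomes a coboundary
  after passing to some refinement \<open>(\<V>, \<tau>)\<close>.
\<close>

definition H1_vanishes ::
  "('n::finite) proj set \<Rightarrow> ('n proj set \<Rightarrow> (complex ^ 'n option \<Rightarrow> complex) set) \<Rightarrow> bool"
  where "H1_vanishes X F \<longleftrightarrow> (\<forall>\<U> c. zariski_cover X \<U> \<and> cech_cocycle F \<U> c \<longrightarrow>
     (\<exists>\<V> \<tau> b. zariski_cover X \<V> \<and> (\<forall>A\<in>\<V>. \<tau> A \<in> \<U> \<and> A \<subseteq> \<tau> A) \<and> (\<forall>A\<in>\<V>. b A \<in> F A) \<and>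
        (\<forall>A\<in>\<V>. \<forall>B\<in>\<V>. \<forall>v\<in>cone (A \<inter> B). c (\<tau> A) (\<tau> B) v = b B v - b A v)))"

end

theory Submission
  imports "HOL-Complex_Analysis.Complex_Analysis" "HOL-Library.Function_Algebras" Defs
begin

no_notation fps_nth (infixl "$" 75)

text \<open>
  Near a node \<open>p\<close> of \<open>X \<inter> H\<close> the local equation of \<open>X \<inter> [h]\<close> has a unique critical point \<open>[\<sigma> p h]\<close>, by the
  nondegeneracy of the Hessian, and \<open>[h]\<close> is tangent to \<open>X\<close> near \<open>p\<close> iff \<open>\<phi> p h = h \<cdot> \<sigma> p h\<close> vanishes. By
  compactness the singular points of \<open>X \<inter> [h]\<close> stay near \<open>\<Delta>\<close>, so \<open>X\<^sup>\<or>\<close> is the union of the hypersurfaces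
  \<open>\<phi> p = 0\<close> near \<open>H\<close>, and exactly \<open>r\<close> of them pass through a point of \<open>X\<^sup>\<or>\<^sub>r\<close>. The derivative of \<open>\<phi> p\<close> at \<open>h\<close> is
  \<open>k \<mapsto> k \<cdot> \<sigma> p h\<close>, since \<open>h\<close> annihilates the tangent space. As \<open>\<Delta>\<close> imposes independent conditions, lifts of
  its points are linearly independent, and the \<open>\<phi> p\<close> are part of a coordinate system at \<open>H\<close>.

  For the expected dimension, let \<open>F\<close> be an equation of \<open>X\<^sup>\<or>\<close> and \<open>m\<close> its generic multiplicity along \<open>X\<^sup>\<or>\<close>. It is
  attained on each branch because the conormal variety is irreducible. Hence \<open>F\<close> has multiplicity at least
  \<open>m * \<delta>\<close> on \<open>X\<^sup>\<or>\<^sub>\<delta>\<close> and exactly \<open>m * \<delta>\<close> at \<open>H\<close>, with a leading form vanishing on the tangent hyperplanes of the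
  branches. The derivatives of \<open>F\<close> of order \<open>m * \<delta> - 1\<close> vanish on the Zariski closure of a component
  of \<open>X\<^sup>\<or>\<^sub>\<delta>\<close>, so its tangent space at \<open>H\<close> lies in all these hyperplanes.
\<close>

text \<open>The hypotheses are algebraic (forms, Zariski chains), the argument on branches is
  analytic. The bridge is \<open>vanishing_on_germ\<close>: by Krull's intersection theorem a form
  that vanishes on an analytic germ cut out by forms with independent differentials vanishes on the
  whole irreducible set. So \<open>X\<close> lies in the Zariski closure of its germ, and comparing
  lengths of chains makes the two equal when \<open>X\<close> is smooth. The same comparison bounds
  the length of chains by tangent spaces at any point of any irreducible set, and this is how Krull
  dimensions are bounded from above. The obstacle is the upper bound for components of the nodal
  locus. That the locus is a submanifold near \<open>H\<close> says nothing about chains in the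
  Zariski closure of a component, which might acquire further branches at \<open>H\<close>. Needed
  are forms vanishing on the whole locus whose differentials at \<open>H\<close> cut down the
  tangent space, but the local equations \<open>dotp h (\<sigma> p h)\<close> are only holomorphic.
  The Taylor coefficients of an equation \<open>F\<close> of the dual variety supply such forms.
  Since \<open>F\<close> need not be reduced, its generic multiplicity enters.\<close>

abbreviation fd :: "('a::real_normed_vector => 'b::real_normed_vector) => 'a => 'a => 'b" where
  "fd f x \<equiv> frechet_derivative f (at x)"

section \<open>Homogeneous forms\<close>

lemma finite_exponents: "finite {\<alpha> :: 'm::finite => nat. (\<Sum>i\<in>UNIV. \<alpha> i) = d}"
proof (rule finite_subset)
  show "{\<alpha> :: 'm => nat. (\<Sum>i\<in>UNIV. \<alpha> i) = d} \<subseteq> PiE UNIV (\<lambda>_. {..d})"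
    by (auto simp: PiE_iff intro!: member_le_sum)
  show "finite (PiE (UNIV :: 'm set) (\<lambda>_. {..d}))" by (intro finite_PiE) auto
qed

lemma forms_const [intro]: "(\<lambda>x. c) \<in> forms 0"
proof -
  have eq: "{\<alpha> :: 'm::finite => nat. (\<Sum>i\<in>UNIV. \<alpha> i) = 0} = {\<lambda>_. 0}" by auto
  show ?thesis unfolding forms_def mem_Collect_eq
    by (rule exI[of _ "\<lambda>_. c"]) (simp only: eq, simp)
qed

lemma forms_zero [intro]: "(\<lambda>x. 0) \<in> forms d"
  unfolding forms_def by (auto intro!: exI[of _ "\<lambda>_. 0"])

lemma forms_add [intro]:
  assumes "f \<in> forms d" "g \<in> forms d" shows "(\<lambda>x. f x + g x) \<in> forms d"
proof -
  obtain a b where "f = (\<lambda>x. \<Sum>\<alpha> | (\<Sum>i\<in>UNIV. \<alpha> i) = d. a \<alpha> * (\<Prod>i\<in>UNIV. x $ i ^ \<alpha> i))"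
    "g = (\<lambda>x. \<Sum>\<alpha> | (\<Sum>i\<in>UNIV. \<alpha> i) = d. b \<alpha> * (\<Prod>i\<in>UNIV. x $ i ^ \<alpha> i))"
    using assms unfolding forms_def by auto
  then show ?thesis unfolding forms_def
    by (auto intro!: exI[of _ "\<lambda>\<alpha>. a \<alpha> + b \<alpha>"] simp: algebra_simps sum.distrib)
qed

lemma forms_coord [intro]:
  fixes f :: "complex ^ 'm::finite => complex"
  assumes "f \<in> forms d" shows "(\<lambda>x. x $ i * f x) \<in> forms (Suc d)"
proof -
  obtain a where a: "f = (\<lambda>x. \<Sum>\<alpha> | (\<Sum>i\<in>UNIV. \<alpha> i) = d. a \<alpha> * (\<Prod>i\<in>UNIV. x $ i ^ \<alpha> i))"
    using assms unfolding forms_def by auto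
  let ?up = "\<lambda>\<alpha>. \<alpha>(i := Suc (\<alpha> i))"
  let ?A = "{\<alpha> :: 'm => nat. (\<Sum>i\<in>UNIV. \<alpha> i) = d}" and ?B = "{\<alpha> :: 'm => nat. (\<Sum>i\<in>UNIV. \<alpha> i) = Suc d}"
  have s: "(\<Sum>j\<in>UNIV. ?up \<alpha> j) = Suc (\<Sum>j\<in>UNIV. \<alpha> j)" for \<alpha> :: "'m => nat"
    by (subst (1 2) sum.remove[of UNIV i]) auto
  have p: "(\<Prod>j\<in>UNIV. x $ j ^ ?up \<alpha> j) = x $ i * (\<Prod>j\<in>UNIV. x $ j ^ \<alpha> j)" for \<alpha> :: "'m => nat" and x :: "complex^'m"
    by (subst (1 2) prod.remove[of UNIV i]) (auto simp: mult_ac)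
  have inj: "inj_on ?up ?A"
  proof (rule inj_onI)
    fix \<alpha> \<beta> assume "?up \<alpha> = ?up \<beta>"
    then have "\<And>j. ?up \<alpha> j = ?up \<beta> j" by metis
    then show "\<alpha> = \<beta>" by (intro ext) (metis fun_upd_apply nat.inject)
  qed
  \<comment> \<open>Coefficients are transported along the injective shift \<open>?up\<close>;
    exponents outside its range, those not involving coordinate \<open>i\<close>, get 0.\<close>
  define c where "c \<beta> = (if \<beta> \<in> ?up ` ?A then a (\<beta>(i := \<beta> i - 1)) else 0)" for \<beta>
  have "(\<lambda>x. x $ i * f x) x = (\<Sum>\<beta>\<in>?B. c \<beta> * (\<Prod>j\<in>UNIV. x $ j ^ \<beta> j))" for x
  proof -
    have "(\<Sum>\<beta>\<in>?B. c \<beta> * (\<Prod>j\<in>UNIV. x $ j ^ \<beta> j)) = (\<Sum>\<beta>\<in>?up ` ?A. c \<beta> * (\<Prod>j\<in>UNIV. x $ j ^ \<beta> j))"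
      by (rule sum.mono_neutral_right) (use s finite_exponents in \<open>auto simp: c_def simp del: fun_upd_apply\<close>)
    also have "\<dots> = (\<Sum>\<alpha>\<in>?A. c (?up \<alpha>) * (\<Prod>j\<in>UNIV. x $ j ^ ?up \<alpha> j))"
      by (rule sum.reindex_cong[OF inj]) auto
    also have "\<dots> = (\<Sum>\<alpha>\<in>?A. x $ i * (a \<alpha> * (\<Prod>j\<in>UNIV. x $ j ^ \<alpha> j)))"
    proof (rule sum.cong, rule refl)
      fix \<alpha> assume "\<alpha> \<in> ?A"
      then have "c (?up \<alpha>) = a \<alpha>" unfolding c_def by (subst if_P) (auto simp: fun_upd_idem)
      then show "c (?up \<alpha>) * (\<Prod>j\<in>UNIV. x $ j ^ ?up \<alpha> j) = x $ i * (a \<alpha> * (\<Prod>j\<in>UNIV. x $ j ^ \<alpha> j))"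
        by (simp only: p mult_ac)
    qed
    finally show ?thesis by (simp add: a sum_distrib_left)
  qed
  then show ?thesis unfolding forms_def by blast
qed

lemma forms_sum [intro]:
  assumes "\<And>i. i \<in> I ==> f i \<in> forms d" shows "(\<lambda>x. \<Sum>i\<in>I. f i x) \<in> forms d"
  using assms by (induction I rule: infinite_finite_induct) auto

text \<open>A monomial arises from a constant by multiplying with one coordinate at a time. This
  spares nearly all later arguments the exponent vectors.\<close>

lemma forms_induct [consumes 1, case_names const coord add]:
  fixes f :: "complex ^ 'm::finite => complex"
  assumes f: "f \<in> forms d"
    and const: "\<And>c. P 0 (\<lambda>x. c)"
    and coord: "\<And>d f i. f \<in> forms d ==> P d f ==> P (Suc d) (\<lambda>x. x $ i * f x)"
    and add: "\<And>d f g. f \<in> forms d ==> g \<in> forms d ==> P d f ==> P d g ==> P d (\<lambda>x. f x + g x)"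
  shows "P d f"
proof -
  have mono: "(\<lambda>x. c * (\<Prod>i\<in>UNIV. x $ i ^ \<alpha> i)) \<in> forms d \<and> P d (\<lambda>x. c * (\<Prod>i\<in>UNIV. x $ i ^ \<alpha> i))"
    if "(\<Sum>i\<in>UNIV. \<alpha> i) = d" for c and \<alpha> :: "'m => nat" and d
    using that
  proof (induction d arbitrary: \<alpha>)
    case 0
    then have "\<And>i. \<alpha> i = 0" by auto
    then show ?case using const by auto
  next
    case (Suc d)
    then obtain i where i: "\<alpha> i > 0" by (metis finite_UNIV gr0I nat.distinct(1) sum.neutral)
    define \<beta> where "\<beta> = \<alpha>(i := \<alpha> i - 1)"
    have "(\<Sum>j\<in>UNIV. \<alpha> j) = Suc (\<Sum>j\<in>UNIV. \<beta> j)"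
      by (subst (1 2) sum.remove[of UNIV i]) (use i in \<open>auto simp: \<beta>_def\<close>)
    with Suc have "(\<lambda>x. c * (\<Prod>i\<in>UNIV. x $ i ^ \<beta> i)) \<in> forms d \<and> P d (\<lambda>x. c * (\<Prod>i\<in>UNIV. x $ i ^ \<beta> i))" by auto
    moreover have "(\<lambda>x::complex^'m. c * (\<Prod>j\<in>UNIV. x $ j ^ \<alpha> j)) = (\<lambda>x. x $ i * (c * (\<Prod>j\<in>UNIV. x $ j ^ \<beta> j)))"
    proof
      fix x :: "complex^'m"
      have "x $ i ^ \<alpha> i = x $ i * x $ i ^ (\<alpha> i - 1)" using i by (simp add: power_eq_if)
      then show "c * (\<Prod>j\<in>UNIV. x $ j ^ \<alpha> j) = x $ i * (c * (\<Prod>j\<in>UNIV. x $ j ^ \<beta> j))"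
        by (subst (1 2) prod.remove[of UNIV i]) (auto simp: \<beta>_def)
    qed
    ultimately show ?case using coord by auto
  qed
  \<comment> \<open>The empty sum of monomials must be covered in every degree, although
    \<open>const\<close> gives constants in degree 0 only; a coordinate times 0 raises the
    degree.\<close>
  have zero: "P d (\<lambda>x. 0)" for d
  proof (induction d)
    case 0 show ?case by (rule const)
  next
    case (Suc d)
    have "P (Suc d) (\<lambda>x. x $ undefined * 0)" by (rule coord) (use Suc in auto)
    then show ?case by simp
  qed
  have sum: "(\<lambda>x. \<Sum>i\<in>I. F i x) \<in> forms d \<and> P d (\<lambda>x. \<Sum>i\<in>I. F i x)"
    if "finite I" "\<And>i. i \<in> I ==> F i \<in> forms d \<and> P d (F i)" for I :: "('m => nat) set" and F
    using that by (induction I rule: finite_induct) (auto intro!: zero add)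
  obtain a where a: "f = (\<lambda>x. \<Sum>\<alpha> | (\<Sum>i\<in>UNIV. \<alpha> i) = d. a \<alpha> * (\<Prod>i\<in>UNIV. x $ i ^ \<alpha> i))"
    using f unfolding forms_def by auto
  show ?thesis unfolding a using mono by (intro sum[THEN conjunct2] finite_exponents) auto
qed

lemma forms_scale [intro]: "f \<in> forms d ==> (\<lambda>x. c * f x) \<in> forms d"
proof (induction rule: forms_induct)
  case (coord d f i)
  have "(\<lambda>x. x $ i * (c * f x)) \<in> forms (Suc d)" by (rule forms_coord) (rule coord)
  then show ?case by (simp add: mult_ac)
next
  case (add d f g)
  then have "(\<lambda>x. c * f x + c * g x) \<in> forms d" by (intro forms_add)
  then show ?case by (simp add: algebra_simps)
qed auto

lemma forms_diff [intro]: "f \<in> forms d ==> g \<in> forms d ==> (\<lambda>x. f x - g x) \<in> forms d"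
  using forms_add[of f d "\<lambda>x. (-1) * g x"] forms_scale[of g d "-1"] by simp

lemma forms_mult [intro]: "f \<in> forms d ==> g \<in> forms e ==> (\<lambda>x. f x * g x) \<in> forms (d + e)"
proof (induction rule: forms_induct)
  case (coord d f i)
  have "(\<lambda>x. x $ i * (f x * g x)) \<in> forms (Suc (d + e))" by (rule forms_coord) (use coord in blast)
  then show ?case by (simp add: mult_ac)
next
  case (add d f f')
  then have "(\<lambda>x. f x * g x + f' x * g x) \<in> forms (d + e)" by (intro forms_add)
  then show ?case by (simp add: algebra_simps)
qed auto

lemma forms_component [intro]: "(\<lambda>x. x $ i) \<in> forms 1"
  using forms_coord[of "\<lambda>_. 1" 0 i] by auto

lemma forms_power [intro]: "f \<in> forms d ==> (\<lambda>x. f x ^ k) \<in> forms (k * d)"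
  by (induction k) (auto intro: forms_mult)

lemma forms_prod [intro]:
  assumes "\<And>i. i \<in> I ==> f i \<in> forms (d i)" shows "(\<lambda>x. \<Prod>i\<in>I. f i x) \<in> forms (\<Sum>i\<in>I. d i)"
  using assms by (induction I rule: infinite_finite_induct) auto

definition dotp :: "complex ^ 'm::finite => complex ^ 'm => complex" where
  "dotp h w = (\<Sum>i\<in>UNIV. h $ i * w $ i)"

lemma forms_dotp [intro]: "dotp h \<in> forms 1"
proof -
  have "(\<lambda>x. \<Sum>i\<in>UNIV. h $ i * x $ i) \<in> forms 1"
    by (intro forms_sum forms_scale forms_component)
  then show ?thesis by (simp add: dotp_def[abs_def])
qed

lemma dotp_commute: "dotp h w = dotp w h" by (simp add: dotp_def mult.commute)

lemma dotp_simps [simp]: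
  "dotp 0 w = 0" "dotp h 0 = 0" "dotp (h + h') w = dotp h w + dotp h' w" "dotp h (w + w') = dotp h w + dotp h w'"
  "dotp (h - h') w = dotp h w - dotp h' w" "dotp h (w - w') = dotp h w - dotp h w'"
  "dotp (c *s h) w = c * dotp h w" "dotp h (c *s w) = c * dotp h w"
  "dotp (axis i 1) w = w $ i" "dotp w (axis i 1) = w $ i"
  by (simp_all add: dotp_def algebra_simps sum.distrib sum_subtractf sum_distrib_left axis_def if_distrib
      if_distribR cong: if_cong)

lemma dotp_sum: "dotp (sum f A) w = (\<Sum>i\<in>A. dotp (f i) w)" "dotp w (sum f A) = (\<Sum>i\<in>A. dotp w (f i))"
  by (induction A rule: infinite_finite_induct) auto

lemma dotp_nondegenerate: "(\<And>w. dotp h w = 0) ==> h = 0"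
  by (metis dotp_simps(10) vec_eq_iff zero_index)

lemma forms_homogeneous: "f \<in> forms d ==> f (c *s x) = c ^ d * f x"
  by (induction rule: forms_induct) (auto simp: algebra_simps)

lemma forms_1E:
  assumes "f \<in> forms 1" obtains h where "f = dotp h"
proof -
  \<comment> \<open>Degree 0 is included because the coordinate case lowers the degree by
    one.\<close>
  have "(d = 0 --> (\<exists>c. f = (\<lambda>x. c))) \<and> (d = 1 --> (\<exists>h. f = dotp h))" if "f \<in> forms d" for d and f :: "complex^'a => complex"
    using that
  proof (induction rule: forms_induct)
    case (const c) then show ?case by auto
  next
    case (coord d f i)
    { assume "Suc d = 1"
      then obtain c where "f = (\<lambda>x. c)" using coord by auto
      then have "(\<lambda>x. x $ i * f x) = dotp (c *s axis i 1)" by (auto simp: mult.commute)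
      then have "\<exists>h. (\<lambda>x. x $ i * f x) = dotp h" by blast }
    then show ?case by auto
  next
    case (add d f g)
    { assume "d = 1"
      then obtain h k where "f = dotp h" "g = dotp k" using add by auto
      then have "(\<lambda>x. f x + g x) = dotp (h + k)" by auto
      then have "\<exists>h. (\<lambda>x. f x + g x) = dotp h" by blast }
    moreover have "d = 0 ==> \<exists>c. (\<lambda>x. f x + g x) = (\<lambda>x. c)" using add by auto
    ultimately show ?case by auto
  qed
  then show ?thesis using assms that by blast
qed

section \<open>Restriction of forms to lines\<close>

text \<open>Substitute for higher derivatives: up to the factor k!, coefficient k is the k-th
  derivative at \<open>x\<close> along \<open>u\<close>. For a form of degree d it is again a form,
  of degree d - k in \<open>x\<close> and of degree k in \<open>u\<close>
  (\<open>forms_lpoly\<close>), so conditions on multiplicities are closed conditions. A complex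
  polynomial is determined by its values, which makes \<open>THE\<close> meaningful.\<close>

definition lpoly :: "(complex ^ 'm::finite => complex) => complex ^ 'm => complex ^ 'm => complex poly" where
  "lpoly f x u = (THE p. \<forall>t. poly p t = f (x + t *s u))"

lemma lpoly_unique: "(\<And>t. poly p t = f (x + t *s u)) ==> lpoly f x u = p"
  unfolding lpoly_def by (rule the_equality) (auto intro!: poly_eq_poly_eq_iff[THEN iffD1])

lemma forms_lpoly:
  fixes f :: "complex ^ 'm::finite => complex"
  assumes "f \<in> forms d"
  shows "poly (lpoly f x u) t = f (x + t *s u)" "degree (lpoly f x u) \<le> d"
    "(\<lambda>x. coeff (lpoly f x u) k) \<in> forms (d - k)" "(\<lambda>u. coeff (lpoly f x u) k) \<in> forms k"
proof -
  have "\<exists>p. (\<forall>x u t. poly (p x u) t = f (x + t *s u)) \<and> (\<forall>x u. degree (p x u) \<le> d) \<and>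
    (\<forall>k u. (\<lambda>x. coeff (p x u) k) \<in> forms (d - k)) \<and> (\<forall>k x. (\<lambda>u. coeff (p x u) k) \<in> forms k)"
    using assms
  proof (induction rule: forms_induct)
    case (const c)
    have "(\<lambda>u. coeff [:c:] k) \<in> forms k" for k by (cases k) auto
    moreover have "(\<lambda>u. coeff [:c:] k) \<in> forms (0 - k)" for k by auto
    ultimately show ?case by (intro exI[of _ "\<lambda>x u. [:c:]"]) auto
  next
    case (coord d f i)
    then obtain p where p: "\<And>x u t. poly (p x u) t = f (x + t *s u)" "\<And>x u. degree (p x u) \<le> d"
      "\<And>k u. (\<lambda>x. coeff (p x u) k) \<in> forms (d - k)" "\<And>k x. (\<lambda>u. coeff (p x u) k) \<in> forms k" by blast
    let ?q = "\<lambda>x u. [:x $ i, u $ i:] * p x u"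
    have co: "coeff (?q x u) k = x $ i * coeff (p x u) k + (case k of 0 => 0 | Suc j => u $ i * coeff (p x u) j)" for x u k
      by (simp add: mult_pCons_left coeff_pCons split: nat.split)
    have z: "coeff (p x u) k = 0" if "k > d" for x u k
      using p(2)[of x u] that by (intro coeff_eq_0) auto
    have "degree (?q x u) \<le> Suc d" for x u
      using degree_mult_le[of "[:x $ i, u $ i:]" "p x u"] p(2)[of x u] degree_pCons_le[of "x $ i" "[:u $ i:]"] by simp
    moreover have "(\<lambda>x. coeff (?q x u) k) \<in> forms (Suc d - k)" for k u
    proof -
      have "(\<lambda>x. x $ i * coeff (p x u) k) \<in> forms (Suc d - k)"
      \<comment> \<open>Beyond degree d the natural subtraction \<open>d - k\<close> is cut off, but
        there the coefficient is zero and thus a form of any degree.\<close>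
      proof (cases "k \<le> d")
        case True
        then show ?thesis using forms_coord[OF p(3)[of u k], of i] by (simp add: Suc_diff_le)
      qed (use z in auto)
      moreover have "(\<lambda>x. case k of 0 => 0 | Suc j => u $ i * coeff (p x u) j) \<in> forms (Suc d - k)"
        by (cases k) (use p(3) in auto)
      ultimately show ?thesis unfolding co by (rule forms_add)
    qed
    moreover have "(\<lambda>u. coeff (?q x u) k) \<in> forms k" for k x
    proof -
      have "(\<lambda>u. x $ i * coeff (p x u) k) \<in> forms k" using p(4) by auto
      moreover have "(\<lambda>u. case k of 0 => 0 | Suc j => u $ i * coeff (p x u) j) \<in> forms k"
        by (cases k) (use p(4) in auto)
      ultimately show ?thesis unfolding co by (rule forms_add)
    qed
    moreover have "poly (?q x u) t = (\<lambda>x. x $ i * f x) (x + t *s u)" for x u t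
      by (simp add: p(1)[symmetric] algebra_simps)
    ultimately show ?case by (intro exI[of _ ?q]) (auto simp del: mult_pCons_left)
  next
    case (add d f g)
    then obtain p q where "\<And>x u t. poly (p x u) t = f (x + t *s u)" "\<And>x u. degree (p x u) \<le> d"
      "\<And>k u. (\<lambda>x. coeff (p x u) k) \<in> forms (d - k)" "\<And>k x. (\<lambda>u. coeff (p x u) k) \<in> forms k"
      "\<And>x u t. poly (q x u) t = g (x + t *s u)" "\<And>x u. degree (q x u) \<le> d"
      "\<And>k u. (\<lambda>x. coeff (q x u) k) \<in> forms (d - k)" "\<And>k x. (\<lambda>u. coeff (q x u) k) \<in> forms k" by metis
    then show ?case by (intro exI[of _ "\<lambda>x u. p x u + q x u"]) (auto intro: degree_add_le)
  qed
  then obtain p where p: "\<And>x u t. poly (p x u) t = f (x + t *s u)" "\<And>x u. degree (p x u) \<le> d"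
      "\<And>k u. (\<lambda>x. coeff (p x u) k) \<in> forms (d - k)" "\<And>k x. (\<lambda>u. coeff (p x u) k) \<in> forms k" by blast
  have "lpoly f x u = p x u" for x u by (rule lpoly_unique) (simp add: p)
  then show "poly (lpoly f x u) t = f (x + t *s u)" "degree (lpoly f x u) \<le> d"
    "(\<lambda>x. coeff (lpoly f x u) k) \<in> forms (d - k)" "(\<lambda>u. coeff (lpoly f x u) k) \<in> forms k"
    using p by auto
qed

lemma forms_lpoly_0: "f \<in> forms d ==> coeff (lpoly f x u) 0 = f x"
  using forms_lpoly(1)[of f d x u 0] by (simp add: poly_0_coeff_0)

lemma bounded_linear_vsmult: "bounded_linear (\<lambda>t::complex. t *s (u :: complex^'m::finite))"
  by (rule linear_conv_bounded_linear[THEN iffD1], rule linearI) (auto simp: vec_eq_iff algebra_simps)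

text \<open>Only existence of a derivative is proved by induction; its value along \<open>u\<close>
  is then read off from the restriction to a line, by uniqueness.\<close>

lemma forms_has_derivative:
  fixes f :: "complex ^ 'm::finite => complex"
  assumes f: "f \<in> forms d"
  shows "(f has_derivative (\<lambda>u. coeff (lpoly f x u) 1)) (at x)"
proof -
  have "\<exists>A. (f has_derivative A) (at x)" using f
  proof (induction rule: forms_induct)
    case (const c) then show ?case by (intro exI) (rule has_derivative_const)
  next
    case (coord d f i)
    then obtain A where "(f has_derivative A) (at x)" by blast
    moreover have "((\<lambda>x. x $ i) has_derivative (\<lambda>x. x $ i)) (at x)" by (rule bounded_linear_imp_has_derivative) (rule bounded_linear_vec_nth)
    ultimately show ?case by (intro exI) (rule has_derivative_mult)
  next
    case (add d f g)
    then obtain A B where "(f has_derivative A) (at x)" "(g has_derivative B) (at x)" by blast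
    then show ?case by (intro exI) (rule has_derivative_add)
  qed
  then obtain A where A: "(f has_derivative A) (at x)" by blast
  have "A u = coeff (lpoly f x u) 1" for u
  proof -
    have "((\<lambda>t. x + t *s u) has_derivative (\<lambda>t. t *s u)) (at 0)"
      by (rule has_derivative_eq_rhs, rule has_derivative_add, rule has_derivative_const,
          rule bounded_linear_imp_has_derivative, rule bounded_linear_vsmult) simp
    then have "((\<lambda>t. f (x + t *s u)) has_derivative (\<lambda>t. A (t *s u))) (at 0)"
      by (rule has_derivative_compose) (use A in simp)
    moreover have "(poly (lpoly f x u) has_derivative (\<lambda>t. poly (pderiv (lpoly f x u)) 0 * t)) (at 0)"
      using poly_DERIV by (simp add: has_field_derivative_def)
    moreover have "poly (lpoly f x u) = (\<lambda>t. f (x + t *s u))" using forms_lpoly(1)[OF f] by auto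
    ultimately have "(\<lambda>t. A (t *s u)) = (\<lambda>t. poly (pderiv (lpoly f x u)) 0 * t)"
      by (metis has_derivative_unique)
    then have "A (1 *s u) = poly (pderiv (lpoly f x u)) 0" by (metis mult.right_neutral)
    then show ?thesis by (simp add: poly_0_coeff_0 coeff_pderiv)
  qed
  then show ?thesis using A by (metis (no_types, lifting) ext)
qed

lemma forms_frechet: "f \<in> forms d ==> fd f x = (\<lambda>u. coeff (lpoly f x u) 1)"
  by (metis forms_has_derivative frechet_derivative_at)

lemma forms_continuous: "f \<in> forms d ==> continuous_on S f"
  by (meson continuous_at_imp_continuous_on forms_has_derivative has_derivative_continuous)

section \<open>Points and lines of projective space\<close>

lemma line_proj_point: "v \<noteq> 0 ==> line (proj_point v) = range (\<lambda>c. c *s v)"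
  unfolding proj_point_def by (rule Abs_proj_inverse) auto

lemma proj_point_scale:
  assumes "c \<noteq> 0" "v \<noteq> 0" shows "proj_point (c *s v) = proj_point v"
proof -
  have "range (\<lambda>a. a *s (c *s v)) = range (\<lambda>a. a *s v)"
    using assms by (auto simp: image_iff) (metis nonzero_mult_div_cancel_right times_divide_eq_left vector_smult_assoc)
  then show ?thesis by (simp add: proj_point_def)
qed

lemma proj_point_eq_iff:
  assumes "v \<noteq> 0" "w \<noteq> 0" shows "proj_point v = proj_point w \<longleftrightarrow> (\<exists>c. c \<noteq> 0 \<and> w = c *s v)"
proof
  assume "proj_point v = proj_point w"
  then have "range (\<lambda>c. c *s v) = range (\<lambda>c. c *s w)" using assms by (metis line_proj_point)
  then have "1 *s w \<in> range (\<lambda>c. c *s v)" by (metis rangeI)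
  then show "\<exists>c. c \<noteq> 0 \<and> w = c *s v" using assms by auto
qed (use assms proj_point_scale in metis)

lemma proj_cases: obtains v where "v \<noteq> 0" "p = proj_point v"
proof -
  obtain v where "v \<noteq> 0" "line p = range (\<lambda>c. c *s v)" using line[of p] by auto
  then show ?thesis using that by (metis line_inject line_proj_point)
qed

lemma in_line_iff: "v \<in> line p - {0} \<longleftrightarrow> v \<noteq> 0 \<and> proj_point v = p"
proof -
  obtain w where w: "w \<noteq> 0" "p = proj_point w" by (rule proj_cases)
  have "v \<in> range (\<lambda>c. c *s w) \<longleftrightarrow> proj_point v = proj_point w" if "v \<noteq> 0"
  proof
    assume "v \<in> range (\<lambda>c. c *s w)"
    then obtain c where "v = c *s w" by auto
    then show "proj_point v = proj_point w" using that w(1) by (auto intro!: proj_point_scale)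
  next
    assume "proj_point v = proj_point w"
    then show "v \<in> range (\<lambda>c. c *s w)" using that w(1) proj_point_eq_iff[of w v] by auto
  qed
  then show ?thesis unfolding w(2) line_proj_point[OF w(1)] by blast
qed

lemma in_zeros_iff:
  assumes "f \<in> forms d" "v \<noteq> 0" shows "proj_point v \<in> zeros f \<longleftrightarrow> f v = 0"
proof -
  have "f w = 0" if w: "w \<noteq> 0" "proj_point w = proj_point v" "f v = 0" for w
  proof -
    obtain c where "w = c *s v" using w assms proj_point_eq_iff[of v w] by auto
    then show ?thesis using w assms by (simp add: forms_homogeneous)
  qed
  then show ?thesis unfolding zeros_def mem_Collect_eq in_line_iff Ball_def using assms by blast
qed

lemma subset_zeros_iff:
  assumes "f \<in> forms d" shows "S \<subseteq> zeros f \<longleftrightarrow> (\<forall>v\<in>cone S. f v = 0)"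
proof
  assume "S \<subseteq> zeros f" then show "\<forall>v\<in>cone S. f v = 0"
    using in_zeros_iff[OF assms] by (auto simp: cone_def)
next
  assume *: "\<forall>v\<in>cone S. f v = 0"
  show "S \<subseteq> zeros f"
  proof
    fix p assume "p \<in> S"
    obtain v where "v \<noteq> 0" "p = proj_point v" by (rule proj_cases)
    then show "p \<in> zeros f" using * \<open>p \<in> S\<close> in_zeros_iff[OF assms] by (auto simp: cone_def)
  qed
qed

lemma hyp_proj_point:
  assumes "h \<noteq> 0" shows "hyp (proj_point h) = {w. dotp h w = 0}"
proof -
  have "hyp (proj_point h) = {w. \<forall>c. dotp (c *s h) w = 0}"
    unfolding hyp_def line_proj_point[OF assms] dotp_def by auto
  also have "\<dots> = {w. dotp h w = 0}" by auto
  finally show ?thesis .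
qed

text \<open>A single representative \<open>v\<close> suffices because the linear coefficient is
  homogeneous in the base point.\<close>

lemma tangent_proj_point:
  assumes "v \<noteq> 0"
  shows "tangent X (proj_point v) = {w. \<forall>d. \<forall>f\<in>forms d. X \<subseteq> zeros f --> coeff (lpoly f v w) 1 = 0}"
proof -
  have "(\<forall>u\<in>line (proj_point v) - {0}. fd f u w = 0) \<longleftrightarrow> coeff (lpoly f v w) 1 = 0"
    if f: "f \<in> forms d" for f d w
  proof -
    have "coeff (lpoly f (c *s v) w) 1 = 0 \<longleftrightarrow> coeff (lpoly f v w) 1 = 0" if "c \<noteq> 0" for c :: complex
    proof -
      have "(\<lambda>x. coeff (lpoly f x w) 1) \<in> forms (d - 1)" by (rule forms_lpoly(3)[OF f])
      from forms_homogeneous[OF this, of c v] show ?thesis using that by simp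
    qed
    then show ?thesis unfolding in_line_iff forms_frechet[OF f] Ball_def
      using proj_point_eq_iff[OF assms] assms by metis
  qed
  then show ?thesis unfolding tangent_def by (metis (no_types, lifting))
qed

lemma open_proj_iff: "open (U :: 'n::finite proj set) \<longleftrightarrow> open (cone U)"
  by (rule open_proj_def)

lemma vsmult_cancel [simp]: "c \<noteq> 0 ==> inverse c *s (c *s v) = (v :: complex^'m::finite)" "c \<noteq> 0 ==> c *s (inverse c *s v) = v"
  by auto

lemma continuous_vsmult [continuous_intros]:
  fixes g :: "'a::topological_space => complex^'m::finite"
  assumes "continuous_on S f" "continuous_on S g"
  shows "continuous_on S (\<lambda>x. f x *s g x)"
proof -
  have "(\<lambda>x. f x *s g x) = (\<lambda>x. \<chi> i. f x * g x $ i)" by (auto simp: vec_eq_iff)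
  moreover have "continuous_on S (\<lambda>x. \<chi> i. f x * g x $ i)"
    using assms by (intro continuous_intros)
  ultimately show ?thesis by metis
qed

text \<open>The cone over the image is the union of all nonzero multiples of \<Omega>, hence
  open.\<close>

lemma open_proj_point_image:
  assumes "open \<Omega>" "0 \<notin> \<Omega>" shows "open (proj_point ` \<Omega> :: 'n::finite proj set)"
proof -
  have "cone (proj_point ` \<Omega>) = (\<Union>c\<in>-{0}. (\<lambda>v. c *s v) -` \<Omega>)"
  proof (intro set_eqI iffI)
    fix v :: "complex ^ 'n option" assume "v \<in> cone (proj_point ` \<Omega>)"
    then obtain w where "v \<noteq> 0" "w \<in> \<Omega>" "proj_point v = proj_point w" by (auto simp: cone_def)
    moreover from this have "w \<noteq> 0" using assms(2) by metis
    ultimately obtain c where "c \<noteq> 0" "w = c *s v" using proj_point_eq_iff[of v w] by auto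
    then show "v \<in> (\<Union>c\<in>-{0}. (\<lambda>v. c *s v) -` \<Omega>)" using \<open>w \<in> \<Omega>\<close> by auto
  next
    fix v :: "complex ^ 'n option" assume "v \<in> (\<Union>c\<in>-{0}. (\<lambda>v. c *s v) -` \<Omega>)"
    then obtain c where c: "c \<noteq> 0" "c *s v \<in> \<Omega>" by auto
    then have v: "v \<noteq> 0" using assms(2) by auto
    then have "proj_point v = proj_point (c *s v)" using c by (simp add: proj_point_scale)
    then show "v \<in> cone (proj_point ` \<Omega>)" unfolding cone_def using c v by blast
  qed
  moreover have "open ((\<lambda>v. c *s v) -` \<Omega>)" for c
    by (rule open_vimage[OF assms(1)]) (intro continuous_intros)
  ultimately show ?thesis by (simp add: open_proj_iff open_UN)
qed

section \<open>The Zariski topology\<close>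

lemma zeros_mult:
  assumes "f \<in> forms d" "g \<in> forms e" shows "zeros (\<lambda>x. f x * g x) = zeros f \<union> zeros g"
proof (intro set_eqI)
  fix p :: "'a proj" obtain v where "v \<noteq> 0" "p = proj_point v" by (rule proj_cases)
  then show "p \<in> zeros (\<lambda>x. f x * g x) \<longleftrightarrow> p \<in> zeros f \<union> zeros g"
    using assms forms_mult[OF assms] by (simp add: in_zeros_iff)
qed

text \<open>The Zariski closure, described by equations instead of closed sets;
  \<open>closedin_zcl\<close> and \<open>zcl_minimal\<close> show that it is the topological
  closure.\<close>

definition zcl :: "'n::finite proj set => 'n proj set" where
  "zcl S = {p. \<forall>d. \<forall>f\<in>forms d. S \<subseteq> zeros f --> p \<in> zeros f}"

lemma topspace_zariski [simp]: "topspace zariski = UNIV"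
proof -
  have "p \<notin> zeros (\<lambda>_. 1)" for p :: "'a proj"
  proof -
    obtain v where "v \<noteq> 0" "p = proj_point v" by (rule proj_cases)
    then show ?thesis using in_zeros_iff[of "\<lambda>_. 1" 0 v] by auto
  qed
  then have "- zeros (\<lambda>_. 1) = (UNIV :: 'a proj set)" by auto
  moreover have "openin zariski (- zeros (\<lambda>_. 1) :: 'a proj set)"
    unfolding zariski_def by (rule topology_generated_by_Basis) blast
  ultimately show ?thesis by (metis openin_subset top.extremum_unique)
qed

lemma closedin_zeros: "f \<in> forms d ==> closedin zariski (zeros f)"
proof -
  assume "f \<in> forms d"
  then have "openin zariski (- zeros f)"
    unfolding zariski_def by (intro topology_generated_by_Basis) blast
  then show ?thesis by (simp add: closedin_def Compl_eq_Diff_UNIV)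
qed

text \<open>The complements of zero sets generate the topology as a subbasis; they form a basis
  because the zero set of a product is a union.\<close>

lemma openin_zariskiD:
  assumes "openin zariski U" "p \<in> U"
  shows "\<exists>d. \<exists>f\<in>forms d. p \<notin> zeros f \<and> - zeros f \<subseteq> U"
proof -
  have "generate_topology_on {- zeros f | f d. f \<in> forms d} U"
    using assms unfolding zariski_def by (simp add: openin_topology_generated_by_iff)
  then have "\<forall>p\<in>U. \<exists>d. \<exists>f\<in>forms d. p \<notin> zeros f \<and> - zeros f \<subseteq> U"
  proof induction
    case (Int a b)
    show ?case
    proof
      fix p assume "p \<in> a \<inter> b"
      then obtain d e f g where "f \<in> forms d" "g \<in> forms e" "p \<notin> zeros f" "p \<notin> zeros g" "- zeros f \<subseteq> a" "- zeros g \<subseteq> b"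
        using Int by (meson IntD1 IntD2)
      then show "\<exists>d. \<exists>f\<in>forms d. p \<notin> zeros f \<and> - zeros f \<subseteq> a \<inter> b"
        by (intro exI[of _ "d + e"] bexI[of _ "\<lambda>x. f x * g x"]) (auto simp: zeros_mult)
    qed
  next
    case (UN K) then show ?case by (meson Union_iff Sup_upper2)
  qed auto
  then show ?thesis using assms by blast
qed

lemma zcl_subset: "S \<subseteq> zcl S" by (auto simp: zcl_def)

lemma zcl_mono: "S \<subseteq> T ==> zcl S \<subseteq> zcl T" by (auto simp: zcl_def)

lemma closedin_zcl [intro]: "closedin zariski (zcl S)"
proof -
  have "zcl S = \<Inter> (insert UNIV {zeros f | f d. f \<in> forms d \<and> S \<subseteq> zeros f})" by (auto simp: zcl_def)
  moreover have "closedin zariski (UNIV :: 'a proj set)" using closedin_topspace[of zariski] by simp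
  ultimately show ?thesis using closedin_zeros by (simp only: closedin_Inter, intro closedin_Inter) auto
qed

lemma zcl_closed:
  assumes "closedin zariski Z" shows "zcl Z = Z"
proof
  show "zcl Z \<subseteq> Z"
  proof
    fix p assume p: "p \<in> zcl Z"
    show "p \<in> Z"
    proof (rule ccontr)
      assume "p \<notin> Z"
      moreover have "openin zariski (- Z)" using assms by (simp add: closedin_def Compl_eq_Diff_UNIV)
      ultimately obtain d f where "f \<in> forms d" "p \<notin> zeros f" "- zeros f \<subseteq> - Z" using openin_zariskiD[of "-Z" p] by blast
      then show False using p by (auto simp: zcl_def)
    qed
  qed
qed (rule zcl_subset)

lemma zcl_subset_zeros: "f \<in> forms d ==> zcl S \<subseteq> zeros f \<longleftrightarrow> S \<subseteq> zeros f"
  using zcl_subset[of S] by (auto simp: zcl_def)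

lemma zcl_minimal: "S \<subseteq> T ==> closedin zariski T ==> zcl S \<subseteq> T"
  using zcl_mono zcl_closed by metis

text \<open>A point outside a closed set is separated from it by one form, so arbitrary closed sets
  can be replaced by zero sets of single forms. This turns irreducibility into a cancellation
  property.\<close>

lemma irreducible_iff:
  "irreducible_in zariski S \<longleftrightarrow> S \<noteq> {} \<and>
    (\<forall>d e. \<forall>f\<in>forms d. \<forall>g\<in>forms e. S \<subseteq> zeros f \<union> zeros g --> S \<subseteq> zeros f \<or> S \<subseteq> zeros g)"
    (is "?L \<longleftrightarrow> ?R")
proof
  assume ?L then show ?R unfolding irreducible_in_def using closedin_zeros by metis
next
  assume R: ?R
  have "S \<subseteq> A \<or> S \<subseteq> B" if AB: "closedin zariski A" "closedin zariski B" "S \<subseteq> A \<union> B" for A B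
  proof (rule ccontr)
    assume "\<not> ?thesis"
    then obtain p q where "p \<in> S" "q \<in> S" "p \<notin> zcl A" "q \<notin> zcl B" using zcl_closed AB by blast
    then obtain d e f g where "f \<in> forms d" "g \<in> forms e" "A \<subseteq> zeros f" "B \<subseteq> zeros g" "p \<notin> zeros f" "q \<notin> zeros g"
      unfolding zcl_def by blast
    moreover have "S \<subseteq> zeros f \<union> zeros g" using AB(3) \<open>A \<subseteq> zeros f\<close> \<open>B \<subseteq> zeros g\<close> by blast
    ultimately have "S \<subseteq> zeros f \<or> S \<subseteq> zeros g" using R by blast
    then show False using \<open>p \<in> S\<close> \<open>q \<in> S\<close> \<open>p \<notin> zeros f\<close> \<open>q \<notin> zeros g\<close> by blast
  qed
  then show ?L using R by (auto simp: irreducible_in_def)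
qed

lemma irreducible_zcl: "irreducible_in zariski S ==> irreducible_in zariski (zcl S)"
  unfolding irreducible_iff
proof (elim conjE, intro conjI allI ballI impI)
  assume "S \<noteq> {}" then show "zcl S \<noteq> {}" using zcl_subset[of S] by auto
next
  fix d e and f g :: "complex ^ 'a option => complex"
  assume *: "\<forall>d e. \<forall>f\<in>forms d. \<forall>g\<in>forms e. S \<subseteq> zeros f \<union> zeros g --> S \<subseteq> zeros f \<or> S \<subseteq> zeros g"
    and fg: "f \<in> forms d" "g \<in> forms e" and "zcl S \<subseteq> zeros f \<union> zeros g"
  then have "S \<subseteq> zeros f \<union> zeros g" using zcl_subset[of S] by blast
  then have "S \<subseteq> zeros f \<or> S \<subseteq> zeros g" using * fg by blast
  then show "zcl S \<subseteq> zeros f \<or> zcl S \<subseteq> zeros g" using fg by (simp add: zcl_subset_zeros)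
qed

section \<open>Holomorphic functions of several variables\<close>

text \<open>Scalar counterpart of \<open>holo_on\<close>, to which the latter reduces componentwise
  by \<open>holo_on_iff\<close>. The derivative is the real Frechet derivative, so complex
  homogeneity is a separate clause.\<close>

definition shol :: "(complex ^ 'a::finite => complex) => (complex ^ 'a) set => bool" where
  "shol f V \<longleftrightarrow> (\<forall>x\<in>V. \<exists>A. (f has_derivative A) (at x) \<and> (\<forall>c w. A (c *s w) = c * A w))"

lemma holo_on_subset: "holo_on f V ==> W \<subseteq> V ==> holo_on f W"
  by (auto simp: holo_on_def)

lemma shol_fd: "shol f V ==> x \<in> V ==> (f has_derivative fd f x) (at x)"
  by (metis frechet_derivative_at shol_def)

lemma shol_fd_scale: "shol f V ==> x \<in> V ==> fd f x (c *s w) = c * fd f x w"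
  by (metis frechet_derivative_at shol_def)

lemma has_derivative_vec_iff:
  fixes f :: "'a::real_normed_vector => complex ^ 'b::finite"
  shows "(f has_derivative A) (at x) \<longleftrightarrow> (\<forall>i. ((\<lambda>x. f x $ i) has_derivative (\<lambda>u. A u $ i)) (at x))"
proof
  assume *: "(f has_derivative A) (at x)"
  show "\<forall>i. ((\<lambda>x. f x $ i) has_derivative (\<lambda>u. A u $ i)) (at x)"
    using bounded_linear.has_derivative[OF bounded_linear_vec_nth *] by blast
next
  assume *: "\<forall>i. ((\<lambda>x. f x $ i) has_derivative (\<lambda>u. A u $ i)) (at x)"
  have "((\<lambda>x. f x \<bullet> b) has_derivative (\<lambda>u. A u \<bullet> b)) (at x)" if "b \<in> Basis" for b
  proof -
    from that obtain i c where b: "b = axis i c" unfolding Basis_vec_def by blast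
    have "((\<lambda>x. f x $ i \<bullet> c) has_derivative (\<lambda>u. A u $ i \<bullet> c)) (at x)"
      by (rule bounded_linear.has_derivative[OF bounded_linear_inner_left]) (use * in blast)
    then show ?thesis by (simp add: b inner_axis)
  qed
  then show "(f has_derivative A) (at x)" using has_derivative_componentwise_within by blast
qed

lemma holo_on_iff: "holo_on F V \<longleftrightarrow> (\<forall>i. shol (\<lambda>x. F x $ i) V)"
proof
  assume F: "holo_on F V"
  show "\<forall>i. shol (\<lambda>x. F x $ i) V" unfolding shol_def
  proof (intro allI ballI)
    fix i x assume "x \<in> V"
    then obtain A where "(F has_derivative A) (at x)" "\<forall>c w. A (c *s w) = c *s A w" using F by (auto simp: holo_on_def)
    then show "\<exists>A. ((\<lambda>x. F x $ i) has_derivative A) (at x) \<and> (\<forall>c w. A (c *s w) = c * A w)"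
      unfolding has_derivative_vec_iff by (intro exI[of _ "\<lambda>u. A u $ i"]) auto
  qed
next
  assume F: "\<forall>i. shol (\<lambda>x. F x $ i) V"
  show "holo_on F V" unfolding holo_on_def
  proof
    fix x assume "x \<in> V"
    then have "\<forall>i. \<exists>A. ((\<lambda>x. F x $ i) has_derivative A) (at x) \<and> (\<forall>c w. A (c *s w) = c * A w)"
      using F by (auto simp: shol_def)
    then obtain A where "\<forall>i. ((\<lambda>x. F x $ i) has_derivative A i) (at x) \<and> (\<forall>c w. A i (c *s w) = c * A i w)" by metis
    then show "\<exists>A. (F has_derivative A) (at x) \<and> (\<forall>c w. A (c *s w) = c *s A w)"
      unfolding has_derivative_vec_iff by (intro exI[of _ "\<lambda>u. \<chi> i. A i u"]) (auto simp: vec_eq_iff)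
  qed
qed

lemma holo_on_has_derivative:
  assumes "holo_on F V" "x \<in> V"
  shows "(F has_derivative fd F x) (at x)"
    "fd F x (c *s w) = c *s fd F x w"
  using assms unfolding holo_on_def by (metis frechet_derivative_at)+

lemma shol_const [intro]: "shol (\<lambda>x. c) V"
  unfolding shol_def by (auto intro!: exI[of _ "\<lambda>_. 0"])

lemma shol_coord [intro]: "shol (\<lambda>x. x $ i) V"
  unfolding shol_def by (auto intro!: exI[of _ "\<lambda>x. x $ i"] bounded_linear_imp_has_derivative bounded_linear_vec_nth)

lemma shol_add [intro]: assumes "shol f V" "shol g V" shows "shol (\<lambda>x. f x + g x) V"
  unfolding shol_def
  by (intro ballI exI conjI allI, rule has_derivative_add, rule shol_fd[OF assms(1)], assumption,
      rule shol_fd[OF assms(2)], assumption) (simp add: shol_fd_scale[OF assms(1)] shol_fd_scale[OF assms(2)] algebra_simps)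

lemma shol_mult [intro]: assumes "shol f V" "shol g V" shows "shol (\<lambda>x. f x * g x) V"
  unfolding shol_def
  by (intro ballI exI conjI allI, rule has_derivative_mult, rule shol_fd[OF assms(1)], assumption,
      rule shol_fd[OF assms(2)], assumption) (simp add: shol_fd_scale[OF assms(1)] shol_fd_scale[OF assms(2)] algebra_simps)

lemma shol_diff [intro]: assumes "shol f V" "shol g V" shows "shol (\<lambda>x. f x - g x) V"
  using shol_add[OF assms(1) shol_mult[OF shol_const[of "-1"] assms(2)]] by simp

lemma shol_sum [intro]: "(\<And>i. i \<in> I ==> shol (f i) V) ==> shol (\<lambda>x. \<Sum>i\<in>I. f i x) V"
  by (induction I rule: infinite_finite_induct) auto

lemma shol_prod [intro]: "(\<And>i. i \<in> I ==> shol (f i) V) ==> shol (\<lambda>x. \<Prod>i\<in>I. f i x) V"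
  by (induction I rule: infinite_finite_induct) auto

lemma shol_inverse:
  assumes "shol f V" "\<And>x. x \<in> V ==> f x \<noteq> 0" shows "shol (\<lambda>x. inverse (f x)) V"
  unfolding shol_def
proof
  fix x assume x: "x \<in> V"
  show "\<exists>A. ((\<lambda>x. inverse (f x)) has_derivative A) (at x) \<and> (\<forall>c w. A (c *s w) = c * A w)"
    using Deriv.has_derivative_inverse[OF assms(2)[OF x] shol_fd[OF assms(1) x]]
    by (intro exI[of _ "\<lambda>h. - (inverse (f x) * fd f x h * inverse (f x))"]) (simp add: shol_fd_scale[OF assms(1) x] algebra_simps)
qed

lemma shol_divide:
  assumes "shol f V" "shol g V" "\<And>x. x \<in> V ==> g x \<noteq> 0" shows "shol (\<lambda>x. f x / g x) V"
  using shol_mult[OF assms(1) shol_inverse[OF assms(2)]] assms(3) by (simp add: divide_inverse)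

lemma shol_forms [intro]: "f \<in> forms d ==> shol f V"
proof (induction rule: forms_induct)
  case (coord d f i) show ?case by (rule shol_mult) (use coord in auto)
next
  case (add d f g) show ?case by (rule shol_add) (use add in auto)
qed auto

lemma shol_dotp [intro]:
  assumes "holo_on F V" "holo_on G V" shows "shol (\<lambda>x. dotp (F x) (G x)) V"
  unfolding dotp_def using assms by (intro shol_sum shol_mult) (auto simp: holo_on_iff)

lemma holo_on_const [intro]: "holo_on (\<lambda>x. c) V" by (auto simp: holo_on_iff)

lemma holo_on_id [intro]: "holo_on (\<lambda>x. x) V" by (auto simp: holo_on_iff)

lemma holo_on_add [intro]: "holo_on F V ==> holo_on G V ==> holo_on (\<lambda>x. F x + G x) V"
  by (auto simp: holo_on_iff)

lemma holo_on_diff [intro]: "holo_on F V ==> holo_on G V ==> holo_on (\<lambda>x. F x - G x) V"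
  by (auto simp: holo_on_iff)

lemma holo_on_scale [intro]: "shol f V ==> holo_on G V ==> holo_on (\<lambda>x. f x *s G x) V"
  by (auto simp: holo_on_iff)

lemma holo_on_lambda [intro]: "(\<And>i. shol (\<lambda>x. F x i) V) ==> holo_on (\<lambda>x. \<chi> i. F x i) V"
  by (auto simp: holo_on_iff)

lemma shol_compose:
  assumes "shol f W" "holo_on G V" "G ` V \<subseteq> W" shows "shol (\<lambda>x. f (G x)) V"
  unfolding shol_def
proof
  fix x assume x: "x \<in> V"
  then obtain A where A: "(G has_derivative A) (at x)" "\<forall>c w. A (c *s w) = c *s A w" using assms by (auto simp: holo_on_def)
  have "((\<lambda>x. f (G x)) has_derivative (\<lambda>u. fd f (G x) (A u))) (at x)"
    by (rule has_derivative_compose[OF A(1)]) (use assms x in \<open>auto intro!: shol_fd\<close>)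
  then show "\<exists>A. ((\<lambda>x. f (G x)) has_derivative A) (at x) \<and> (\<forall>c w. A (c *s w) = c * A w)"
    using A(2) shol_fd_scale[OF assms(1), of "G x"] assms(3) x
    by (intro exI[of _ "\<lambda>u. fd f (G x) (A u)"]) auto
qed

lemma holo_on_compose: "holo_on F W ==> holo_on G V ==> G ` V \<subseteq> W ==> holo_on (\<lambda>x. F (G x)) V"
  unfolding holo_on_iff[of F] holo_on_iff[of "\<lambda>x. F (G x)"] using shol_compose by blast

lemma shol_continuous: "shol f V ==> continuous_on V f"
  by (meson continuous_at_imp_continuous_on has_derivative_continuous shol_fd)

lemma holo_on_continuous: "holo_on f V ==> continuous_on V f"
  by (meson continuous_at_imp_continuous_on has_derivative_continuous holo_on_has_derivative(1))

lemma shol_cong: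
  assumes "shol f V" "open V" "\<And>x. x \<in> V ==> f x = g x" shows "shol g V"
  unfolding shol_def
proof
  fix x assume x: "x \<in> V"
  then have "(g has_derivative fd f x) (at x)"
    using has_derivative_transform_within_open[OF shol_fd[OF assms(1)] assms(2)] assms(3) by blast
  then show "\<exists>A. (g has_derivative A) (at x) \<and> (\<forall>c w. A (c *s w) = c * A w)"
    using shol_fd_scale[OF assms(1) x] by blast
qed

lemma holo_on_cong: "holo_on f V ==> open V ==> (\<And>x. x \<in> V ==> f x = g x) ==> holo_on g V"
  unfolding holo_on_iff by (metis (mono_tags, lifting) shol_cong)

lemma fd_holo_component:
  assumes "holo_on F V" "x \<in> V" shows "fd F x u $ i = fd (\<lambda>x. F x $ i) x u"
  using holo_on_has_derivative(1)[OF assms] unfolding has_derivative_vec_iff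
  by (metis frechet_derivative_at)

lemma line_has_derivative: "((\<lambda>t. x + t *s u) has_derivative (\<lambda>t. t *s u)) (at (t0::complex))"
  by (rule has_derivative_eq_rhs, rule has_derivative_add, rule has_derivative_const,
      rule bounded_linear_imp_has_derivative, rule bounded_linear_vsmult) simp

lemma shol_line_field_derivative:
  assumes "shol f V" "x + t *s u \<in> V"
  shows "((\<lambda>t. f (x + t *s u)) has_field_derivative fd f (x + t *s u) u) (at t)"
  unfolding has_field_derivative_def
  by (rule has_derivative_eq_rhs, rule has_derivative_compose[OF line_has_derivative], rule shol_fd[OF assms])
     (simp add: fun_eq_iff shol_fd_scale[OF assms])

lemma shol_line:
  assumes "shol f V" "\<And>t. t \<in> T ==> x + t *s u \<in> V"
  shows "(\<lambda>t. f (x + t *s u)) holomorphic_on T"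
  using shol_line_field_derivative[OF assms(1) assms(2)] unfolding holomorphic_on_def field_differentiable_def
  by (metis has_field_derivative_at_within)

lemma continuous_on_line: "continuous_on T (\<lambda>t::complex. x + t *s (u :: complex^'a::finite))"
  by (intro continuous_intros)

text \<open>Cauchy's formula on a disc in the direction \<open>u\<close>. Written as an integral
  over a fixed interval, the derivative can be studied as a parameter integral, which yields its
  continuity, its holomorphy and the symmetry of second derivatives.\<close>

lemma shol_cauchy:
  assumes f: "shol f V" and r: "0 < r" and V: "\<And>t. t \<in> cball 0 r ==> x + t *s u \<in> V"
  shows "fd f x u = integral {0..1} (\<lambda>s. f (x + circlepath 0 r s *s u) / circlepath 0 r s)"
proof -
  let ?F = "\<lambda>t. f (x + t *s u)"
  have hol: "?F holomorphic_on cball 0 r" by (rule shol_line[OF f V])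
  have d: "(?F has_field_derivative fd f x u) (at 0)"
    using shol_line_field_derivative[OF f, of x 0 u] V[of 0] r by simp
  have "(?F has_field_derivative (1 / (2 * of_real pi * \<i>) * contour_integral (circlepath 0 r) (\<lambda>u. ?F u / (u - 0)^2))) (at 0)"
    by (rule Cauchy_derivative_integral_circlepath(2)[where r=r and z=0])
     (use hol r in \<open>auto intro: holomorphic_on_imp_continuous_on holomorphic_on_subset\<close>)
  then have "fd f x u = 1 / (2 * of_real pi * \<i>) * contour_integral (circlepath 0 r) (\<lambda>u. ?F u / u^2)"
    using DERIV_unique[OF d] by simp
  also have "contour_integral (circlepath 0 r) (\<lambda>u. ?F u / u^2) =
      integral {0..1} (\<lambda>s. (2 * of_real pi * \<i>) * (f (x + circlepath 0 r s *s u) / circlepath 0 r s))"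
    unfolding contour_integral_integral vector_derivative_circlepath
    by (rule integral_cong) (use r in \<open>simp add: circlepath power2_eq_square field_simps\<close>)
  also have "1 / (2 * of_real pi * \<i>) * \<dots> = integral {0..1} (\<lambda>s. f (x + circlepath 0 r s *s u) / circlepath 0 r s)"
    by (simp only: integral_mult_right) simp
  finally show ?thesis .
qed

text \<open>One radius has to serve all base points near \<open>x0\<close>, since the base point is
  the parameter of the Cauchy integrals.\<close>

lemma shol_local_disc:
  fixes V :: "(complex^'a::finite) set"
  assumes "open V" "x0 \<in> V"
  obtains r where "0 < r" "\<And>x t. x \<in> ball x0 r ==> t \<in> cball 0 r ==> x + t *s u \<in> V"
proof -
  obtain e where e: "0 < e" "ball x0 e \<subseteq> V" using assms openE by blast
  obtain K where K: "K > 0" "\<And>t::complex. norm (t *s u) \<le> norm t * K"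
    using bounded_linear.pos_bounded[OF bounded_linear_vsmult[of u]] by blast
  define r where "r = e / (2 * (1 + K))"
  have r: "0 < r" "r + r * K < e" using e K by (auto simp: r_def field_simps add_pos_pos)
  have "x + t *s u \<in> V" if *: "x \<in> ball x0 r" "t \<in> cball 0 r" for x t
  proof -
    have "norm (t *s u) \<le> r * K" using K(2)[of t] * K(1) by (smt (verit) dist_0_norm mem_cball mult_right_mono)
    then have "dist x0 (x + t *s u) \<le> dist x0 x + r * K"
      using dist_triangle[of x0 "x + t *s u" x] by (simp add: dist_norm)
    then have "x + t *s u \<in> ball x0 e" using * r by auto
    then show ?thesis using e by auto
  qed
  then show ?thesis using r that by blast
qed

lemma continuous_on_circle_line:
  "continuous_on S (\<lambda>(x, s). x + circlepath 0 r s *s (u::complex^'a::finite))"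
  unfolding circlepath split_def by (intro continuous_intros)

lemma shol_fd_continuous:
  assumes f: "shol f V" and V: "open V"
  shows "continuous_on V (\<lambda>x. fd f x u)"
proof (rule continuous_at_imp_continuous_on, rule ballI)
  fix x0 assume "x0 \<in> V"
  then obtain r where r: "0 < r" "\<And>x t. x \<in> ball x0 r ==> t \<in> cball 0 r ==> x + t *s u \<in> V"
    using shol_local_disc[OF V] by metis
  have c: "circlepath 0 r s \<in> cball 0 r" for s using r(1) by (simp add: circlepath norm_mult)
  have "continuous_on (ball x0 r) (\<lambda>x. integral (cbox 0 1) (\<lambda>s. f (x + circlepath 0 r s *s u) / circlepath 0 r s))"
  proof (rule integral_continuous_on_param)
    have "continuous_on (ball x0 r \<times> cbox 0 1) (\<lambda>p. f ((\<lambda>(x, s). x + circlepath 0 r s *s u) p))"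
      by (rule continuous_on_compose2[OF shol_continuous[OF f] continuous_on_circle_line]) (use r(2) c in auto)
    then have "continuous_on (ball x0 r \<times> cbox 0 1) (\<lambda>p. f ((\<lambda>(x, s). x + circlepath 0 r s *s u) p) / circlepath 0 r (snd p))"
      by (rule continuous_on_divide) (use r(1) in \<open>auto simp: circlepath intro!: continuous_intros\<close>)
    then show "continuous_on (ball x0 r \<times> cbox 0 1) (\<lambda>(x, s). f (x + circlepath 0 r s *s u) / circlepath 0 r s)"
      by (simp add: split_def)
  qed
  then have "continuous_on (ball x0 r) (\<lambda>x. fd f x u)"
    by (rule continuous_on_eq) (use shol_cauchy[OF f r(1)] r(2) in auto)
  then show "continuous (at x0) (\<lambda>x. fd f x u)" using r(1) by (simp add: continuous_on_eq_continuous_at)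
qed

text \<open>The Leibniz rule for parameter integrals asks for derivatives bundled as bounded linear
  maps.\<close>

definition bfd :: "(complex ^ 'a::finite => complex) => complex ^ 'a => ((complex ^ 'a) \<Rightarrow>\<^sub>L complex)" where
  "bfd f x = Blinfun (fd f x)"

lemma bfd_apply: "shol f V ==> x \<in> V ==> blinfun_apply (bfd f x) = fd f x"
  unfolding bfd_def by (intro bounded_linear_Blinfun_apply) (metis has_derivative_bounded_linear shol_fd)

lemma bfd_continuous: assumes "shol f V" "open V" shows "continuous_on V (bfd f)"
proof (rule continuous_on_blinfun_componentwise)
  fix i show "continuous_on V (\<lambda>x. blinfun_apply (bfd f x) i)"
    using shol_fd_continuous[OF assms, of i] by (rule continuous_on_eq) (simp add: bfd_apply[OF assms(1)])
qed

text \<open>The Cauchy integral is differentiated under the integral sign. The Leibniz rule requires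
  the derivative of the integrand to be jointly continuous, which is why continuity of the first
  derivative had to come before. Complex homogeneity passes through the integral.\<close>

lemma shol_derivative:
  assumes f: "shol f V" and V: "open V"
  shows "shol (\<lambda>x. fd f x u) V"
  unfolding shol_def
proof
  fix x0 assume x0: "x0 \<in> V"
  then obtain r where r: "0 < r" "\<And>x t. x \<in> ball x0 r ==> t \<in> cball 0 r ==> x + t *s u \<in> V"
    using shol_local_disc[OF V] by metis
  let ?c = "circlepath 0 r"
  have c: "?c s \<in> cball 0 r" for s using r(1) by (simp add: circlepath norm_mult)
  have c0: "?c s \<noteq> 0" for s using r(1) by (simp add: circlepath)
  define fx where "fx x s = blinfun_mult_left (inverse (?c s)) o\<^sub>L bfd f (x + ?c s *s u)" for x s
  have fxa: "blinfun_apply (fx x s) = (\<lambda>w. fd f (x + ?c s *s u) w / ?c s)" if "x \<in> ball x0 r" for x s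
    using r(2)[OF that c] by (auto simp: fx_def bfd_apply[OF f] divide_inverse)
  let ?G = "\<lambda>x. integral (cbox 0 1) (\<lambda>s. f (x + ?c s *s u) / ?c s)"
  have "(?G has_derivative blinfun_apply (integral (cbox 0 1) (fx x0))) (at x0 within ball x0 r)"
  proof (rule leibniz_rule)
    fix x s assume x: "x \<in> ball x0 r"
    have "((\<lambda>x. x + ?c s *s u) has_derivative (\<lambda>x. x)) (at x)" by (auto intro!: derivative_eq_intros)
    then have "((\<lambda>x. f (x + ?c s *s u)) has_derivative fd f (x + ?c s *s u)) (at x)"
      by (rule has_derivative_compose) (rule shol_fd[OF f r(2)[OF x c]])
    then have "((\<lambda>x. f (x + ?c s *s u) / ?c s) has_derivative (\<lambda>w. fd f (x + ?c s *s u) w / ?c s)) (at x)"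
      unfolding divide_inverse by (rule has_derivative_mult_left)
    then show "((\<lambda>x. f (x + ?c s *s u) / ?c s) has_derivative blinfun_apply (fx x s)) (at x within ball x0 r)"
      using fxa[OF x] has_derivative_at_withinI by metis
  next
    fix x assume x: "x \<in> ball x0 r"
    have "continuous_on (cbox 0 1) (\<lambda>s. f (x + ?c s *s u))"
      by (rule continuous_on_compose2[OF shol_continuous[OF f]]) (use r(2)[OF x c] in \<open>auto simp: circlepath intro!: continuous_intros\<close>)
    then have "continuous_on (cbox 0 1) (\<lambda>s. f (x + ?c s *s u) / ?c s)"
      by (rule continuous_on_divide) (use c0 in \<open>auto simp: circlepath intro!: continuous_intros\<close>)
    then show "(\<lambda>s. f (x + ?c s *s u) / ?c s) integrable_on cbox 0 1" by (rule integrable_continuous)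
  next
    have "continuous_on (ball x0 r \<times> cbox 0 1) (\<lambda>p. bfd f ((\<lambda>(x, s). x + ?c s *s u) p))"
      by (rule continuous_on_compose2[OF bfd_continuous[OF f V] continuous_on_circle_line]) (use r(2) c in auto)
    moreover have "continuous_on (ball x0 r \<times> cbox 0 1) (\<lambda>p. blinfun_mult_left (inverse (?c (snd p))) :: complex \<Rightarrow>\<^sub>L complex)"
      by (intro bounded_linear.continuous_on[OF bounded_linear_blinfun_mult_left] continuous_on_inverse) (use r(1) in \<open>auto simp: circlepath intro!: continuous_intros\<close>)
    ultimately have "continuous_on (ball x0 r \<times> cbox 0 1) (\<lambda>p. blinfun_mult_left (inverse (?c (snd p))) o\<^sub>L bfd f ((\<lambda>(x, s). x + ?c s *s u) p))"
      by (intro bounded_bilinear.continuous_on[OF bounded_bilinear_blinfun_compose])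
    then show "continuous_on (ball x0 r \<times> cbox 0 1) (\<lambda>(x, s). fx x s)" by (simp add: split_def fx_def)
  qed (use r in auto)
  note DB = this
  have D: "(?G has_derivative blinfun_apply (integral (cbox 0 1) (fx x0))) (at x0)"
  proof -
    have "at x0 within ball x0 r = at x0" by (rule at_within_open) (use r(1) in auto)
    then show ?thesis using DB by metis
  qed
  have D': "((\<lambda>x. fd f x u) has_derivative blinfun_apply (integral (cbox 0 1) (fx x0))) (at x0)"
    by (rule has_derivative_transform_within_open[OF D open_ball[of x0 r]])
       (use r shol_cauchy[OF f r(1)] in auto)
  have int: "fx x0 integrable_on cbox 0 1"
  proof (rule integrable_continuous)
    have "continuous_on (cbox 0 1) (\<lambda>s. bfd f (x0 + ?c s *s u))"
      by (rule continuous_on_compose2[OF bfd_continuous[OF f V]]) (use r c in \<open>auto simp: circlepath intro!: continuous_intros\<close>)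
    moreover have "continuous_on (cbox 0 1) (\<lambda>s. blinfun_mult_left (inverse (?c s)) :: complex \<Rightarrow>\<^sub>L complex)"
      by (intro bounded_linear.continuous_on[OF bounded_linear_blinfun_mult_left] continuous_on_inverse) (use r(1) in \<open>auto simp: circlepath intro!: continuous_intros\<close>)
    ultimately show "continuous_on (cbox 0 1) (fx x0)" unfolding fx_def
      by (intro bounded_bilinear.continuous_on[OF bounded_bilinear_blinfun_compose])
  qed
  have "blinfun_apply (integral (cbox 0 1) (fx x0)) (z *s w) = z * blinfun_apply (integral (cbox 0 1) (fx x0)) w" for z w
  proof -
    have "x0 \<in> ball x0 r" using r(1) by simp
    note a = fxa[OF this]
    have "blinfun_apply (integral (cbox 0 1) (fx x0)) (z *s w) = integral (cbox 0 1) (\<lambda>s. z * (fd f (x0 + ?c s *s u) w / ?c s))"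
      unfolding blinfun_apply_integral[OF int] a
      by (rule integral_cong) (use r c shol_fd_scale[OF f] in auto)
    then show ?thesis unfolding blinfun_apply_integral[OF int] a by (simp only: integral_mult_right)
  qed
  then show "\<exists>A. ((\<lambda>x. fd f x u) has_derivative A) (at x0) \<and> (\<forall>c w. A (c *s w) = c * A w)" using D' by blast
qed

subsection \<open>Identity theorem\<close>

lemma line_preimage:
  fixes V :: "(complex ^ 'a::finite) set"
  assumes V: "open V" "convex V"
  shows "open {t. a + t *s u \<in> V}" "connected {t. a + t *s u \<in> V}"
proof -
  show "open {t. a + t *s u \<in> V}"
    using open_vimage[OF V(1) continuous_on_line[of UNIV a u]] by (simp add: vimage_def)
  have "convex {t. a + t *s u \<in> V}" unfolding convex_def
  proof (intro ballI allI impI)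
    fix s t and \<alpha> \<beta> :: real assume *: "s \<in> {t. a + t *s u \<in> V}" "t \<in> {t. a + t *s u \<in> V}" "0 \<le> \<alpha>" "0 \<le> \<beta>" "\<alpha> + \<beta> = 1"
    then have "\<alpha> *\<^sub>R (a + s *s u) + \<beta> *\<^sub>R (a + t *s u) \<in> V" using V(2) by (auto simp: convex_def)
    moreover have "\<alpha> *\<^sub>R (a + s *s u) + \<beta> *\<^sub>R (a + t *s u) = a + (\<alpha> *\<^sub>R s + \<beta> *\<^sub>R t) *s u"
    proof -
      have "complex_of_real \<alpha> = 1 - complex_of_real \<beta>" using *(5) by (metis add_diff_cancel_right' of_real_1 of_real_diff)
      then have z: "complex_of_real \<alpha> * z + complex_of_real \<beta> * z = z" for z by (metis diff_add_cancel distrib_right mult_1)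
      show ?thesis by (simp add: vec_eq_iff scaleR_conv_of_real[where 'a=complex] algebra_simps) (simp only: z simp_thms)
    qed
    ultimately show "\<alpha> *\<^sub>R s + \<beta> *\<^sub>R t \<in> {t. a + t *s u \<in> V}" by simp
  qed
  then show "connected {t. a + t *s u \<in> V}" by (rule convex_connected)
qed

text \<open>On \<open>V \<inter> L\<close> holomorphic functions form an integral domain;
  \<open>L\<close> stands for an affine subspace. On the complex line from \<open>a\<close> to
  \<open>b\<close> the function \<open>f\<close> is nonzero near \<open>a\<close>, so
  \<open>g\<close> vanishes there, and the one-variable identity theorem carries this to
  \<open>b\<close>, the part of the line inside the convex \<open>V\<close> being connected.\<close>

lemma shol_domain:
  fixes V L :: "(complex ^ 'a::finite) set"
  assumes V: "open V" "convex V" and L: "\<And>a b t. a \<in> L ==> b \<in> L ==> a + t *s (b - a) \<in> L"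
    and f: "shol f V" and g: "shol g V" and 0: "\<And>x. x \<in> V \<inter> L ==> f x * g x = 0"
    and a: "a \<in> V \<inter> L" "f a \<noteq> 0" and b: "b \<in> V \<inter> L"
  shows "g b = 0"
proof -
  define T where "T = {t. a + t *s (b - a) \<in> V}"
  note T = line_preimage[OF V, of a "b - a", folded T_def]
  have T01: "0 \<in> T" "1 \<in> T" using a b by (auto simp: T_def)
  let ?F = "\<lambda>t. f (a + t *s (b - a))" and ?G = "\<lambda>t. g (a + t *s (b - a))"
  have holG: "?G holomorphic_on T" by (rule shol_line[OF g]) (auto simp: T_def)
  have "continuous_on T ?F" by (rule holomorphic_on_imp_continuous_on, rule shol_line[OF f]) (auto simp: T_def)
  moreover have "?F 0 \<noteq> 0" using a by simp
  ultimately obtain e where e: "e > 0" "\<And>t. t \<in> T ==> dist 0 t < e ==> ?F t \<noteq> 0"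
    using continuous_on_avoid[of T ?F 0 0] T01 by metis
  define U where "U = T \<inter> ball 0 e"
  have "?G t = 0" if "t \<in> U" for t
  proof -
    have "a + t *s (b - a) \<in> V \<inter> L" using that L a b by (auto simp: U_def T_def)
    from 0[OF this] show ?thesis using e(2)[of t] that by (auto simp: U_def)
  qed
  moreover have "0 islimpt U"
  proof -
    have "open U" "0 \<in> U" using T(1) T01 e by (auto simp: U_def)
    then show ?thesis by (simp add: interior_limit_point interior_open)
  qed
  ultimately have "?G 1 = 0"
    using analytic_continuation[OF holG T, of U 0 1] T01 by (auto simp: U_def)
  then show ?thesis by simp
qed

text \<open>Source of all generic choices below: finitely many nontrivial holomorphic conditions can
  be met at once.\<close>

lemma shol_prod_nonzero:
  fixes V L :: "(complex ^ 'a::finite) set"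
  assumes V: "open V" "convex V" and L: "\<And>a b t. a \<in> L ==> b \<in> L ==> a + t *s (b - a) \<in> L"
    and ne: "V \<inter> L \<noteq> {}" and I: "finite I" and f: "\<And>i. i \<in> I ==> shol (f i) V" "\<And>i. i \<in> I ==> \<exists>x\<in>V \<inter> L. f i x \<noteq> 0"
  shows "\<exists>x\<in>V \<inter> L. \<forall>i\<in>I. f i x \<noteq> 0"
proof -
  have "\<exists>x\<in>V \<inter> L. (\<Prod>i\<in>I. f i x) \<noteq> 0" using I f
  proof (induction I)
    case empty then show ?case using ne by auto
  next
    case (insert j I)
    then obtain a where a: "a \<in> V \<inter> L" "(\<Prod>i\<in>I. f i a) \<noteq> 0" by blast
    obtain b where b: "b \<in> V \<inter> L" "f j b \<noteq> 0" using insert by blast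
    show ?case
    proof (rule ccontr)
      assume "\<not> ?thesis"
      then have "\<And>x. x \<in> V \<inter> L ==> (\<Prod>i\<in>I. f i x) * f j x = 0" using insert by (simp add: mult.commute)
      then have "f j b = 0"
        using shol_domain[OF V L, of "\<lambda>x. \<Prod>i\<in>I. f i x" "f j" a b] a b insert.prems(1) by blast
      then show False using b by simp
    qed
  qed
  then show ?thesis using I by auto
qed

subsection \<open>The inverse function theorem\<close>

lemma holo_bfd:
  fixes F :: "complex ^ 'a::finite => complex ^ 'b::finite"
  assumes F: "holo_on F V" and V: "open V"
  shows "continuous_on V (\<lambda>x. Blinfun (fd F x))"
    and "x \<in> V ==> blinfun_apply (Blinfun (fd F x)) = fd F x"
proof -
  show a: "blinfun_apply (Blinfun (fd F x)) = fd F x" if "x \<in> V" for x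
    using holo_on_has_derivative(1)[OF F that] has_derivative_bounded_linear bounded_linear_Blinfun_apply by blast
  show "continuous_on V (\<lambda>x. Blinfun (fd F x))"
  proof (rule continuous_on_blinfun_componentwise)
    fix u :: "complex^'a"
    have "continuous_on V (\<lambda>x. \<chi> i. fd (\<lambda>x. F x $ i) x u)"
      using F V by (intro continuous_intros shol_fd_continuous) (auto simp: holo_on_iff)
    then show "continuous_on V (\<lambda>x. blinfun_apply (Blinfun (fd F x)) u)"
      by (rule continuous_on_eq) (simp add: a vec_eq_iff fd_holo_component[OF F])
  qed
qed

text \<open>The real inverse function theorem gives \<open>g\<close>; its derivative is complex
  homogeneous because it inverts a map that is. Bijectivity of the derivative on all of
  \<open>U\<close> is kept since it later shows that nodes remain nodes.\<close>

lemma holo_inverse: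
  fixes F :: "complex ^ 'a::finite => complex ^ 'a"
  assumes F: "holo_on F V" and V: "open V" "x0 \<in> V" and inj: "\<And>u. fd F x0 u = 0 ==> u = 0"
  obtains U W g where "open U" "U \<subseteq> V" "x0 \<in> U" "open W" "F x0 \<in> W" "homeomorphism U W F g" "holo_on g W"
    "\<And>x. x \<in> U ==> bij (fd F x)"
    "\<And>x u. x \<in> U ==> fd g (F x) (fd F x u) = u"
proof -
  let ?D = "\<lambda>x. fd F x"
  have lin: "linear (?D x)" if "x \<in> V" for x using holo_on_has_derivative(1)[OF F that] has_derivative_linear by blast
  have "inj (?D x0)" using lin[OF V(2)] inj linear_injective_0 by blast
  then obtain h where h: "linear h" "h \<circ> ?D x0 = id" "?D x0 \<circ> h = id"
    using linear_injective_isomorphism[OF lin[OF V(2)]] by (metis comp_apply eq_id_iff ext)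
  have inv: "Blinfun h o\<^sub>L Blinfun (?D x0) = id_blinfun"
  proof (rule blinfun_eqI)
    fix u
    have "blinfun_apply (Blinfun h) = h" using h(1) by (simp add: bounded_linear_Blinfun_apply linear_conv_bounded_linear)
    then show "blinfun_apply (Blinfun h o\<^sub>L Blinfun (?D x0)) u = blinfun_apply id_blinfun u"
      using h(2) by (simp add: holo_bfd(2)[OF F V] fun_eq_iff)
  qed
  have derf: "(F has_derivative blinfun_apply (Blinfun (?D x))) (at x)" if "x \<in> V" for x
    using holo_on_has_derivative(1)[OF F that] holo_bfd(2)[OF F V(1) that] by simp
  obtain U W g g' where *: "open U" "U \<subseteq> V" "x0 \<in> U" "open W" "F x0 \<in> W" "homeomorphism U W F g"
    "\<And>y. y \<in> W ==> (g has_derivative (g' y)) (at y)"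
    "\<And>y. y \<in> W ==> g' y = inv (blinfun_apply (Blinfun (?D (g y))))"
    "\<And>y. y \<in> W ==> bij (blinfun_apply (Blinfun (?D (g y))))"
    by (rule inverse_function_theorem[OF V(1) derf holo_bfd(1)[OF F V(1)] V(2) inv]) (assumption | (rule that; assumption))+
  have g: "g y \<in> U" "F (g y) = y" if "y \<in> W" for y using *(6) that by (auto simp: homeomorphism_def)
  have g'1: "bij (?D (g y))" "g' y = inv (?D (g y))" if "y \<in> W" for y
    using *(8,9)[OF that] holo_bfd(2)[OF F V(1)] g(1)[OF that] *(2) by auto
  have "holo_on g W" unfolding holo_on_def
  proof (intro ballI exI conjI allI)
    fix y c w assume y: "y \<in> W"
    show "(g has_derivative g' y) (at y)" by (rule *(7)[OF y])
    have "?D (g y) (g' y w) = w" for w using g'1[OF y] by (simp add: bij_is_surj surj_f_inv_f)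
    moreover have "?D (g y) (c *s g' y w) = c *s ?D (g y) (g' y w)"
      using holo_on_has_derivative(2)[OF F] g(1)[OF y] *(2) by blast
    ultimately have "?D (g y) (c *s g' y w) = ?D (g y) (g' y (c *s w))" by simp
    then show "g' y (c *s w) = c *s g' y w" using g'1[OF y] by (metis bij_is_inj injD)
  qed
  moreover have "F x \<in> W" "g (F x) = x" if "x \<in> U" for x using *(6) that by (auto simp: homeomorphism_def)
  moreover have "fd g (F x) (?D x u) = u" if "x \<in> U" for x u
  proof -
    have Fx: "F x \<in> W" "g (F x) = x" using *(6) that by (auto simp: homeomorphism_def)
    have "fd g (F x) = g' (F x)" using *(7)[OF Fx(1)] frechet_derivative_at by metis
    then show ?thesis using g'1[OF Fx(1)] Fx(2) by (simp add: bij_is_inj)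
  qed
  moreover have "bij (?D x)" if "x \<in> U" for x
    using g'1(1)[of "F x"] *(6) that by (auto simp: homeomorphism_def)
  ultimately show ?thesis using that[OF *(1-6)] by blast
qed

section \<open>Noetherian rings\<close>

text \<open>Rings are subsets of an ambient ring type: polynomial functions will be taken inside the
  ring of all complex functions on the space.\<close>

definition is_subring :: "'r::comm_ring_1 set => bool" where
  "is_subring S \<longleftrightarrow> 0 \<in> S \<and> 1 \<in> S \<and> (\<forall>a\<in>S. \<forall>b\<in>S. a + b \<in> S \<and> a * b \<in> S \<and> - a \<in> S)"

definition is_ideal :: "'r::comm_ring_1 set => 'r set => bool" where
  "is_ideal S I \<longleftrightarrow> I \<subseteq> S \<and> 0 \<in> I \<and> (\<forall>a\<in>I. \<forall>b\<in>I. a + b \<in> I) \<and> (\<forall>s\<in>S. \<forall>a\<in>I. s * a \<in> I)"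

definition noeth :: "'r::comm_ring_1 set => bool" where
  "noeth S \<longleftrightarrow> (\<forall>I :: nat => 'r set. (\<forall>n. is_ideal S (I n)) \<and> (\<forall>n. I n \<subseteq> I (Suc n)) --> (\<exists>m. \<forall>n\<ge>m. I n = I m))"

text \<open>The ring generated by \<open>S\<close> and \<open>x\<close> in the ambient ring;
  \<open>x\<close> may satisfy relations over \<open>S\<close>.\<close>

definition adj :: "'r::comm_ring_1 set => 'r => 'r set" where
  "adj S x = {poly p x | p. \<forall>k. coeff p k \<in> S}"

lemma subringD:
  assumes "is_subring S"
  shows "0 \<in> S" "1 \<in> S" "a \<in> S ==> b \<in> S ==> a + b \<in> S" "a \<in> S ==> b \<in> S ==> a * b \<in> S" "a \<in> S ==> - a \<in> S"
    "a \<in> S ==> b \<in> S ==> a - b \<in> S" "a \<in> S ==> a ^ k \<in> S"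
proof -
  show *: "0 \<in> S" "1 \<in> S" "\<And>a b. a \<in> S ==> b \<in> S ==> a + b \<in> S" "\<And>a b. a \<in> S ==> b \<in> S ==> a * b \<in> S" "\<And>a. a \<in> S ==> - a \<in> S"
    using assms by (auto simp: is_subring_def)
  show "a \<in> S ==> b \<in> S ==> a - b \<in> S" using *(3)[of a "- b"] *(5)[of b] by simp
  show "a \<in> S ==> a ^ k \<in> S" by (induction k) (auto intro: *)
qed

lemma subring_sum: "is_subring S ==> (\<And>i. i \<in> I ==> f i \<in> S) ==> sum f I \<in> S"
  by (induction I rule: infinite_finite_induct) (auto intro: subringD)

lemma idealD:
  assumes "is_subring S" "is_ideal S I"
  shows "I \<subseteq> S" "0 \<in> I" "a \<in> I ==> b \<in> I ==> a + b \<in> I" "s \<in> S ==> a \<in> I ==> s * a \<in> I" "s \<in> S ==> a \<in> I ==> a * s \<in> I"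
    "a \<in> I ==> b \<in> I ==> a - b \<in> I"
proof -
  show *: "I \<subseteq> S" "0 \<in> I" "\<And>a b. a \<in> I ==> b \<in> I ==> a + b \<in> I" "\<And>s a. s \<in> S ==> a \<in> I ==> s * a \<in> I"
    using assms(2) by (auto simp: is_ideal_def)
  show "s \<in> S ==> a \<in> I ==> a * s \<in> I" using *(4)[of s a] by (simp add: mult.commute)
  show "a \<in> I ==> b \<in> I ==> a - b \<in> I"
    using *(3)[of a "(-1) * b"] *(4)[of "-1" b] subringD[OF assms(1)] by simp
qed

lemma ideal_sum: "is_subring S ==> is_ideal S J ==> (\<And>i. i \<in> I ==> f i \<in> J) ==> sum f I \<in> J"
  by (induction I rule: infinite_finite_induct) (auto intro: idealD)

lemma chain_mono: "(\<And>n. I n \<subseteq> I (Suc n)) ==> m \<le> n ==> I m \<subseteq> (I n :: 'a set)"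
  by (metis lift_Suc_mono_le)

lemma adj_subring:
  assumes S: "is_subring S"
  shows "is_subring (adj S x)" "S \<subseteq> adj S x" "x \<in> adj S x"
proof -
  note s = subringD[OF S]
  have c: "coeff [:a:] k \<in> S" if "a \<in> S" for a k using that s(1) by (cases k) auto
  show "S \<subseteq> adj S x"
  proof
    fix a assume "a \<in> S"
    then have "a = poly [:a:] x \<and> (\<forall>k. coeff [:a:] k \<in> S)" using c by simp
    then show "a \<in> adj S x" unfolding adj_def by blast
  qed
  have "coeff [:0, 1:] k \<in> S" for k using s(1,2) by (auto simp: coeff_pCons split: nat.split)
  then show "x \<in> adj S x" unfolding adj_def by (auto intro!: exI[of _ "[:0,1:]"])
  show "is_subring (adj S x)" unfolding is_subring_def
  proof (intro conjI ballI)
    show "0 \<in> adj S x" "1 \<in> adj S x" using \<open>S \<subseteq> adj S x\<close> s by auto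
    fix a b assume "a \<in> adj S x" "b \<in> adj S x"
    then obtain p q where pq: "a = poly p x" "b = poly q x" "\<And>k. coeff p k \<in> S" "\<And>k. coeff q k \<in> S"
      by (auto simp: adj_def)
    have "a + b = poly (p + q) x \<and> (\<forall>k. coeff (p + q) k \<in> S)" using pq s by auto
    then show "a + b \<in> adj S x" unfolding adj_def by blast
    have "coeff (p * q) k \<in> S" for k unfolding coeff_mult using pq s by (intro subring_sum[OF S]) auto
    then have "a * b = poly (p * q) x \<and> (\<forall>k. coeff (p * q) k \<in> S)" using pq by auto
    then show "a * b \<in> adj S x" unfolding adj_def by blast
    have "- a = poly (- p) x \<and> (\<forall>k. coeff (- p) k \<in> S)" using pq s by auto
    then show "- a \<in> adj S x" unfolding adj_def by blast
  qed
qed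

text \<open>Hilbert's basis theorem: an ideal is determined by the ideals of leading coefficients of its
  elements of each degree, and these form a doubly increasing family.\<close>

theorem noeth_adj:
  assumes S: "is_subring S" "noeth S" shows "noeth (adj S x)"
  unfolding noeth_def
proof (intro allI impI, elim conjE)
  fix I assume I: "\<forall>n. is_ideal (adj S x) (I n)" and asc: "\<forall>n. I n \<subseteq> I (Suc n)"
  note s = subringD[OF S(1)] and A = adj_subring[OF S(1), of x]
  note i = idealD[OF A(1) I[rule_format]]
  \<comment> \<open>Since \<open>x\<close> may be algebraic over \<open>S\<close>, leading
    coefficients make sense only for polynomials; \<open>J n\<close> is the preimage of
    \<open>I n\<close> under evaluation.\<close>
  define J where "J n = {p. (\<forall>k. coeff p k \<in> S) \<and> poly p x \<in> I n}" for n
  define L where "L n d = {a. \<exists>p\<in>J n. degree p \<le> d \<and> coeff p d = a}" for n d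
  have J_add: "p + q \<in> J n" if "p \<in> J n" "q \<in> J n" for p q n using that s i by (auto simp: J_def)
  have J_smult: "smult a p \<in> J n" if "a \<in> S" "p \<in> J n" for a p n using that s i A(2) by (auto simp: J_def)
  have J_shift: "pCons 0 p \<in> J n" if "p \<in> J n" for p n using that s i A(3) by (auto simp: J_def coeff_pCons split: nat.split)
  have "0 \<in> J n" for n using s i by (auto simp: J_def)
  then have L_ideal: "is_ideal S (L n d)" for n d
  proof -
    have "a + b \<in> L n d" if ab: "a \<in> L n d" "b \<in> L n d" for a b
    proof -
      obtain p q where "p \<in> J n" "degree p \<le> d" "coeff p d = a" "q \<in> J n" "degree q \<le> d" "coeff q d = b"
        using ab by (auto simp: L_def)
      then have "p + q \<in> J n \<and> degree (p + q) \<le> d \<and> coeff (p + q) d = a + b" using J_add by (auto intro: degree_add_le)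
      then show ?thesis by (auto simp: L_def)
    qed
    moreover have "c * a \<in> L n d" if ac: "c \<in> S" "a \<in> L n d" for a c
    proof -
      obtain p where "p \<in> J n" "degree p \<le> d" "coeff p d = a" using ac by (auto simp: L_def)
      then have "smult c p \<in> J n \<and> degree (smult c p) \<le> d \<and> coeff (smult c p) d = c * a"
        using J_smult ac by (auto intro: order_trans[OF degree_smult_le])
      then show ?thesis by (auto simp: L_def)
    qed
    moreover have "L n d \<subseteq> S" by (auto simp: L_def J_def)
    moreover have "0 \<in> L n d" using \<open>\<And>n. 0 \<in> J n\<close> by (auto simp: L_def intro!: bexI[of _ 0])
    ultimately show ?thesis by (auto simp: is_ideal_def)
  qed
  have L_n: "L m d \<subseteq> L n d" if "m \<le> n" for m n d
    using chain_mono[of I m n] asc that by (auto simp: L_def J_def)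
  have "L n d \<subseteq> L n (Suc d)" for n d
  proof
    fix a assume "a \<in> L n d"
    then obtain p where "p \<in> J n" "degree p \<le> d" "coeff p d = a" by (auto simp: L_def)
    then have "pCons 0 p \<in> J n \<and> degree (pCons 0 p) \<le> Suc d \<and> coeff (pCons 0 p) (Suc d) = a"
      using J_shift by (auto intro: order_trans[OF degree_pCons_le])
    then show "a \<in> L n (Suc d)" unfolding L_def by blast
  qed
  then have L_d: "L n d \<subseteq> L n e" if "d \<le> e" for n d e using chain_mono[of "L n"] that by blast
  have "L n d \<subseteq> L (Suc n) d" for n d by (rule L_n) simp
  then have "\<exists>m. \<forall>n\<ge>m. L n d = L m d" for d
    using S(2)[unfolded noeth_def, rule_format, of "\<lambda>n. L n d"] L_ideal by blast
  then obtain N where N: "\<And>d n. n \<ge> N d ==> L n d = L (N d) d" by metis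
  \<comment> \<open>The diagonal chain settles all degrees at or above \<open>m0\<close> together;
    the finitely many degrees below are settled by \<open>N d\<close>.\<close>
  have "L n n \<subseteq> L (Suc n) (Suc n)" for n using L_n[of n "Suc n" n] L_d[of n "Suc n" "Suc n"] by auto
  then obtain m0 where m0: "\<And>n. n \<ge> m0 ==> L n n = L m0 m0"
    using S(2)[unfolded noeth_def, rule_format, of "\<lambda>n. L n n"] L_ideal by blast
  define m where "m = Max (insert m0 (N ` {..<m0}))"
  have m: "m0 \<le> m" "\<And>d. d < m0 ==> N d \<le> m" by (auto simp: m_def)
  have stab: "L n d \<subseteq> L m d" if "n \<ge> m" for n d
  proof (cases "d < m0")
    case True
    then show ?thesis using N[of d n] N[of d m] m that by (metis order_refl order_trans)
  next
    case False
    have "L n d \<subseteq> L (max n d) (max n d)" using L_n[of n "max n d" d] L_d[of d "max n d" "max n d"] by auto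
    also have "\<dots> = L m0 m0" using False by (intro m0) auto
    also have "\<dots> \<subseteq> L m d" using L_n[of m0 m m0] L_d[of m0 d m] m False by auto
    finally show ?thesis .
  qed
  \<comment> \<open>Subtracting an element of \<open>J m\<close> with the same coefficient in degree
    \<open>d\<close> lowers the degree bound.\<close>
  have "p \<in> J m" if nm: "n \<ge> m" "p \<in> J n" "degree p < d" for n p d
    using nm(2,3)
  proof (induction d arbitrary: p)
    case (Suc d)
    have "p \<in> J n \<and> degree p \<le> d \<and> coeff p d = coeff p d" using Suc.prems by simp
    then have "coeff p d \<in> L n d" unfolding L_def by blast
    then obtain q where q: "q \<in> J m" "degree q \<le> d" "coeff q d = coeff p d" using stab[OF nm(1)] by (auto simp: L_def)
    then have qn: "q \<in> J n" using chain_mono[of I m n] asc nm by (auto simp: J_def)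
    have "p + smult (- 1) q \<in> J n" using J_add[OF Suc.prems(1) J_smult[OF _ qn, of "-1"]] s by simp
    then have pq: "p - q \<in> J n" by simp
    have "p - q \<in> J m"
    proof (cases "p - q = 0")
      case True then show ?thesis using \<open>\<And>n. 0 \<in> J n\<close> by metis
    next
      case False
      have "degree (p - q) \<le> d" using Suc.prems q by (auto intro: degree_diff_le)
      moreover have "coeff (p - q) d = 0" using q by simp
      ultimately have "degree (p - q) < d" using False by (metis leading_coeff_0_iff le_neq_implies_less)
      then show ?thesis using Suc.IH pq by blast
    qed
    then show ?case using J_add[of "p - q" m q] q by simp
  qed simp
  then have "J n \<subseteq> J m" if "n \<ge> m" for n using that by (metis lessI subsetI)
  moreover have "I n \<subseteq> {poly p x | p. p \<in> J n}" for n using i(1)[of n] by (auto simp: adj_def J_def)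
  ultimately have "I n \<subseteq> I m" if "n \<ge> m" for n using that by (fastforce simp: J_def)
  then show "\<exists>m. \<forall>n\<ge>m. I n = I m" using chain_mono[of I] asc by (metis subset_antisym)
qed

text \<open>The \<open>k\<close>-th power of the ideal generated by the \<open>a i\<close>.\<close>

primrec mk :: "'r::comm_ring_1 set => ('m::finite => 'r) => nat => 'r set" where
  "mk S a 0 = S"
| "mk S a (Suc k) = {\<Sum>i\<in>UNIV. a i * g i | g. \<forall>i. g i \<in> mk S a k}"

lemma mk_subset: "is_subring S ==> (\<And>i. a i \<in> S) ==> mk S a k \<subseteq> S"
proof (induction k)
  case (Suc k) then show ?case by (auto intro!: subring_sum subringD)
qed auto

text \<open>Induction on the sum of the exponents: replacing \<open>Q\<close> by the colon ideal of
  the elements that multiply \<open>a i\<close> into \<open>Q\<close> lowers the exponent of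
  \<open>a i\<close> by one. Once some exponent is 0, \<open>Q\<close> is the whole ring.\<close>

lemma mk_subset_powers:
  assumes S: "is_subring S" and a: "\<And>i. a i \<in> S" and Q: "is_ideal S Q" and e: "\<And>i. a i ^ e i \<in> Q"
    and n: "(\<Sum>i\<in>UNIV. e i) = n"
  shows "mk S a n \<subseteq> Q"
  using Q e n
proof (induction n arbitrary: Q e)
  case 0
  then have "e undefined = 0" by simp
  then have "1 \<in> Q" using 0(2)[of undefined] by simp
  then show ?case using idealD(5)[OF S 0(1), of _ 1] by auto
next
  case (Suc n)
  note q = idealD[OF S Suc.prems(1)] and s = subringD[OF S]
  show ?case
  proof (cases "\<exists>i. e i = 0")
    case True
    then have "1 \<in> Q" using Suc.prems(2) by (metis power_0)
    then have "S \<subseteq> Q" using q(5)[of _ 1] by auto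
    moreover have "mk S a (Suc n) \<subseteq> S" by (rule mk_subset[OF S a])
    ultimately show ?thesis by (rule order_trans[rotated])
  next
    case False
    { fix i g assume g: "g \<in> mk S a n"
      define R where "R = {r \<in> S. r * a i \<in> Q}"
      have R: "is_ideal S R" unfolding is_ideal_def R_def using q s a by (auto simp: algebra_simps)
      have "a j ^ (e(i := e i - 1)) j \<in> R" for j
      proof (cases "j = i")
        case True
        have "a i ^ (e i - 1) * a i = a i ^ e i" using False by (metis gr0I power_minus_mult)
        then show ?thesis using True Suc.prems(2) s a by (auto simp: R_def)
      next
        case False
        then show ?thesis using Suc.prems(2) s a q by (auto simp: R_def)
      qed
      moreover have "(\<Sum>j\<in>UNIV. (e(i := e i - 1)) j) = n"
      proof -
        have "(\<Sum>j\<in>UNIV. e j) = Suc (\<Sum>j\<in>UNIV. (e(i := e i - 1)) j)"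
          by (subst (1 2) sum.remove[of UNIV i]) (use False in auto)
        then show ?thesis using Suc.prems(3) by simp
      qed
      ultimately have "g \<in> R" using Suc.IH[OF R] g by blast
      then have "a i * g \<in> Q" by (simp add: R_def mult.commute) }
    then show ?thesis by (auto intro!: ideal_sum[OF S Suc.prems(1)])
  qed
qed

text \<open>Krull's intersection theorem. A maximal ideal \<open>Q\<close> among those that meet \<open>F + (g)\<close> only in
  \<open>F + \<mm> g\<close> contains a power of every \<open>a i\<close>, hence a power of \<open>\<mm>\<close>, and therefore \<open>g\<close>.\<close>

theorem krull_intersection:
  fixes a :: "'m::finite => 'r::comm_ring_1"
  assumes S: "is_subring S" "noeth S" and F: "is_ideal S F" and a: "\<And>i. a i \<in> S" and g: "g \<in> S"
    and mem: "\<And>k. \<exists>f\<in>F. g - f \<in> mk S a k"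
  shows "\<exists>b. (\<forall>i. b i \<in> S) \<and> g - (\<Sum>i\<in>UNIV. b i * a i) * g \<in> F"
proof -
  note s = subringD[OF S(1)] and f = idealD[OF S(1) F]
  \<comment> \<open>With \<mm> the ideal generated by the \<open>a i\<close>, \<open>N\<close> is F
    + \<mm> g and \<open>FG\<close> is F + (g); the goal is that \<open>g\<close> lies in
    \<open>N\<close>.\<close>
  define N where "N = {u. \<exists>f\<in>F. \<exists>b. (\<forall>i. b i \<in> S) \<and> u = f + (\<Sum>i\<in>UNIV. b i * a i) * g}"
  define FG where "FG = {u. \<exists>f\<in>F. \<exists>r\<in>S. u = f + r * g}"
  have NI: "f1 + (\<Sum>i\<in>UNIV. b i * a i) * g \<in> N" if "f1 \<in> F" "\<And>i. b i \<in> S" for f1 b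
    unfolding N_def using that by blast
  have N: "is_ideal S N" unfolding is_ideal_def
  proof (intro conjI ballI)
    show "N \<subseteq> S" using f(1) s a g by (auto simp: N_def intro!: s(3,4) subring_sum[OF S(1)])
    show "0 \<in> N" unfolding N_def using f(2) s by (auto intro!: bexI[of _ 0] exI[of _ "\<lambda>_. 0"])
    fix u v assume "u \<in> N" "v \<in> N"
    then obtain f1 f2 b1 b2 where "f1 \<in> F" "f2 \<in> F" "\<forall>i. b1 i \<in> S" "\<forall>i. b2 i \<in> S" "u = f1 + (\<Sum>i\<in>UNIV. b1 i * a i) * g"
      "v = f2 + (\<Sum>i\<in>UNIV. b2 i * a i) * g" by (auto simp: N_def)
    moreover from this have eq: "u + v = (f1 + f2) + (\<Sum>i\<in>UNIV. (b1 i + b2 i) * a i) * g"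
      by (simp add: algebra_simps sum.distrib)
    moreover have "f1 + f2 \<in> F" "\<And>i. b1 i + b2 i \<in> S" using calculation f(3) s(3) by blast+
    ultimately show "u + v \<in> N" unfolding eq by (intro NI)
  next
    fix r u assume r: "r \<in> S" "u \<in> N"
    then obtain f1 b1 where "f1 \<in> F" "\<forall>i. b1 i \<in> S" "u = f1 + (\<Sum>i\<in>UNIV. b1 i * a i) * g" by (auto simp: N_def)
    moreover from this have eq: "r * u = r * f1 + (\<Sum>i\<in>UNIV. (r * b1 i) * a i) * g"
      by (simp add: algebra_simps sum_distrib_left)
    moreover have "r * f1 \<in> F" "\<And>i. r * b1 i \<in> S" using calculation f(4) s(4) r by blast+
    ultimately show "r * u \<in> N" unfolding eq by (intro NI)
  qed
  have aFG: "a i * u \<in> N" if u: "u \<in> FG" for i u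
  proof -
    obtain f1 r where "f1 \<in> F" "r \<in> S" "u = f1 + r * g" using u by (auto simp: FG_def)
    moreover have "(\<Sum>j\<in>UNIV. (if j = i then r else 0) * a j) = r * a i"
    proof -
      have "(\<Sum>j\<in>UNIV. (if j = i then r else 0) * a j) = (\<Sum>j\<in>UNIV. if j = i then r * a j else 0)"
        by (rule sum.cong) auto
      then show ?thesis by simp
    qed
    ultimately have eq: "a i * u = a i * f1 + (\<Sum>j\<in>UNIV. (if j = i then r else 0) * a j) * g"
      by (simp add: algebra_simps)
    moreover have "a i * f1 \<in> F" "\<And>j. (if j = i then r else 0) \<in> S" using f(4) a \<open>f1 \<in> F\<close> \<open>r \<in> S\<close> s(1) by auto
    ultimately show ?thesis unfolding eq by (intro NI)
  qed
  define good where "good Q \<longleftrightarrow> is_ideal S Q \<and> N \<subseteq> Q \<and> Q \<inter> FG \<subseteq> N" for Q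
  \<comment> \<open>Otherwise every good ideal has a strictly larger good one, and iterating from
    \<open>N\<close> contradicts the ascending chain condition.\<close>
  have "\<exists>Q. good Q \<and> (\<forall>Q'. good Q' \<and> Q \<subseteq> Q' --> Q' = Q)"
  proof (rule ccontr)
    assume "\<not> ?thesis"
    then obtain h where h: "\<And>Q. good Q ==> good (h Q) \<and> Q \<subset> h Q" by (metis psubsetI)
    have "good N" using N by (auto simp: good_def)
    then have *: "good ((h ^^ n) N)" for n using h by (induction n) auto
    then have "(h ^^ n) N \<subset> (h ^^ Suc n) N" for n using h by auto
    then have "\<exists>m. \<forall>n\<ge>m. (h ^^ n) N = (h ^^ m) N"
      using * S(2)[unfolded noeth_def, rule_format, of "\<lambda>n. (h ^^ n) N"] unfolding good_def by blast
    then show False using \<open>\<And>n. (h ^^ n) N \<subset> (h ^^ Suc n) N\<close> by (metis le_add2 plus_1_eq_Suc psubset_eq)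
  qed
  then obtain Q where Q: "good Q" and max: "\<And>Q'. good Q' ==> Q \<subseteq> Q' ==> Q' = Q" by blast
  have Qi: "is_ideal S Q" using Q by (simp add: good_def)
  note q = idealD[OF S(1) Qi]
  have "\<exists>j. a i ^ j \<in> Q" for i
  proof -
    \<comment> \<open>The colon ideals of the powers of \<open>a i\<close> stabilise, say at
      \<open>j\<close>. An element q1 + r a^j of F + (g) satisfies a (q1 + r a^j) \<in> N
      \<subseteq> Q, so r a^(j+1) and by stability r a^j lie in Q. Thus Q + (a^j) is still good, and
      maximality puts a^j into Q.\<close>
    define C where "C j = {r \<in> S. r * a i ^ j \<in> Q}" for j
    have "is_ideal S (C j)" for j unfolding is_ideal_def C_def using q s by (auto simp: algebra_simps)
    moreover have "C j \<subseteq> C (Suc j)" for j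
    proof
      fix r assume "r \<in> C j"
      then have "r \<in> S" "a i * (r * a i ^ j) \<in> Q" using q(4)[OF a[of i]] by (auto simp: C_def)
      then show "r \<in> C (Suc j)" by (simp add: C_def algebra_simps)
    qed
    ultimately obtain j where j0: "\<forall>n\<ge>j. C n = C j" using S(2) unfolding noeth_def by blast
    have j: "C (Suc j) = C j" by (rule j0[rule_format]) simp
    define Q' where "Q' = {u. \<exists>q\<in>Q. \<exists>r\<in>S. u = q + r * a i ^ j}"
    have Q'i: "is_ideal S Q'" unfolding is_ideal_def
    proof (intro conjI ballI)
      show "Q' \<subseteq> S" using q(1) s a by (auto simp: Q'_def intro!: s(3,4,7))
      show "0 \<in> Q'" unfolding Q'_def using q(2) s by (auto intro!: bexI[of _ 0])
      fix u v assume "u \<in> Q'" "v \<in> Q'"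
      then obtain q1 q2 r1 r2 where "q1 \<in> Q" "q2 \<in> Q" "r1 \<in> S" "r2 \<in> S" "u = q1 + r1 * a i ^ j" "v = q2 + r2 * a i ^ j"
        by (auto simp: Q'_def)
      moreover from this have "u + v = (q1 + q2) + (r1 + r2) * a i ^ j" by (simp add: algebra_simps)
      moreover have "q1 + q2 \<in> Q" "r1 + r2 \<in> S" using calculation q(3) s(3) by blast+
      ultimately show "u + v \<in> Q'" unfolding Q'_def by blast
    next
      fix r u assume r: "r \<in> S" "u \<in> Q'"
      then obtain q1 r1 where "q1 \<in> Q" "r1 \<in> S" "u = q1 + r1 * a i ^ j" by (auto simp: Q'_def)
      moreover from this have "r * u = r * q1 + (r * r1) * a i ^ j" by (simp add: algebra_simps)
      moreover have "r * q1 \<in> Q" "r * r1 \<in> S" using calculation q(4) s(4) r(1) by blast+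
      ultimately show "r * u \<in> Q'" unfolding Q'_def by blast
    qed
    have QI: "q + r * a i ^ j \<in> Q'" if "q \<in> Q" "r \<in> S" for q r unfolding Q'_def using that by blast
    have QQ: "Q \<subseteq> Q'" using QI[of _ 0] s by auto
    have Q'N: "Q' \<inter> FG \<subseteq> N"
    proof
      fix u assume u: "u \<in> Q' \<inter> FG"
      then obtain q1 r where qr: "q1 \<in> Q" "r \<in> S" "u = q1 + r * a i ^ j" by (auto simp: Q'_def)
      have "a i * u \<in> Q" using aFG[of u i] u Q by (auto simp: good_def)
      then have "a i * u - a i * q1 \<in> Q" using q(6) q(4)[OF a qr(1)] by metis
      moreover have "a i * u - a i * q1 = r * a i ^ Suc j" by (simp add: qr(3) algebra_simps)
      ultimately have "r \<in> C (Suc j)" using qr by (simp add: C_def)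
      then have "r * a i ^ j \<in> Q" using j by (auto simp: C_def)
      then have "u \<in> Q" using q(3)[OF qr(1)] qr(3) by simp
      then show "u \<in> N" using u Q by (auto simp: good_def)
    qed
    have "good Q'" using Q Q'i QQ Q'N by (auto simp: good_def)
    then have "Q' = Q" using max QQ by blast
    moreover have "a i ^ j \<in> Q'" using QI[of 0 1] q(2) s by simp
    ultimately show ?thesis by blast
  qed
  then obtain e where e: "\<And>i. a i ^ e i \<in> Q" by metis
  obtain f1 where f1: "f1 \<in> F" "g - f1 \<in> mk S a (\<Sum>i\<in>UNIV. e i)" using mem by blast
  have "mk S a (\<Sum>i\<in>UNIV. e i) \<subseteq> Q" by (rule mk_subset_powers[OF S(1) a Qi e refl])
  then have "g - f1 \<in> Q" using f1 by blast
  moreover have "f1 \<in> Q"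
  proof -
    have "f1 \<in> N" using NI[of f1 "\<lambda>_. 0"] f1 s by simp
    then show ?thesis using Q by (auto simp: good_def)
  qed
  ultimately have "(g - f1) + f1 \<in> Q" by (rule q(3))
  moreover have "g \<in> FG"
  proof -
    have "0 + 1 * g \<in> FG" unfolding FG_def using f(2) s(2) by blast
    then show ?thesis by simp
  qed
  ultimately have "g \<in> N" using Q by (auto simp: good_def)
  then obtain f2 b where "f2 \<in> F" "\<forall>i. b i \<in> S" "g = f2 + (\<Sum>i\<in>UNIV. b i * a i) * g" by (auto simp: N_def)
  moreover from this have "g - (\<Sum>i\<in>UNIV. b i * a i) * g = f2" by (simp add: algebra_simps)
  ultimately show ?thesis by metis
qed

section \<open>Polynomial functions\<close>

text \<open>Inhomogeneous polynomials are needed because the local argument expands in powers of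
  \<open>x - v\<close>. The generating rules imitate \<open>forms_induct\<close>.\<close>

inductive_set PF :: "(complex ^ 'm::finite => complex) set" where
  PF_const: "(\<lambda>x. c) \<in> PF"
| PF_coord: "f \<in> PF ==> (\<lambda>x. x $ i * f x) \<in> PF"
| PF_add: "f \<in> PF ==> g \<in> PF ==> (\<lambda>x. f x + g x) \<in> PF"

lemma PF_mult: "f \<in> PF ==> g \<in> PF ==> (\<lambda>x. f x * g x) \<in> PF"
proof (induction rule: PF.induct)
  case (PF_const c)
  from PF_const show ?case
  proof (induction rule: PF.induct)
    case (PF_coord f i)
    have "(\<lambda>x. x $ i * (c * f x)) \<in> PF" by (rule PF.PF_coord) (rule PF_coord)
    then show ?case by (simp add: mult_ac)
  next
    case (PF_add f g)
    have "(\<lambda>x. c * f x + c * g x) \<in> PF" by (rule PF.PF_add) (rule PF_add)+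
    then show ?case by (simp add: algebra_simps)
  qed (rule PF.PF_const)
next
  case (PF_coord f i)
  have "(\<lambda>x. x $ i * (f x * g x)) \<in> PF" by (rule PF.PF_coord) (use PF_coord in blast)
  then show ?case by (simp add: mult_ac)
next
  case (PF_add f f')
  have "(\<lambda>x. f x * g x + f' x * g x) \<in> PF" by (rule PF.PF_add) (use PF_add in blast)+
  then show ?case by (simp add: algebra_simps)
qed

lemma forms_PF: "f \<in> forms d ==> f \<in> PF"
  by (induction rule: forms_induct) (auto intro: PF.intros)

lemma PF_subring: "is_subring PF"
  unfolding is_subring_def zero_fun_def one_fun_def plus_fun_def times_fun_def
proof (intro conjI ballI)
  fix f g :: "complex ^ 'm::finite => complex" assume "f \<in> PF" "g \<in> PF"
  then have "(\<lambda>x. (-1) * f x) \<in> PF" by (intro PF_mult PF_const)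
  moreover have "(\<lambda>x. (-1) * f x) = - f" by auto
  ultimately show "- f \<in> PF" by metis
qed (auto intro: PF.intros PF_mult)

text \<open>The coordinates are adjoined one by one to the constants; these form a field, whose only
  ideals are 0 and the whole.\<close>

lemma noeth_PF: "noeth (PF :: (complex ^ 'm::finite => complex) set)"
proof -
  define K :: "(complex ^ 'm => complex) set" where "K = range (\<lambda>c x. c)"
  have K: "is_subring K" unfolding is_subring_def K_def zero_fun_def one_fun_def plus_fun_def times_fun_def
    by (auto simp: image_iff fun_eq_iff)
  have nK: "noeth K" unfolding noeth_def
  proof (intro allI impI, elim conjE)
    fix I assume I: "\<forall>n. is_ideal K (I n)" and asc: "\<forall>n. I n \<subseteq> I (Suc n)"
    note i = idealD[OF K I[rule_format]]
    show "\<exists>m. \<forall>n\<ge>m. I n = I m"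
    proof (cases "\<exists>m f. f \<in> I m \<and> f \<noteq> 0")
      case True
      then obtain m c where c: "(\<lambda>x. c) \<in> I m" "c \<noteq> 0" using i(1) by (fastforce simp: K_def zero_fun_def)
      have "K \<subseteq> I m"
      proof
        fix f assume "f \<in> K"
        then obtain d where d: "f = (\<lambda>x. d)" by (auto simp: K_def)
        have "(\<lambda>x. d / c) * (\<lambda>x. c) \<in> I m" by (rule i(4)) (use c in \<open>auto simp: K_def\<close>)
        then show "f \<in> I m" using c by (simp add: d times_fun_def)
      qed
      then have "I n = I m" if "n \<ge> m" for n using chain_mono[of I m n] asc that i(1)[of n] by blast
      then show ?thesis by blast
    next
      case False
      then have "I n = {0}" for n using i(2)[of n] by blast
      then show ?thesis by blast
    qed
  qed
  have ex: "finite (A :: 'm set) ==> \<exists>S. is_subring S \<and> noeth S \<and> K \<subseteq> S \<and> (\<forall>i\<in>A. (\<lambda>x. x $ i) \<in> S) \<and> S \<subseteq> PF" for A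
  proof (induction A rule: finite_induct)
    case empty
    have "K \<subseteq> PF" by (auto simp: K_def intro: PF_const)
    then show ?case using K nK by blast
  next
    case (insert j A)
    then obtain S where S: "is_subring S" "noeth S" "K \<subseteq> S" "\<forall>i\<in>A. (\<lambda>x. x $ i) \<in> S" "S \<subseteq> PF" by blast
    let ?x = "(\<lambda>x. x $ j) :: complex^'m => complex"
    have x: "?x \<in> PF" using forms_PF[OF forms_component] .
    have "poly p ?x \<in> PF" if "\<forall>k. coeff p k \<in> S" for p
      unfolding poly_altdef using that S(5) x
      by (intro subring_sum[OF PF_subring] subringD(4)[OF PF_subring] subringD(7)[OF PF_subring]) auto
    then have "adj S ?x \<subseteq> PF" by (auto simp: adj_def)
    then show ?case using S adj_subring[OF S(1), of ?x] noeth_adj[OF S(1,2), of ?x]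
      by (intro exI[of _ "adj S ?x"]) auto
  qed
  obtain S :: "(complex ^ 'm => complex) set" where S: "is_subring S" "noeth S" "K \<subseteq> S" "\<forall>i. (\<lambda>x. x $ i) \<in> S" "S \<subseteq> PF"
    using ex[OF finite_class.finite_UNIV] by auto
  have "f \<in> S" if "f \<in> PF" for f using that
  proof (induction rule: PF.induct)
    case (PF_const c) then show ?case using S by (auto simp: K_def)
  next
    case (PF_coord f i)
    then have "(\<lambda>x. x $ i) * f \<in> S" using S subringD(4)[OF S(1)] by blast
    then show ?case by (simp add: times_fun_def)
  next
    case (PF_add f g)
    then have "f + g \<in> S" using S subringD(3)[OF S(1)] by blast
    then show ?case by (simp add: plus_fun_def)
  qed
  then have "S = PF" using S by blast
  then show ?thesis using S by blast
qed

lemma PF_forms: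
  assumes "f \<in> PF"
  obtains D F where "\<And>d. F d \<in> forms d" "f = (\<lambda>x. \<Sum>d\<le>(D::nat). F d x)"
proof -
  have "\<exists>D F. (\<forall>d. F d \<in> forms d) \<and> (\<forall>d>D. F d = (\<lambda>x. 0)) \<and> f = (\<lambda>x. \<Sum>d\<le>(D::nat). F d x)"
    using assms
  proof (induction rule: PF.induct)
    case (PF_const c)
    show ?case by (rule exI[of _ 0], rule exI[of _ "\<lambda>d. if d = 0 then (\<lambda>x. c) else (\<lambda>x. 0)"]) auto
  next
    case (PF_coord f i)
    then obtain D F where F: "\<forall>d. F d \<in> forms d" "\<forall>d>D. F d = (\<lambda>x. 0)" "f = (\<lambda>x. \<Sum>d\<le>D. F d x)" by blast
    have "(\<lambda>x. x $ i * f x) = (\<lambda>x. \<Sum>d\<le>Suc D. (case d of 0 => (\<lambda>x. 0) | Suc e => (\<lambda>x. x $ i * F e x)) x)"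
      by (rule ext, subst sum.atMost_Suc_shift) (simp add: F sum_distrib_left)
    then show ?case using F
      by (intro exI[of _ "Suc D"] exI[of _ "\<lambda>d. case d of 0 => (\<lambda>x. 0) | Suc e => (\<lambda>x. x $ i * F e x)"])
        (auto split: nat.split)
  next
    case (PF_add f g)
    then obtain D F E G where F: "\<forall>d. F d \<in> forms d" "\<forall>d>D. F d = (\<lambda>x. 0)" "f = (\<lambda>x. \<Sum>d\<le>D. F d x)"
      "\<forall>d. G d \<in> forms d" "\<forall>d>E. G d = (\<lambda>x. 0)" "g = (\<lambda>x. \<Sum>d\<le>E. G d x)" by blast
    have "(\<Sum>d\<le>D. F d x) = (\<Sum>d\<le>max D E. F d x)" for x by (rule sum.mono_neutral_left) (use F in auto)
    moreover have "(\<Sum>d\<le>E. G d x) = (\<Sum>d\<le>max D E. G d x)" for x by (rule sum.mono_neutral_left) (use F in auto)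
    ultimately have "(\<lambda>x. f x + g x) = (\<lambda>x. \<Sum>d\<le>max D E. F d x + G d x)" by (simp add: F sum.distrib)
    then show ?case using F by (intro exI[of _ "max D E"] exI[of _ "\<lambda>d x. F d x + G d x"]) auto
  qed
  then show ?thesis using that by blast
qed

lemma cone_scale: "v \<in> cone S ==> c \<noteq> 0 ==> c *s v \<in> cone S"
  by (auto simp: cone_def proj_point_scale)

text \<open>Irreducibility speaks about forms only. Since the cone is stable under scaling,
  \<open>g * s\<close> on the multiples of \<open>v\<close> is a polynomial in the scalar with
  infinitely many roots, so \<open>g\<close> times each homogeneous component of \<open>s\<close>
  vanishes on the cone.\<close>

lemma PF_irreducible:
  assumes W: "irreducible_in zariski W" and g: "g \<in> forms e" and s: "s \<in> PF"
    and 0: "\<And>v. v \<in> cone W ==> g v * s v = 0"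
  shows "(\<forall>v\<in>cone W. g v = 0) \<or> (\<forall>v\<in>cone W. s v = 0)"
proof -
  obtain D F where F: "\<And>d. F d \<in> forms d" "s = (\<lambda>x. \<Sum>d\<le>(D::nat). F d x)" using PF_forms[OF s] by blast
  have Fd: "g v * F d v = 0" if v: "v \<in> cone W" and d: "d \<le> D" for v d
  proof -
    let ?p = "\<Sum>d\<le>D. monom (g v * F d v) d"
    have "poly ?p c = 0" if "c \<noteq> 0" for c
    proof -
      have "g (c *s v) * s (c *s v) = 0" using 0 cone_scale[OF v that] .
      then have "c ^ e * (g v * (\<Sum>d\<le>D. c ^ d * F d v)) = 0"
        by (simp add: F(2) forms_homogeneous[OF g] forms_homogeneous[OF F(1)])
      then have "g v * (\<Sum>d\<le>D. c ^ d * F d v) = 0" using that by simp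
      moreover have "poly ?p c = g v * (\<Sum>d\<le>D. c ^ d * F d v)"
        by (simp add: poly_sum poly_monom sum_distrib_left mult_ac)
      ultimately show ?thesis by simp
    qed
    then have "{c. poly ?p c = 0} \<supseteq> - {0}" by auto
    moreover have "infinite (- {0 :: complex})"
      by (simp add: infinite_UNIV_char_0 finite_compl)
    ultimately have "?p = 0" using poly_roots_finite[of ?p] finite_subset by blast
    then have "coeff ?p d = 0" by simp
    then show ?thesis using d by (simp add: coeff_sum)
  qed
  have "W \<subseteq> zeros g \<or> W \<subseteq> zeros (F d)" if "d \<le> D" for d
  proof -
    have "W \<subseteq> zeros (\<lambda>x. g x * F d x)" using subset_zeros_iff[OF forms_mult[OF g F(1)]] Fd that by blast
    then show ?thesis using W unfolding zeros_mult[OF g F(1)] irreducible_iff using g F(1) by blast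
  qed
  then have d: "(\<forall>v\<in>cone W. g v = 0) \<or> (\<forall>v\<in>cone W. F d v = 0)" if "d \<le> D" for d
    using subset_zeros_iff[OF g] subset_zeros_iff[OF F(1)] that by blast
  show ?thesis
  proof (cases "\<forall>v\<in>cone W. g v = 0")
    case False
    then have "\<forall>v\<in>cone W. F d v = 0" if "d \<le> D" for d using d[OF that] by blast
    then show ?thesis unfolding F(2) by (auto intro!: sum.neutral)
  qed simp
qed

section \<open>Chains of irreducible closed sets\<close>

lemma underdetermined_system:
  fixes M :: "'a => 'b => complex"
  assumes "finite B" "finite A" "card B < card A"
  shows "\<exists>x. (\<exists>a\<in>A. x a \<noteq> 0) \<and> (\<forall>b\<in>B. (\<Sum>a\<in>A. M a b * x a) = 0)"
  using assms
proof (induction B arbitrary: A M rule: finite_induct)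
  case empty
  then obtain a where "a \<in> A" by fastforce
  then show ?case by (intro exI[of _ "\<lambda>_. 1"]) auto
next
  case (insert b B)
  show ?case
  proof (cases "\<forall>a\<in>A. M a b = 0")
    case True
    obtain x where "\<exists>a\<in>A. x a \<noteq> 0" "\<forall>b\<in>B. (\<Sum>a\<in>A. M a b * x a) = 0"
      using insert.IH[of A M] insert.prems insert.hyps by auto
    then show ?thesis using True by (intro exI[of _ x]) auto
  next
    case False
    then obtain a0 where a0: "a0 \<in> A" "M a0 b \<noteq> 0" by blast
    \<comment> \<open>Gaussian elimination: equation \<open>b\<close> is solved for the pivot
      unknown \<open>a0\<close>, and \<open>M'\<close> is the remaining system.\<close>
    define M' where "M' a b' = M a b' - M a b / M a0 b * M a0 b'" for a b'
    have "card B < card (A - {a0})" using insert a0 by simp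
    then obtain x where x: "\<exists>a\<in>A - {a0}. x a \<noteq> 0" "\<forall>b\<in>B. (\<Sum>a\<in>A - {a0}. M' a b * x a) = 0"
      using insert.IH[of "A - {a0}" M'] insert.prems by auto
    define y where "y = x(a0 := - (\<Sum>a\<in>A - {a0}. M a b * x a) / M a0 b)"
    have s: "(\<Sum>a\<in>A. M a b' * y a) = M a0 b' * y a0 + (\<Sum>a\<in>A - {a0}. M a b' * x a)" for b'
      using insert.prems a0 by (subst sum.remove[of A a0]) (auto simp: y_def intro!: sum.cong)
    have "(\<Sum>a\<in>A. M a b' * y a) = 0" if "b' \<in> insert b B" for b'
    proof (cases "b' = b")
      case True then show ?thesis using a0 unfolding s by (simp add: y_def)
    next
      case False
      then have "0 = (\<Sum>a\<in>A - {a0}. M' a b' * x a)" using x that by auto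
      also have "\<dots> = (\<Sum>a\<in>A - {a0}. M a b' * x a) - M a0 b' / M a0 b * (\<Sum>a\<in>A - {a0}. M a b * x a)"
        by (simp add: M'_def algebra_simps sum_subtractf sum_distrib_left)
      finally show ?thesis unfolding s by (simp add: y_def)
    qed
    moreover have "\<exists>a\<in>A. y a \<noteq> 0" using x by (auto simp: y_def)
    ultimately show ?thesis by blast
  qed
qed

text \<open>Chains of sets closed in the whole projective space. Chains that are relatively closed
  in a subset are reduced to these by taking closures.\<close>

definition achain :: "(nat => 'n::finite proj set) => nat => bool" where
  "achain Y k \<longleftrightarrow> (\<forall>i\<le>k. irreducible_in zariski (Y i) \<and> closedin zariski (Y i)) \<and> (\<forall>i<k. Y i \<subset> Y (Suc i))"

lemma achainD:
  assumes "achain Y k" "i \<le> k"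
  shows "irreducible_in zariski (Y i)" "closedin zariski (Y i)" "Y i \<noteq> {}"
  using assms by (auto simp: achain_def irreducible_in_def)

lemma achain_mono:
  assumes "achain Y k" "i \<le> j" "j \<le> k" shows "Y i \<subseteq> Y j"
  using assms(2,3)
proof (induction j rule: dec_induct)
  case (step n)
  then have "Y n \<subset> Y (Suc n)" using assms(1) by (auto simp: achain_def)
  then show ?case using step by auto
qed simp

lemma forms_0_const: "f \<in> forms 0 ==> f x = f y"
  using forms_homogeneous[of f 0 0 x] forms_homogeneous[of f 0 0 y] by simp

lemma forms_pos_0: "f \<in> forms d ==> d > 0 ==> f 0 = 0"
  using forms_homogeneous[of f d 0 0] by (simp add: power_0_left)

text \<open>The vertex is excluded from \<open>cone\<close>, but a polynomial vanishing on a
  punctured line through 0 vanishes at 0.\<close>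

lemma PF_vanish_0:
  assumes "v \<in> cone W" "s \<in> PF" "\<And>v. v \<in> cone W ==> s v = 0" shows "s 0 = 0"
proof -
  obtain D F where F: "\<And>d. F d \<in> forms d" "s = (\<lambda>x. \<Sum>d\<le>(D::nat). F d x)" using PF_forms[OF assms(2)] by blast
  let ?p = "\<Sum>d\<le>D. monom (F d v) d"
  have p: "poly ?p c = s (c *s v)" for c
    by (simp add: F(2) forms_homogeneous[OF F(1)] poly_sum poly_monom mult.commute)
  then have "poly ?p c = 0" if "c \<noteq> 0" for c using assms(3)[OF cone_scale[OF assms(1) that]] by simp
  then have "{c. poly ?p c = 0} \<supseteq> - {0}" by auto
  moreover have "infinite (- {0 :: complex})" by (simp add: infinite_UNIV_char_0 finite_compl)
  ultimately have "?p = 0" using poly_roots_finite[of ?p] finite_subset by blast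
  then show ?thesis using p[of 0] by simp
qed

lemma PF_sum: "(\<And>i. i \<in> I ==> f i \<in> PF) ==> (\<lambda>v. \<Sum>i\<in>I. f i v) \<in> PF"
  by (induction I rule: infinite_finite_induct) (auto intro: PF.intros)

lemma PF_prod: "(\<And>i. i \<in> I ==> f i \<in> PF) ==> (\<lambda>v. \<Prod>i\<in>I. f i v) \<in> PF"
  by (induction I rule: infinite_finite_induct) (auto intro: PF_const PF_mult)

lemma PF_power: "f \<in> PF ==> (\<lambda>v. f v ^ n) \<in> PF"
  by (induction n) (auto intro: PF_const PF_mult)

lemma sum_PiE_Suc:
  fixes F :: "(nat => nat) => complex"
  shows "(\<Sum>\<alpha>\<in>PiE {..<Suc i} (\<lambda>_. {..<D}). F \<alpha>) = (\<Sum>e<D. \<Sum>\<beta>\<in>PiE {..<i} (\<lambda>_. {..<D}). F (\<beta>(i := e)))"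
proof -
  have "{..<Suc i} = insert i {..<i}" by auto
  then have "(\<Sum>\<alpha>\<in>PiE {..<Suc i} (\<lambda>_. {..<D}). F \<alpha>)
      = (\<Sum>\<alpha>\<in>(\<lambda>(y, g). g(i := y)) ` ({..<D} \<times> PiE {..<i} (\<lambda>_. {..<D})). F \<alpha>)"
    by (simp only: PiE_insert_eq)
  also have "\<dots> = (\<Sum>(y, g)\<in>{..<D} \<times> PiE {..<i} (\<lambda>_. {..<D}). F (g(i := y)))"
    by (subst sum.reindex, rule inj_combinator) (auto simp: split_def)
  finally show ?thesis by (simp add: sum.cartesian_product)
qed

text \<open>A form vanishing on \<open>Z (i - 1)\<close> but not on \<open>Z i\<close> is algebraically independent of forms that are
  algebraically independent on \<open>Z (i - 1)\<close>. The chain is started with the vertex of the cone.\<close>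

lemma chain_algebraic_independence:
  fixes Z :: "nat => 'n::finite proj set"
  assumes Z: "achain Z k"
  obtains g :: "nat => complex ^ 'n option => complex" and d :: "nat => nat"
  where "\<forall>j\<le>k. g j \<in> forms (d j)"
    "\<forall>D a. (\<forall>v. (\<Sum>\<alpha>\<in>PiE {..<Suc k} (\<lambda>_. {..<D}). a \<alpha> * (\<Prod>j<Suc k. g j v ^ \<alpha> j)) = 0) -->
       (\<forall>\<alpha>\<in>PiE {..<Suc k} (\<lambda>_. {..<D}). a \<alpha> = 0)"
proof -
  \<comment> \<open>\<open>C i\<close> is the affine cone over \<open>Z (i - 1)\<close>, and just
    the vertex for \<open>i = 0\<close>. This additional bottom step yields k + 1 forms from a chain
    of length k.\<close>
  define C where "C i = (case i of 0 => {0} | Suc j => insert 0 (cone (Z j)))" for i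
  have "\<exists>e. \<exists>f\<in>forms e. (\<forall>v\<in>C i. f v = 0) \<and> (\<exists>v\<in>cone (Z i). f v \<noteq> 0)" if i: "i \<le> k" for i
  proof (cases i)
    case 0
    obtain p where "p \<in> Z 0" using achainD(3)[OF Z, of 0] by auto
    moreover obtain v where v: "v \<noteq> 0" "p = proj_point v" by (rule proj_cases)
    ultimately have "v \<in> cone (Z 0)" by (auto simp: cone_def)
    moreover obtain j where "v $ j \<noteq> 0" using v by (auto simp: vec_eq_iff)
    ultimately show ?thesis using 0
      by (intro exI[of _ 1] bexI[of _ "\<lambda>x. x $ j"] forms_component) (auto simp: C_def)
  next
    case (Suc j)
    then have "Z j \<subset> Z i" "closedin zariski (Z j)" "Z j \<noteq> {}" using Z i achainD[OF Z, of j] by (auto simp: achain_def)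
    then obtain p q where pq: "p \<in> Z i" "p \<notin> zcl (Z j)" "q \<in> Z j" using zcl_closed[of "Z j"] by blast
    then obtain e f where f: "f \<in> forms e" "Z j \<subseteq> zeros f" "p \<notin> zeros f" by (auto simp: zcl_def)
    then have v: "\<exists>v\<in>cone (Z i). f v \<noteq> 0" using pq subset_zeros_iff[OF f(1)] by blast
    obtain w where "w \<in> cone (Z j)" using pq(3) proj_cases[of q] by (auto simp: cone_def)
    then have "f w = 0" using f subset_zeros_iff[OF f(1)] by blast
    then have "e > 0" using v f(1) forms_0_const[of f] by (metis gr0I)
    then have "f 0 = 0" using forms_pos_0 f by blast
    then show ?thesis using f v Suc subset_zeros_iff[OF f(1)] by (intro exI[of _ e] bexI[of _ f]) (auto simp: C_def)
  qed
  then obtain d g where g: "\<And>i. i \<le> k ==> g i \<in> forms (d i)" "\<And>i v. i \<le> k ==> v \<in> C i ==> g i v = 0"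
    "\<And>i. i \<le> k ==> \<exists>v\<in>cone (Z i). g i v \<noteq> 0" by metis
  have CC: "C i \<subseteq> C (Suc i)" if "i \<le> k" for i
  proof (cases i)
    case (Suc j)
    then have "Z j \<subseteq> Z i" using achain_mono[OF Z, of j i] that by simp
    then show ?thesis using Suc by (auto simp: C_def cone_def)
  qed (simp add: C_def)
  \<comment> \<open>Induction up the chain: a relation among the first i forms is trivial as soon as
    it holds on \<open>C i\<close>. In the step the relation is sorted by the powers of
    \<open>g i\<close>.\<close>
  have main: "\<forall>\<alpha>\<in>PiE {..<i} (\<lambda>_. {..<D}). a \<alpha> = 0"
    if "i \<le> Suc k" "\<And>v. v \<in> C i ==> (\<Sum>\<alpha>\<in>PiE {..<i} (\<lambda>_. {..<D}). a \<alpha> * (\<Prod>j<i. g j v ^ \<alpha> j)) = 0" for i D a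
    using that
  proof (induction i arbitrary: a)
    case 0
    show ?case using 0(2)[of 0] by (simp add: C_def)
  next
    case (Suc i)
    define P where "P e v = (\<Sum>\<beta>\<in>PiE {..<i} (\<lambda>_. {..<D}). a (\<beta>(i := e)) * (\<Prod>j<i. g j v ^ \<beta> j))" for e v
    have g_PF: "g j \<in> PF" if "j \<le> i" for j using forms_PF[OF g(1)[of j]] that Suc.prems(1) by simp
    have P_PF: "P e \<in> PF" for e
      unfolding P_def[abs_def] by (intro PF_sum PF_mult PF_const PF_prod PF_power g_PF) auto
    have eq: "(\<Sum>\<alpha>\<in>PiE {..<Suc i} (\<lambda>_. {..<D}). a \<alpha> * (\<Prod>j<Suc i. g j v ^ \<alpha> j)) = (\<Sum>e<D. g i v ^ e * P e v)" for v
    proof -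
      have "(\<Prod>j<i. g j v ^ (\<beta>(i := e)) j) = (\<Prod>j<i. g j v ^ \<beta> j)" for \<beta> e by (rule prod.cong) auto
      then show ?thesis unfolding sum_PiE_Suc P_def by (simp add: sum_distrib_left mult_ac)
    qed
    have zero: "\<forall>\<beta>\<in>PiE {..<i} (\<lambda>_. {..<D}). a (\<beta>(i := e)) = 0" if "e < D" for e
      using that
    proof (induction e rule: less_induct)
      case (less e)
      have P0: "P e' v = 0" if "e' < e" for e' v
      proof -
        have "a (\<beta>(i := e')) = 0" if "\<beta> \<in> PiE {..<i} (\<lambda>_. {..<D})" for \<beta>
          using less.IH[OF \<open>e' < e\<close>] \<open>e' < e\<close> less.prems that by (meson less_trans)
        then show ?thesis unfolding P_def by (intro sum.neutral ballI) simp
      qed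
      \<comment> \<open>The terms with exponent below \<open>e\<close> are already known to vanish,
        so the relation is \<open>g i ^ e\<close> times \<open>R\<close>. Irreducibility of
        \<open>Z i\<close> cancels the power, and on \<open>C i\<close>, where \<open>g i\<close> is
        zero, only \<open>P e\<close> survives in \<open>R\<close>.\<close>
      define R where "R v = (\<Sum>e'\<in>{e..<D}. g i v ^ (e' - e) * P e' v)" for v
      have R: "(\<Sum>e'<D. g i v ^ e' * P e' v) = g i v ^ e * R v" for v
      proof -
        have "(\<Sum>e'<D. g i v ^ e' * P e' v) = (\<Sum>e'\<in>{e..<D}. g i v ^ e' * P e' v)"
          by (rule sum.mono_neutral_right) (use P0 less.prems in auto)
        also have "\<dots> = (\<Sum>e'\<in>{e..<D}. g i v ^ e * (g i v ^ (e' - e) * P e' v))"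
          by (rule sum.cong) (auto simp: power_add[symmetric] mult.assoc[symmetric])
        finally show ?thesis by (simp add: R_def sum_distrib_left)
      qed
      have RPF: "R \<in> PF"
        unfolding R_def[abs_def] by (intro PF_sum PF_mult PF_power g_PF P_PF) auto
      have i: "i \<le> k" using Suc.prems(1) by simp
      have "g i v ^ e * R v = 0" if "v \<in> cone (Z i)" for v
        using Suc.prems(2)[of v] that unfolding eq R by (simp add: C_def)
      then have "(\<forall>v\<in>cone (Z i). g i v ^ e = 0) \<or> (\<forall>v\<in>cone (Z i). R v = 0)"
        using Z i by (intro PF_irreducible[OF _ forms_power[OF g(1)[OF i]] RPF]) (auto simp: achain_def)
      then have R0: "R v = 0" if "v \<in> cone (Z i)" for v using g(3)[OF i] that by auto
      obtain v0 where "v0 \<in> cone (Z i)" using g(3)[OF i] by blast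
      then have "R 0 = 0" using PF_vanish_0 RPF R0 by blast
      then have R0: "R v = 0" if "v \<in> C (Suc i)" for v using R0 that by (auto simp: C_def)
      have "P e v = 0" if v: "v \<in> C i" for v
      proof -
        have "R v = P e v + (\<Sum>e'\<in>{Suc e..<D}. g i v ^ (e' - e) * P e' v)"
          unfolding R_def by (subst sum.atLeast_Suc_lessThan) (use less.prems in auto)
        also have "(\<Sum>e'\<in>{Suc e..<D}. g i v ^ (e' - e) * P e' v) = 0"
          by (rule sum.neutral) (use g(2)[OF i v] in auto)
        finally show ?thesis using R0 CC[OF i] v by auto
      qed
      then show ?case using Suc.IH[of "\<lambda>\<beta>. a (\<beta>(i := e))"] Suc.prems(1) by (simp add: P_def del: fun_upd_apply)
    qed
    show ?case
    proof
      fix \<alpha> assume \<alpha>: "\<alpha> \<in> PiE {..<Suc i} (\<lambda>_. {..<D})"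
      have "{..<Suc i} = insert i {..<i}" by auto
      then obtain e \<beta> where "e < D" "\<beta> \<in> PiE {..<i} (\<lambda>_. {..<D})" "\<alpha> = \<beta>(i := e)"
        using \<alpha> by (auto simp: PiE_insert_eq simp del: fun_upd_apply)
      then show "a \<alpha> = 0" using zero by blast
    qed
  qed
  show ?thesis by (rule that[of g d]) (use g(1) main[of "Suc k"] in blast)+
qed

text \<open>Counting dimensions: k + 1 algebraically independent forms give D^(k+1) linearly
  independent products with exponents below D, and all of these are combinations of the at most (E D
  + 1)^(N+1) monomials with exponents up to E D. For k > N and large D this is impossible.\<close>

lemma achain_bound:
  fixes Z :: "nat => 'n::finite proj set"
  assumes Z: "achain Z k" shows "k \<le> CARD('n)"
proof (rule ccontr)
  assume k: "\<not> k \<le> CARD('n)"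
  let ?N = "CARD('n)"
  obtain g :: "nat => complex ^ 'n option => complex" and d :: "nat => nat"
    where g: "\<forall>j\<le>k. g j \<in> forms (d j)"
    and ind: "\<forall>D a. (\<forall>v. (\<Sum>\<alpha>\<in>PiE {..<Suc k} (\<lambda>_. {..<D}). a \<alpha> * (\<Prod>j<Suc k. g j v ^ \<alpha> j)) = 0) -->
       (\<forall>\<alpha>\<in>PiE {..<Suc k} (\<lambda>_. {..<D}). a \<alpha> = 0)"
    by (rule chain_algebraic_independence[OF Z], erule (1) that)
  define E where "E = (\<Sum>j<Suc k. d j)"
  \<comment> \<open>Large enough that (E + 1)^(N+1) < D, whence (E D + 1)^(N+1) < D^(N+2), which is
    at most D^(k+1).\<close>
  define D where "D = Suc (Suc E ^ Suc ?N)"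
  define A where "A = PiE {..<Suc k} (\<lambda>_::nat. {..<D})"
  define B where "B = {\<beta> :: 'n option => nat. \<forall>i. \<beta> i \<le> E * D}"
  define dg where "dg \<alpha> = (\<Sum>j<Suc k. \<alpha> j * d j)" for \<alpha>
  have Bpi: "B = PiE UNIV (\<lambda>_. {..E * D})" by (auto simp: B_def PiE_def)
  have "finite A" "finite B" by (auto simp: A_def Bpi intro!: finite_PiE)
  have cA: "card A = D ^ Suc k" by (simp add: A_def card_PiE)
  have cB: "card B = Suc (E * D) ^ Suc ?N" by (simp add: Bpi card_PiE)
  have "Suc (E * D) \<le> Suc E * D" by (simp add: D_def)
  then have "card B \<le> (Suc E * D) ^ Suc ?N" unfolding cB by (rule power_mono) simp
  also have "\<dots> = Suc E ^ Suc ?N * D ^ Suc ?N" by (rule power_mult_distrib)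
  also have "\<dots> < D * D ^ Suc ?N" by (intro mult_strict_right_mono) (auto simp: D_def)
  also have "\<dots> = D ^ Suc (Suc ?N)" by simp
  also have "\<dots> \<le> D ^ Suc k" using k by (intro power_increasing) (auto simp: D_def)
  finally have "card B < card A" unfolding cA .
  have "\<forall>\<alpha>. \<exists>c. \<forall>v. (\<Prod>j<Suc k. g j v ^ \<alpha> j) = (\<Sum>\<beta> | (\<Sum>i\<in>UNIV. \<beta> i) = dg \<alpha>. c \<beta> * (\<Prod>i\<in>UNIV. v $ i ^ \<beta> i))"
  proof
    fix \<alpha>
    have "(\<lambda>v. \<Prod>j<Suc k. g j v ^ \<alpha> j) \<in> forms (dg \<alpha>)" unfolding dg_def
      by (intro forms_prod forms_power g[rule_format]) auto
    then show "\<exists>c. \<forall>v. (\<Prod>j<Suc k. g j v ^ \<alpha> j) = (\<Sum>\<beta> | (\<Sum>i\<in>UNIV. \<beta> i) = dg \<alpha>. c \<beta> * (\<Prod>i\<in>UNIV. v $ i ^ \<beta> i))"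
      unfolding forms_def by (auto simp: fun_eq_iff)
  qed
  from choice[OF this] obtain c where c: "\<forall>\<alpha> v. (\<Prod>j<Suc k. g j v ^ \<alpha> j) = (\<Sum>\<beta> | (\<Sum>i\<in>UNIV. \<beta> i) = dg \<alpha>. c \<alpha> \<beta> * (\<Prod>i\<in>UNIV. v $ i ^ \<beta> i))"
    by (elim exE) (erule that)
  define M where "M \<alpha> \<beta> = (if (\<Sum>i\<in>UNIV. \<beta> i) = dg \<alpha> then c \<alpha> \<beta> else 0)" for \<alpha> \<beta>
  have cM: "(\<Prod>j<Suc k. g j v ^ \<alpha> j) = (\<Sum>\<beta>\<in>B. M \<alpha> \<beta> * (\<Prod>i\<in>UNIV. v $ i ^ \<beta> i))" if \<alpha>: "\<alpha> \<in> A" for \<alpha> v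
  proof -
    have "dg \<alpha> \<le> E * D" unfolding dg_def E_def sum_distrib_right
      by (rule sum_mono) (use \<alpha> in \<open>auto simp: A_def PiE_iff mult.commute intro!: mult_right_mono less_imp_le\<close>)
    have "{\<beta>. (\<Sum>i\<in>UNIV. \<beta> i) = dg \<alpha>} \<subseteq> B"
    proof (unfold B_def, intro subsetI CollectI allI, elim CollectE)
      fix \<beta> :: "'n option => nat" and i assume \<beta>: "(\<Sum>i\<in>UNIV. \<beta> i) = dg \<alpha>"
      have "\<beta> i \<le> (\<Sum>i\<in>UNIV. \<beta> i)" by (rule member_le_sum) auto
      then show "\<beta> i \<le> E * D" using \<open>dg \<alpha> \<le> E * D\<close> \<beta> by linarith
    qed
    then have "(\<Sum>\<beta>\<in>B. M \<alpha> \<beta> * (\<Prod>i\<in>UNIV. v $ i ^ \<beta> i)) = (\<Sum>\<beta> | (\<Sum>i\<in>UNIV. \<beta> i) = dg \<alpha>. M \<alpha> \<beta> * (\<Prod>i\<in>UNIV. v $ i ^ \<beta> i))"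
      using \<open>finite B\<close> by (intro sum.mono_neutral_right) (auto simp: M_def)
    also have "\<dots> = (\<Sum>\<beta> | (\<Sum>i\<in>UNIV. \<beta> i) = dg \<alpha>. c \<alpha> \<beta> * (\<Prod>i\<in>UNIV. v $ i ^ \<beta> i))"
      by (rule sum.cong) (auto simp: M_def)
    finally show ?thesis by (simp only: c)
  qed
  obtain x where x: "\<exists>a\<in>A. x a \<noteq> 0" "\<forall>b\<in>B. (\<Sum>a\<in>A. M a b * x a) = 0"
    using underdetermined_system[OF \<open>finite B\<close> \<open>finite A\<close> \<open>card B < card A\<close>, of M] by blast
  have "(\<Sum>\<alpha>\<in>A. x \<alpha> * (\<Prod>j<Suc k. g j v ^ \<alpha> j)) = 0" for v
  proof -
    have "(\<Sum>\<alpha>\<in>A. x \<alpha> * (\<Prod>j<Suc k. g j v ^ \<alpha> j)) = (\<Sum>\<alpha>\<in>A. \<Sum>\<beta>\<in>B. x \<alpha> * (M \<alpha> \<beta> * (\<Prod>i\<in>UNIV. v $ i ^ \<beta> i)))"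
      by (rule sum.cong) (simp_all only: cM sum_distrib_left)
    also have "\<dots> = (\<Sum>\<beta>\<in>B. \<Sum>\<alpha>\<in>A. x \<alpha> * (M \<alpha> \<beta> * (\<Prod>i\<in>UNIV. v $ i ^ \<beta> i)))" by (rule sum.swap)
    also have "\<dots> = (\<Sum>\<beta>\<in>B. (\<Prod>i\<in>UNIV. v $ i ^ \<beta> i) * (\<Sum>\<alpha>\<in>A. M \<alpha> \<beta> * x \<alpha>))"
      unfolding sum_distrib_left by (intro sum.cong refl) (simp only: mult_ac)
    also have "\<dots> = 0" using x(2) by (intro sum.neutral ballI) simp
    finally show ?thesis .
  qed
  then have "\<forall>\<alpha>\<in>A. x \<alpha> = 0" using ind unfolding A_def by blast
  then show False using x(1) by blast
qed

lemma achain_extend: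
  assumes "achain Y k" "irreducible_in zariski W" "closedin zariski W" "Y k \<subset> W"
  shows "achain (Y(Suc k := W)) (Suc k)"
  using assms by (auto simp: achain_def le_Suc_eq less_Suc_eq)

lemma irreducible_between:
  assumes "irreducible_in zariski S" "S \<subseteq> T" "T \<subseteq> zcl S" shows "irreducible_in zariski T"
  unfolding irreducible_iff
proof (intro conjI allI ballI impI)
  show "T \<noteq> {}" using assms by (auto simp: irreducible_iff)
  fix d e and f g :: "complex ^ 'a option => complex"
  assume fg: "f \<in> forms d" "g \<in> forms e" "T \<subseteq> zeros f \<union> zeros g"
  then have "S \<subseteq> zeros f \<union> zeros g" using assms by blast
  then have "S \<subseteq> zeros f \<or> S \<subseteq> zeros g" using assms fg by (auto simp: irreducible_iff)
  then have "zcl S \<subseteq> zeros f \<or> zcl S \<subseteq> zeros g" using fg by (simp add: zcl_subset_zeros)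
  then show "T \<subseteq> zeros f \<or> T \<subseteq> zeros g" using assms by blast
qed

lemma closedin_sub_zcl:
  assumes "closedin (subtopology zariski S) Z" shows "Z = S \<inter> zcl Z"
proof -
  obtain C where "closedin zariski C" "Z = C \<inter> S" using assms by (auto simp: closedin_subtopology)
  then show ?thesis using zcl_minimal[of Z C] zcl_subset[of Z] by blast
qed

text \<open>Inclusions stay strict under closure because each member is the trace on
  \<open>S\<close> of its own closure.\<close>

lemma krull_dim_le:
  assumes "\<And>k Y. achain Y k ==> Y k \<subseteq> zcl S ==> k \<le> d"
  shows "krull_dim zariski S \<le> enat d"
  unfolding krull_dim_def
proof (rule Sup_least, clarify)
  fix k Z assume Z: "\<forall>i\<le>k. irreducible_in zariski (Z i) \<and> closedin (subtopology zariski S) (Z i)" "\<forall>i<k. Z i \<subset> Z (Suc i)"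
  have "achain (\<lambda>i. zcl (Z i)) k" unfolding achain_def
  proof (intro conjI allI impI)
    fix i assume "i \<le> k" then show "irreducible_in zariski (zcl (Z i))" "closedin zariski (zcl (Z i))"
      using Z irreducible_zcl by auto
  next
    fix i assume i: "i < k"
    then have "zcl (Z i) \<subseteq> zcl (Z (Suc i))" using Z by (intro zcl_mono) auto
    moreover have "Z i = S \<inter> zcl (Z i)" "Z (Suc i) = S \<inter> zcl (Z (Suc i))" using Z(1) i closedin_sub_zcl[of S] by auto
    moreover have "Z i \<subset> Z (Suc i)" using Z i by blast
    ultimately show "zcl (Z i) \<subset> zcl (Z (Suc i))" by blast
  qed
  moreover have "Z k \<subseteq> S" using Z(1) closedin_sub_zcl[of S "Z k"] by blast
  ultimately show "enat k \<le> enat d" using assms[of "\<lambda>i. zcl (Z i)" k] zcl_mono by auto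
qed

lemma krull_dim_attained:
  assumes W: "irreducible_in zariski W" "closedin zariski W" and d: "krull_dim zariski W = enat d"
  obtains Y where "achain Y d" "Y d \<subseteq> W"
proof -
  have "\<exists>k\<ge>d. \<exists>Y. achain Y k \<and> Y k \<subseteq> W"
  proof (rule ccontr)
    assume neg: "\<not> ?thesis"
    have "achain (\<lambda>_. W) 0" using W by (simp add: achain_def)
    with neg have "d > 0" by (metis gr0I order_refl)
    moreover have "krull_dim zariski W \<le> enat (d - 1)"
    proof (rule krull_dim_le)
      fix k Y assume "achain Y k" "Y k \<subseteq> zcl W"
      then have "\<not> d \<le> k" using neg zcl_closed[OF W(2)] by metis
      then show "k \<le> d - 1" by simp
    qed
    ultimately show False using d by simp
  qed
  then obtain k Y where Y: "k \<ge> d" "achain Y k" "Y k \<subseteq> W" by blast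
  have "achain Y d" using Y by (auto simp: achain_def)
  moreover have "Y d \<subseteq> Y k" using achain_mono[OF Y(2,1)] by simp
  ultimately show ?thesis using that Y by blast
qed

text \<open>The \<open>S i\<close> need not be closed in \<open>Z\<close>; the chain consists of the
  traces of their closures, kept distinct by the separating forms.\<close>

lemma krull_dim_ge:
  assumes S: "\<And>i. i \<le> d ==> irreducible_in zariski (S i)" "\<And>i. i \<le> d ==> S i \<subseteq> Z"
    and l: "\<And>i. i < d ==> S i \<subseteq> S (Suc i)" "\<And>i. i < d ==> \<exists>e. \<exists>l\<in>forms e. S i \<subseteq> zeros l \<and> \<not> S (Suc i) \<subseteq> zeros l"
  shows "enat d \<le> krull_dim zariski Z"
proof -
  have "(\<forall>i\<le>d. irreducible_in zariski (Z \<inter> zcl (S i)) \<and> closedin (subtopology zariski Z) (Z \<inter> zcl (S i))) \<and>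
    (\<forall>i<d. Z \<inter> zcl (S i) \<subset> Z \<inter> zcl (S (Suc i)))"
proof (intro conjI allI impI)
  fix i assume i: "i \<le> d"
  show "irreducible_in zariski (Z \<inter> zcl (S i))"
    by (rule irreducible_between[OF S(1)[OF i]]) (use S(2)[OF i] zcl_subset[of "S i"] in auto)
  show "closedin (subtopology zariski Z) (Z \<inter> zcl (S i))"
    by (auto simp: closedin_subtopology)
next
  fix i assume i: "i < d"
  obtain e f where f: "f \<in> forms e" "S i \<subseteq> zeros f" "\<not> S (Suc i) \<subseteq> zeros f" using l(2)[OF i] by blast
  then have "zcl (S i) \<subseteq> zeros f" using zcl_subset_zeros by blast
  moreover have "S (Suc i) \<subseteq> Z \<inter> zcl (S (Suc i))" using S(2)[of "Suc i"] zcl_subset[of "S (Suc i)"] i by auto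
  ultimately show "Z \<inter> zcl (S i) \<subset> Z \<inter> zcl (S (Suc i))" using zcl_mono[OF l(1)[OF i]] f(3) by blast
qed
  then have "\<exists>Y. (\<forall>i\<le>d. irreducible_in zariski (Y i) \<and> closedin (subtopology zariski Z) (Y i)) \<and> (\<forall>i<d. Y i \<subset> Y (Suc i))"
    by (rule exI[of _ "\<lambda>i. Z \<inter> zcl (S i)"])
  then show ?thesis unfolding krull_dim_def by (intro Sup_upper CollectI exI[of _ d] conjI[OF refl])
qed

section \<open>Linear algebra\<close>

definition grad :: "(complex ^ 'm::finite => complex) => complex ^ 'm => complex ^ 'm" where
  "grad f v = (\<chi> i. coeff (lpoly f v (axis i 1)) 1)"

lemma vec_expand: "(\<Sum>i\<in>UNIV. x $ i *s axis i 1) = (x :: complex ^ 'm::finite)"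
  by (rule basis_expansion)

lemma dotp_grad:
  assumes "f \<in> forms d" shows "dotp (grad f v) u = coeff (lpoly f v u) 1"
proof -
  obtain h where h: "(\<lambda>u. coeff (lpoly f v u) 1) = dotp h" using forms_1E[OF forms_lpoly(4)[OF assms, of v 1]] by blast
  have "coeff (lpoly f v u) 1 = dotp h u" for u using h by metis
  moreover have "grad f v = h" unfolding grad_def vec_eq_iff using h by (auto simp: fun_eq_iff)
  ultimately show ?thesis by simp
qed

lemma tangent_grad:
  assumes "v \<noteq> 0"
  shows "tangent X (proj_point v) = {u. \<forall>d. \<forall>f\<in>forms d. X \<subseteq> zeros f --> dotp (grad f v) u = 0}"
  unfolding tangent_proj_point[OF assms] using dotp_grad by (metis (no_types, lifting))

lemma matrix_dotp: "(A :: complex ^ 'm::finite ^ 'k::finite) *v u = (\<chi> i. dotp (A $ i) u)"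
  by (simp add: matrix_vector_mult_def dotp_def)

lemma dim_coordinate_subspace: "vec.dim {y :: complex ^ 'm::finite. \<forall>i. i \<notin> J --> y $ i = 0} = card J"
proof -
  let ?L = "{y :: complex ^ 'm. \<forall>i. i \<notin> J --> y $ i = 0}" and ?B = "(\<lambda>i. axis i 1 :: complex ^ 'm) ` J"
  have "inj_on (\<lambda>i. axis i (1::complex) :: complex ^ 'm) J" by (auto simp: inj_on_def axis_eq_axis)
  then have c: "card ?B = card J" by (rule card_image)
  have "?B \<subseteq> cart_basis" by (auto simp: cart_basis_def)
  then have i: "vec.independent ?B" using independent_cart_basis vec.independent_mono by blast
  have "?L \<subseteq> vec.span ?B"
  proof
    fix y assume y: "y \<in> ?L"
    have "y = (\<Sum>i\<in>UNIV. y $ i *s axis i 1)" by (simp add: vec_expand)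
    also have "\<dots> = (\<Sum>i\<in>J. y $ i *s axis i 1)" by (rule sum.mono_neutral_right) (use y in auto)
    also have "\<dots> \<in> vec.span ?B" by (intro vec.span_sum vec.span_scale vec.span_base) auto
    finally show "y \<in> vec.span ?B" .
  qed
  moreover have "?B \<subseteq> ?L" by (auto simp: axis_def)
  ultimately show ?thesis using vec.dim_unique[OF _ _ i c] by blast
qed

text \<open>A family of rows is completed to a basis by coordinate rows; \<open>J\<close> indexes the added ones.\<close>

lemma row_basis:
  fixes G :: "(complex ^ 'm::finite) set"
  obtains J b where "\<forall>i. i \<notin> J --> b i \<in> G" "\<forall>j\<in>J. b j = axis j 1" "\<forall>u. (\<forall>i. dotp (b i) u = 0) --> u = 0"
    "\<forall>r\<in>G. \<exists>c. r = (\<Sum>i\<in>-J. c i *s b i)" "vec.dim {u. \<forall>r\<in>G. dotp r u = 0} = card J"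
proof -
  obtain B0 where B0: "B0 \<subseteq> G" "vec.independent B0" "G \<subseteq> vec.span B0"
    using vec.maximal_independent_subset[of G] by blast
  obtain B where B: "B0 \<subseteq> B" "B \<subseteq> B0 \<union> cart_basis" "vec.independent B" "B0 \<union> cart_basis \<subseteq> vec.span B"
    using vec.maximal_independent_subset_extend[of B0 "B0 \<union> cart_basis"] B0(2) by blast
  have "vec.span B = UNIV" using B(4) span_cart_basis by (metis le_sup_iff vec.span_minimal vec.subspace_span top.extremum_uniqueI)
  have finB: "finite B" using B(3) vec.finiteI_independent by blast
  then have finB0: "finite B0" using B(1) finite_subset by blast
  have cardB: "card B = CARD('m)"
    using vec.dim_eq_card_independent[OF B(3)] \<open>vec.span B = UNIV\<close> by (metis vec.dim_span vec.dim_UNIV vec.dimension_def card_cart_basis cart_basis_def)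
  define J where "J = {j. axis j 1 \<in> B - B0}"
  have BJ: "B - B0 = (\<lambda>j. axis j 1) ` J" using B(2) by (auto simp: J_def cart_basis_def)
  have "inj_on (\<lambda>i. axis i (1::complex) :: complex ^ 'm) J" by (auto simp: inj_on_def axis_eq_axis)
  then have "card (B - B0) = card J" unfolding BJ by (rule card_image)
  then have "card B0 = CARD('m) - card J" using cardB B(1) finB finB0
    by (metis card_Diff_subset card_mono diff_diff_cancel)
  also have "\<dots> = card (- J)" by (simp add: Compl_eq_Diff_UNIV card_Diff_subset)
  finally obtain b0 where b0: "bij_betw b0 (- J) B0" using finB0 by (metis finite finite_same_card_bij)
  define b where "b i = (if i \<in> J then axis i 1 else b0 i)" for i
  have Bb: "B \<subseteq> range b"
  proof
    fix r assume "r \<in> B"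
    then consider "r \<in> B0" | "r \<in> B - B0" by blast
    then show "r \<in> range b"
    proof cases
      case 1 then obtain i where "i \<notin> J" "r = b0 i" using b0 by (auto simp: bij_betw_def)
      then show ?thesis by (auto simp: b_def)
    next
      case 2 then obtain j where "j \<in> J" "r = axis j 1" unfolding BJ by blast
      then have "r = b j" by (simp add: b_def)
      then show ?thesis by blast
    qed
  qed
  have ann: "dotp r u = 0" if "r \<in> vec.span S" "\<And>s. s \<in> S ==> dotp s u = 0" for r u :: "complex^'m" and S
    using that by (induction rule: vec.span_induct_alt) auto
  have inj: "\<forall>u. (\<forall>i. dotp (b i) u = 0) --> u = 0"
  proof (intro allI impI)
    fix u assume u: "\<forall>i. dotp (b i) u = 0"
    have "dotp r u = 0" for r using ann[of r B u] Bb u \<open>vec.span B = UNIV\<close> by blast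
    then show "u = 0" using dotp_nondegenerate by (metis dotp_commute)
  qed
  have span: "\<exists>c. r = (\<Sum>i\<in>-J. c i *s b i)" if r: "r \<in> vec.span B0" for r
  proof -
    obtain c where "r = (\<Sum>s\<in>B0. c s *s s)" using r finB0 by (auto simp: vec.span_finite)
    also have "\<dots> = (\<Sum>i\<in>-J. c (b0 i) *s b0 i)" by (rule sum.reindex_bij_betw[OF b0, symmetric])
    also have "\<dots> = (\<Sum>i\<in>-J. c (b0 i) *s b i)" by (rule sum.cong) (auto simp: b_def)
    finally show ?thesis by (rule exI[of _ "\<lambda>i. c (b0 i)"])
  qed
  let ?A = "\<chi> i. b i" and ?T = "{u. \<forall>r\<in>G. dotp r u = 0}" and ?L = "{y :: complex ^ 'm. \<forall>i. i \<notin> J --> y $ i = 0}"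
  have lin: "Vector_Spaces.linear (*s) (*s) ((*v) ?A)" by (rule matrix_vector_mul_linear_gen)
  have injA: "inj ((*v) ?A)" using inj unfolding vec.linear_inj_iff_eq_0[OF lin] by (auto simp: matrix_dotp vec_eq_iff)
  then have surjA: "surj ((*v) ?A)" using vec.linear_injective_imp_surjective[OF lin] by blast
  have T: "?T = {u. \<forall>i. i \<notin> J --> dotp (b i) u = 0}"
  proof (rule set_eqI, rule iffI)
    fix u assume "u \<in> ?T"
    moreover have "b i \<in> G" if "i \<notin> J" for i using that b0 B0(1) by (auto simp: b_def bij_betw_def)
    ultimately show "u \<in> {u. \<forall>i. i \<notin> J --> dotp (b i) u = 0}" by blast
  next
    fix u assume u: "u \<in> {u. \<forall>i. i \<notin> J --> dotp (b i) u = 0}"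
    have "dotp s u = 0" if "s \<in> B0" for s
    proof -
      obtain i where "i \<notin> J" "s = b0 i" using b0 \<open>s \<in> B0\<close> by (auto simp: bij_betw_def)
      then have "s = b i" by (simp add: b_def)
      then show ?thesis using u \<open>i \<notin> J\<close> by blast
    qed
    then show "u \<in> ?T" using ann B0(3) by blast
  qed
  have "(*v) ?A ` ?T = ?L"
  proof
    show "(*v) ?A ` ?T \<subseteq> ?L" unfolding T by (auto simp: matrix_dotp)
    show "?L \<subseteq> (*v) ?A ` ?T"
    proof
      fix y assume y: "y \<in> ?L"
      obtain u where u: "y = ?A *v u" using surjA by blast
      then show "y \<in> (*v) ?A ` ?T" using y unfolding T by (auto simp: matrix_dotp)
    qed
  qed
  moreover have "vec.dim ((*v) ?A ` ?T) = vec.dim ?T"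
    by (rule vec.dim_image_eq[OF lin]) (use injA in \<open>auto intro: inj_on_subset\<close>)
  ultimately have 5: "vec.dim ?T = card J" using dim_coordinate_subspace[of J] by simp
  have 1: "\<forall>i. i \<notin> J --> b i \<in> G" using b0 B0(1) by (auto simp: b_def bij_betw_def)
  have 2: "\<forall>j\<in>J. b j = axis j 1" by (simp add: b_def)
  have 4: "\<forall>r\<in>G. \<exists>c. r = (\<Sum>i\<in>-J. c i *s b i)"
    by (intro ballI span) (use B0(3) in auto)
  show ?thesis by (rule that[OF 1 2 inj 4 5])
qed

text \<open>Rows without a common nonzero zero form a left invertible matrix; the coefficients are
  \<open>h\<close> times the left inverse.\<close>

lemma row_basis_expand:
  fixes b :: "'m => complex ^ 'm::finite"
  assumes "\<forall>u. (\<forall>i. dotp (b i) u = 0) --> u = 0"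
  obtains c where "h = (\<Sum>i\<in>UNIV. c i *s b i)"
proof -
  let ?A = "\<chi> i. b i"
  have "\<forall>u. ?A *v u = 0 --> u = 0" using assms by (auto simp: matrix_dotp vec_eq_iff)
  then obtain B where "B ** ?A = mat 1" using matrix_left_invertible_ker by blast
  then have "h = h v* (B ** ?A)" by simp
  also have "\<dots> = (h v* B) v* ?A" by (simp add: vector_matrix_mul_assoc)
  also have "\<dots> = (\<Sum>i\<in>UNIV. (h v* B) $ i *s b i)"
    by (simp add: vec_eq_iff vector_matrix_mult_def sum_component mult.commute)
  finally show ?thesis by (rule that)
qed

section \<open>Polynomials modulo powers of a maximal ideal\<close>

lemma sum_fun_apply [simp]: "(\<Sum>i\<in>I. f i) x = (\<Sum>i\<in>I. f i x)"
  by (induction I rule: infinite_finite_induct) auto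

text \<open>A bound of order |t|^k makes the polynomial divisible by t^k. The bound is asked for
  away from 0 only, so that one factor t can be removed at a time.\<close>

lemma poly_small_coeff:
  fixes p :: "complex poly"
  assumes "\<delta> > 0" "\<And>t. 0 < norm t ==> norm t < \<delta> ==> norm (poly p t) \<le> C * norm t ^ k" "l < k"
  shows "coeff p l = 0"
  using assms(2,3)
proof (induction k arbitrary: p l)
  case (Suc k)
  have "(poly p \<longlongrightarrow> 0) (at 0)"
  proof (rule Lim_null_comparison)
    show "eventually (\<lambda>t. norm (poly p t) \<le> C * norm t ^ Suc k) (at 0)"
      unfolding eventually_at using assms(1) Suc.prems(1) by (intro exI[of _ \<delta>]) auto
    have "((\<lambda>t::complex. C * norm t ^ Suc k) \<longlongrightarrow> C * norm (0::complex) ^ Suc k) (at 0)" by (intro tendsto_intros)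
    then show "((\<lambda>t::complex. C * norm t ^ Suc k) \<longlongrightarrow> 0) (at 0)" by simp
  qed
  moreover have "(poly p \<longlongrightarrow> poly p 0) (at 0)" using isCont_def poly_isCont by blast
  ultimately have p0: "poly p 0 = 0" using LIM_unique by blast
  then obtain q where q: "p = pCons 0 q" by (metis pCons_cases poly_0_coeff_0 coeff_pCons_0)
  have qb: "norm (poly q t) \<le> C * norm t ^ k" if "0 < norm t" "norm t < \<delta>" for t
  proof -
    have "norm t * norm (poly q t) \<le> norm t * (C * norm t ^ k)" using Suc.prems(1)[OF that] by (simp add: q norm_mult mult.left_commute)
    then show ?thesis by (rule mult_left_le_imp_le) (rule that(1))
  qed
  have "coeff q l = 0" if lk: "l < k" for l by (rule Suc.IH[OF _ lk]) (rule qb; assumption)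
  then show ?case using Suc.prems(2) by (cases l) (auto simp: q)
qed simp

text \<open>Hadamard's lemma with polynomial remainders.\<close>

lemma PF_taylor:
  assumes "f \<in> PF"
  shows "\<exists>g. (\<forall>i. g i \<in> PF) \<and> (\<forall>x. f x = f v + (\<Sum>i\<in>UNIV. (x $ i - v $ i) * g i x))"
  using assms
proof (induction rule: PF.induct)
  case (PF_const c)
  then show ?case by (intro exI[of _ "\<lambda>i x. 0"]) (auto intro: PF.PF_const)
next
  case (PF_coord f j)
  then obtain g where g: "\<forall>i. g i \<in> PF" "\<And>x. f x = f v + (\<Sum>i\<in>UNIV. (x $ i - v $ i) * g i x)" by blast
  let ?g = "\<lambda>i x. v $ j * g i x + (if i = j then f x else 0)"
  have "(\<lambda>x. v $ j * g i x) \<in> PF" for i using g(1) by (intro PF_mult PF_const) blast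
  moreover have "(\<lambda>x. if i = j then f x else 0) \<in> PF" for i using PF_coord.hyps by (cases "i = j") (simp_all add: PF_const)
  ultimately have 1: "?g i \<in> PF" for i by (rule PF.PF_add)
  have 2: "x $ j * f x = v $ j * f v + (\<Sum>i\<in>UNIV. (x $ i - v $ i) * ?g i x)" for x
  proof -
    have "(\<Sum>i\<in>UNIV. (x $ i - v $ i) * ?g i x) = v $ j * (\<Sum>i\<in>UNIV. (x $ i - v $ i) * g i x) + (\<Sum>i\<in>UNIV. if i = j then (x $ i - v $ i) * f x else 0)"
      unfolding sum_distrib_left sum.distrib[symmetric] by (rule sum.cong) (auto simp: algebra_simps)
    also have "\<dots> = v $ j * (f x - f v) + (x $ j - v $ j) * f x"
    proof -
      have "(\<Sum>i\<in>UNIV. (x $ i - v $ i) * g i x) = f x - f v" using g(2)[of x] by simp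
      then show ?thesis by simp
    qed
    finally show ?thesis by (simp add: algebra_simps)
  qed
  show ?case by (intro exI[of _ ?g] conjI allI 1 2)
next
  case (PF_add f1 f2)
  then obtain g1 g2 where g: "\<forall>i. g1 i \<in> PF" "\<And>x. f1 x = f1 v + (\<Sum>i\<in>UNIV. (x $ i - v $ i) * g1 i x)"
    "\<forall>i. g2 i \<in> PF" "\<And>x. f2 x = f2 v + (\<Sum>i\<in>UNIV. (x $ i - v $ i) * g2 i x)" by blast
  have 2: "f1 x + f2 x = f1 v + f2 v + (\<Sum>i\<in>UNIV. (x $ i - v $ i) * (g1 i x + g2 i x))" for x
  proof -
    have "(\<Sum>i\<in>UNIV. (x $ i - v $ i) * (g1 i x + g2 i x)) = (\<Sum>i\<in>UNIV. (x $ i - v $ i) * g1 i x) + (\<Sum>i\<in>UNIV. (x $ i - v $ i) * g2 i x)"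
      by (simp only: distrib_left sum.distrib)
    then show ?thesis using g(2)[of x] g(4)[of x] by simp
  qed
  have 1: "(\<lambda>x. g1 i x + g2 i x) \<in> PF" for i using g(1,3) by (intro PF.PF_add) blast+
  show ?case by (intro exI[of _ "\<lambda>i x. g1 i x + g2 i x"] conjI allI 1 2)
qed

lemma PF_shol: "f \<in> PF ==> shol f V"
proof (induction rule: PF.induct)
  case (PF_coord f i) show ?case by (rule shol_mult) (use PF_coord in auto)
next
  case (PF_add f g) show ?case by (rule shol_add) (use PF_add in auto)
qed auto

section \<open>Powers of an ideal and reduction to the free coordinates\<close>

lemma mk_ideal:
  assumes S: "is_subring S" and a: "\<And>i. a i \<in> S" shows "is_ideal S (mk S a k)"
proof (induction k)
  case 0 then show ?case using subringD[OF S] by (auto simp: is_ideal_def)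
next
  case (Suc k)
  note m = idealD[OF S Suc]
  show ?case unfolding is_ideal_def
  proof (intro conjI ballI)
    show "mk S a (Suc k) \<subseteq> S" by (rule mk_subset[OF S a])
    show "0 \<in> mk S a (Suc k)" unfolding mk.simps mem_Collect_eq using m(2) by (intro exI[of _ "\<lambda>_. 0"]) simp
    fix u w assume "u \<in> mk S a (Suc k)" "w \<in> mk S a (Suc k)"
    then obtain g h where "u = (\<Sum>i\<in>UNIV. a i * g i)" "w = (\<Sum>i\<in>UNIV. a i * h i)" "\<forall>i. g i \<in> mk S a k" "\<forall>i. h i \<in> mk S a k" by auto
    then have "u + w = (\<Sum>i\<in>UNIV. a i * (g i + h i)) \<and> (\<forall>i. g i + h i \<in> mk S a k)"
      using m(3) by (simp add: sum.distrib algebra_simps)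
    then show "u + w \<in> mk S a (Suc k)" unfolding mk.simps mem_Collect_eq by (intro exI[of _ "\<lambda>i. g i + h i"])
  next
    fix s u assume "s \<in> S" "u \<in> mk S a (Suc k)"
    then obtain g where g: "u = (\<Sum>i\<in>UNIV. a i * g i)" "\<forall>i. g i \<in> mk S a k" by auto
    have "s * u = (\<Sum>i\<in>UNIV. a i * (s * g i))" using g by (simp add: sum_distrib_left mult_ac)
    moreover have "\<forall>i. s * g i \<in> mk S a k" using m(4)[OF \<open>s \<in> S\<close>] g by blast
    ultimately have "s * u = (\<Sum>i\<in>UNIV. a i * (s * g i)) \<and> (\<forall>i. s * g i \<in> mk S a k)" by blast
    then show "s * u \<in> mk S a (Suc k)" unfolding mk.simps mem_Collect_eq by (intro exI[of _ "\<lambda>i. s * g i"])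
  qed
qed

lemma mk_mult:
  assumes S: "is_subring S" and a: "\<And>i. a i \<in> S"
  shows "m \<in> mk S a l ==> g \<in> mk S a k ==> m * g \<in> mk S a (l + k)"
proof (induction l arbitrary: m)
  case 0 then show ?case using idealD(4)[OF S mk_ideal[OF S a, where k = k], of m g] by simp
next
  case (Suc l)
  then obtain h where h: "m = (\<Sum>i\<in>UNIV. a i * h i)" "\<forall>i. h i \<in> mk S a l" by auto
  have "m * g = (\<Sum>i\<in>UNIV. a i * (h i * g))" unfolding h(1) by (simp add: sum_distrib_right mult.assoc)
  moreover have "\<forall>i. h i * g \<in> mk S a (l + k)" using Suc h by blast
  ultimately have "m * g = (\<Sum>i\<in>UNIV. a i * (h i * g)) \<and> (\<forall>i. h i * g \<in> mk S a (l + k))" by blast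
  then show ?case unfolding add_Suc mk.simps mem_Collect_eq by (intro exI[of _ "\<lambda>i. h i * g"])
qed

lemma mk_coord:
  assumes S: "is_subring S" and a: "\<And>i. a i \<in> S" and "g \<in> mk S a k"
  shows "a i * g \<in> mk S a (Suc k)"
proof -
  have z: "0 \<in> mk S a k" using idealD(2)[OF S mk_ideal[OF S a]] .
  have "(\<Sum>j\<in>UNIV. a j * (if j = i then g else 0)) = (\<Sum>j\<in>UNIV. if j = i then a j * g else 0)" by (rule sum.cong) auto
  then have "a i * g = (\<Sum>j\<in>UNIV. a j * (if j = i then g else 0)) \<and> (\<forall>j. (if j = i then g else 0) \<in> mk S a k)"
    using assms(3) z by simp
  then show ?thesis unfolding mk.simps mem_Collect_eq by (intro exI[of _ "\<lambda>j. if j = i then g else 0"])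
qed

text \<open>Homogeneous polynomials of degree \<open>k\<close> over \<open>C\<close> in those
  \<open>a j\<close> with \<open>j \<in> J\<close>, which will be the free coordinates of a
  germ.\<close>

primrec Yk :: "'r::comm_ring_1 set => ('m::finite => 'r) => 'm set => nat => 'r set" where
  "Yk C a J 0 = C"
| "Yk C a J (Suc k) = {\<Sum>j\<in>J. a j * h j | h. \<forall>j. h j \<in> Yk C a J k}"

lemma Yk_closed:
  assumes C: "is_subring C"
  shows "0 \<in> Yk C a J k" "g \<in> Yk C a J k ==> h \<in> Yk C a J k ==> g + h \<in> Yk C a J k"
    "c \<in> C ==> g \<in> Yk C a J k ==> c * g \<in> Yk C a J k"
proof -
  have "0 \<in> Yk C a J k \<and> (\<forall>g h. g \<in> Yk C a J k --> h \<in> Yk C a J k --> g + h \<in> Yk C a J k) \<and>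
    (\<forall>c g. c \<in> C --> g \<in> Yk C a J k --> c * g \<in> Yk C a J k)"
  proof (induction k)
    case 0 then show ?case using subringD[OF C] by simp
  next
    case (Suc k)
    have Y: "(\<Sum>j\<in>J. a j * h j) \<in> Yk C a J (Suc k)" if "\<forall>j. h j \<in> Yk C a J k" for h
      unfolding Yk.simps mem_Collect_eq using that by (intro exI[of _ h]) simp
    show ?case
    proof (intro conjI allI impI)
      show "0 \<in> Yk C a J (Suc k)" using Y[of "\<lambda>_. 0"] Suc by simp
      fix g h assume "g \<in> Yk C a J (Suc k)" "h \<in> Yk C a J (Suc k)"
      then obtain g' h' where "g = (\<Sum>j\<in>J. a j * g' j)" "\<forall>j. g' j \<in> Yk C a J k"
        "h = (\<Sum>j\<in>J. a j * h' j)" "\<forall>j. h' j \<in> Yk C a J k" by auto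
      then show "g + h \<in> Yk C a J (Suc k)" using Y[of "\<lambda>j. g' j + h' j"] Suc
        by (simp only: sum.distrib distrib_left) blast
    next
      fix c g assume c: "c \<in> C" "g \<in> Yk C a J (Suc k)"
      then obtain g' where "g = (\<Sum>j\<in>J. a j * g' j)" "\<forall>j. g' j \<in> Yk C a J k" by auto
      then show "c * g \<in> Yk C a J (Suc k)" using Y[of "\<lambda>j. c * g' j"] Suc c(1)
        by (simp only: sum_distrib_left mult.left_commute) blast
    qed
  qed
  then show "0 \<in> Yk C a J k" "g \<in> Yk C a J k ==> h \<in> Yk C a J k ==> g + h \<in> Yk C a J k"
    "c \<in> C ==> g \<in> Yk C a J k ==> c * g \<in> Yk C a J k" by blast+
qed

lemma Yk_sum:
  "is_subring C ==> (\<And>i. i \<in> I ==> f i \<in> Yk C a J k) ==> (\<Sum>i\<in>I. f i) \<in> Yk C a J k"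
  by (induction I rule: infinite_finite_induct) (auto intro: Yk_closed)

text \<open>By \<open>a_eq\<close> every generator is, up to \<open>F\<close> and second order, a
  \<open>C\<close>-linear combination of the free ones. Hence an element of order \<open>k\<close>
  is, up to \<open>F\<close> and order k + 1, a form of degree \<open>k\<close> in the free
  generators alone.\<close>

lemma mk_decompose_step:
  fixes a :: "'m::finite => 'r::comm_ring_1"
  assumes S: "is_subring S" and C: "is_subring C" "C \<subseteq> S" and F: "is_ideal S F" and a: "\<And>i. a i \<in> S"
    and S0: "\<And>g. g \<in> S ==> \<exists>c\<in>C. \<exists>m\<in>mk S a 1. g = c + m"
    and q: "\<And>i. q i \<in> F" and c: "\<And>i j. c i j \<in> C" and m: "\<And>i. m i \<in> mk S a 2"
    and a_eq: "\<And>i. a i = q i + (\<Sum>j\<in>J. c i j * a j) + m i"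
  shows "g \<in> mk S a k ==> \<exists>q\<in>F. \<exists>h\<in>Yk C a J k. \<exists>r\<in>mk S a (Suc k). g = q + h + r"
proof (induction k arbitrary: g)
  case 0
  then obtain c m where "c \<in> C" "m \<in> mk S a 1" "g = c + m" using S0[of g] by auto
  then have "0 \<in> F" "c \<in> Yk C a J 0" "m \<in> mk S a (Suc 0)" "g = 0 + c + m" using idealD(2)[OF S F] by simp_all
  then show ?case by blast
next
  case (Suc k)
  obtain g' where g': "g = (\<Sum>i\<in>UNIV. a i * g' i)" "\<forall>i. g' i \<in> mk S a k" using Suc.prems by auto
  have "\<forall>i. \<exists>p. fst p \<in> F \<and> fst (snd p) \<in> Yk C a J k \<and> snd (snd p) \<in> mk S a (Suc k) \<and> g' i = fst p + fst (snd p) + snd (snd p)"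
  proof
    fix i
    obtain q1 h1 r1 where "q1 \<in> F" "h1 \<in> Yk C a J k" "r1 \<in> mk S a (Suc k)" "g' i = q1 + h1 + r1"
      using Suc.IH[of "g' i"] g'(2) by blast
    then show "\<exists>p. fst p \<in> F \<and> fst (snd p) \<in> Yk C a J k \<and> snd (snd p) \<in> mk S a (Suc k) \<and> g' i = fst p + fst (snd p) + snd (snd p)"
      by (intro exI[of _ "(q1, h1, r1)"]) simp
  qed
  from choice[OF this] obtain p where p: "\<forall>i. fst (p i) \<in> F \<and> fst (snd (p i)) \<in> Yk C a J k \<and> snd (snd (p i)) \<in> mk S a (Suc k) \<and>
      g' i = fst (p i) + fst (snd (p i)) + snd (snd (p i))" by (elim exE) (erule that)
  define q' where "q' i = fst (p i)" for i
  define h' where "h' i = fst (snd (p i))" for i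
  define r' where "r' i = snd (snd (p i))" for i
  have p1: "q' i \<in> F" "h' i \<in> Yk C a J k" "r' i \<in> mk S a (Suc k)" "g' i = q' i + h' i + r' i" for i
    using p by (simp_all add: q'_def h'_def r'_def)
  define l where "l i = (\<Sum>j\<in>J. c i j * a j)" for i
  have lS: "l i \<in> S" for i unfolding l_def using c C a by (intro subring_sum[OF S] subringD(4)[OF S]) auto
  have l1: "l i * u \<in> mk S a (Suc n)" if u: "u \<in> mk S a n" for i u n
    unfolding l_def sum_distrib_right
    by (intro ideal_sum[OF S mk_ideal[OF S a]], simp only: mult.assoc,
        intro idealD(4)[OF S mk_ideal[OF S a]] mk_coord[OF S a u]) (use c C in auto)
  \<comment> \<open>Expanding (q + l + m) g' with g' = q' + h' + r': the terms containing q or q'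
    lie in \<open>F\<close>, the terms m g' and l r' have order k + 2, and l h' contributes the
    leading part \<open>T\<close>.\<close>
  define Q where "Q = (\<Sum>i\<in>UNIV. q i * g' i + l i * q' i)"
  define R where "R = (\<Sum>i\<in>UNIV. m i * g' i + l i * r' i)"
  define T where "T = (\<Sum>j\<in>J. a j * (\<Sum>i\<in>UNIV. c i j * h' i))"
  have g'S: "g' i \<in> S" for i by (rule subsetD[OF mk_subset[OF S a] g'(2)[rule_format]])
  have "Q \<in> F" unfolding Q_def
    by (intro ideal_sum[OF S F] idealD(3)[OF S F] idealD(5)[OF S F g'S q] idealD(4)[OF S F lS p1(1)])
  moreover have "R \<in> mk S a (Suc (Suc k))" unfolding R_def
  proof (intro ideal_sum[OF S mk_ideal[OF S a]] idealD(3)[OF S mk_ideal[OF S a]])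
    fix i show "m i * g' i \<in> mk S a (Suc (Suc k))" using mk_mult[OF S a m[of i], of "g' i" k] g'(2) by simp
    show "l i * r' i \<in> mk S a (Suc (Suc k))" by (rule l1[OF p1(3)])
  qed
  moreover have "T \<in> Yk C a J (Suc k)" unfolding T_def Yk.simps mem_Collect_eq
    by (intro exI[of _ "\<lambda>j. \<Sum>i\<in>UNIV. c i j * h' i"] conjI refl allI Yk_sum[OF C(1)] Yk_closed(3)[OF C(1) c p1(2)])
  moreover have "g = Q + T + R"
  proof -
    have "(\<Sum>i\<in>UNIV. l i * h' i) = T"
      unfolding T_def l_def sum_distrib_left sum_distrib_right by (subst sum.swap) (simp add: mult_ac)
    moreover have "a i * g' i = (q i * g' i + l i * q' i) + l i * h' i + (m i * g' i + l i * r' i)" for i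
    proof -
      have "a i * g' i = (q i + l i + m i) * g' i" using a_eq[of i] by (simp add: l_def)
      also have "\<dots> = q i * g' i + l i * g' i + m i * g' i" by (simp add: algebra_simps)
      also have "l i * g' i = l i * q' i + l i * h' i + l i * r' i" by (subst p1(4)) (simp add: algebra_simps)
      finally show ?thesis by (simp add: algebra_simps)
    qed
    ultimately show ?thesis unfolding g'(1) Q_def R_def by (simp add: sum.distrib)
  qed
  ultimately show ?case by blast
qed

lemma mk_decompose:
  fixes a :: "'m::finite => 'r::comm_ring_1"
  assumes S: "is_subring S" and C: "is_subring C" "C \<subseteq> S" and F: "is_ideal S F" and a: "\<And>i. a i \<in> S"
    and S0: "\<And>g. g \<in> S ==> \<exists>c\<in>C. \<exists>m\<in>mk S a 1. g = c + m"
    and q: "\<And>i. q i \<in> F" and c: "\<And>i j. c i j \<in> C" and m: "\<And>i. m i \<in> mk S a 2"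
    and a_eq: "\<And>i. a i = q i + (\<Sum>j\<in>J. c i j * a j) + m i" and g: "g \<in> S"
  shows "\<exists>q\<in>F. \<exists>r\<in>mk S a k. \<exists>h. (\<forall>l. h l \<in> Yk C a J l) \<and> g = q + (\<Sum>l<k. h l) + r"
proof (induction k)
  case 0
  have "0 \<in> F" "g \<in> mk S a 0" "\<forall>l. (\<lambda>_. 0) l \<in> Yk C a J l" using idealD(2)[OF S F] g Yk_closed(1)[OF C(1)] by auto
  then show ?case by (intro bexI[of _ 0] bexI[of _ g] exI[of _ "\<lambda>_. 0"]) auto
next
  case (Suc k)
  then obtain q1 r1 h1 where 1: "q1 \<in> F" "r1 \<in> mk S a k" "\<forall>l. h1 l \<in> Yk C a J l" "g = q1 + (\<Sum>l<k. h1 l) + r1" by blast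
  obtain q2 h2 r2 where 2: "q2 \<in> F" "h2 \<in> Yk C a J k" "r2 \<in> mk S a (Suc k)" "r1 = q2 + h2 + r2"
    using mk_decompose_step[OF S C F a S0 q c m a_eq 1(2)] by blast
  have "q1 + q2 \<in> F" using idealD(3)[OF S F] 1 2 by blast
  moreover have "\<forall>l. (h1(k := h2)) l \<in> Yk C a J l" using 1 2 by simp
  moreover have "g = (q1 + q2) + (\<Sum>l<Suc k. (h1(k := h2)) l) + r2"
  proof -
    have "(\<Sum>l<k. (h1(k := h2)) l) = (\<Sum>l<k. h1 l)" by (rule sum.cong) auto
    then show ?thesis using 1(4) 2(4) by (simp add: algebra_simps)
  qed
  ultimately show ?case using 2(3) by blast
qed

section \<open>Polynomial functions near a point and analytic germs\<close>

definition acoord :: "complex ^ 'm::finite => 'm => complex ^ 'm => complex" where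
  "acoord v i = (\<lambda>x. x $ i - v $ i)"

lemma acoord_PF: "acoord v i \<in> PF"
proof -
  have "(\<lambda>x. x $ i + (- (v $ i))) \<in> PF" by (intro PF_add PF_const forms_PF[OF forms_component])
  then show ?thesis by (simp add: acoord_def)
qed

text \<open>Two applications of Hadamard's lemma; the linear coefficients are identified with the
  gradient by uniqueness of the derivative.\<close>

lemma forms_taylor2:
  assumes f: "f \<in> forms d"
  shows "\<exists>m\<in>mk PF (acoord v) 2. f = (\<lambda>_. f v) + (\<Sum>i\<in>UNIV. (\<lambda>_. grad f v $ i) * acoord v i) + m"
proof -
  obtain g where g: "\<forall>i. g i \<in> PF" "\<And>x. f x = f v + (\<Sum>i\<in>UNIV. (x $ i - v $ i) * g i x)"
    using PF_taylor[OF forms_PF[OF f], of v] by blast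
  have "\<forall>i. \<exists>h. (\<forall>j. h j \<in> PF) \<and> (\<forall>x. g i x = g i v + (\<Sum>j\<in>UNIV. (x $ j - v $ j) * h j x))"
    using PF_taylor g(1) by blast
  from choice[OF this] obtain h where h: "\<forall>i. (\<forall>j. h i j \<in> PF) \<and> (\<forall>x. g i x = g i v + (\<Sum>j\<in>UNIV. (x $ j - v $ j) * h i j x))"
    by (elim exE) (erule that)
  have "(f has_derivative (\<lambda>u. \<Sum>i\<in>UNIV. u $ i * g i v)) (at v)"
  proof -
    have "((\<lambda>x. f v + (\<Sum>i\<in>UNIV. (x $ i - v $ i) * g i x)) has_derivative (\<lambda>u. \<Sum>i\<in>UNIV. (v $ i - v $ i) * fd (g i) v u + u $ i * g i v)) (at v)"
    proof (rule has_derivative_eq_rhs, rule has_derivative_add, rule has_derivative_const, rule has_derivative_sum, rule has_derivative_mult)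
      fix i
      show "((\<lambda>x. x $ i - v $ i) has_derivative (\<lambda>u. u $ i)) (at v)"
        by (rule has_derivative_eq_rhs, rule has_derivative_diff, rule bounded_linear_imp_has_derivative,
            rule bounded_linear_vec_nth, rule has_derivative_const) simp
      show "(g i has_derivative fd (g i) v) (at v)" using shol_fd[OF PF_shol, of "g i" v UNIV] g(1) by simp
    qed simp
    moreover have "(\<lambda>x. f v + (\<Sum>i\<in>UNIV. (x $ i - v $ i) * g i x)) = f" by (rule ext, rule g(2)[symmetric])
    ultimately show ?thesis by simp
  qed
  then have "(\<lambda>u. coeff (lpoly f v u) 1) = (\<lambda>u. \<Sum>i\<in>UNIV. u $ i * g i v)"
    using forms_has_derivative[OF f, of v] has_derivative_unique by blast
  note eq = this
  have gr: "grad f v $ i = g i v" for i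
  proof -
    have "grad f v $ i = (\<lambda>u. coeff (lpoly f v u) 1) (axis i 1)" by (simp only: grad_def vec_lambda_beta)
    also have "\<dots> = (\<Sum>j\<in>UNIV. axis i 1 $ j * g j v)" by (rule fun_cong[OF eq])
    also have "\<dots> = (\<Sum>j\<in>UNIV. if j = i then g j v else 0)" by (rule sum.cong) (auto simp: axis_def)
    finally show ?thesis by simp
  qed
  define m where "m = (\<Sum>i\<in>UNIV. acoord v i * (\<Sum>j\<in>UNIV. acoord v j * h i j))"
  have 1: "(\<Sum>j\<in>UNIV. acoord v j * h i j) \<in> mk PF (acoord v) (Suc 0)" for i
    unfolding mk.simps mem_Collect_eq by (rule exI[of _ "h i"]) (use h in simp)
  have "m \<in> mk PF (acoord v) (Suc (Suc 0))"
    unfolding m_def mk.simps(2)[of _ _ "Suc 0"] mem_Collect_eq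
    by (rule exI[of _ "\<lambda>i. \<Sum>j\<in>UNIV. acoord v j * h i j"]) (use 1 in \<open>simp del: mk.simps\<close>)
  moreover have "f = (\<lambda>_. f v) + (\<Sum>i\<in>UNIV. (\<lambda>_. grad f v $ i) * acoord v i) + m"
  proof
    fix x
    have gx: "g i x = g i v + (\<Sum>j\<in>UNIV. (x $ j - v $ j) * h i j x)" for i using h by blast
    have "f x = f v + (\<Sum>i\<in>UNIV. (x $ i - v $ i) * g i x)" by (rule g(2))
    also have "(\<Sum>i\<in>UNIV. (x $ i - v $ i) * g i x)
        = (\<Sum>i\<in>UNIV. (x $ i - v $ i) * (g i v + (\<Sum>j\<in>UNIV. (x $ j - v $ j) * h i j x)))"
      by (rule sum.cong[OF refl]) (subst gx, rule refl)
    finally show "f x = ((\<lambda>_. f v) + (\<Sum>i\<in>UNIV. (\<lambda>_. grad f v $ i) * acoord v i) + m) x"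
      by (simp add: m_def acoord_def gr distrib_left sum.distrib mult.commute)
  qed
  ultimately show ?thesis unfolding numeral_2_eq_2 by blast
qed

definition constf :: "(complex ^ 'm::finite => complex) set" where "constf = range (\<lambda>c _. c)"

lemma constf_subring: "is_subring constf" "constf \<subseteq> PF"
  unfolding is_subring_def constf_def zero_fun_def one_fun_def plus_fun_def times_fun_def
  by (auto simp: image_iff fun_eq_iff intro: PF_const)

lemma Yk_homogeneous:
  assumes "h \<in> Yk constf (acoord v) J k" "\<And>j. j \<in> J ==> x' $ j - v $ j = t * (x $ j - v $ j)"
  shows "h x' = t ^ k * h x"
  using assms(1)
proof (induction k arbitrary: h)
  case 0 then show ?case by (auto simp: constf_def)
next
  case (Suc k)
  then obtain h' where h': "h = (\<Sum>j\<in>J. acoord v j * h' j)" "\<forall>j. h' j \<in> Yk constf (acoord v) J k" by auto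
  have "h x' = (\<Sum>j\<in>J. (x' $ j - v $ j) * h' j x')" by (simp add: h' acoord_def)
  also have "\<dots> = (\<Sum>j\<in>J. t ^ Suc k * ((x $ j - v $ j) * h' j x))"
    by (rule sum.cong) (use Suc.IH h' assms(2) in auto)
  finally show ?case by (simp only: h' sum_fun_apply times_fun_apply acoord_def sum_distrib_left)
qed

text \<open>Turns an algebraic order of vanishing at \<open>v\<close> into an estimate, the only
  kind of information that survives composition with the analytic map \<Psi>.\<close>

lemma mk_bound:
  assumes "r \<in> mk PF (acoord v) k"
  shows "\<exists>K\<ge>0. \<forall>x. norm (x - v) < 1 --> norm (r x) \<le> K * norm (x - v) ^ k"
  using assms
proof (induction k arbitrary: r)
  case 0
  then have "continuous_on (cball v 1) r" using PF_shol shol_continuous by auto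
  then have "bounded (r ` cball v 1)" using compact_continuous_image compact_imp_bounded compact_cball by blast
  then obtain K where K: "\<forall>y\<in>r ` cball v 1. norm y \<le> K" unfolding bounded_iff by blast
  have "K \<ge> 0" using K[rule_format, of "r v"] norm_ge_zero[of "r v"] by (metis centre_in_cball imageI order_trans zero_le_one)
  moreover have "norm (r x) \<le> K * norm (x - v) ^ 0" if "norm (x - v) < 1" for x
  proof -
    have "x \<in> cball v 1" using that by (simp add: dist_norm norm_minus_commute)
    then show ?thesis using K by auto
  qed
  ultimately show ?case by blast
next
  case (Suc k)
  then obtain g where g: "r = (\<Sum>i\<in>UNIV. acoord v i * g i)" "\<forall>i. g i \<in> mk PF (acoord v) k" by auto
  have "\<forall>i. \<exists>K\<ge>0. \<forall>x. norm (x - v) < 1 --> norm (g i x) \<le> K * norm (x - v) ^ k" using Suc.IH g(2) by blast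
  from choice[OF this] obtain K where K: "\<forall>i. K i \<ge> 0 \<and> (\<forall>x. norm (x - v) < 1 --> norm (g i x) \<le> K i * norm (x - v) ^ k)"
    by (elim exE) (erule that)
  have "norm (r x) \<le> (\<Sum>i\<in>UNIV. K i) * norm (x - v) ^ Suc k" if x: "norm (x - v) < 1" for x
  proof -
    have "norm (r x) \<le> (\<Sum>i\<in>UNIV. norm (x $ i - v $ i) * norm (g i x))"
      unfolding g(1) by (simp add: acoord_def norm_mult[symmetric] norm_sum)
    also have "\<dots> \<le> (\<Sum>i\<in>UNIV. norm (x - v) * (K i * norm (x - v) ^ k))"
    proof (rule sum_mono, rule mult_mono)
      fix i show "norm (x $ i - v $ i) \<le> norm (x - v)" using Finite_Cartesian_Product.norm_nth_le[of "x - v" i] by simp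
      show "norm (g i x) \<le> K i * norm (x - v) ^ k" using K x by blast
    qed auto
    also have "\<dots> = (\<Sum>i\<in>UNIV. K i * norm (x - v) ^ Suc k)" by (rule sum.cong) auto
    also have "\<dots> = (\<Sum>i\<in>UNIV. K i) * norm (x - v) ^ Suc k" by (simp only: sum_distrib_right)
    finally show ?thesis .
  qed
  moreover have "(\<Sum>i\<in>UNIV. K i) \<ge> 0" using K by (intro sum_nonneg) blast
  ultimately show ?case by blast
qed

lemma has_derivative_lipschitz_at:
  assumes "(f has_derivative D) (at x)"
  shows "\<exists>K>0. \<exists>\<delta>>0. \<forall>z. norm (z - x) < \<delta> --> norm (f z - f x) \<le> K * norm (z - x)"
proof -
  obtain \<delta> where \<delta>: "\<delta> > 0" "\<forall>z. norm (z - x) < \<delta> --> norm (f z - f x - D (z - x)) \<le> 1 * norm (z - x)"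
    using assms[unfolded has_derivative_at_alt] zero_less_one by blast
  obtain B where B: "B > 0" "\<And>z. norm (D z) \<le> norm z * B"
    using bounded_linear.pos_bounded[OF has_derivative_bounded_linear[OF assms]] by blast
  have "norm (f z - f x) \<le> (1 + B) * norm (z - x)" if "norm (z - x) < \<delta>" for z
  proof -
    have "norm (f z - f x) \<le> norm (f z - f x - D (z - x)) + norm (D (z - x))" using norm_triangle_sub by (metis add.commute)
    also have "\<dots> \<le> 1 * norm (z - x) + norm (z - x) * B" using \<delta>(2) that B(2)[of "z - x"] by (intro add_mono) auto
    finally show ?thesis by (simp add: algebra_simps)
  qed
  then show ?thesis using \<delta>(1) B(1) by (intro exI[of _ "1 + B"] conjI exI[of _ \<delta>]) auto
qed

text \<open>The algebraic core: a form vanishing on the analytic germ cut out by forms with independent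
  differentials lies, locally, in the ideal generated by them.\<close>

lemma vanishing_on_germ:
  fixes W :: "'n::finite proj set"
  assumes W: "irreducible_in zariski W" and v: "v \<in> cone W"
    and f: "\<And>i. i \<notin> J ==> f i \<in> forms (d i)" "\<And>i. i \<notin> J ==> W \<subseteq> zeros (f i)"
    and b: "\<And>i. i \<in> J ==> b i = axis i 1" "\<And>i. i \<notin> J ==> b i = grad (f i) v" "\<forall>u. (\<forall>i. dotp (b i) u = 0) --> u = 0"
    and g: "g \<in> forms e"
    and \<Psi>: "(\<Psi> has_derivative D) (at 0)" "\<Psi> 0 = v" "\<epsilon> > 0"
      "\<And>y i. norm y < \<epsilon> ==> \<forall>i. i \<notin> J --> y $ i = 0 ==> i \<in> J ==> \<Psi> y $ i = v $ i + y $ i"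
      "\<And>y i. norm y < \<epsilon> ==> \<forall>i. i \<notin> J --> y $ i = 0 ==> i \<notin> J ==> f i (\<Psi> y) = 0"
      "\<And>y. norm y < \<epsilon> ==> \<forall>i. i \<notin> J --> y $ i = 0 ==> g (\<Psi> y) = 0"
  shows "W \<subseteq> zeros g"
proof -
  let ?a = "acoord v" and ?C = "constf :: (complex ^ 'n option => complex) set"
  note S = PF_subring and a = acoord_PF[of v]
  have MI: "is_ideal PF (mk PF ?a k)" for k by (rule mk_ideal[OF S a])
  have fv: "f i v = 0" if "i \<notin> J" for i using \<Psi>(5)[of 0 i] \<Psi>(2,3) that by simp
  define F where "F = {\<Sum>i\<in>-J. q i * f i | q. \<forall>i. q i \<in> PF}"
  have FI: "(\<Sum>i\<in>-J. q i * f i) \<in> F" if "\<forall>i. q i \<in> PF" for q unfolding F_def using that by blast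
  have F: "is_ideal PF F" unfolding is_ideal_def
  proof (intro conjI ballI)
    show "F \<subseteq> PF" unfolding F_def using f(1)
      by (auto intro!: subring_sum[OF S] subringD(4)[OF S] intro: forms_PF)
    show "0 \<in> F" using FI[of "\<lambda>_. 0"] subringD(1)[OF S] by simp
    fix u w assume "u \<in> F" "w \<in> F"
    then obtain q r where "u = (\<Sum>i\<in>-J. q i * f i)" "w = (\<Sum>i\<in>-J. r i * f i)" "\<forall>i. q i \<in> PF" "\<forall>i. r i \<in> PF"
      unfolding F_def by blast
    moreover have "\<forall>i. q i + r i \<in> PF" using calculation(3,4) by (intro allI subringD(3)[OF S]) blast+
    ultimately show "u + w \<in> F" using FI[of "\<lambda>i. q i + r i"] by (simp add: distrib_right sum.distrib)
  next
    fix s u :: "complex ^ 'n option => complex" assume su: "s \<in> PF" "u \<in> F"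
    then obtain q where "u = (\<Sum>i\<in>-J. q i * f i)" "\<forall>i. q i \<in> PF" unfolding F_def by blast
    moreover have "\<forall>i. s * q i \<in> PF" using calculation(2) su(1) by (intro allI subringD(4)[OF S]) blast+
    ultimately show "s * u \<in> F" using FI[of "\<lambda>i. s * q i"] by (simp add: sum_distrib_left mult.assoc)
  qed
  have S0: "\<exists>c\<in>?C. \<exists>m\<in>mk PF ?a 1. h = c + m" if h: "h \<in> PF" for h
  proof -
    obtain g' where g': "\<forall>i. g' i \<in> PF" "\<And>x. h x = h v + (\<Sum>i\<in>UNIV. (x $ i - v $ i) * g' i x)" using PF_taylor[OF h, of v] by blast
    have "(\<Sum>i\<in>UNIV. ?a i * g' i) \<in> mk PF ?a 1" using g'(1) by auto
    moreover have "h = (\<lambda>_. h v) + (\<Sum>i\<in>UNIV. ?a i * g' i)"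
      by (rule ext) (simp only: plus_fun_apply sum_fun_apply times_fun_apply acoord_def, rule g'(2))
    moreover have "(\<lambda>_. h v) \<in> ?C" by (auto simp: constf_def)
    ultimately show ?thesis by blast
  qed
  have "\<forall>i. \<exists>m. m \<in> mk PF ?a 2 \<and> (i \<notin> J --> f i = (\<Sum>l\<in>UNIV. (\<lambda>_. grad (f i) v $ l) * ?a l) + m)"
  proof
    fix i
    show "\<exists>m. m \<in> mk PF ?a 2 \<and> (i \<notin> J --> f i = (\<Sum>l\<in>UNIV. (\<lambda>_. grad (f i) v $ l) * ?a l) + m)"
    proof (cases "i \<in> J")
      case True then show ?thesis using idealD(2)[OF S MI[of 2]] by blast
    next
      case False
      obtain m where "m \<in> mk PF ?a 2" "f i = (\<lambda>_. f i v) + (\<Sum>l\<in>UNIV. (\<lambda>_. grad (f i) v $ l) * ?a l) + m"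
        using forms_taylor2[OF f(1)[OF False], of v] by blast
      then show ?thesis using fv[OF False] by (intro exI[of _ m]) (simp add: zero_fun_def[symmetric])
    qed
  qed
  from choice[OF this] obtain \<mu>
    where \<mu>: "\<forall>i. \<mu> i \<in> mk PF ?a 2 \<and> (i \<notin> J --> f i = (\<Sum>l\<in>UNIV. (\<lambda>_. grad (f i) v $ l) * ?a l) + \<mu> i)"
    by (elim exE) (erule that)
  have "\<forall>i. \<exists>c. axis i 1 = (\<Sum>l\<in>UNIV. c l *s b l)"
  proof
    fix i show "\<exists>c. axis i 1 = (\<Sum>l\<in>UNIV. c l *s b l)" by (rule row_basis_expand[OF b(3), of "axis i 1"]) (rule exI)
  qed
  from choice[OF this] obtain c where c: "\<forall>i. axis i 1 = (\<Sum>l\<in>UNIV. c i l *s b l)" by (elim exE) (erule that)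
  \<comment> \<open>Expanding the coordinate rows in the rows \<open>b l\<close> expresses each
    \<open>x $ i - v $ i\<close> by the values of \<open>b l\<close> on \<open>x - v\<close>. For
    \<open>l \<in> J\<close> these are the free coordinates, for the others they equal
    \<open>f l\<close> up to the second-order term \<open>\<mu> l\<close>.\<close>
  define q where "q i = (\<Sum>l\<in>-J. (\<lambda>_. c i l) * f l)" for i
  define m where "m i = (\<Sum>l\<in>-J. (\<lambda>_. - c i l) * \<mu> l)" for i
  have q: "q i \<in> F" for i unfolding q_def by (rule FI) (auto intro: PF_const)
  have m: "m i \<in> mk PF ?a 2" for i unfolding m_def
    using \<mu> by (intro ideal_sum[OF S MI] idealD(4)[OF S MI] PF_const) blast
  have cC: "(\<lambda>_. c i j) \<in> ?C" for i j by (auto simp: constf_def)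
  have a_eq: "?a i = q i + (\<Sum>j\<in>J. (\<lambda>_. c i j) * ?a j) + m i" for i
  proof
    fix x
    have fl: "f l x = dotp (b l) (x - v) + \<mu> l x" if l: "l \<notin> J" for l
    proof -
      have "f l = (\<Sum>j\<in>UNIV. (\<lambda>_. grad (f l) v $ j) * ?a j) + \<mu> l" using \<mu> l by blast
      then have "f l x = ((\<Sum>j\<in>UNIV. (\<lambda>_. grad (f l) v $ j) * ?a j) + \<mu> l) x" by (rule arg_cong)
      then show ?thesis using b(2)[OF l] by (simp add: dotp_def acoord_def)
    qed
    have "x $ i - v $ i = dotp (axis i 1) (x - v)" by simp
    also have "\<dots> = (\<Sum>l\<in>UNIV. c i l * dotp (b l) (x - v))"
    proof -
      have "dotp (\<Sum>l\<in>UNIV. c i l *s b l) y = (\<Sum>l\<in>UNIV. c i l * dotp (b l) y)" for y by (simp add: dotp_sum)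
      then show ?thesis using c by metis
    qed
    also have "\<dots> = (\<Sum>l\<in>-J. c i l * dotp (b l) (x - v)) + (\<Sum>l\<in>J. c i l * dotp (b l) (x - v))"
      by (subst sum.union_disjoint[symmetric]) (auto intro: sum.cong)
    also have "(\<Sum>l\<in>J. c i l * dotp (b l) (x - v)) = (\<Sum>l\<in>J. c i l * (x $ l - v $ l))"
      by (rule sum.cong) (use b(1) in auto)
    also have "(\<Sum>l\<in>-J. c i l * dotp (b l) (x - v)) = (\<Sum>l\<in>-J. c i l * f l x - c i l * \<mu> l x)"
    proof (rule sum.cong[OF refl])
      fix l assume "l \<in> -J"
      then have "f l x = dotp (b l) (x - v) + \<mu> l x" using fl by simp
      then show "c i l * dotp (b l) (x - v) = c i l * f l x - c i l * \<mu> l x" by (simp only: distrib_left) simp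
    qed
    finally show "?a i x = (q i + (\<Sum>j\<in>J. (\<lambda>_. c i j) * ?a j) + m i) x"
      by (simp add: q_def m_def acoord_def sum_subtractf sum_negf)
  qed
  have gPF: "g \<in> PF" by (rule forms_PF[OF g])
  \<comment> \<open>By \<open>mk_decompose\<close>, \<open>g\<close> is an element of
    \<open>F\<close> plus forms \<open>h l\<close> of degree l < k in the free coordinates plus a
    remainder of order k. On the germ \<open>g\<close> and \<open>F\<close> vanish, so along a ray
    the sum of the \<open>h l\<close> is a polynomial in t of size |t|^k; hence all
    \<open>h l\<close> are zero.\<close>
  have mem: "\<exists>u\<in>F. g - u \<in> mk PF ?a k" for k
  proof -
    obtain u r h where u: "u \<in> F" and r: "r \<in> mk PF ?a k" and h: "\<forall>l. h l \<in> Yk ?C ?a J l" and eq: "g = u + (\<Sum>l<k. h l) + r"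
      using mk_decompose[OF S constf_subring F a S0 q cC m a_eq gPF, of k] by blast
    obtain q' where q': "u = (\<Sum>i\<in>-J. q' i * f i)" using u unfolding F_def by blast
    obtain K where K: "K \<ge> 0" "\<forall>x. norm (x - v) < 1 --> norm (r x) \<le> K * norm (x - v) ^ k" using mk_bound[OF r] by blast
    obtain L \<delta> where L: "L > 0" "\<delta> > 0" "\<forall>z. norm (z - 0) < \<delta> --> norm (\<Psi> z - \<Psi> 0) \<le> L * norm (z - 0)"
      using has_derivative_lipschitz_at[OF \<Psi>(1)] by blast
    have hz: "h l x = 0" if l: "l < k" for l x
    proof -
      define y where "y = (\<chi> j. if j \<in> J then x $ j - v $ j else 0)"
      have yJ: "\<forall>i. i \<notin> J --> (t *s y) $ i = 0" for t by (simp add: y_def)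
      define p where "p = (\<Sum>l<k. monom (h l x) l)"
      \<comment> \<open>For |t| below this bound \<open>t *s y\<close> stays within \<epsilon> and
        \<delta>, and its image under \<Psi> within distance 1 of \<open>v\<close>, where
        \<open>mk_bound\<close> applies.\<close>
      define \<eta> where "\<eta> = min (min \<epsilon> \<delta>) (1 / L) / (1 + norm y)"
      have pos: "1 + norm y > 0" using norm_ge_zero[of y] by linarith
      have \<eta>: "\<eta> > 0" unfolding \<eta>_def using \<Psi>(3) L pos by simp
      have "norm (poly p t) \<le> (K * (L * norm y) ^ k) * norm t ^ k" if t: "0 < norm t" "norm t < \<eta>" for t
      proof -
        have nty: "norm (t *s y) = norm t * norm y" by (simp add: norm_vec_def L2_set_right_distrib norm_mult)
        have "norm t * (1 + norm y) < min (min \<epsilon> \<delta>) (1 / L)" using t(2) pos unfolding \<eta>_def by (simp only: pos_less_divide_eq)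
        moreover have "norm t * norm y \<le> norm t * (1 + norm y)" by (intro mult_left_mono) auto
        ultimately have small: "norm (t *s y) < min (min \<epsilon> \<delta>) (1 / L)" unfolding nty by (rule order.strict_trans1[rotated])
        let ?X = "\<Psi> (t *s y)"
        have s\<epsilon>: "norm (t *s y) < \<epsilon>" using small by simp
        have "norm (?X - v) \<le> L * norm (t *s y)" using L(3)[rule_format, of "t *s y"] small \<Psi>(2) by simp
        moreover have "L * norm (t *s y) < 1" using small L(1) by (simp add: pos_less_divide_eq mult.commute)
        ultimately have X: "norm (?X - v) < 1" "norm (?X - v) \<le> L * (norm t * norm y)" using nty by auto
        have "?X $ j - v $ j = t * (x $ j - v $ j)" if "j \<in> J" for j
          using \<Psi>(4)[OF s\<epsilon> yJ that] that by (simp add: y_def)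
        then have hX: "h l ?X = t ^ l * h l x" for l using Yk_homogeneous[OF h[rule_format]] by blast
        have "u ?X = 0" unfolding q' using \<Psi>(5)[OF s\<epsilon> yJ] by simp
        moreover have "g ?X = 0" by (rule \<Psi>(6)[OF s\<epsilon> yJ])
        moreover have "g ?X = u ?X + (\<Sum>l<k. h l ?X) + r ?X" by (subst eq) simp
        ultimately have "(\<Sum>l<k. t ^ l * h l x) = - r ?X" using hX by (simp add: eq_neg_iff_add_eq_0)
        then have "poly p t = - r ?X" by (simp add: p_def poly_sum poly_monom mult.commute)
        then have "norm (poly p t) = norm (r ?X)" by simp
        also have "\<dots> \<le> K * norm (?X - v) ^ k" using K X by blast
        also have "\<dots> \<le> K * (L * (norm t * norm y)) ^ k" using K X by (intro mult_left_mono power_mono) auto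
        finally show ?thesis by (simp add: power_mult_distrib mult_ac)
      qed
      then have "coeff p l = 0" by (rule poly_small_coeff[OF \<eta> _ l])
      then show ?thesis using l by (simp add: p_def coeff_sum)
    qed
    have "(\<Sum>l<k. h l) = 0" by (rule sum.neutral) (use hz in \<open>auto simp: fun_eq_iff\<close>)
    then have "g - u = r" using eq by simp
    then show ?thesis using u r by blast
  qed
  obtain \<beta> where \<beta>: "\<forall>i. \<beta> i \<in> PF" "g - (\<Sum>i\<in>UNIV. \<beta> i * ?a i) * g \<in> F"
    using krull_intersection[OF S noeth_PF F a gPF mem] by blast
  \<comment> \<open>The factor from Krull's theorem takes the value 1 at \<open>v\<close>, so it
    does not vanish on the cone over \<open>W\<close>; since \<open>g * s\<close> does,
    irreducibility leaves only \<open>g\<close>.\<close>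
  define s where "s = 1 - (\<Sum>i\<in>UNIV. \<beta> i * ?a i)"
  have sPF: "s \<in> PF" unfolding s_def using \<beta>(1) a
    by (intro subringD(6)[OF S] subringD(2)[OF S] subring_sum[OF S] subringD(4)[OF S]) auto
  obtain q' where q': "g - (\<Sum>i\<in>UNIV. \<beta> i * ?a i) * g = (\<Sum>i\<in>-J. q' i * f i)" using \<beta>(2) unfolding F_def by blast
  have "g w * s w = 0" if w: "w \<in> cone W" for w
  proof -
    have "f i w = 0" if "i \<notin> J" for i using f(2)[OF that] w subset_zeros_iff[OF f(1)[OF that]] by blast
    then have "(\<Sum>i\<in>-J. q' i * f i) w = 0" by simp
    then have "(g - (\<Sum>i\<in>UNIV. \<beta> i * ?a i) * g) w = 0" using q' by simp
    then show ?thesis by (simp add: s_def algebra_simps)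
  qed
  then have "(\<forall>w\<in>cone W. g w = 0) \<or> (\<forall>w\<in>cone W. s w = 0)" by (rule PF_irreducible[OF W g sPF])
  moreover have "s v = 1" by (simp add: s_def acoord_def)
  ultimately show ?thesis using v subset_zeros_iff[OF g] by auto
qed

text \<open>The pullbacks of forms are holomorphic functions on a convex piece of an affine
  subspace, and these have no zero divisors. No closedness of the image is involved.\<close>

lemma irreducible_image:
  fixes \<Psi> :: "complex ^ 'a::finite => complex ^ 'n::finite option"
  assumes V: "open V" "convex V" and L: "\<And>a b t. a \<in> L ==> b \<in> L ==> a + t *s (b - a) \<in> L"
    and ne: "V \<inter> L \<noteq> {}" and \<Psi>: "holo_on \<Psi> V" "\<And>y. y \<in> V ==> \<Psi> y \<noteq> 0"
  shows "irreducible_in zariski ((\<lambda>y. proj_point (\<Psi> y)) ` (V \<inter> L))" (is "irreducible_in _ ?S")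
  unfolding irreducible_iff
proof (intro conjI allI ballI impI)
  show "?S \<noteq> {}" using ne by blast
  fix d e and f g :: "complex ^ 'n option => complex"
  assume fg: "f \<in> forms d" "g \<in> forms e" "?S \<subseteq> zeros f \<union> zeros g"
  have z: "proj_point (\<Psi> y) \<in> zeros p \<longleftrightarrow> p (\<Psi> y) = 0" if "p \<in> forms k" "y \<in> V" for p k y
    using in_zeros_iff[OF that(1)] \<Psi>(2)[OF that(2)] by blast
  have 0: "f (\<Psi> y) * g (\<Psi> y) = 0" if "y \<in> V \<inter> L" for y
    using fg(3) z[OF fg(1)] z[OF fg(2)] that by auto
  have sf: "shol (\<lambda>y. f (\<Psi> y)) V" by (rule shol_compose[OF shol_forms[OF fg(1)] \<Psi>(1)]) (rule subset_UNIV)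
  have sg: "shol (\<lambda>y. g (\<Psi> y)) V" by (rule shol_compose[OF shol_forms[OF fg(2)] \<Psi>(1)]) (rule subset_UNIV)
  show "?S \<subseteq> zeros f \<or> ?S \<subseteq> zeros g"
  proof (cases "\<exists>a\<in>V \<inter> L. f (\<Psi> a) \<noteq> 0")
    case True
    then obtain a where a: "a \<in> V \<inter> L" "f (\<Psi> a) \<noteq> 0" by blast
    have "g (\<Psi> b) = 0" if "b \<in> V \<inter> L" for b by (rule shol_domain[OF V L sf sg 0 a that])
    then show ?thesis using z[OF fg(2)] by auto
  next
    case False
    then show ?thesis using z[OF fg(1)] by auto
  qed
qed

section \<open>Gradients and local coordinates of a variety\<close>

lemma lpoly_add: "f \<in> forms d ==> g \<in> forms d ==> lpoly (\<lambda>x. f x + g x) x u = lpoly f x u + lpoly g x u"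
  by (rule lpoly_unique) (simp add: forms_lpoly(1))

lemma lpoly_mult: "f \<in> forms d ==> g \<in> forms e ==> lpoly (\<lambda>x. f x * g x) x u = lpoly f x u * lpoly g x u"
  by (rule lpoly_unique) (simp add: forms_lpoly(1))

lemma lpoly_const: "lpoly (\<lambda>x. c) x u = [:c:]"
  by (rule lpoly_unique) simp

lemma grad_mult_zero:
  assumes "p \<in> forms a" "f \<in> forms d" "f v = 0"
  shows "grad (\<lambda>x. p x * f x) v = p v *s grad f v"
proof -
  have "coeff (lpoly p v u * lpoly f v u) 1 = p v * coeff (lpoly f v u) 1" for u
    using forms_lpoly_0[OF assms(1), of v u] forms_lpoly_0[OF assms(2), of v u] assms(3)
    by (simp add: coeff_mult)
  then show ?thesis unfolding grad_def lpoly_mult[OF assms(1,2)] by (simp add: vec_eq_iff)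
qed

lemma grad_add: "f \<in> forms d ==> g \<in> forms d ==> grad (\<lambda>x. f x + g x) v = grad f v + grad g v"
  by (simp add: grad_def lpoly_add vec_eq_iff)

lemma grad_sum:
  assumes "\<And>i. i \<in> I ==> f i \<in> forms d" shows "grad (\<lambda>x. \<Sum>i\<in>I. f i x) v = (\<Sum>i\<in>I. grad (f i) v)"
  using assms
proof (induction I rule: infinite_finite_induct)
  case (insert j I)
  have "grad (\<lambda>x. f j x + (\<Sum>i\<in>I. f i x)) v = grad (f j) v + grad (\<lambda>x. \<Sum>i\<in>I. f i x) v"
    by (rule grad_add) (use insert in auto)
  then show ?case using insert by simp
qed (simp_all add: grad_def lpoly_const vec_eq_iff)

text \<open>Local coordinates \<open>\<Theta>\<close> at \<open>v\<close> with inverse \<open>\<Psi>\<close>: the coordinates outside \<open>J\<close> are forms vanishing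
  on \<open>X\<close> whose differentials cut out the tangent space.\<close>

definition germ ::
  "'n::finite proj set => complex ^ 'n option => 'n option set => (complex ^ 'n option => complex ^ 'n option) =>
   (complex ^ 'n option => complex ^ 'n option) => real => bool" where
  "germ X v J \<Theta> \<Psi> \<rho> \<longleftrightarrow> 0 < \<rho> \<and> holo_on \<Theta> UNIV \<and> holo_on \<Psi> (ball 0 \<rho>) \<and> \<Theta> v = 0 \<and> \<Psi> 0 = v \<and> open (\<Psi> ` ball 0 \<rho>) \<and>
     (\<forall>y\<in>ball 0 \<rho>. \<Psi> y \<noteq> 0 \<and> \<Theta> (\<Psi> y) = y) \<and>
     (\<forall>i. i \<notin> J --> (\<exists>d. (\<lambda>x. \<Theta> x $ i) \<in> forms d \<and> X \<subseteq> zeros (\<lambda>x. \<Theta> x $ i))) \<and>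
     (\<forall>i\<in>J. \<forall>x. \<Theta> x $ i = x $ i - v $ i) \<and>
     (\<forall>u. fd \<Psi> 0 (fd \<Theta> v u) = u) \<and>
     (\<forall>u. fd \<Theta> v (fd \<Psi> 0 u) = u) \<and>
     tangent X (proj_point v) = {u. \<forall>i. i \<notin> J --> fd \<Theta> v u $ i = 0} \<and>
     vec.dim (tangent X (proj_point v)) = card J"

lemma germD:
  assumes "germ X v J \<Theta> \<Psi> \<rho>"
  shows "0 < \<rho>" "holo_on \<Theta> UNIV" "holo_on \<Psi> (ball 0 \<rho>)" "\<Theta> v = 0" "\<Psi> 0 = v" "open (\<Psi> ` ball 0 \<rho>)"
    "y \<in> ball 0 \<rho> ==> \<Psi> y \<noteq> 0" "y \<in> ball 0 \<rho> ==> \<Theta> (\<Psi> y) = y"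
    "i \<notin> J ==> \<exists>d. (\<lambda>x. \<Theta> x $ i) \<in> forms d \<and> X \<subseteq> zeros (\<lambda>x. \<Theta> x $ i)"
    "i \<in> J ==> \<Theta> x $ i = x $ i - v $ i"
    "fd \<Psi> 0 (fd \<Theta> v u) = u"
    "fd \<Theta> v (fd \<Psi> 0 u) = u"
    "tangent X (proj_point v) = {u. \<forall>i. i \<notin> J --> fd \<Theta> v u $ i = 0}"
    "vec.dim (tangent X (proj_point v)) = card J"
  using assms unfolding germ_def by blast+

text \<open>The equations are forms vanishing on \<open>X\<close> whose gradients at
  \<open>v\<close> are a basis of the span of all such gradients; with complementary coordinates
  they have invertible differential. Smoothness is not assumed, so the germ may be larger than
  \<open>X\<close>.\<close>

lemma germ_exists:
  fixes X :: "'n::finite proj set"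
  assumes v: "v \<noteq> 0" and vX: "proj_point v \<in> X"
  obtains J \<Theta> \<Psi> \<rho> where "germ X v J \<Theta> \<Psi> \<rho>"
proof -
  define G where "G = {r. \<exists>f d. f \<in> forms d \<and> X \<subseteq> zeros f \<and> r = grad f v}"
  obtain J b where 1: "\<forall>i. i \<notin> J --> b i \<in> G" and 2: "\<forall>j\<in>J. b j = axis j 1" and 3: "\<forall>u. (\<forall>i. dotp (b i) u = 0) --> u = 0"
    and 4: "\<forall>r\<in>G. \<exists>c. r = (\<Sum>i\<in>-J. c i *s b i)" and 5: "vec.dim {u. \<forall>r\<in>G. dotp r u = 0} = card J"
    by (rule row_basis[of G])
  have "\<forall>i. \<exists>f. i \<notin> J --> (\<exists>d. f \<in> forms d \<and> X \<subseteq> zeros f \<and> b i = grad f v)" using 1 unfolding G_def by blast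
  from choice[OF this] obtain f where f: "\<forall>i. i \<notin> J --> (\<exists>d. f i \<in> forms d \<and> X \<subseteq> zeros (f i) \<and> b i = grad (f i) v)"
    by (elim exE) (erule that)
  define \<Theta> where "\<Theta> x = (\<chi> i. if i \<in> J then x $ i - v $ i else f i x)" for x
  have \<Theta>J: "(\<lambda>x. \<Theta> x $ i) = (\<lambda>x. x $ i - v $ i)" if "i \<in> J" for i using that by (simp add: \<Theta>_def)
  have \<Theta>n: "(\<lambda>x. \<Theta> x $ i) = f i" if "i \<notin> J" for i using that by (simp add: \<Theta>_def fun_eq_iff)
  have hol: "holo_on \<Theta> UNIV" unfolding holo_on_iff
  proof
    fix i show "shol (\<lambda>x. \<Theta> x $ i) UNIV"
    proof (cases "i \<in> J")
      case True show ?thesis unfolding \<Theta>J[OF True] by (intro shol_diff shol_coord shol_const)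
    next
      case False show ?thesis unfolding \<Theta>n[OF False] using f False by blast
    qed
  qed
  have D\<Theta>: "fd \<Theta> v u $ i = dotp (b i) u" for u i
  proof (cases "i \<in> J")
    case True
    have "((\<lambda>x. x $ i - v $ i) has_derivative (\<lambda>u. u $ i)) (at v)"
      by (rule has_derivative_eq_rhs, rule has_derivative_diff, rule bounded_linear_imp_has_derivative,
          rule bounded_linear_vec_nth, rule has_derivative_const) simp
    then have "fd (\<lambda>x. x $ i - v $ i) v = (\<lambda>u. u $ i)" by (rule frechet_derivative_at[symmetric])
    then show ?thesis unfolding fd_holo_component[OF hol UNIV_I] \<Theta>J[OF True] using 2 True by simp
  next
    case False
    then obtain d where "f i \<in> forms d" "b i = grad (f i) v" using f by blast
    then show ?thesis unfolding fd_holo_component[OF hol UNIV_I] \<Theta>n[OF False] by (simp only: forms_frechet dotp_grad)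
  qed
  have fv: "f i v = 0" if "i \<notin> J" for i
  proof -
    obtain d where d: "f i \<in> forms d" "X \<subseteq> zeros (f i)" using f \<open>i \<notin> J\<close> by blast
    then show ?thesis using in_zeros_iff[OF d(1) v] vX by blast
  qed
  have "fd \<Theta> v u = 0 ==> u = 0" for u using 3 D\<Theta> by (metis zero_index)
  moreover have "holo_on \<Theta> (-{0})" by (rule holo_on_subset[OF hol]) simp
  moreover have "v \<in> -{0}" using v by simp
  ultimately obtain U W \<Psi> where U: "open U" "U \<subseteq> -{0}" "v \<in> U" "open W" "\<Theta> v \<in> W" "homeomorphism U W \<Theta> \<Psi>" "holo_on \<Psi> W"
    "\<And>x. x \<in> U ==> bij (fd \<Theta> x)"
    "\<And>x u. x \<in> U ==> fd \<Psi> (\<Theta> x) (fd \<Theta> x u) = u"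
    using holo_inverse[of \<Theta> "-{0}" v] by (metis (no_types, lifting) open_Compl closed_singleton)
  have \<Theta>v: "\<Theta> v = 0" using fv by (simp add: \<Theta>_def vec_eq_iff)
  obtain \<rho> where \<rho>: "0 < \<rho>" "ball 0 \<rho> \<subseteq> W" using U(4,5) \<Theta>v openE by metis
  have hm: "\<Theta> x \<in> W" "\<Psi> (\<Theta> x) = x" if "x \<in> U" for x using U(6) that by (auto simp: homeomorphism_def)
  have hm': "\<Psi> y \<in> U" "\<Theta> (\<Psi> y) = y" if "y \<in> W" for y using U(6) that by (auto simp: homeomorphism_def)
  have im: "\<Psi> ` ball 0 \<rho> = U \<inter> \<Theta> -` ball 0 \<rho>"
  proof
    show "\<Psi> ` ball 0 \<rho> \<subseteq> U \<inter> \<Theta> -` ball 0 \<rho>" using hm' \<rho>(2) by auto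
    show "U \<inter> \<Theta> -` ball 0 \<rho> \<subseteq> \<Psi> ` ball 0 \<rho>" using hm(2) by (force simp: image_iff)
  qed
  have "open (\<Theta> -` ball 0 \<rho>)" using holo_on_continuous[OF hol] by (intro open_vimage open_ball)
  then have opn: "open (\<Psi> ` ball 0 \<rho>)" unfolding im using U(1) by blast
  have inv1: "fd \<Psi> 0 (fd \<Theta> v u) = u" for u using U(9)[OF U(3), of u] \<Theta>v by simp
  have inv2: "fd \<Theta> v (fd \<Psi> 0 u) = u" for u
  proof -
    obtain w where "u = fd \<Theta> v w" using bij_is_surj[OF U(8)[OF U(3)]] by blast
    then show ?thesis using inv1 by simp
  qed
  have T: "tangent X (proj_point v) = {u. \<forall>r\<in>G. dotp r u = 0}" unfolding tangent_grad[OF v] G_def by blast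
  have T2: "{u. \<forall>r\<in>G. dotp r u = 0} = {u. \<forall>i. i \<notin> J --> fd \<Theta> v u $ i = 0}"
  proof
    show "{u. \<forall>r\<in>G. dotp r u = 0} \<subseteq> {u. \<forall>i. i \<notin> J --> fd \<Theta> v u $ i = 0}" using 1 D\<Theta> by auto
    show "{u. \<forall>i. i \<notin> J --> fd \<Theta> v u $ i = 0} \<subseteq> {u. \<forall>r\<in>G. dotp r u = 0}"
    proof (intro subsetI CollectI ballI, elim CollectE)
      fix u r assume u: "\<forall>i. i \<notin> J --> fd \<Theta> v u $ i = 0" and r: "r \<in> G"
      obtain c where c: "r = (\<Sum>i\<in>-J. c i *s b i)" using 4 r by blast
      show "dotp r u = 0" unfolding c dotp_sum using u D\<Theta> by (intro sum.neutral) simp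
    qed
  qed
  have \<Psi>0: "\<Psi> 0 = v" using hm(2)[OF U(3)] \<Theta>v by simp
  have vf: "\<exists>d. (\<lambda>x. \<Theta> x $ i) \<in> forms d \<and> X \<subseteq> zeros (\<lambda>x. \<Theta> x $ i)" if "i \<notin> J" for i
    unfolding \<Theta>n[OF that] using f that by blast
  have h\<Psi>: "holo_on \<Psi> (ball 0 \<rho>)" by (rule holo_on_subset[OF U(7) \<rho>(2)])
  have nz: "\<Psi> y \<noteq> 0 \<and> \<Theta> (\<Psi> y) = y" if "y \<in> ball 0 \<rho>" for y using hm'[of y] that \<rho>(2) U(2) by auto
  have "germ X v J \<Theta> \<Psi> \<rho>" unfolding germ_def
    using \<rho>(1) hol h\<Psi> \<Theta>v \<Psi>0 opn nz vf inv1 inv2 T T2 5 by (simp add: \<Theta>_def)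
  then show ?thesis by (rule that)
qed

lemma norm_vsmult [simp]: "norm (t *s y) = norm t * norm (y :: complex ^ 'm::finite)"
  by (simp add: norm_vec_def L2_set_right_distrib norm_mult)

lemma germ_vanish:
  fixes X :: "'n::finite proj set"
  assumes X: "irreducible_in zariski X" and v: "v \<in> cone X" and G: "germ X v J \<Theta> \<Psi> \<rho>"
    and g: "g \<in> forms e" and \<epsilon>: "\<epsilon> > 0" "\<And>y. norm y < \<epsilon> ==> y \<in> ball 0 \<rho> ==> \<forall>i. i \<notin> J --> y $ i = 0 ==> g (\<Psi> y) = 0"
  shows "X \<subseteq> zeros g"
proof -
  note G' = germD[OF G]
  have "\<forall>i. \<exists>d. i \<notin> J --> (\<lambda>x. \<Theta> x $ i) \<in> forms d \<and> X \<subseteq> zeros (\<lambda>x. \<Theta> x $ i)" using G'(9) by blast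
  from choice[OF this] obtain d where d: "\<forall>i. i \<notin> J --> (\<lambda>x. \<Theta> x $ i) \<in> forms (d i) \<and> X \<subseteq> zeros (\<lambda>x. \<Theta> x $ i)"
    by (elim exE) (erule that)
  define b where "b i = (if i \<in> J then axis i 1 else grad (\<lambda>x. \<Theta> x $ i) v)" for i
  have Db: "fd \<Theta> v u $ i = dotp (b i) u" for u i
  proof (cases "i \<in> J")
    case True
    have "((\<lambda>x. x $ i - v $ i) has_derivative (\<lambda>u. u $ i)) (at v)"
      by (rule has_derivative_eq_rhs, rule has_derivative_diff, rule bounded_linear_imp_has_derivative,
          rule bounded_linear_vec_nth, rule has_derivative_const) simp
    then have "fd (\<lambda>x. x $ i - v $ i) v = (\<lambda>u. u $ i)" by (rule frechet_derivative_at[symmetric])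
    then show ?thesis unfolding fd_holo_component[OF G'(2) UNIV_I] G'(10)[OF True] by (simp add: b_def True)
  next
    case False
    then have "(\<lambda>x. \<Theta> x $ i) \<in> forms (d i)" using d by blast
    then show ?thesis unfolding fd_holo_component[OF G'(2) UNIV_I] by (simp add: forms_frechet dotp_grad b_def False)
  qed
  have b3: "\<forall>u. (\<forall>i. dotp (b i) u = 0) --> u = 0"
  proof (intro allI impI)
    fix u assume "\<forall>i. dotp (b i) u = 0"
    then have z: "fd \<Theta> v u = 0" by (simp add: vec_eq_iff Db)
    have "linear (fd \<Psi> 0)"
      using has_derivative_linear[OF holo_on_has_derivative(1)[OF G'(3), of 0]] G'(1) by simp
    then show "u = 0" using G'(11)[of u] z linear_0 by metis
  qed
  show ?thesis
  proof (rule vanishing_on_germ[OF X v _ _ _ _ b3 g, where f = "\<lambda>i x. \<Theta> x $ i" and d = d and \<Psi> = \<Psi> and \<epsilon> = "min \<epsilon> \<rho>"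
        and D = "fd \<Psi> 0" and J = J])
    show "(\<Psi> has_derivative fd \<Psi> 0) (at 0)"
      by (rule holo_on_has_derivative(1)[OF G'(3)]) (use G'(1) in simp)
    fix y :: "complex ^ 'n option" and i assume y: "norm y < min \<epsilon> \<rho>" "\<forall>i. i \<notin> J --> y $ i = 0"
    then have yb: "y \<in> ball 0 \<rho>" by simp
    show "g (\<Psi> y) = 0" using \<epsilon>(2)[of y] y yb by simp
    show "\<Theta> (\<Psi> y) $ i = 0" if "i \<notin> J" using G'(8)[OF yb] y that by simp
    show "\<Psi> y $ i = v $ i + y $ i" if "i \<in> J" using G'(8)[OF yb] G'(10)[OF that, of "\<Psi> y"] by simp
  qed (use d b_def G' \<epsilon> in auto)
qed

text \<open>For \<open>A = - J\<close> this is the germ itself; smaller \<open>A\<close> give the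
  sets obtained by dropping equations.\<close>

definition gS :: "(complex ^ 'a::finite => complex ^ 'n::finite option) => real => 'a set => 'n proj set" where
  "gS \<Psi> \<rho> A = (\<lambda>y. proj_point (\<Psi> y)) ` (ball 0 \<rho> \<inter> {y. \<forall>i\<in>A. y $ i = 0})"

lemma gS_irreducible:
  assumes "0 < \<rho>" "holo_on \<Psi> (ball 0 \<rho>)" "\<And>y. y \<in> ball 0 \<rho> ==> \<Psi> y \<noteq> 0"
  shows "irreducible_in zariski (gS \<Psi> \<rho> A)"
  unfolding gS_def
proof (rule irreducible_image[OF open_ball convex_ball _ _ assms(2,3)])
  have "0 \<in> ball 0 \<rho> \<inter> {y. \<forall>i\<in>A. y $ i = 0}" using assms(1) by simp
  then show "ball 0 \<rho> \<inter> {y. \<forall>i\<in>A. y $ i = 0} \<noteq> {}" by blast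
qed auto

text \<open>Dropping the equations one at a time extends any chain below the germ to a chain of
  projective space.\<close>

lemma germ_chain_bound:
  fixes X :: "'n::finite proj set"
  assumes G: "germ X v J \<Theta> \<Psi> \<rho>" and Y: "achain Y k" "Y k \<subseteq> zcl (gS \<Psi> \<rho> (- J))"
  shows "k + card (- J) \<le> CARD('n)"
proof -
  note G' = germD[OF G]
  have irr: "irreducible_in zariski (zcl (gS \<Psi> \<rho> A))" for A
    by (rule irreducible_zcl, rule gS_irreducible[OF G'(1,3,7)])
  have "k + card A \<le> CARD('n)" if "finite A" "A \<subseteq> - J" "achain Y k" "Y k \<subseteq> zcl (gS \<Psi> \<rho> A)" for A Y k
    using that
  proof (induction A arbitrary: Y k rule: finite_induct)
    case empty then show ?case using achain_bound by simp
  next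
    case (insert j A)
    then have j: "j \<notin> J" by blast
    obtain d where d: "(\<lambda>x. \<Theta> x $ j) \<in> forms d" using G'(9)[OF j] by blast
    have sub: "gS \<Psi> \<rho> (insert j A) \<subseteq> gS \<Psi> \<rho> A" unfolding gS_def by auto
    have z: "proj_point (\<Psi> y) \<in> zeros (\<lambda>x. \<Theta> x $ j) \<longleftrightarrow> y $ j = 0" if "y \<in> ball 0 \<rho>" for y
      using in_zeros_iff[OF d G'(7)[OF that]] G'(8)[OF that] by simp
    then have "gS \<Psi> \<rho> (insert j A) \<subseteq> zeros (\<lambda>x. \<Theta> x $ j)" unfolding gS_def by auto
    then have "zcl (gS \<Psi> \<rho> (insert j A)) \<subseteq> zeros (\<lambda>x. \<Theta> x $ j)" using zcl_subset_zeros[OF d] by blast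
    moreover have "\<not> zcl (gS \<Psi> \<rho> A) \<subseteq> zeros (\<lambda>x. \<Theta> x $ j)"
    proof
      assume "zcl (gS \<Psi> \<rho> A) \<subseteq> zeros (\<lambda>x. \<Theta> x $ j)"
      then have sz: "gS \<Psi> \<rho> A \<subseteq> zeros (\<lambda>x. \<Theta> x $ j)" using zcl_subset_zeros[OF d] by blast
      define y where "y = (of_real (\<rho> / 2) *s axis j 1 :: complex ^ 'n option)"
      have "norm y < \<rho>" using G'(1) by (simp add: y_def norm_axis_1)
      moreover have "\<forall>i\<in>A. y $ i = 0" using insert.hyps(2) by (auto simp: y_def axis_def)
      ultimately have yb: "y \<in> ball 0 \<rho>" "proj_point (\<Psi> y) \<in> gS \<Psi> \<rho> A" unfolding gS_def by auto
      then have "y $ j = 0" using z sz by blast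
      then show False using G'(1) by (simp add: y_def axis_def)
    qed
    ultimately have "Y k \<subset> zcl (gS \<Psi> \<rho> A)" using insert.prems(3) zcl_mono[OF sub] by blast
    then have "achain (Y(Suc k := zcl (gS \<Psi> \<rho> A))) (Suc k)"
      using achain_extend[OF insert.prems(2) irr] by blast
    moreover have "(Y(Suc k := zcl (gS \<Psi> \<rho> A))) (Suc k) \<subseteq> zcl (gS \<Psi> \<rho> A)" by simp
    moreover have "A \<subseteq> - J" using insert.prems(1) by blast
    ultimately have "Suc k + card A \<le> CARD('n)" using insert.IH by blast
    then show ?case using insert.hyps by simp
  qed
  then show ?thesis using Y by auto
qed

text \<open>The direction that holds without smoothness: every form vanishing on the germ vanishes
  on \<open>X\<close>.\<close>

lemma zcl_germ:
  fixes X :: "'n::finite proj set"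
  assumes X: "irreducible_in zariski X" and v: "v \<in> cone X" and G: "germ X v J \<Theta> \<Psi> \<rho>"
  shows "X \<subseteq> zcl (gS \<Psi> \<rho> (- J))"
proof
  fix p assume p: "p \<in> X"
  note G' = germD[OF G]
  show "p \<in> zcl (gS \<Psi> \<rho> (- J))" unfolding zcl_def
  proof (intro CollectI allI ballI impI)
    fix d f assume f: "f \<in> forms d" "gS \<Psi> \<rho> (- J) \<subseteq> zeros f"
    have "X \<subseteq> zeros f"
    proof (rule germ_vanish[OF X v G f(1) G'(1)])
      fix y :: "complex ^ 'n option" assume y: "y \<in> ball 0 \<rho>" "\<forall>i. i \<notin> J --> y $ i = 0"
      then have "proj_point (\<Psi> y) \<in> gS \<Psi> \<rho> (- J)" unfolding gS_def by auto
      then show "f (\<Psi> y) = 0" using f(2) in_zeros_iff[OF f(1) G'(7)[OF y(1)]] by blast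
    qed
    then show "p \<in> zeros f" using p by blast
  qed
qed

text \<open>A chain in \<open>X\<close> lies below the closure of the germ and can be prolonged by
  one step for each local equation up to projective space, whose chains have length at most
  N.\<close>

lemma krull_chain_tangent:
  fixes X :: "'n::finite proj set"
  assumes X: "irreducible_in zariski X" and v: "v \<in> cone X" and Y: "achain Y k" "Y k \<subseteq> X"
  shows "k + 1 \<le> vec.dim (tangent X (proj_point v))"
proof -
  have "v \<noteq> 0" "proj_point v \<in> X" using v by (auto simp: cone_def)
  then obtain J \<Theta> \<Psi> \<rho> where G: "germ X v J \<Theta> \<Psi> \<rho>" by (rule germ_exists)
  have "k + card (- J) \<le> CARD('n)" using germ_chain_bound[OF G Y(1)] zcl_germ[OF X v G] Y(2) by blast
  moreover have "card J + card (- J) = Suc CARD('n)"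
    using card_Un_disjoint[of J "- J"] by (simp add: Compl_partition)
  ultimately show ?thesis using germD(14)[OF G] by simp
qed

section \<open>Smooth projective varieties\<close>

lemma tangent_curve:
  fixes X :: "'n::finite proj set"
  assumes \<gamma>: "(\<gamma> has_derivative (\<lambda>t. t *s u)) (at (0::complex))" "\<gamma> 0 \<noteq> 0" "eventually (\<lambda>t. \<gamma> t \<in> cone X) (nhds 0)"
  shows "u \<in> tangent X (proj_point (\<gamma> 0))"
  unfolding tangent_proj_point[OF \<gamma>(2)]
proof (intro CollectI allI ballI impI)
  fix d f assume f: "f \<in> forms d" "X \<subseteq> zeros f"
  have d: "((\<lambda>t. f (\<gamma> t)) has_derivative (\<lambda>t. coeff (lpoly f (\<gamma> 0) (t *s u)) 1)) (at 0)"
    by (rule has_derivative_compose[OF \<gamma>(1) forms_has_derivative[OF f(1)]])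
  have "eventually (\<lambda>t. f (\<gamma> t) = 0) (nhds 0)"
    using \<gamma>(3) by eventually_elim (use f subset_zeros_iff[OF f(1)] in blast)
  then obtain S where S: "open S" "0 \<in> S" "\<And>t. t \<in> S ==> f (\<gamma> t) = 0" unfolding eventually_nhds by blast
  have "((\<lambda>t. 0) has_derivative (\<lambda>t. coeff (lpoly f (\<gamma> 0) (t *s u)) 1)) (at 0)"
    by (rule has_derivative_transform_within_open[OF d S(1,2)]) (rule S(3))
  then have "(\<lambda>t. coeff (lpoly f (\<gamma> 0) (t *s u)) 1) = (\<lambda>t. 0)"
    by (rule has_derivative_unique) (rule has_derivative_const)
  then have "coeff (lpoly f (\<gamma> 0) (1 *s u)) 1 = 0" by (rule fun_cong)
  then show "coeff (lpoly f (\<gamma> 0) u) 1 = 0" by simp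
qed

text \<open>The closure of the germ is irreducible and contains \<open>X\<close>. Were it strictly
  larger, it would prolong a chain of maximal length in \<open>X\<close> by one, and
  \<open>germ_chain_bound\<close> would be violated because the tangent space has dimension m + 1.
  Hence the germ lies in \<open>X\<close>.\<close>

lemma smooth_germ:
  fixes X :: "'n::finite proj set"
  assumes X: "smooth_projective_variety X" and m: "krull_dim zariski X = enat m" and v: "v \<in> cone X"
    and G: "germ X v J \<Theta> \<Psi> \<rho>" and y: "y \<in> ball 0 \<rho>" "\<forall>i. i \<notin> J --> y $ i = 0"
  shows "\<Psi> y \<in> cone X"
proof -
  note G' = germD[OF G]
  have X': "irreducible_in zariski X" "closedin zariski X" using X
    by (auto simp: smooth_projective_variety_def projective_variety_def)
  obtain Y where Y: "achain Y m" "Y m \<subseteq> X" by (rule krull_dim_attained[OF X' m])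
  have "enat (card J) = enat m + 1" using X v G'(14) m
    by (auto simp: smooth_projective_variety_def cone_def)
  then have cJ: "card J = m + 1" by (metis enat.inject one_enat_def plus_enat_simps(1))
  let ?Z = "zcl (gS \<Psi> \<rho> (- J))"
  have XZ: "X \<subseteq> ?Z" by (rule zcl_germ[OF X'(1) v G])
  have "X = ?Z"
  proof (rule ccontr)
    assume "X \<noteq> ?Z"
    then have "Y m \<subset> ?Z" using Y XZ by blast
    then have "achain (Y(Suc m := ?Z)) (Suc m)"
      using achain_extend[OF Y(1) irreducible_zcl[OF gS_irreducible[OF G'(1,3,7)]]] by blast
    moreover have "(Y(Suc m := ?Z)) (Suc m) \<subseteq> ?Z" by simp
    ultimately have "Suc m + card (- J) \<le> CARD('n)" using germ_chain_bound[OF G] by blast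
    moreover have "card J + card (- J) = Suc CARD('n)"
      using card_Un_disjoint[of J "- J"] by (simp add: Compl_partition)
    ultimately show False using cJ by simp
  qed
  moreover have "proj_point (\<Psi> y) \<in> gS \<Psi> \<rho> (- J)" unfolding gS_def using y by auto
  ultimately have "proj_point (\<Psi> y) \<in> X" using zcl_subset by blast
  then show ?thesis using G'(7)[OF y(1)] by (simp add: cone_def)
qed

lemma germ_inverse:
  assumes G: "germ X v J \<Theta> \<Psi> \<rho>" and x: "x \<in> \<Psi> ` ball 0 \<rho>" "x \<in> cone X"
  shows "\<Theta> x \<in> ball 0 \<rho>" "\<forall>i. i \<notin> J --> \<Theta> x $ i = 0" "\<Psi> (\<Theta> x) = x"
proof -
  note G' = germD[OF G]
  obtain y where y: "y \<in> ball 0 \<rho>" "x = \<Psi> y" using x by blast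
  then show "\<Theta> x \<in> ball 0 \<rho>" "\<Psi> (\<Theta> x) = x" using G'(8) by auto
  show "\<forall>i. i \<notin> J --> \<Theta> x $ i = 0"
  proof (intro allI impI)
    fix i assume "i \<notin> J"
    then obtain d where d: "(\<lambda>x. \<Theta> x $ i) \<in> forms d" "X \<subseteq> zeros (\<lambda>x. \<Theta> x $ i)" using G'(9) by blast
    then show "\<Theta> x $ i = 0" using subset_zeros_iff[OF d(1)] x(2) by blast
  qed
qed

text \<open>Converse of \<open>tangent_curve\<close>: in the local coordinates the curve is a
  straight line, which stays in \<open>X\<close> by \<open>smooth_germ\<close>.\<close>

lemma smooth_curve:
  fixes X :: "'n::finite proj set"
  assumes X: "smooth_projective_variety X" and m: "krull_dim zariski X = enat m" and v: "v \<in> cone X"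
    and u: "u \<in> tangent X (proj_point v)"
  obtains \<gamma> where "(\<gamma> has_derivative (\<lambda>t. t *s u)) (at (0::complex))" "\<gamma> 0 = v" "eventually (\<lambda>t. \<gamma> t \<in> cone X) (nhds 0)"
proof -
  have "v \<noteq> 0" "proj_point v \<in> X" using v by (auto simp: cone_def)
  then obtain J \<Theta> \<Psi> \<rho> where G: "germ X v J \<Theta> \<Psi> \<rho>" by (rule germ_exists)
  note G' = germD[OF G]
  define \<eta> where "\<eta> = fd \<Theta> v u"
  have \<eta>: "\<forall>i. i \<notin> J --> \<eta> $ i = 0" using u unfolding G'(13) \<eta>_def by blast
  have d: "((\<lambda>t::complex. t *s \<eta>) has_derivative (\<lambda>t. t *s \<eta>)) (at 0)"
    by (rule bounded_linear_imp_has_derivative[OF bounded_linear_vsmult])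
  have "(\<Psi> has_derivative fd \<Psi> 0) (at (0 *s \<eta>))"
    using holo_on_has_derivative(1)[OF G'(3), of 0] G'(1) by simp
  from has_derivative_compose[OF d this]
  have 1: "((\<lambda>t. \<Psi> (t *s \<eta>)) has_derivative (\<lambda>t. fd \<Psi> 0 (t *s \<eta>))) (at 0)" .
  have "fd \<Psi> 0 (t *s \<eta>) = t *s u" for t
    using holo_on_has_derivative(2)[OF G'(3), of 0 t \<eta>] G'(1) G'(11)[of u] by (simp add: \<eta>_def)
  then have 1: "((\<lambda>t. \<Psi> (t *s \<eta>)) has_derivative (\<lambda>t. t *s u)) (at 0)" using 1 by simp
  have "open ((\<lambda>t::complex. t *s \<eta>) -` ball 0 \<rho>)"
    by (intro open_vimage open_ball continuous_intros)
  moreover have "0 \<in> (\<lambda>t::complex. t *s \<eta>) -` ball 0 \<rho>" using G'(1) by simp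
  moreover have "\<Psi> (t *s \<eta>) \<in> cone X" if "t \<in> (\<lambda>t. t *s \<eta>) -` ball 0 \<rho>" for t
    by (rule smooth_germ[OF X m v G]) (use that \<eta> in auto)
  ultimately have "eventually (\<lambda>t. \<Psi> (t *s \<eta>) \<in> cone X) (nhds 0)" unfolding eventually_nhds by blast
  then show ?thesis using that[OF 1] G'(5) by simp
qed

text \<open>Identity theorem on \<open>X\<close>: an open piece in the classical topology is already
  Zariski dense.\<close>

lemma smooth_identity:
  fixes X :: "'n::finite proj set"
  assumes X: "smooth_projective_variety X" and m: "krull_dim zariski X = enat m" and v: "v \<in> cone X"
    and g: "g \<in> forms e" and O: "open O'" "v \<in> O'" "\<And>w. w \<in> cone X ==> w \<in> O' ==> g w = 0"
  shows "X \<subseteq> zeros g"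
proof -
  have "v \<noteq> 0" "proj_point v \<in> X" using v by (auto simp: cone_def)
  then obtain J \<Theta> \<Psi> \<rho> where G: "germ X v J \<Theta> \<Psi> \<rho>" by (rule germ_exists)
  note G' = germD[OF G]
  have X': "irreducible_in zariski X" using X by (auto simp: smooth_projective_variety_def projective_variety_def)
  have "isCont \<Psi> 0" using has_derivative_continuous[OF holo_on_has_derivative(1)[OF G'(3), of 0]] G'(1) by simp
  then obtain A where A: "open A" "0 \<in> A" "\<forall>y\<in>A. \<Psi> y \<in> O'" using O G'(5) unfolding continuous_at_open by metis
  obtain \<epsilon> where \<epsilon>: "\<epsilon> > 0" "ball 0 \<epsilon> \<subseteq> A" using A openE by metis
  show ?thesis
  proof (rule germ_vanish[OF X' v G g \<epsilon>(1)])
    fix y :: "complex ^ 'n option" assume y: "norm y < \<epsilon>" "y \<in> ball 0 \<rho>" "\<forall>i. i \<notin> J --> y $ i = 0"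
    have "\<Psi> y \<in> cone X" by (rule smooth_germ[OF X m v G y(2,3)])
    moreover have "\<Psi> y \<in> O'" using y \<epsilon> A by auto
    ultimately show "g (\<Psi> y) = 0" by (rule O(3))
  qed
qed

lemma tendsto_dotp:
  assumes "(f \<longlongrightarrow> a) F" "(g \<longlongrightarrow> b) F" shows "((\<lambda>x. dotp (f x) (g x)) \<longlongrightarrow> dotp a b) F"
  unfolding dotp_def by (intro tendsto_intros tendsto_vec_nth assms)

text \<open>A tangent vector at \<open>v\<close> extends to a continuous field of tangent vectors at
  the nearby points of \<open>X\<close>, namely the derivative of \<Psi> in a fixed coordinate
  direction. The relation at the points \<open>w k\<close> then passes to the limit.\<close>

lemma smooth_conormal_closed:
  fixes X :: "'n::finite proj set"
  assumes X: "smooth_projective_variety X" and m: "krull_dim zariski X = enat m" and v: "v \<in> cone X"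
    and w: "w \<longlonglongrightarrow> v" "\<And>k. w k \<in> cone X" and h: "h \<longlonglongrightarrow> h0"
    and t: "\<And>k u. u \<in> tangent X (proj_point (w k)) ==> dotp (h k) u = 0"
    and u: "u \<in> tangent X (proj_point v)"
  shows "dotp h0 u = 0"
proof -
  have "v \<noteq> 0" "proj_point v \<in> X" using v by (auto simp: cone_def)
  then obtain J \<Theta> \<Psi> \<rho> where G: "germ X v J \<Theta> \<Psi> \<rho>" by (rule germ_exists)
  note G' = germD[OF G]
  define \<eta> where "\<eta> = fd \<Theta> v u"
  have \<eta>: "\<forall>i. i \<notin> J --> \<eta> $ i = 0" using u unfolding G'(13) \<eta>_def by blast
  define D where "D y = fd \<Psi> y \<eta>" for y
  have "v \<in> \<Psi> ` ball 0 \<rho>" using G'(1,5) by (metis centre_in_ball imageI)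
  then have ev: "eventually (\<lambda>k. w k \<in> \<Psi> ` ball 0 \<rho>) sequentially" using w(1) G'(6) by (rule topological_tendstoD[rotated 2])
  have "isCont \<Theta> v" using has_derivative_continuous[OF holo_on_has_derivative(1)[OF G'(2), of v]] by simp
  then have y0: "(\<lambda>k. \<Theta> (w k)) \<longlonglongrightarrow> 0" using w(1) G'(4) isCont_tendsto_compose by metis
  have D0: "isCont D 0"
  proof -
    have "continuous_on (ball 0 \<rho>) (\<lambda>y. \<chi> i. fd (\<lambda>x. \<Psi> x $ i) y \<eta>)"
      using G'(3) by (intro continuous_intros shol_fd_continuous) (auto simp: holo_on_iff)
    then have "continuous_on (ball 0 \<rho>) D"
      by (rule continuous_on_eq) (simp add: D_def vec_eq_iff fd_holo_component[OF G'(3)])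
    then show ?thesis using G'(1) by (simp add: continuous_on_eq_continuous_at)
  qed
  then have "(\<lambda>k. D (\<Theta> (w k))) \<longlonglongrightarrow> D 0" using y0 isCont_tendsto_compose by blast
  then have lim: "(\<lambda>k. dotp (h k) (D (\<Theta> (w k)))) \<longlonglongrightarrow> dotp h0 (D 0)" by (intro tendsto_dotp h)
  have "eventually (\<lambda>k. dotp (h k) (D (\<Theta> (w k))) = 0) sequentially"
    using ev
  proof eventually_elim
    fix k assume wk: "w k \<in> \<Psi> ` ball 0 \<rho>"
    note y = germ_inverse[OF G wk w(2)]
    let ?y = "\<Theta> (w k)"
    have d: "((\<lambda>t::complex. ?y + t *s \<eta>) has_derivative (\<lambda>t. t *s \<eta>)) (at 0)" by (rule line_has_derivative)
    have "(\<Psi> has_derivative fd \<Psi> ?y) (at (?y + 0 *s \<eta>))"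
      using holo_on_has_derivative(1)[OF G'(3) y(1)] by simp
    from has_derivative_compose[OF d this]
    have 1: "((\<lambda>t. \<Psi> (?y + t *s \<eta>)) has_derivative (\<lambda>t. fd \<Psi> ?y (t *s \<eta>))) (at 0)" .
    have "fd \<Psi> ?y (t *s \<eta>) = t *s D ?y" for t
      using holo_on_has_derivative(2)[OF G'(3) y(1)] by (simp add: D_def)
    then have 1: "((\<lambda>t. \<Psi> (?y + t *s \<eta>)) has_derivative (\<lambda>t. t *s D ?y)) (at 0)" using 1 by simp
    have "open ((\<lambda>t::complex. ?y + t *s \<eta>) -` ball 0 \<rho>)"
      by (intro open_vimage open_ball continuous_intros)
    moreover have "0 \<in> (\<lambda>t::complex. ?y + t *s \<eta>) -` ball 0 \<rho>" using y(1) by simp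
    moreover have "\<Psi> (?y + t *s \<eta>) \<in> cone X" if "t \<in> (\<lambda>t. ?y + t *s \<eta>) -` ball 0 \<rho>" for t
      by (rule smooth_germ[OF X m v G]) (use that \<eta> y(2) in auto)
    ultimately have ev': "eventually (\<lambda>t. \<Psi> (?y + t *s \<eta>) \<in> cone X) (nhds 0)" unfolding eventually_nhds by blast
    have eq: "\<Psi> (?y + 0 *s \<eta>) = w k" using y(3) by simp
    have "w k \<noteq> 0" using w(2)[of k] by (simp add: cone_def)
    then have "D ?y \<in> tangent X (proj_point (w k))" using tangent_curve[OF 1 _ ev'] eq by simp
    then show "dotp (h k) (D ?y) = 0" by (rule t)
  qed
  then have "(\<lambda>k. dotp (h k) (D (\<Theta> (w k)))) \<longlonglongrightarrow> 0" by (rule tendsto_eventually)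
  then have "dotp h0 (D 0) = 0" using lim LIMSEQ_unique by blast
  moreover have "D 0 = u" using G'(11)[of u] by (simp add: D_def \<eta>_def)
  ultimately show ?thesis by simp
qed

text \<open>A covector killing the tangent space is a combination of the gradients of the local
  equations. These have different degrees, so they are first multiplied by powers of a coordinate
  that is nonzero at \<open>v\<close>.\<close>

lemma conormal_gradient:
  fixes X :: "'n::finite proj set"
  assumes v: "v \<noteq> 0" "proj_point v \<in> X" and h: "\<And>u. u \<in> tangent X (proj_point v) ==> dotp h u = 0"
  obtains e f where "f \<in> forms e" "X \<subseteq> zeros f" "grad f v = h"
proof -
  obtain J \<Theta> \<Psi> \<rho> where G: "germ X v J \<Theta> \<Psi> \<rho>" by (rule germ_exists[OF v])
  note G' = germD[OF G]
  have "\<forall>i. \<exists>d. i \<notin> J --> (\<lambda>x. \<Theta> x $ i) \<in> forms d \<and> X \<subseteq> zeros (\<lambda>x. \<Theta> x $ i)" using G'(9) by blast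
  from choice[OF this] obtain d where d: "\<forall>i. i \<notin> J --> (\<lambda>x. \<Theta> x $ i) \<in> forms (d i) \<and> X \<subseteq> zeros (\<lambda>x. \<Theta> x $ i)"
    by (elim exE) (erule that)
  let ?f = "\<lambda>i x. \<Theta> x $ i"
  define c where "c i = dotp h (fd \<Psi> 0 (axis i 1))" for i
  have c0: "c i = 0" if "i \<in> J" for i unfolding c_def
  proof (rule h)
    show "fd \<Psi> 0 (axis i 1) \<in> tangent X (proj_point v)"
      unfolding G'(13) using G'(12)[of "axis i 1"] that by (auto simp: axis_def)
  qed
  have "dotp h u = dotp (\<Sum>i\<in>-J. c i *s grad (?f i) v) u" for u
  proof -
    let ?y = "fd \<Theta> v u"
    have lin: "linear (fd \<Psi> 0)"
      using has_derivative_linear[OF holo_on_has_derivative(1)[OF G'(3), of 0]] G'(1) by simp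
    have sc: "fd \<Psi> 0 (a *s w) = a *s fd \<Psi> 0 w" for a w
      using holo_on_has_derivative(2)[OF G'(3)] G'(1) by simp
    have "u = fd \<Psi> 0 (\<Sum>i\<in>UNIV. ?y $ i *s axis i 1)" using G'(11)[of u] by (simp add: vec_expand)
    also have "\<dots> = (\<Sum>i\<in>UNIV. ?y $ i *s fd \<Psi> 0 (axis i 1))"
      by (simp only: linear_sum[OF lin] sc)
    finally have "dotp h u = (\<Sum>i\<in>UNIV. ?y $ i * c i)" unfolding c_def by (metis (no_types, lifting) dotp_sum(2) dotp_simps(8) sum.cong)
    also have "\<dots> = (\<Sum>i\<in>-J. ?y $ i * c i)" by (rule sum.mono_neutral_right) (use c0 in auto)
    also have "\<dots> = (\<Sum>i\<in>-J. c i * dotp (grad (?f i) v) u)"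
    proof (rule sum.cong[OF refl])
      fix i assume "i \<in> -J"
      then have "?f i \<in> forms (d i)" using d by blast
      then show "?y $ i * c i = c i * dotp (grad (?f i) v) u"
        unfolding fd_holo_component[OF G'(2) UNIV_I] by (simp add: forms_frechet dotp_grad)
    qed
    finally show ?thesis by (simp add: dotp_sum)
  qed
  then have "dotp (h - (\<Sum>i\<in>-J. c i *s grad (?f i) v)) u = 0" for u by (simp only: dotp_simps) simp
  then have hc: "h = (\<Sum>i\<in>-J. c i *s grad (?f i) v)" using dotp_nondegenerate by fastforce
  obtain k where k: "v $ k \<noteq> 0" using v(1) by (auto simp: vec_eq_iff)
  define E where "E = (\<Sum>i\<in>-J. d i)"
  have dE: "d i \<le> E" if "i \<in> -J" for i unfolding E_def by (rule member_le_sum) (use that in auto)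
  \<comment> \<open>Raises the degree of equation i to the common value \<open>E\<close> and takes
    the value \<open>c i\<close> at \<open>v\<close>. As the equation vanishes at \<open>v\<close>,
    its gradient there is just multiplied by \<open>c i\<close>.\<close>
  define p where "p i x = (c i / (v $ k) ^ (E - d i)) * (x $ k) ^ (E - d i)" for i and x :: "complex ^ 'n option"
  have pf: "p i \<in> forms (E - d i)" for i
  proof -
    have "(\<lambda>x. x $ k ^ (E - d i)) \<in> forms ((E - d i) * 1)" by (rule forms_power[OF forms_component])
    then have "(\<lambda>x. (c i / (v $ k) ^ (E - d i)) * x $ k ^ (E - d i)) \<in> forms (E - d i)" by (intro forms_scale) simp
    then show ?thesis by (simp add: p_def[abs_def])
  qed
  define F where "F x = (\<Sum>i\<in>-J. p i x * ?f i x)" for x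
  have pfF: "(\<lambda>x. p i x * ?f i x) \<in> forms E" if "i \<in> -J" for i
    using forms_mult[OF pf[of i], of "?f i" "d i"] d dE[OF that] that by simp
  have "F \<in> forms E" unfolding F_def[abs_def] by (rule forms_sum) (rule pfF)
  moreover have "X \<subseteq> zeros F"
  proof -
    have "F w = 0" if w: "w \<in> cone X" for w unfolding F_def
    proof (rule sum.neutral, rule ballI)
      fix i assume "i \<in> -J"
      then have "?f i w = 0" using d subset_zeros_iff[of "?f i" "d i" X] w by blast
      then show "p i w * ?f i w = 0" by simp
    qed
    then show ?thesis using subset_zeros_iff[OF \<open>F \<in> forms E\<close>] by blast
  qed
  moreover have "grad F v = h"
  proof -
    have "grad F v = (\<Sum>i\<in>-J. grad (\<lambda>x. p i x * ?f i x) v)" unfolding F_def[abs_def] by (rule grad_sum) (rule pfF)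
    also have "\<dots> = (\<Sum>i\<in>-J. c i *s grad (?f i) v)"
    proof (rule sum.cong[OF refl])
      fix i assume i: "i \<in> -J"
      have "grad (\<lambda>x. p i x * ?f i x) v = p i v *s grad (?f i) v"
        by (rule grad_mult_zero[OF pf]) (use d i G'(4) in auto)
      then show "grad (\<lambda>x. p i x * ?f i x) v = c i *s grad (?f i) v" using k by (simp add: p_def)
    qed
    finally show ?thesis using hc by simp
  qed
  ultimately show ?thesis by (rule that)
qed

section \<open>Second derivatives\<close>

text \<open>Both mixed derivatives are iterated Cauchy integrals of the same function over a torus,
  and the order of integration can be exchanged.\<close>

lemma shol_second_derivative_symmetric:
  assumes f: "shol f V" and V: "open V" "x \<in> V"
  shows "fd (\<lambda>y. fd f y u) x v = fd (\<lambda>y. fd f y v) x u"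
proof -
  obtain r1 where r1: "0 < r1" "\<And>y t. y \<in> ball x r1 ==> t \<in> cball 0 r1 ==> y + t *s u \<in> V"
    by (rule shol_local_disc[OF V, of u]) blast
  obtain r2 where r2: "0 < r2" "\<And>y t. y \<in> ball x r2 ==> t \<in> cball 0 r2 ==> y + t *s v \<in> V"
    by (rule shol_local_disc[OF V, of v]) blast
  obtain r3 where r3: "0 < r3" "\<And>y t. y \<in> ball x r3 ==> t \<in> cball 0 r3 ==> y + t *s v \<in> ball x r1"
    by (rule shol_local_disc[OF open_ball[of x r1], of x v]) (use r1 in auto)
  obtain r4 where r4: "0 < r4" "\<And>y t. y \<in> ball x r4 ==> t \<in> cball 0 r4 ==> y + t *s u \<in> ball x r2"
    by (rule shol_local_disc[OF open_ball[of x r2], of x u]) (use r2 in auto)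
  \<comment> \<open>Small enough that steps along \<open>u\<close> and \<open>v\<close>, taken in
    either order, remain in \<open>V\<close>.\<close>
  define r where "r = min (min r1 r2) (min r3 r4)"
  have r: "0 < r" "r \<le> r1" "r \<le> r2" "r \<le> r3" "r \<le> r4" using r1(1) r2(1) r3(1) r4(1) by (auto simp: r_def)
  let ?c = "circlepath 0 r"
  have c: "?c s \<in> cball 0 r" for s using r(1) by (simp add: circlepath norm_mult)
  have c0: "?c s \<noteq> 0" for s using r(1) by (simp add: circlepath)
  have xb: "x \<in> ball x r3" "x \<in> ball x r4" using r3 r4 by auto
  have xv: "x + t *s v \<in> ball x r1" if "t \<in> cball 0 r" for t using r3(2)[OF xb(1)] that r by auto
  have xu: "x + t *s u \<in> ball x r2" if "t \<in> cball 0 r" for t using r4(2)[OF xb(2)] that r by auto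
  have V1: "x + s *s v + t *s u \<in> V" if "s \<in> cball 0 r" "t \<in> cball 0 r" for s t
    using r1(2)[OF xv[OF that(1)]] that(2) r by auto
  have V2: "x + s *s u + t *s v \<in> V" if "s \<in> cball 0 r" "t \<in> cball 0 r" for s t
    using r2(2)[OF xu[OF that(1)]] that(2) r by auto
  have z: "(0::complex) \<in> cball 0 r" using r(1) by simp
  have Vv: "x + t *s v \<in> V" if "t \<in> cball 0 r" for t using V1[OF that z] by simp
  have Vu: "x + t *s u \<in> V" if "t \<in> cball 0 r" for t using V2[OF that z] by simp
  let ?F = "\<lambda>t s. f (x + ?c t *s v + ?c s *s u) / ?c s / ?c t"
  have "fd (\<lambda>y. fd f y u) x v = integral {0..1} (\<lambda>t. fd f (x + ?c t *s v) u / ?c t)"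
    by (rule shol_cauchy[OF shol_derivative[OF f V(1)] r(1) Vv])
  also have "\<dots> = integral {0..1} (\<lambda>t. integral {0..1} (\<lambda>s. ?F t s))"
  proof (rule integral_cong)
    fix t :: real
    have "fd f (x + ?c t *s v) u = integral {0..1} (\<lambda>s. f (x + ?c t *s v + ?c s *s u) / ?c s)"
      by (rule shol_cauchy[OF f r(1) V1[OF c]])
    then show "fd f (x + ?c t *s v) u / ?c t = integral {0..1} (\<lambda>s. ?F t s)" by (simp only: integral_divide)
  qed
  also have "\<dots> = integral {0..1} (\<lambda>s. integral {0..1} (\<lambda>t. ?F t s))"
  proof -
    have "continuous_on (cbox (0, 0) (1, 1)) (\<lambda>p. f (x + ?c (fst p) *s v + ?c (snd p) *s u) / ?c (snd p) / ?c (fst p))"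
    proof (intro continuous_on_divide)
      show "continuous_on (cbox (0, 0) (1, 1)) (\<lambda>p. f (x + ?c (fst p) *s v + ?c (snd p) *s u))"
        by (rule continuous_on_compose2[OF shol_continuous[OF f]])
          (use V1 c in \<open>auto simp: circlepath intro!: continuous_intros\<close>)
    qed (use c0 in \<open>auto simp: circlepath intro!: continuous_intros\<close>)
    then have "continuous_on (cbox (0, 0) (1, 1)) (\<lambda>(t, s). ?F t s)" by (simp add: split_def)
    from integral_swap_continuous[OF this] show ?thesis by simp
  qed
  also have "\<dots> = integral {0..1} (\<lambda>s. fd f (x + ?c s *s u) v / ?c s)"
  proof (rule integral_cong)
    fix s :: real
    have "fd f (x + ?c s *s u) v = integral {0..1} (\<lambda>t. f (x + ?c s *s u + ?c t *s v) / ?c t)"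
      by (rule shol_cauchy[OF f r(1) V2[OF c]])
    also have "\<dots> = integral {0..1} (\<lambda>t. f (x + ?c t *s v + ?c s *s u) / ?c t)" by (simp add: add_ac)
    finally have "fd f (x + ?c s *s u) v / ?c s = integral {0..1} (\<lambda>t. f (x + ?c t *s v + ?c s *s u) / ?c t / ?c s)"
      by (simp only: integral_divide)
    also have "\<dots> = integral {0..1} (\<lambda>t. ?F t s)" by (rule integral_cong) (simp add: mult.commute)
    finally show "integral {0..1} (\<lambda>t. ?F t s) = fd f (x + ?c s *s u) v / ?c s" by (rule sym)
  qed
  also have "\<dots> = fd (\<lambda>y. fd f y v) x u"
    by (rule shol_cauchy[OF shol_derivative[OF f V(1)] r(1) Vu, symmetric])
  finally show ?thesis .
qed

lemma fd_cong:
  assumes "shol f V" "open V" "x \<in> V" "\<And>y. y \<in> V ==> f y = g y" shows "fd g x = fd f x"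
  using has_derivative_transform_within_open[OF shol_fd[OF assms(1,3)] assms(2,3,4)] frechet_derivative_at by metis

lemma dotp_has_derivative:
  fixes F G :: "complex ^ 'a::finite => complex ^ 'm::finite"
  assumes "(F has_derivative F') (at x)" "(G has_derivative G') (at x)"
  shows "((\<lambda>x. dotp (F x) (G x)) has_derivative (\<lambda>e. dotp (F x) (G' e) + dotp (F' e) (G x))) (at x)"
proof -
  have "((\<lambda>x. \<Sum>i\<in>UNIV. F x $ i * G x $ i) has_derivative (\<lambda>e. \<Sum>i\<in>UNIV. F x $ i * G' e $ i + F' e $ i * G x $ i)) (at x)"
    using assms unfolding has_derivative_vec_iff by (intro has_derivative_sum has_derivative_mult) blast+
  then show ?thesis by (simp add: dotp_def[abs_def] sum.distrib)
qed

lemma fd_dotp: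
  assumes "holo_on s V" "x \<in> V" shows "fd (\<lambda>x. dotp h (s x)) x e = dotp h (fd s x e)"
proof -
  have "((\<lambda>x. dotp h (s x)) has_derivative (\<lambda>e. dotp h (fd s x e) + dotp 0 (s x))) (at x)"
    by (rule dotp_has_derivative[OF has_derivative_const holo_on_has_derivative(1)[OF assms]])
  from fun_cong[OF frechet_derivative_at[OF this], of e] show ?thesis by simp
qed

lemma holo_on_derivative:
  assumes "holo_on s V" "open V" shows "holo_on (\<lambda>y. fd s y e) V"
proof -
  have "shol (\<lambda>y. fd s y e $ i) V" for i
  proof (rule shol_cong[OF _ assms(2)])
    show "shol (\<lambda>y. fd (\<lambda>x. s x $ i) y e) V" using assms by (intro shol_derivative) (auto simp: holo_on_iff)
    fix y assume "y \<in> V" then show "fd (\<lambda>x. s x $ i) y e = fd s y e $ i"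
      by (simp add: fd_holo_component[OF assms(1)])
  qed
  then show ?thesis by (simp add: holo_on_iff)
qed

abbreviation D2 :: "(complex ^ 'a::finite => complex ^ 'b::finite) => complex ^ 'a => complex ^ 'a => complex ^ 'a => complex ^ 'b" where
  "D2 s x e \<kappa> \<equiv> fd (\<lambda>y. fd s y e) x \<kappa>"

lemma D2_symmetric:
  assumes s: "holo_on s V" "open V" "x \<in> V" shows "D2 s x e \<kappa> = D2 s x \<kappa> e"
proof -
  have "D2 s x e \<kappa> $ i = fd (\<lambda>y. fd (\<lambda>x. s x $ i) y e) x \<kappa>" for i e \<kappa>
  proof -
    have "D2 s x e \<kappa> $ i = fd (\<lambda>y. fd s y e $ i) x \<kappa>"
      by (rule fd_holo_component[OF holo_on_derivative[OF s(1,2)] s(3)])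
    also have "fd (\<lambda>y. fd s y e $ i) x = fd (\<lambda>y. fd (\<lambda>x. s x $ i) y e) x"
      by (rule fd_cong[OF _ s(2,3)]) (use s in \<open>auto simp: holo_on_iff fd_holo_component[OF s(1)] intro!: shol_derivative\<close>)
    finally show ?thesis .
  qed
  moreover have "shol (\<lambda>x. s x $ i) V" for i using s by (simp add: holo_on_iff)
  ultimately show ?thesis using shol_second_derivative_symmetric[OF _ s(2,3)] by (simp add: vec_eq_iff)
qed

lemma hessian_eq:
  assumes s: "holo_on s V" "open V" "x \<in> V"
  shows "hessian (\<lambda>x. \<Sum>i\<in>UNIV. h $ i * s x $ i) x e \<kappa> = dotp h (D2 s x e \<kappa>)"
proof -
  have "fd (\<lambda>y. fd (\<lambda>x. dotp h (s x)) y e) x = fd (\<lambda>y. dotp h (fd s y e)) x"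
  proof (rule fd_cong[OF _ s(2,3)])
    show "shol (\<lambda>y. dotp h (fd s y e)) V"
      by (intro shol_dotp holo_on_const holo_on_derivative s)
    fix y assume "y \<in> V"
    then show "dotp h (fd s y e) = fd (\<lambda>x. dotp h (s x)) y e" by (simp add: fd_dotp[OF s(1)])
  qed
  then show ?thesis unfolding hessian_def dotp_def[symmetric]
    using fd_dotp[OF holo_on_derivative[OF s(1,2)] s(3)] by simp
qed

lemma isCont_eventually:
  assumes "isCont g x" "open S" "g x \<in> S" shows "eventually (\<lambda>t. g t \<in> S) (nhds x)"
proof -
  obtain N where "open N" "x \<in> N" "\<forall>t\<in>N. g t \<in> S" using assms unfolding continuous_at_open by blast
  then show ?thesis unfolding eventually_nhds by blast
qed

section \<open>Charts adapted to a smooth variety\<close>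

lemma coord_chartD:
  assumes "coord_chart U z s"
  shows "open U" "open (z ` U)" "holo_on (\<lambda>v. z (proj_point v)) (cone U)" "holo_on s (z ` U)"
    "p \<in> U ==> s (z p) \<noteq> 0" "p \<in> U ==> proj_point (s (z p)) = p"
    "x \<in> z ` U ==> s x \<noteq> 0" "x \<in> z ` U ==> proj_point (s x) \<in> U" "x \<in> z ` U ==> z (proj_point (s x)) = x"
  using assms unfolding coord_chart_def by auto

lemma chart_open:
  assumes c: "coord_chart U z s" and S: "open S"
  shows "open {q \<in> U. z q \<in> S}"
proof -
  have "cone {q \<in> U. z q \<in> S} = {v \<in> cone U. z (proj_point v) \<in> S}" by (auto simp: cone_def)
  moreover have "open {v \<in> cone U. z (proj_point v) \<in> S}"
    using continuous_on_open_vimage[of "cone U" "\<lambda>v. z (proj_point v)"] holo_on_continuous[OF coord_chartD(3)[OF c]]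
      coord_chartD(1)[OF c] S unfolding open_proj_iff by (auto simp: vimage_def Int_def conj_commute)
  ultimately show ?thesis by (simp add: open_proj_iff)
qed

lemma adapted_cone:
  assumes a: "adapted_chart X U z s I" and x: "x \<in> z ` U" "\<forall>i. i \<notin> I --> x $ i = 0"
  shows "s x \<in> cone X"
proof -
  have c: "coord_chart U z s" using a by (simp add: adapted_chart_def)
  have "proj_point (s x) \<in> {q \<in> U. \<forall>i. i \<notin> I --> z q $ i = 0}" using coord_chartD[OF c] x by simp
  then have "proj_point (s x) \<in> X" using a by (auto simp: adapted_chart_def)
  then show ?thesis using coord_chartD(7)[OF c x(1)] by (simp add: cone_def)
qed

text \<open>The tangent space, defined by equations, is spanned by the lift of \<open>q\<close> and
  the derivatives of the lift \<open>s\<close> along the free coordinates. One inclusion uses curves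
  in the chart, the other projects a curve of \<open>X\<close> to the chart.\<close>

lemma adapted_tangent:
  fixes X :: "'n::finite proj set"
  assumes X: "smooth_projective_variety X" and m: "krull_dim zariski X = enat m"
    and a: "adapted_chart X U z s I" and q: "q \<in> X" "q \<in> U"
  shows "(\<forall>u\<in>tangent X q. dotp h u = 0) \<longleftrightarrow>
    dotp h (s (z q)) = 0 \<and> (\<forall>e. (\<forall>i. i \<notin> I --> e $ i = 0) --> dotp h (fd s (z q) e) = 0)"
proof -
  have c: "coord_chart U z s" using a by (simp add: adapted_chart_def)
  note C = coord_chartD[OF c]
  let ?x = "z q" and ?v = "s (z q)"
  have x: "?x \<in> z ` U" using q by blast
  have xE: "\<forall>i. i \<notin> I --> ?x $ i = 0" using a q by (auto simp: adapted_chart_def)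
  have v: "?v \<noteq> 0" "proj_point ?v = q" using C(5,6) q by auto
  have vX: "?v \<in> cone X" using v q by (simp add: cone_def)
  let ?Ds = "fd s ?x"
  have Ds: "(s has_derivative ?Ds) (at ?x)" by (rule holo_on_has_derivative(1)[OF C(4) x])
  have Dsc: "?Ds (t *s e) = t *s ?Ds e" for t e by (rule holo_on_has_derivative(2)[OF C(4) x])
  \<comment> \<open>The radial direction; it is tangent because the cone is invariant under
    scaling.\<close>
  have T1: "?v \<in> tangent X q"
  proof -
    have "((\<lambda>t. ?v + t *s ?v) has_derivative (\<lambda>t. t *s ?v)) (at 0)" by (rule line_has_derivative)
    moreover have "?v + 0 *s ?v \<noteq> 0" using v by simp
    moreover have "eventually (\<lambda>t. ?v + t *s ?v \<in> cone X) (nhds 0)"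
    proof -
      have "?v + t *s ?v \<in> cone X" if "t \<in> ball 0 1" for t
      proof -
        have "1 + t \<noteq> 0" using that by (metis add_eq_0_iff mem_ball_0 norm_minus_cancel norm_one less_irrefl)
        moreover have "?v + t *s ?v = (1 + t) *s ?v" by (simp add: vec_eq_iff algebra_simps)
        ultimately show ?thesis using cone_scale[OF vX] by metis
      qed
      then show ?thesis unfolding eventually_nhds by (intro exI[of _ "ball 0 1"]) auto
    qed
    ultimately have "?v \<in> tangent X (proj_point (?v + 0 *s ?v))" by (rule tangent_curve)
    then show ?thesis using v by simp
  qed
  have T2: "?Ds e \<in> tangent X q" if e: "\<forall>i. i \<notin> I --> e $ i = 0" for e
  proof -
    have l: "((\<lambda>t. ?x + t *s e) has_derivative (\<lambda>t. t *s e)) (at (0::complex))" by (rule line_has_derivative)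
    have "(s has_derivative ?Ds) (at (?x + 0 *s e))" using Ds by simp
    from has_derivative_compose[OF l this]
    have d: "((\<lambda>t. s (?x + t *s e)) has_derivative (\<lambda>t. t *s ?Ds e)) (at 0)" by (simp add: Dsc)
    have "open ((\<lambda>t::complex. ?x + t *s e) -` (z ` U))"
      by (intro open_vimage C(2) continuous_intros)
    moreover have "0 \<in> (\<lambda>t::complex. ?x + t *s e) -` (z ` U)" using x by simp
    moreover have "s (?x + t *s e) \<in> cone X" if "t \<in> (\<lambda>t. ?x + t *s e) -` (z ` U)" for t
      by (rule adapted_cone[OF a]) (use that xE e in auto)
    ultimately have ev: "eventually (\<lambda>t. s (?x + t *s e) \<in> cone X) (nhds 0)" unfolding eventually_nhds by blast
    have "?Ds e \<in> tangent X (proj_point (s (?x + 0 *s e)))" by (rule tangent_curve[OF d _ ev]) (use v in simp)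
    then show ?thesis using v by simp
  qed
  have T3: "\<exists>\<mu> e. (\<forall>i. i \<notin> I --> e $ i = 0) \<and> u = ?Ds e + \<mu> *s ?v" if u: "u \<in> tangent X q" for u
  proof -
    have u': "u \<in> tangent X (proj_point ?v)" using u v by simp
    obtain \<gamma> where \<gamma>: "(\<gamma> has_derivative (\<lambda>t. t *s u)) (at (0::complex))" "\<gamma> 0 = ?v" "eventually (\<lambda>t. \<gamma> t \<in> cone X) (nhds 0)"
      by (rule smooth_curve[OF X m vX u'])
    have vU: "?v \<in> cone U" using v q by (simp add: cone_def)
    let ?Z = "\<lambda>v. z (proj_point v)"
    let ?A = "fd ?Z ?v"
    define e where "e = ?A u"
    have "(?Z has_derivative ?A) (at (\<gamma> 0))" using holo_on_has_derivative(1)[OF C(3) vU] \<gamma>(2) by simp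
    from has_derivative_compose[OF \<gamma>(1) this]
    have x': "((\<lambda>t. ?Z (\<gamma> t)) has_derivative (\<lambda>t. t *s e)) (at 0)"
      using holo_on_has_derivative(2)[OF C(3) vU] by (simp add: e_def)
    have "(s has_derivative ?Ds) (at (?Z (\<gamma> 0)))" using Ds \<gamma>(2) v by simp
    from has_derivative_compose[OF x' this]
    have s': "((\<lambda>t. s (?Z (\<gamma> t))) has_derivative (\<lambda>t. t *s ?Ds e)) (at 0)" by (simp add: Dsc)
    have "isCont \<gamma> 0" using \<gamma>(1) has_derivative_continuous by blast
    moreover have "open (cone U)" using C(1) by (simp add: open_proj_iff)
    ultimately have "eventually (\<lambda>t. \<gamma> t \<in> cone U) (nhds 0)" using \<gamma>(2) vU by (intro isCont_eventually) simp_all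
    then have "eventually (\<lambda>t. \<gamma> t \<in> cone U \<and> \<gamma> t \<in> cone X) (nhds 0)" using \<gamma>(3) by (rule eventually_conj)
    then obtain N where N: "open N" "0 \<in> N" "\<And>t. t \<in> N ==> \<gamma> t \<in> cone U \<and> \<gamma> t \<in> cone X" unfolding eventually_nhds by blast
    have "e $ i = 0" if i: "i \<notin> I" for i
    proof -
      have d: "((\<lambda>t. ?Z (\<gamma> t) $ i) has_derivative (\<lambda>t. (t *s e) $ i)) (at 0)" using x' unfolding has_derivative_vec_iff by blast
      have "?Z (\<gamma> t) $ i = 0" if "t \<in> N" for t
      proof -
        have "proj_point (\<gamma> t) \<in> X \<inter> U" using N(3)[OF that] by (simp add: cone_def)
        then show ?thesis using a i by (auto simp: adapted_chart_def)
      qed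
      then have "((\<lambda>t. 0) has_derivative (\<lambda>t. (t *s e) $ i)) (at 0)"
        by (rule has_derivative_transform_within_open[OF d N(1,2)])
      then have "(\<lambda>t. (t *s e) $ i) = (\<lambda>t. 0)" by (rule has_derivative_unique) (rule has_derivative_const)
      then have "(1 *s e) $ i = 0" by (rule fun_cong)
      then show ?thesis by simp
    qed
    \<comment> \<open>The curve and the lift of its image in the chart are proportional, so their 2
      by 2 minors vanish identically; this is the derivative of that relation at 0. It makes
      \<open>u - ?Ds e\<close> a multiple of \<open>?v\<close>.\<close>
    moreover have pr: "u $ k * ?v $ l + ?v $ k * ?Ds e $ l = u $ l * ?v $ k + ?v $ l * ?Ds e $ k" for k l
    proof -
      have g: "((\<lambda>t. \<gamma> t $ k) has_derivative (\<lambda>t. t * u $ k)) (at 0)" for k using \<gamma>(1) unfolding has_derivative_vec_iff by simp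
      have s: "((\<lambda>t. s (?Z (\<gamma> t)) $ k) has_derivative (\<lambda>t. t * ?Ds e $ k)) (at 0)" for k using s' unfolding has_derivative_vec_iff by simp
      have eq: "\<gamma> t $ k * s (?Z (\<gamma> t)) $ l = \<gamma> t $ l * s (?Z (\<gamma> t)) $ k" if "t \<in> N" for t
      proof -
        have gt: "\<gamma> t \<noteq> 0" "proj_point (\<gamma> t) \<in> U" using N(3)[OF that] by (auto simp: cone_def)
        then obtain b where "\<gamma> t = b *s s (?Z (\<gamma> t))" using C(5,6)[OF gt(2)] proj_point_eq_iff[of "s (?Z (\<gamma> t))" "\<gamma> t"] by metis
        then have "\<gamma> t $ i = b * s (?Z (\<gamma> t)) $ i" for i by (metis vector_smult_component)
        then show ?thesis by simp
      qed
      have d1: "((\<lambda>t. \<gamma> t $ k * s (?Z (\<gamma> t)) $ l) has_derivative (\<lambda>t. \<gamma> 0 $ k * (t * ?Ds e $ l) + t * u $ k * s (?Z (\<gamma> 0)) $ l)) (at 0)"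
        by (rule has_derivative_mult[OF g s])
      have d2: "((\<lambda>t. \<gamma> t $ l * s (?Z (\<gamma> t)) $ k) has_derivative (\<lambda>t. \<gamma> 0 $ l * (t * ?Ds e $ k) + t * u $ l * s (?Z (\<gamma> 0)) $ k)) (at 0)"
        by (rule has_derivative_mult[OF g s])
      have "((\<lambda>t. \<gamma> t $ l * s (?Z (\<gamma> t)) $ k) has_derivative (\<lambda>t. \<gamma> 0 $ k * (t * ?Ds e $ l) + t * u $ k * s (?Z (\<gamma> 0)) $ l)) (at 0)"
        by (rule has_derivative_transform_within_open[OF d1 N(1,2)]) (rule eq)
      then have "(\<lambda>t. \<gamma> 0 $ k * (t * ?Ds e $ l) + t * u $ k * s (?Z (\<gamma> 0)) $ l) = (\<lambda>t. \<gamma> 0 $ l * (t * ?Ds e $ k) + t * u $ l * s (?Z (\<gamma> 0)) $ k)"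
        using d2 by (rule has_derivative_unique)
      from fun_cong[OF this, of 1] show ?thesis using \<gamma>(2) v by (simp add: algebra_simps)
    qed
    obtain k where k: "?v $ k \<noteq> 0" using v(1) by (auto simp: vec_eq_iff)
    define \<mu> where "\<mu> = (u $ k - ?Ds e $ k) / ?v $ k"
    have "u = ?Ds e + \<mu> *s ?v"
    proof (rule vec_eq_iff[THEN iffD2], rule allI)
      fix l
      have "(u $ l - ?Ds e $ l) * ?v $ k = (u $ k - ?Ds e $ k) * ?v $ l" using pr[of k l] by (simp add: algebra_simps)
      then show "u $ l = (?Ds e + \<mu> *s ?v) $ l" using k by (simp add: \<mu>_def field_simps)
    qed
    ultimately show ?thesis by blast
  qed
  show ?thesis
  proof (intro iffI conjI allI impI ballI)
    assume *: "\<forall>u\<in>tangent X q. dotp h u = 0"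
    show "dotp h ?v = 0" using * T1 by blast
    show "dotp h (?Ds e) = 0" if "\<forall>i. i \<notin> I --> e $ i = 0" for e using * T2[OF that] by blast
  next
    fix u assume *: "dotp h ?v = 0 \<and> (\<forall>e. (\<forall>i. i \<notin> I --> e $ i = 0) --> dotp h (?Ds e) = 0)" and "u \<in> tangent X q"
    then obtain \<mu> e where "\<forall>i. i \<notin> I --> e $ i = 0" "u = ?Ds e + \<mu> *s ?v" using T3 by blast
    then show "dotp h u = 0" using * by simp
  qed
qed

lemma subspace_tangent: "p = proj_point v ==> v \<noteq> 0 ==> vec.subspace (tangent X p)"
  unfolding vec.subspace_def by (auto simp: tangent_grad)

lemma tangent_base:
  assumes "v \<in> cone X" shows "v \<in> tangent X (proj_point v)"
proof -
  have v: "v \<noteq> 0" "proj_point v \<in> X" using assms by (auto simp: cone_def)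
  show ?thesis unfolding tangent_proj_point[OF v(1)]
  proof (intro CollectI allI ballI impI)
    fix d f assume f: "f \<in> forms d" "X \<subseteq> zeros f"
    have "lpoly f v v = 0"
    proof (rule lpoly_unique)
      fix t
      have "f v = 0" using f v in_zeros_iff[OF f(1) v(1)] by blast
      moreover have "v + t *s v = (1 + t) *s v" by (simp add: vec_eq_iff algebra_simps)
      moreover have "f ((1 + t) *s v) = (1 + t) ^ d * f v" by (rule forms_homogeneous[OF f(1)])
      ultimately show "poly 0 t = f (v + t *s v)" by (simp only: poly_0 mult_zero_right)
    qed
    then show "coeff (lpoly f v v) 1 = 0" by simp
  qed
qed

text \<open>The tangent space has dimension m + 1, so its intersection with the hyperplane has
  dimension above m only if it is contained in it.\<close>

lemma sing_section_iff:
  fixes X :: "'n::finite proj set"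
  assumes X: "smooth_projective_variety X" and m: "krull_dim zariski X = enat m" and h: "h \<noteq> 0" and q: "q \<in> X"
  shows "q \<in> sing_section X (proj_point h) \<longleftrightarrow> (\<forall>u\<in>tangent X q. dotp h u = 0)"
proof -
  obtain v where v: "v \<noteq> 0" "q = proj_point v" by (rule proj_cases)
  have vX: "v \<in> cone X" using v q by (simp add: cone_def)
  have hy: "hyp (proj_point h) = {w. dotp h w = 0}" by (rule hyp_proj_point[OF h])
  have "enat (vec.dim (tangent X q)) = enat m + 1" using X q m by (auto simp: smooth_projective_variety_def)
  then have d: "vec.dim (tangent X q) = m + 1" by (metis enat.inject one_enat_def plus_enat_simps(1))
  have s1: "vec.subspace (tangent X q)" by (rule subspace_tangent[OF v(2,1)])
  have s2: "vec.subspace (tangent X q \<inter> hyp (proj_point h))" using s1 unfolding hy vec.subspace_def by auto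
  show ?thesis
  proof
    assume "q \<in> sing_section X (proj_point h)"
    then have "m < vec.dim (tangent X q \<inter> hyp (proj_point h))" using m by (simp add: sing_section_def)
    then have "tangent X q \<inter> hyp (proj_point h) = tangent X q"
      using vec.subspace_dim_equal[OF s2 s1] d by simp
    then show "\<forall>u\<in>tangent X q. dotp h u = 0" unfolding hy by blast
  next
    assume *: "\<forall>u\<in>tangent X q. dotp h u = 0"
    then have "tangent X q \<inter> hyp (proj_point h) = tangent X q" unfolding hy by blast
    moreover have "line q \<subseteq> hyp (proj_point h)"
      using * tangent_base[OF vX] v unfolding hy by (auto simp: line_proj_point)
    ultimately show "q \<in> sing_section X (proj_point h)" using d m q by (simp add: sing_section_def)
  qed
qed

lemma dual_variety_iff:
  fixes X :: "'n::finite proj set"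
  assumes X: "smooth_projective_variety X" and m: "krull_dim zariski X = enat m" and h: "h \<noteq> 0"
  shows "proj_point h \<in> dual_variety X \<longleftrightarrow> sing_section X (proj_point h) \<noteq> {}"
proof -
  have "tangent X q \<subseteq> hyp (proj_point h) \<longleftrightarrow> q \<in> sing_section X (proj_point h)" if "q \<in> X" for q
    unfolding sing_section_iff[OF X m h that] hyp_proj_point[OF h] by blast
  moreover have "sing_section X (proj_point h) \<subseteq> X" by (auto simp: sing_section_def)
  ultimately show ?thesis unfolding dual_variety_def by blast
qed

section \<open>Deformation of a node\<close>

text \<open>A pair of a coefficient vector and a point is packed into one vector indexed by a sum
  type, so that the inverse function theorem for a single vector type applies.\<close>

definition hpart :: "complex ^ ('a::finite + 'b::finite) => complex ^ 'a" where "hpart w = (\<chi> i. w $ Inl i)"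
definition xpart :: "complex ^ ('a::finite + 'b::finite) => complex ^ 'b" where "xpart w = (\<chi> j. w $ Inr j)"
definition hx :: "complex ^ 'a::finite => complex ^ 'b::finite => complex ^ ('a + 'b)" where
  "hx h x = (\<chi> k. case k of Inl i => h $ i | Inr j => x $ j)"

lemma hx_simps [simp]: "hpart (hx h x) = h" "xpart (hx h x) = x" "hx (hpart w) (xpart w) = w"
  "hx h x $ Inl i = h $ i" "hx h x $ Inr j = x $ j" "hpart w $ i = w $ Inl i" "xpart w $ j = w $ Inr j"
  by (auto simp: hpart_def xpart_def hx_def vec_eq_iff split: sum.split)

lemma hx_eqI: "hpart w = h ==> xpart w = x ==> w = hx h x" by auto

lemma holo_on_hpart: "holo_on hpart V" "holo_on xpart V"
  by (auto simp: holo_on_iff)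

lemma holo_on_hx_left: "holo_on (\<lambda>h. hx h x) V"
  unfolding holo_on_iff
proof
  fix k show "shol (\<lambda>h. hx h x $ k) V" by (cases k) auto
qed

lemma has_derivative_hpart: "(hpart has_derivative hpart) (at w)" "(xpart has_derivative xpart) (at w)"
  unfolding has_derivative_vec_iff
  by (auto intro!: bounded_linear_imp_has_derivative bounded_linear_vec_nth)

lemma open_hx_rectangle:
  assumes "open S" "hx h x \<in> S"
  obtains A B where "open A" "open B" "h \<in> A" "x \<in> B" "\<And>h' x'. h' \<in> A ==> x' \<in> B ==> hx h' x' \<in> S"
proof -
  have "continuous_on UNIV (\<lambda>p. hx (fst p) (snd p) $ k)" for k
    by (cases k) (auto intro!: continuous_intros)
  then have "continuous_on UNIV (\<lambda>p. \<chi> k. hx (fst p) (snd p) $ k)" by (rule continuous_on_vec_lambda)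
  then have "open ((\<lambda>p. \<chi> k. hx (fst p) (snd p) $ k) -` S)" by (rule open_vimage[OF assms(1)])
  then have "open ((\<lambda>p. hx (fst p) (snd p)) -` S)" by (simp only: vec_nth_inverse)
  moreover have "(h, x) \<in> (\<lambda>p. hx (fst p) (snd p)) -` S" using assms(2) by simp
  ultimately obtain A B where "open A" "open B" "(h, x) \<in> A \<times> B" "A \<times> B \<subseteq> (\<lambda>p. hx (fst p) (snd p)) -` S"
    by (rule open_prod_elim)
  then have AB: "open A" "open B" "h \<in> A" "x \<in> B" "A \<times> B \<subseteq> (\<lambda>p. hx (fst p) (snd p)) -` S" by simp_all
  have "hx h' x' \<in> S" if "h' \<in> A" "x' \<in> B" for h' x'
  proof -
    have "(h', x') \<in> (\<lambda>p. hx (fst p) (snd p)) -` S" using AB(5) that by blast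
    then show ?thesis by simp
  qed
  with AB(1-4) show ?thesis by (rule that[of A B])
qed

lemma holo_frechet_expand:
  assumes F: "holo_on F V" "x \<in> V"
  shows "fd F x v = (\<Sum>i\<in>UNIV. v $ i *s fd F x (axis i 1))"
proof -
  have lin: "linear (fd F x)"
    using has_derivative_linear[OF holo_on_has_derivative(1)[OF F]] .
  have "fd F x v = fd F x (\<Sum>i\<in>UNIV. v $ i *s axis i 1)" by (simp add: vec_expand)
  then show ?thesis by (simp only: linear_sum[OF lin] holo_on_has_derivative(2)[OF F])
qed

text \<open>Keeps \<open>h\<close>, replaces the free coordinates of \<open>x\<close> by the partial
  derivatives of the local equation, and keeps the other coordinates, which are 0 on
  \<open>X\<close>. The preimages of \<open>hx h 0\<close> are thus the critical points of the
  equation of the hyperplane section, and source and target have the same dimension.\<close>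

definition crit :: "(complex ^ 'b::finite => complex ^ 'a::finite) => 'b set => complex ^ ('a + 'b) => complex ^ ('a + 'b)" where
  "crit s I w = hx (hpart w) (\<chi> j. if j \<in> I then dotp (hpart w) (fd s (xpart w) (axis j 1)) else w $ Inr j)"

lemma crit_holo:
  assumes s: "holo_on s V" "open V" shows "holo_on (crit s I) {w. xpart w \<in> V}"
  unfolding holo_on_iff
proof
  fix k
  show "shol (\<lambda>w. crit s I w $ k) {w. xpart w \<in> V}"
  proof (cases k)
    case (Inl i) then show ?thesis by (auto simp: crit_def)
  next
    case (Inr j)
    have "shol (\<lambda>w. dotp (hpart w) (fd s (xpart w) (axis j 1))) {w. xpart w \<in> V}"
      by (intro shol_dotp holo_on_hpart holo_on_compose[OF holo_on_derivative[OF s] holo_on_hpart(2)]) auto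
    then show ?thesis using Inr by (cases "j \<in> I") (auto simp: crit_def)
  qed
qed

lemma crit_derivative:
  assumes s: "holo_on s V" "open V" and w: "xpart w \<in> V"
  shows "fd (crit s I) w k = hx (hpart k) (\<chi> j. if j \<in> I then
      dotp (hpart w) (D2 s (xpart w) (axis j 1) (xpart k)) + dotp (hpart k) (fd s (xpart w) (axis j 1))
      else k $ Inr j)" (is "_ = ?D k")
proof -
  have "((\<lambda>w. crit s I w $ l) has_derivative (\<lambda>k. ?D k $ l)) (at w)" for l
  proof (cases l)
    case (Inl i)
    then show ?thesis by (auto simp: crit_def intro!: bounded_linear_imp_has_derivative bounded_linear_vec_nth)
  next
    case (Inr j)
    show ?thesis
    proof (cases "j \<in> I")
      case True
      have "((\<lambda>w. fd s (xpart w) (axis j 1)) has_derivative (\<lambda>k. D2 s (xpart w) (axis j 1) (xpart k))) (at w)"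
        by (rule has_derivative_compose[OF has_derivative_hpart(2) holo_on_has_derivative(1)[OF holo_on_derivative[OF s] w]])
      from dotp_has_derivative[OF has_derivative_hpart(1) this]
      show ?thesis using Inr True by (simp add: crit_def)
    next
      case False
      then show ?thesis using Inr by (auto simp: crit_def intro!: bounded_linear_imp_has_derivative bounded_linear_vec_nth)
    qed
  qed
  then have "(crit s I has_derivative ?D) (at w)" unfolding has_derivative_vec_iff by blast
  from fun_cong[OF frechet_derivative_at[OF this], of k] show ?thesis by simp
qed

text \<open>Near a node the critical point of the local equation of the hyperplane section depends
  holomorphically on the hyperplane; \<open>\<sigma> h\<close> lifts it, and \<open>dotp h (\<sigma> h)\<close> is the critical value.\<close>

lemma node_local:
  fixes X :: "'n::finite proj set"
  assumes X: "smooth_projective_variety X" and m: "krull_dim zariski X = enat m"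
    and h0: "h0 \<noteq> 0" and node: "node X (proj_point h0) p" and O0: "open O0" "p \<in> O0"
  obtains O' \<Omega> \<sigma> where "open O'" "p \<in> O'" "O' \<subseteq> O0" "open \<Omega>" "h0 \<in> \<Omega>" "0 \<notin> \<Omega>" "holo_on \<sigma> \<Omega>" "proj_point (\<sigma> h0) = p"
    "\<forall>h\<in>\<Omega>. \<sigma> h \<in> cone X \<and> proj_point (\<sigma> h) \<in> O' \<and> (\<forall>k. dotp h (fd \<sigma> h k) = 0) \<and>
       (\<forall>q\<in>X. q \<in> O' --> ((\<forall>u\<in>tangent X q. dotp h u = 0) \<longleftrightarrow> q = proj_point (\<sigma> h) \<and> dotp h (\<sigma> h) = 0)) \<and>
       (dotp h (\<sigma> h) = 0 --> node X (proj_point h) (proj_point (\<sigma> h)))"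
proof -
  define E :: "'n set => (complex ^ 'n) set" where "E I = {u. \<forall>i. i \<notin> I --> u $ i = 0}" for I
  have psing: "p \<in> sing_section X (proj_point h0)" using node by (simp add: node_def)
  then have pX: "p \<in> X" by (simp add: sing_section_def)
  have "\<exists>U z s I. adapted_chart X U z s I \<and> p \<in> U \<and>
       (\<forall>h\<in>line (proj_point h0) - {0}. \<forall>u\<in>E I - {0}. \<exists>v\<in>E I. hessian (\<lambda>x. \<Sum>i\<in>UNIV. h $ i * s x $ i) (z p) u v \<noteq> 0)"
    using node unfolding node_def Let_def E_def by blast
  then obtain U z s I where ac: "adapted_chart X U z s I" and pU: "p \<in> U"
    and nd0: "\<forall>h\<in>line (proj_point h0) - {0}. \<forall>u\<in>E I - {0}. \<exists>v\<in>E I. hessian (\<lambda>x. \<Sum>i\<in>UNIV. h $ i * s x $ i) (z p) u v \<noteq> 0"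
    by blast
  have cc: "coord_chart U z s" using ac by (simp add: adapted_chart_def)
  note C = coord_chartD[OF cc]
  define V where "V = z ` U"
  have V: "open V" "holo_on s V" using C by (auto simp: V_def)
  define x0 where "x0 = z p"
  have x0V: "x0 \<in> V" using pU by (simp add: x0_def V_def)
  have UE: "z q \<in> E I" if "q \<in> X" "q \<in> U" for q using ac that by (auto simp: adapted_chart_def E_def)
  have x0E: "x0 \<in> E I" using UE pX pU by (simp add: x0_def)
  let ?Ds = "\<lambda>x. fd s x"
  let ?G = "crit s I"
  have tan: "(\<forall>u\<in>tangent X q. dotp h u = 0) \<longleftrightarrow> dotp h (s (z q)) = 0 \<and> (\<forall>e\<in>E I. dotp h (?Ds (z q) e) = 0)"
    if "q \<in> X" "q \<in> U" for q h unfolding adapted_tangent[OF X m ac that] E_def by blast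
  have Eexp: "v = (\<Sum>j\<in>I. v $ j *s axis j 1)" if "v \<in> E I" for v
  proof -
    have "(\<Sum>j\<in>I. v $ j *s axis j 1) = (\<Sum>j\<in>UNIV. v $ j *s axis j 1)"
      by (rule sum.mono_neutral_left) (use that in \<open>auto simp: E_def\<close>)
    then show ?thesis by (simp add: vec_expand)
  qed
  have dsum: "dotp h (fd F x v) = (\<Sum>j\<in>I. v $ j * dotp h (fd F x (axis j 1)))"
    if F: "holo_on F V" "x \<in> V" "v \<in> E I" for F :: "complex ^ 'n => complex ^ 'n option" and h x v
  proof -
    have "dotp h (fd F x v) = (\<Sum>j\<in>UNIV. v $ j * dotp h (fd F x (axis j 1)))"
      by (subst holo_frechet_expand[OF F(1,2)]) (simp add: dotp_sum)
    also have "\<dots> = (\<Sum>j\<in>I. v $ j * dotp h (fd F x (axis j 1)))"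
      by (rule sum.mono_neutral_right) (use F(3) in \<open>auto simp: E_def\<close>)
    finally show ?thesis .
  qed
  have axE: "axis j 1 \<in> E I" if "j \<in> I" for j using that by (auto simp: E_def axis_def)
  have critE: "(\<forall>e\<in>E I. dotp h (?Ds x e) = 0) \<longleftrightarrow> (\<forall>j\<in>I. dotp h (?Ds x (axis j 1)) = 0)" if "x \<in> V" for h x
  proof
    assume *: "\<forall>j\<in>I. dotp h (?Ds x (axis j 1)) = 0"
    show "\<forall>e\<in>E I. dotp h (?Ds x e) = 0"
    proof
      fix e assume "e \<in> E I"
      from dsum[OF V(2) that this] show "dotp h (?Ds x e) = 0" using * by simp
    qed
  qed (use axE in blast)
  have p0: "dotp h0 (s x0) = 0" "\<forall>j\<in>I. dotp h0 (?Ds x0 (axis j 1)) = 0"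
  proof -
    have "\<forall>u\<in>tangent X p. dotp h0 u = 0" using psing sing_section_iff[OF X m h0 pX] by blast
    then have "dotp h0 (s x0) = 0 \<and> (\<forall>e\<in>E I. dotp h0 (?Ds x0 e) = 0)" unfolding tan[OF pX pU] x0_def .
    then show "dotp h0 (s x0) = 0" "\<forall>j\<in>I. dotp h0 (?Ds x0 (axis j 1)) = 0" using critE[OF x0V] by blast+
  qed
  have nd: "\<exists>v\<in>E I. dotp h0 (D2 s x0 u v) \<noteq> 0" if "u \<in> E I" "u \<noteq> 0" for u
  proof -
    have "h0 \<in> line (proj_point h0) - {0}" unfolding in_line_iff using h0 by blast
    then show ?thesis using nd0 that unfolding hessian_eq[OF V(2,1) x0V, unfolded x0_def] x0_def by blast
  qed
  define w0 where "w0 = hx h0 x0"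
  have opV: "open {w :: complex ^ ('n option + 'n). xpart w \<in> V}"
    using open_vimage[OF V(1) holo_on_continuous[OF holo_on_hpart(2)[of UNIV]]] by (simp add: vimage_def)
  \<comment> \<open>A kernel vector has zero \<open>h\<close>-part and an \<open>x\<close>-part in
    the free directions on which the Hessian at the node degenerates; so it is zero.\<close>
  have inj: "k = 0" if k: "fd ?G w0 k = 0" for k
  proof -
    have w: "xpart w0 \<in> V" using x0V by (simp add: w0_def)
    have D: "hx (hpart k) (\<chi> j. if j \<in> I then dotp h0 (D2 s x0 (axis j 1) (xpart k)) + dotp (hpart k) (?Ds x0 (axis j 1)) else k $ Inr j) = 0"
    proof -
      have p: "hpart w0 = h0" "xpart w0 = x0" by (simp_all add: w0_def)
      show ?thesis using k unfolding crit_derivative[OF V(2,1) w] p .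
    qed
    have hk: "hpart k = 0"
    proof (rule vec_eq_iff[THEN iffD2], rule allI)
      fix i from arg_cong[OF D, of "\<lambda>w. w $ Inl i"] show "hpart k $ i = 0 $ i" by simp
    qed
    have kI: "(if j \<in> I then dotp h0 (D2 s x0 (axis j 1) (xpart k)) + dotp (hpart k) (?Ds x0 (axis j 1)) else k $ Inr j) = 0" for j
      using arg_cong[OF D, of "\<lambda>w. w $ Inr j"] by simp
    have kE: "xpart k \<in> E I" unfolding E_def
    proof (intro CollectI allI impI)
      fix i assume "i \<notin> I" then show "xpart k $ i = 0" using kI[of i] by simp
    qed
    have kz: "dotp h0 (D2 s x0 (axis j 1) (xpart k)) = 0" if "j \<in> I" for j using kI[of j] that hk by simp
    have "xpart k = 0"
    proof (rule ccontr)
      assume "xpart k \<noteq> 0"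
      then obtain v where v: "v \<in> E I" "dotp h0 (D2 s x0 (xpart k) v) \<noteq> 0" using nd[OF kE] by blast
      have "dotp h0 (D2 s x0 (xpart k) v) = (\<Sum>j\<in>I. v $ j * dotp h0 (D2 s x0 (xpart k) (axis j 1)))"
        by (rule dsum[OF holo_on_derivative[OF V(2,1)] x0V v(1)])
      also have "\<dots> = 0" by (rule sum.neutral) (simp add: D2_symmetric[OF V(2,1) x0V, of "xpart k"] kz)
      finally show False using v(2) by simp
    qed
    then have "k = hx 0 0" using hk by (intro hx_eqI)
    then show ?thesis by (simp add: hx_def vec_eq_iff split: sum.split)
  qed
  have w0V: "w0 \<in> {w. xpart w \<in> V}" using x0V by (simp add: w0_def)
  obtain Ug Wg \<Gamma> where Ug: "open Ug" "Ug \<subseteq> {w. xpart w \<in> V}" "w0 \<in> Ug" "open Wg" "?G w0 \<in> Wg" "homeomorphism Ug Wg ?G \<Gamma>" "holo_on \<Gamma> Wg"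
    and bij: "\<And>w. w \<in> Ug ==> bij (fd ?G w)"
    and "\<And>w u. w \<in> Ug ==> fd \<Gamma> (?G w) (fd ?G w u) = u"
    apply (rule holo_inverse[OF crit_holo[OF V(2,1)] opV w0V inj, of I])
     apply assumption
    apply (rule that)
            prefer 6 apply assumption
           apply assumption+
    done
  have G\<Gamma>: "\<Gamma> w \<in> Ug" "?G (\<Gamma> w) = w" if "w \<in> Wg" for w using Ug(6) that by (auto simp: homeomorphism_def)
  have \<Gamma>G: "?G w \<in> Wg" "\<Gamma> (?G w) = w" if "w \<in> Ug" for w using Ug(6) that by (auto simp: homeomorphism_def)
  define \<Omega>A :: "(complex ^ 'n option) set" where "\<Omega>A = {h. hx h 0 \<in> Wg}"
  have \<Omega>A: "open \<Omega>A"
    using open_vimage[OF Ug(4) holo_on_continuous[OF holo_on_hx_left[of 0 UNIV]]] by (simp add: vimage_def \<Omega>A_def)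
  \<comment> \<open>The critical point as a holomorphic function of \<open>h\<close>.\<close>
  define \<xi> where "\<xi> h = xpart (\<Gamma> (hx h 0))" for h
  have \<xi>h: "holo_on \<xi> \<Omega>A" unfolding \<xi>_def[abs_def]
    by (rule holo_on_compose[OF holo_on_hpart(2)[of UNIV] holo_on_compose[OF Ug(7) holo_on_hx_left]]) (auto simp: \<Omega>A_def)
  have zeroE: "(0 :: complex ^ 'n) \<in> E I" by (simp add: E_def)
  have \<xi>: "hx h (\<xi> h) \<in> Ug" "\<Gamma> (hx h 0) = hx h (\<xi> h)" "\<xi> h \<in> V" "\<xi> h \<in> E I" "\<forall>j\<in>I. dotp h (?Ds (\<xi> h) (axis j 1)) = 0" if h: "h \<in> \<Omega>A" for h
  proof -
    have W: "hx h 0 \<in> Wg" using h by (simp add: \<Omega>A_def)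
    let ?w = "\<Gamma> (hx h 0)"
    have e: "?G ?w = hx h 0" by (rule G\<Gamma>(2)[OF W])
    then have "hpart (?G ?w) = h" by simp
    then have hw: "hpart ?w = h" by (simp add: crit_def)
    show w: "?w = hx h (\<xi> h)" using hw unfolding \<xi>_def by (intro hx_eqI) auto
    show "hx h (\<xi> h) \<in> Ug" using G\<Gamma>(1)[OF W] w by simp
    then show "\<xi> h \<in> V" using Ug(2) by auto
    have c: "(if j \<in> I then dotp h (?Ds (\<xi> h) (axis j 1)) else \<xi> h $ j) = 0" for j
    proof -
      have "?G (hx h (\<xi> h)) = hx h 0" using e w by simp
      from arg_cong[OF this, of "\<lambda>w. w $ Inr j"] show ?thesis by (simp add: crit_def split: if_splits)
    qed
    show "\<forall>j\<in>I. dotp h (?Ds (\<xi> h) (axis j 1)) = 0"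
    proof
      fix j assume "j \<in> I" then show "dotp h (?Ds (\<xi> h) (axis j 1)) = 0" using c[of j] by simp
    qed
    show "\<xi> h \<in> E I" unfolding E_def
    proof (intro CollectI allI impI)
      fix j assume "j \<notin> I" then show "\<xi> h $ j = 0" using c[of j] by simp
    qed
  qed
  have uniq: "?G (hx h x) = hx h 0" if "x \<in> E I" "\<forall>j\<in>I. dotp h (?Ds x (axis j 1)) = 0" for h x
  proof -
    have "(\<chi> j. if j \<in> I then dotp h (?Ds x (axis j 1)) else x $ j) = 0" using that by (auto simp: vec_eq_iff E_def)
    then show ?thesis by (simp add: crit_def cong: if_cong)
  qed
  have Gw0: "?G w0 = hx h0 0" unfolding w0_def by (rule uniq[OF x0E p0(2)])
  have h0A: "h0 \<in> \<Omega>A" using Ug(5) Gw0 by (simp add: \<Omega>A_def)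
  have \<xi>0: "\<xi> h0 = x0" using \<Gamma>G(2)[OF Ug(3)] Gw0 by (simp add: \<xi>_def w0_def)
  \<comment> \<open>Uniqueness of the critical point is known inside \<open>Ug\<close> only; a
    product neighbourhood gives one range of points valid for all \<open>h\<close> near
    \<open>h0\<close>.\<close>
  obtain A B where AB: "open A" "open B" "h0 \<in> A" "x0 \<in> B" "\<And>h x. h \<in> A ==> x \<in> B ==> hx h x \<in> Ug"
    by (rule open_hx_rectangle[OF Ug(1) Ug(3)[unfolded w0_def]]) blast
  define \<sigma> where "\<sigma> h = s (\<xi> h)" for h
  have \<sigma>h: "holo_on \<sigma> \<Omega>A" unfolding \<sigma>_def[abs_def]
    by (rule holo_on_compose[OF V(2) \<xi>h]) (use \<xi>(3) in auto)
  have oc: "open (cone O0)" using O0(1) by (simp add: open_proj_iff)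
  define O' where "O' = {q \<in> U. z q \<in> B} \<inter> O0"
  define \<Omega> where "\<Omega> = ((\<Omega>A \<inter> \<xi> -` B) \<inter> (\<Omega>A \<inter> \<sigma> -` cone O0)) \<inter> (A - {0})"
  have o1: "open (\<Omega>A \<inter> \<xi> -` B)" by (rule continuous_open_preimage[OF holo_on_continuous[OF \<xi>h] \<Omega>A AB(2)])
  have o2: "open (\<Omega>A \<inter> \<sigma> -` cone O0)" by (rule continuous_open_preimage[OF holo_on_continuous[OF \<sigma>h] \<Omega>A oc])
  have \<Omega>: "open \<Omega>" unfolding \<Omega>_def by (rule open_Int[OF open_Int[OF o1 o2] open_Diff[OF AB(1) closed_singleton]])
  have \<Omega>D: "h \<in> \<Omega>A" "\<xi> h \<in> B" "\<sigma> h \<in> cone O0" "h \<in> A" "h \<noteq> 0" if "h \<in> \<Omega>" for h using that by (auto simp: \<Omega>_def)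
  have s0: "\<sigma> h0 \<noteq> 0" "proj_point (\<sigma> h0) = p" using C(5,6)[OF pU] by (simp_all add: \<sigma>_def \<xi>0 x0_def)
  have h0\<Omega>: "h0 \<in> \<Omega>" unfolding \<Omega>_def using h0A \<xi>0 AB s0 O0(2) h0 by (simp add: cone_def)
  have opO: "open O'" unfolding O'_def using chart_open[OF cc AB(2)] O0(1) by blast
  have pO: "p \<in> O'" unfolding O'_def using pU AB(4) O0(2) by (simp add: x0_def)
  have "\<sigma> h \<in> cone X \<and> proj_point (\<sigma> h) \<in> O' \<and> (\<forall>k. dotp h (fd \<sigma> h k) = 0) \<and>
       (\<forall>q\<in>X. q \<in> O' --> ((\<forall>u\<in>tangent X q. dotp h u = 0) \<longleftrightarrow> q = proj_point (\<sigma> h) \<and> dotp h (\<sigma> h) = 0)) \<and>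
       (dotp h (\<sigma> h) = 0 --> node X (proj_point h) (proj_point (\<sigma> h)))" if h: "h \<in> \<Omega>" for h
  proof (intro conjI allI ballI impI)
    note hD = \<Omega>D[OF h]
    note \<xi>h' = \<xi>[OF hD(1)]
    have \<xi>U: "\<xi> h \<in> z ` U" using \<xi>h'(3) by (simp add: V_def)
    have z\<sigma>: "z (proj_point (\<sigma> h)) = \<xi> h" "proj_point (\<sigma> h) \<in> U" using C(8,9)[OF \<xi>U] by (simp_all add: \<sigma>_def)
    show sX: "\<sigma> h \<in> cone X" unfolding \<sigma>_def using adapted_cone[OF ac \<xi>U] \<xi>h'(4) by (simp add: E_def)
    then have qX: "proj_point (\<sigma> h) \<in> X" by (simp add: cone_def)
    show sO: "proj_point (\<sigma> h) \<in> O'" unfolding O'_def using z\<sigma> hD(2,3) by (simp add: cone_def)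
    \<comment> \<open>The critical point moves within \<open>X\<close>, and there the derivative of
      the local equation of \<open>h\<close> vanishes. This holds even when the critical value is
      not 0.\<close>
    show "dotp h (fd \<sigma> h k) = 0" for k
    proof -
      let ?e = "fd \<xi> h k"
      have "(\<sigma> has_derivative (\<lambda>k. ?Ds (\<xi> h) (fd \<xi> h k))) (at h)" unfolding \<sigma>_def[abs_def]
        by (rule has_derivative_compose[OF holo_on_has_derivative(1)[OF \<xi>h hD(1)] holo_on_has_derivative(1)[OF V(2) \<xi>h'(3)]])
      from fun_cong[OF frechet_derivative_at[OF this], of k] have eq: "fd \<sigma> h k = ?Ds (\<xi> h) ?e" by simp
      have "?e \<in> E I" unfolding E_def
      proof (intro CollectI allI impI)
        fix j assume j: "j \<notin> I"
        have "fd (\<lambda>h. \<xi> h $ j) h = fd (\<lambda>h. 0) h"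
          by (rule fd_cong[OF shol_const \<Omega>A hD(1)]) (use \<xi>(4) j in \<open>auto simp: E_def\<close>)
        then show "?e $ j = 0" unfolding fd_holo_component[OF \<xi>h hD(1)] by (simp add: frechet_derivative_const)
      qed
      then show ?thesis unfolding eq using \<xi>h'(5) critE[OF \<xi>h'(3)] by blast
    qed
    show iff: "(\<forall>u\<in>tangent X q. dotp h u = 0) \<longleftrightarrow> q = proj_point (\<sigma> h) \<and> dotp h (\<sigma> h) = 0" if q: "q \<in> X" "q \<in> O'" for q
    proof
      have qU: "q \<in> U" "z q \<in> B" using q(2) by (auto simp: O'_def)
      have zV: "z q \<in> V" using qU by (simp add: V_def)
      assume "\<forall>u\<in>tangent X q. dotp h u = 0"
      then have t: "dotp h (s (z q)) = 0" "\<forall>j\<in>I. dotp h (?Ds (z q) (axis j 1)) = 0"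
        using tan[OF q(1) qU(1)] critE[OF zV] by blast+
      have "?G (hx h (z q)) = hx h 0" by (rule uniq[OF UE[OF q(1) qU(1)] t(2)])
      moreover have "hx h (z q) \<in> Ug" by (rule AB(5)[OF hD(4) qU(2)])
      ultimately have "\<xi> h = z q" using \<Gamma>G(2)[of "hx h (z q)"] by (simp add: \<xi>_def)
      then show "q = proj_point (\<sigma> h) \<and> dotp h (\<sigma> h) = 0" using t(1) C(6)[OF qU(1)] by (simp add: \<sigma>_def)
    next
      assume a: "q = proj_point (\<sigma> h) \<and> dotp h (\<sigma> h) = 0"
      have "dotp h (s (z q)) = 0" using a z\<sigma>(1) by (simp add: \<sigma>_def)
      moreover have "\<forall>e\<in>E I. dotp h (?Ds (z q) e) = 0" using a z\<sigma>(1) \<xi>h'(5) critE[OF \<xi>h'(3)] by simp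
      ultimately show "\<forall>u\<in>tangent X q. dotp h u = 0" using tan[OF q(1)] a z\<sigma>(2) by blast
    qed
    assume v0: "dotp h (\<sigma> h) = 0"
    have "\<forall>u\<in>tangent X (proj_point (\<sigma> h)). dotp h u = 0" using iff[OF qX sO] v0 by blast
    then have sg: "proj_point (\<sigma> h) \<in> sing_section X (proj_point h)" using sing_section_iff[OF X m hD(5) qX] by blast
    \<comment> \<open>Nondegeneracy persists because the derivative of \<open>crit\<close> stays
      bijective on \<open>Ug\<close>; on vectors with zero \<open>h\<close>-part it is the
      Hessian.\<close>
    have nd': "\<exists>v\<in>E I. hessian (\<lambda>x. \<Sum>i\<in>UNIV. h' $ i * s x $ i) (z (proj_point (\<sigma> h))) u v \<noteq> 0"
      if h': "h' \<in> line (proj_point h) - {0}" and u: "u \<in> E I - {0}" for h' u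
    proof -
      obtain c where c: "c \<noteq> 0" "h' = c *s h" using h' hD(5) unfolding in_line_iff by (metis proj_point_eq_iff)
      let ?w = "hx h (\<xi> h)" and ?k = "hx 0 u :: complex ^ ('n option + 'n)"
      have wV: "xpart ?w \<in> V" using \<xi>h'(3) by simp
      have "?k \<noteq> 0"
      proof
        assume "?k = 0"
        then have "xpart ?k = xpart (0 :: complex ^ ('n option + 'n))" by simp
        then show False using u by (simp add: xpart_def vec_eq_iff)
      qed
      moreover have "inj (fd ?G ?w)" using bij[OF \<xi>h'(1)] by (rule bij_is_inj)
      moreover have "linear (fd ?G ?w)"
        using has_derivative_linear[OF holo_on_has_derivative(1)[OF crit_holo[OF V(2,1)], of ?w I]] wV by simp
      ultimately have ne: "fd ?G ?w ?k \<noteq> 0" by (metis injD linear_0)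
      have "\<exists>j\<in>I. dotp h (D2 s (\<xi> h) (axis j 1) u) \<noteq> 0"
      proof (rule ccontr)
        assume "\<not> ?thesis"
        then have "(\<chi> j. if j \<in> I then dotp h (D2 s (\<xi> h) (axis j 1) u) else u $ j) = 0" using u by (auto simp: vec_eq_iff E_def)
        then have "fd ?G ?w ?k = hx 0 0" unfolding crit_derivative[OF V(2,1) wV] by (simp cong: if_cong)
        then show False using ne by (simp add: hx_def vec_eq_iff split: sum.split_asm)
      qed
      then obtain j where j: "j \<in> I" "dotp h (D2 s (\<xi> h) (axis j 1) u) \<noteq> 0" by blast
      have "hessian (\<lambda>x. \<Sum>i\<in>UNIV. h' $ i * s x $ i) (z (proj_point (\<sigma> h))) u (axis j 1) = c * dotp h (D2 s (\<xi> h) (axis j 1) u)"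
        unfolding z\<sigma>(1) hessian_eq[OF V(2,1) \<xi>h'(3)] D2_symmetric[OF V(2,1) \<xi>h'(3), of u] c(2) by simp
      then show ?thesis using j c axE by (intro bexI[of _ "axis j 1"]) auto
    qed
    show "node X (proj_point h) (proj_point (\<sigma> h))" unfolding node_def Let_def
      using sg ac z\<sigma>(2) nd' unfolding E_def by blast
  qed
  then have fin: "\<forall>h\<in>\<Omega>. \<sigma> h \<in> cone X \<and> proj_point (\<sigma> h) \<in> O' \<and> (\<forall>k. dotp h (fd \<sigma> h k) = 0) \<and>
       (\<forall>q\<in>X. q \<in> O' --> ((\<forall>u\<in>tangent X q. dotp h u = 0) \<longleftrightarrow> q = proj_point (\<sigma> h) \<and> dotp h (\<sigma> h) = 0)) \<and>
       (dotp h (\<sigma> h) = 0 --> node X (proj_point h) (proj_point (\<sigma> h)))" by blast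
  have \<Omega>sA: "\<Omega> \<subseteq> \<Omega>A" using \<Omega>D(1) by blast
  have z0: "0 \<notin> \<Omega>" using \<Omega>D(5) by blast
  have OO: "O' \<subseteq> O0" by (auto simp: O'_def)
  show ?thesis by (rule that[OF opO pO OO \<Omega> h0\<Omega> z0 holo_on_subset[OF \<sigma>h \<Omega>sA] s0(2) fin])
qed

section \<open>Singular points of nearby hyperplane sections\<close>

text \<open>\<open>N v u\<close> adds up the norms of the 2 by 2 minors of \<open>u\<close> and
  \<open>v\<close>, so it is zero exactly for proportional vectors. It is homogeneous in
  \<open>u\<close>, hence \<open>N (l p) u < N (l r) u\<close> for all other r describes a Voronoi
  region around p in projective space.\<close>

lemma separate_points:
  fixes \<Delta> :: "'n::finite proj set"
  assumes "finite \<Delta>"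
  obtains S where "\<forall>p\<in>\<Delta>. open (S p) \<and> p \<in> S p" "\<forall>p\<in>\<Delta>. \<forall>q\<in>\<Delta>. p \<noteq> q --> S p \<inter> S q = {}"
proof -
  have "\<forall>p :: 'n proj. \<exists>v. v \<noteq> 0 \<and> proj_point v = p"
  proof
    fix p :: "'n proj" obtain v where "v \<noteq> 0" "p = proj_point v" by (rule proj_cases)
    then show "\<exists>v. v \<noteq> 0 \<and> proj_point v = p" by blast
  qed
  from choice[OF this] obtain l where l: "\<forall>p :: 'n proj. l p \<noteq> 0 \<and> proj_point (l p) = p" by (elim exE) (erule that)
  define N :: "complex ^ 'n option => complex ^ 'n option => real" where
    "N v u = (\<Sum>i\<in>UNIV. \<Sum>j\<in>UNIV. norm (u $ i * v $ j - u $ j * v $ i))" for u v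
  have Nc: "N v (c *s u) = norm c * N v u" for v u c
  proof -
    have "norm (c * u $ i * v $ j - c * u $ j * v $ i) = norm c * norm (u $ i * v $ j - u $ j * v $ i)" for i j
      by (simp add: norm_mult[symmetric] algebra_simps)
    then show ?thesis by (simp add: N_def sum_distrib_left)
  qed
  have cont: "continuous_on UNIV (N v)" for v unfolding N_def[abs_def] by (intro continuous_intros)
  define \<Omega> where "\<Omega> p = (\<Inter>r\<in>\<Delta> - {p}. {u. N (l p) u < N (l r) u}) \<inter> - {0}" for p
  define S where "S p = (proj_point ` \<Omega> p :: 'n proj set)" for p
  have "open (S p)" for p unfolding S_def
  proof (rule open_proj_point_image)
    have "open {u. N (l p) u < N (l r) u}" for r by (rule open_Collect_less[OF cont cont])
    then show "open (\<Omega> p)" unfolding \<Omega>_def using assms by (intro open_Int open_INT) auto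
  qed (simp add: \<Omega>_def)
  moreover have "p \<in> S p" for p
  proof -
    have "N (l p) (l p) < N (l r) (l p)" if "r \<noteq> p" for r
    proof -
      have "N (l p) (l p) = 0" by (simp add: N_def mult.commute)
      moreover have "N (l r) (l p) \<noteq> 0"
      proof
        assume "N (l r) (l p) = 0"
        then have z: "l p $ i * l r $ j = l p $ j * l r $ i" for i j
          unfolding N_def by (simp add: sum_nonneg_eq_0_iff sum_nonneg)
        obtain j where j: "l r $ j \<noteq> 0" using l by (metis vec_eq_iff zero_index)
        have "l p = (l p $ j / l r $ j) *s l r" using z[of _ j] j by (simp add: vec_eq_iff field_simps)
        moreover from this have "l p $ j / l r $ j \<noteq> 0" using l by (metis vector_smult_lzero)
        ultimately have "proj_point (l p) = proj_point (l r)" using l proj_point_scale by metis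
        then show False using l that by metis
      qed
      moreover have "N (l r) (l p) \<ge> 0" by (simp add: N_def sum_nonneg)
      ultimately show ?thesis by linarith
    qed
    then have "l p \<in> \<Omega> p" using l by (auto simp: \<Omega>_def)
    then have "proj_point (l p) \<in> S p" unfolding S_def by blast
    then show ?thesis using l by simp
  qed
  moreover have "S p \<inter> S q = {}" if pq: "p \<in> \<Delta>" "q \<in> \<Delta>" "p \<noteq> q" for p q
  proof (rule ccontr)
    assume "S p \<inter> S q \<noteq> {}"
    then obtain u w where u: "u \<in> \<Omega> p" "w \<in> \<Omega> q" "proj_point u = proj_point w" unfolding S_def by blast
    then have nz: "u \<noteq> 0" "w \<noteq> 0" by (auto simp: \<Omega>_def)
    then obtain c where c: "c \<noteq> 0" "w = c *s u" using u(3) proj_point_eq_iff by blast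
    have "N (l p) u < N (l q) u" using u(1) pq by (auto simp: \<Omega>_def)
    moreover have "N (l q) w < N (l p) w" using u(2) pq by (auto simp: \<Omega>_def)
    ultimately show False using c by (simp add: Nc)
  qed
  ultimately show ?thesis by (intro that[of S]) blast+
qed

lemma cone_closed_limit:
  assumes X: "closedin zariski X" and w: "w \<longlonglongrightarrow> v" "\<And>k. w k \<in> cone X" and v: "v \<noteq> 0"
  shows "v \<in> cone X"
proof -
  have "proj_point v \<in> zcl X" unfolding zcl_def
  proof (intro CollectI allI ballI impI)
    fix d f assume f: "f \<in> forms d" "X \<subseteq> zeros f"
    have "f (w k) = 0" for k using f w(2) subset_zeros_iff[OF f(1)] by blast
    moreover have "isCont f v" using forms_has_derivative[OF f(1)] has_derivative_continuous by blast
    then have "(\<lambda>k. f (w k)) \<longlonglongrightarrow> f v" using w(1) isCont_tendsto_compose by blast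
    ultimately have "f v = 0" by (simp add: LIMSEQ_const_iff)
    then show "proj_point v \<in> zeros f" using in_zeros_iff[OF f(1) v] by blast
  qed
  then show ?thesis using zcl_closed[OF X] v by (simp add: cone_def)
qed

text \<open>Stray singular points for hyperplanes tending to \<open>h0\<close>, lifted to the unit
  sphere, accumulate at a point of \<open>X\<close>. By \<open>smooth_conormal_closed\<close> it is
  singular for \<open>h0\<close>, so it lies in the open set \<open>S\<close>, against the choice of
  the points.\<close>

lemma sing_section_near:
  fixes X :: "'n::finite proj set"
  assumes X: "smooth_projective_variety X" and m: "krull_dim zariski X = enat m" and h0: "h0 \<noteq> 0"
    and S: "open S" "sing_section X (proj_point h0) \<subseteq> S"
  obtains \<epsilon> where "0 < \<epsilon>" "\<forall>h\<in>ball h0 \<epsilon>. h \<noteq> 0 \<and> sing_section X (proj_point h) \<subseteq> S"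
proof (rule ccontr)
  assume neg: "\<not> thesis"
  have X': "closedin zariski X" using X by (auto simp: smooth_projective_variety_def projective_variety_def)
  \<comment> \<open>The radius tends to 0 and stays below \<open>norm h0\<close>, which keeps the
    zero vector out of the ball.\<close>
  have "\<exists>p. fst p \<in> ball h0 (norm h0 / real (Suc (Suc k))) \<and> snd p \<in> sing_section X (proj_point (fst p)) \<and> snd p \<notin> S" for k
  proof (rule ccontr)
    let ?r = "norm h0 / real (Suc (Suc k))"
    assume n: "\<not> ?thesis"
    have r: "0 < ?r" "?r \<le> norm h0" using h0 by (simp_all add: field_simps)
    have "h \<noteq> 0 \<and> sing_section X (proj_point h) \<subseteq> S" if h: "h \<in> ball h0 ?r" for h
    proof
      show "h \<noteq> 0" using h r by (auto simp: dist_norm)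
      show "sing_section X (proj_point h) \<subseteq> S"
      proof
        fix q assume "q \<in> sing_section X (proj_point h)"
        then show "q \<in> S" using n h by (metis fst_conv snd_conv)
      qed
    qed
    then show False using neg that[OF r(1)] by blast
  qed
  then have "\<forall>k. \<exists>p. fst p \<in> ball h0 (norm h0 / real (Suc (Suc k))) \<and> snd p \<in> sing_section X (proj_point (fst p)) \<and> snd p \<notin> S" by blast
  from choice[OF this] obtain P where P: "\<forall>k. fst (P k) \<in> ball h0 (norm h0 / real (Suc (Suc k))) \<and>
      snd (P k) \<in> sing_section X (proj_point (fst (P k))) \<and> snd (P k) \<notin> S" by (elim exE) (erule that)
  define h where "h k = fst (P k)" for k
  define q where "q k = snd (P k)" for k
  have hq: "dist h0 (h k) < norm h0 / real (Suc (Suc k))" "q k \<in> sing_section X (proj_point (h k))" "q k \<notin> S" for k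
    using P by (auto simp: h_def q_def)
  have hlim: "h \<longlonglongrightarrow> h0"
  proof (rule metric_LIMSEQ_I)
    fix r :: real assume r: "0 < r"
    obtain N where N: "norm h0 / r < real N" using reals_Archimedean2 by blast
    have "dist (h n) h0 < r" if n: "n \<ge> N" for n
    proof -
      have "norm h0 < r * real (Suc (Suc n))"
      proof -
        have "norm h0 < r * real N" using N r by (simp add: field_simps)
        also have "\<dots> \<le> r * real (Suc (Suc n))" using n r by (intro mult_left_mono) auto
        finally show ?thesis .
      qed
      then have "norm h0 / real (Suc (Suc n)) < r" by (simp add: field_simps)
      then show ?thesis using hq(1)[of n] by (simp add: dist_commute)
    qed
    then show "\<exists>N. \<forall>n\<ge>N. dist (h n) h0 < r" by blast
  qed
  have h_nz: "h k \<noteq> 0" for k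
  proof
    assume "h k = 0"
    then have "norm h0 < norm h0 / real (Suc (Suc k))" using hq(1)[of k] by simp
    moreover have "norm h0 / real (Suc (Suc k)) \<le> norm h0" by (simp add: field_simps)
    ultimately show False by simp
  qed
  have "\<forall>k. \<exists>v. norm v = 1 \<and> proj_point v = q k"
  proof
    fix k obtain v where v: "v \<noteq> 0" "q k = proj_point v" by (rule proj_cases)
    have "norm (of_real (1 / norm v) *s v) = 1" using v by (simp add: norm_divide)
    moreover have "proj_point (of_real (1 / norm v) *s v) = q k" using v by (simp add: proj_point_scale)
    ultimately show "\<exists>v. norm v = 1 \<and> proj_point v = q k" by blast
  qed
  from choice[OF this] obtain w where w: "\<forall>k. norm (w k) = 1 \<and> proj_point (w k) = q k" by (elim exE) (erule that)
  have "compact (sphere (0 :: complex ^ 'n option) 1)" by simp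
  moreover have "\<forall>k. w k \<in> sphere 0 1" using w by simp
  ultimately obtain v r where vr: "v \<in> sphere 0 1" "strict_mono (r :: nat => nat)" "(w \<circ> r) \<longlonglongrightarrow> v" unfolding compact_def by blast
  have v0: "v \<noteq> 0" using vr(1) by auto
  have w0: "w k \<noteq> 0" for k using w by (metis norm_zero zero_neq_one)
  have qX: "q k \<in> X" for k using hq(2)[of k] by (simp add: sing_section_def)
  have wX: "w k \<in> cone X" for k using w w0 qX by (simp add: cone_def)
  have vX: "v \<in> cone X" by (rule cone_closed_limit[OF X' vr(3)]) (use wX v0 in auto)
  have hr: "(h \<circ> r) \<longlonglongrightarrow> h0" by (rule LIMSEQ_subseq_LIMSEQ[OF hlim vr(2)])
  have "dotp h0 u = 0" if "u \<in> tangent X (proj_point v)" for u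
  proof (rule smooth_conormal_closed[OF X m vX vr(3) _ hr _ that])
    show "(w \<circ> r) k \<in> cone X" for k using wX by simp
    fix k u assume "u \<in> tangent X (proj_point ((w \<circ> r) k))"
    then have "u \<in> tangent X (q (r k))" using w by simp
    then show "dotp ((h \<circ> r) k) u = 0"
      using hq(2)[of "r k"] sing_section_iff[OF X m h_nz qX] by simp
  qed
  then have "proj_point v \<in> sing_section X (proj_point h0)"
    using sing_section_iff[OF X m h0, of "proj_point v"] vX by (simp add: cone_def)
  then have "v \<in> cone S" using S(2) v0 by (auto simp: cone_def)
  moreover have "open (cone S)" using S(1) by (simp add: open_proj_iff)
  ultimately have "eventually (\<lambda>k. (w \<circ> r) k \<in> cone S) sequentially" using vr(3) topological_tendstoD by blast
  then obtain k where "(w \<circ> r) k \<in> cone S" using eventually_happens by fastforce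
  then have "q (r k) \<in> S" using w by (simp add: cone_def)
  then show False using hq(3) by blast
qed

text \<open>The conclusions of \<open>node_local\<close> at all nodes on a common ball. The last
  clause, that a hyperplane tangent to \<open>X\<close> anywhere near p lies on branch p, is what
  later spreads a vanishing statement from the branch to the whole dual variety.\<close>

definition node_data where
  "node_data X \<Delta> h0 \<epsilon> \<sigma> \<longleftrightarrow> 0 < \<epsilon> \<and>
    (\<forall>p\<in>\<Delta>. holo_on (\<sigma> p) (ball h0 \<epsilon>) \<and> proj_point (\<sigma> p h0) = p) \<and>
    (\<forall>h\<in>ball h0 \<epsilon>. h \<noteq> 0) \<and>
    (\<forall>h\<in>ball h0 \<epsilon>. \<forall>p\<in>\<Delta>. \<sigma> p h \<in> cone X \<and> (\<forall>k. dotp h (fd (\<sigma> p) h k) = 0)) \<and>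
    (\<forall>h\<in>ball h0 \<epsilon>. inj_on (\<lambda>p. proj_point (\<sigma> p h)) \<Delta>) \<and>
    (\<forall>h\<in>ball h0 \<epsilon>. sing_section X (proj_point h) = (\<lambda>p. proj_point (\<sigma> p h)) ` {p \<in> \<Delta>. dotp h (\<sigma> p h) = 0}) \<and>
    (\<forall>h\<in>ball h0 \<epsilon>. \<forall>q\<in>sing_section X (proj_point h). node X (proj_point h) q) \<and>
    (\<forall>p\<in>\<Delta>. \<exists>N. open N \<and> p \<in> N \<and> (\<forall>h\<in>ball h0 \<epsilon>. \<forall>q\<in>X. q \<in> N --> (\<forall>u\<in>tangent X q. dotp h u = 0) --> dotp h (\<sigma> p h) = 0))"

lemma node_dataD:
  assumes "node_data X \<Delta> h0 \<epsilon> \<sigma>"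
  shows "0 < \<epsilon>"
    "\<forall>p\<in>\<Delta>. holo_on (\<sigma> p) (ball h0 \<epsilon>) \<and> proj_point (\<sigma> p h0) = p"
    "\<forall>h\<in>ball h0 \<epsilon>. h \<noteq> 0"
    "\<forall>h\<in>ball h0 \<epsilon>. \<forall>p\<in>\<Delta>. \<sigma> p h \<in> cone X \<and> (\<forall>k. dotp h (fd (\<sigma> p) h k) = 0)"
    "\<forall>h\<in>ball h0 \<epsilon>. inj_on (\<lambda>p. proj_point (\<sigma> p h)) \<Delta>"
    "\<forall>h\<in>ball h0 \<epsilon>. sing_section X (proj_point h) = (\<lambda>p. proj_point (\<sigma> p h)) ` {p \<in> \<Delta>. dotp h (\<sigma> p h) = 0}"
    "\<forall>h\<in>ball h0 \<epsilon>. \<forall>q\<in>sing_section X (proj_point h). node X (proj_point h) q"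
    "\<forall>p\<in>\<Delta>. \<exists>N. open N \<and> p \<in> N \<and> (\<forall>h\<in>ball h0 \<epsilon>. \<forall>q\<in>X. q \<in> N --> (\<forall>u\<in>tangent X q. dotp h u = 0) --> dotp h (\<sigma> p h) = 0)"
  using assms unfolding node_data_def by - (elim conjE, assumption)+

lemma nodes_local:
  fixes X :: "'n::finite proj set"
  assumes X: "smooth_projective_variety X" and m: "krull_dim zariski X = enat m" and h0: "h0 \<noteq> 0"
    and \<Delta>: "\<Delta> = sing_section X (proj_point h0)" "finite \<Delta>" "\<forall>p\<in>\<Delta>. node X (proj_point h0) p"
  obtains \<epsilon> \<sigma> where "node_data X \<Delta> h0 \<epsilon> \<sigma>"
proof -
  obtain S where S: "\<forall>p\<in>\<Delta>. open (S p) \<and> p \<in> S p" "\<forall>p\<in>\<Delta>. \<forall>q\<in>\<Delta>. p \<noteq> q --> S p \<inter> S q = {}" by (rule separate_points[OF \<Delta>(2)])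
  define good where "good p t = (case t of (N, \<Omega>, \<sigma>) => open N \<and> p \<in> N \<and> N \<subseteq> S p \<and> open \<Omega> \<and> h0 \<in> \<Omega> \<and> 0 \<notin> \<Omega> \<and> holo_on \<sigma> \<Omega> \<and> proj_point (\<sigma> h0) = p \<and>
    (\<forall>h\<in>\<Omega>. \<sigma> h \<in> cone X \<and> proj_point (\<sigma> h) \<in> N \<and> (\<forall>k. dotp h (fd \<sigma> h k) = 0) \<and>
       (\<forall>q\<in>X. q \<in> N --> ((\<forall>u\<in>tangent X q. dotp h u = 0) \<longleftrightarrow> q = proj_point (\<sigma> h) \<and> dotp h (\<sigma> h) = 0)) \<and>
       (dotp h (\<sigma> h) = 0 --> node X (proj_point h) (proj_point (\<sigma> h)))))" for p t
  have "\<forall>p. \<exists>t. p \<in> \<Delta> --> good p t"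
  proof (rule allI)
    fix p show "\<exists>t. p \<in> \<Delta> --> good p t"
    proof (cases "p \<in> \<Delta>")
      case True
      then have "node X (proj_point h0) p" "open (S p)" "p \<in> S p" using \<Delta>(3) S(1) by auto
      then obtain N \<Omega> \<sigma> where "open N" "p \<in> N" "N \<subseteq> S p" "open \<Omega>" "h0 \<in> \<Omega>" "0 \<notin> \<Omega>" "holo_on \<sigma> \<Omega>" "proj_point (\<sigma> h0) = p"
        "\<forall>h\<in>\<Omega>. \<sigma> h \<in> cone X \<and> proj_point (\<sigma> h) \<in> N \<and> (\<forall>k. dotp h (fd \<sigma> h k) = 0) \<and>
           (\<forall>q\<in>X. q \<in> N --> ((\<forall>u\<in>tangent X q. dotp h u = 0) \<longleftrightarrow> q = proj_point (\<sigma> h) \<and> dotp h (\<sigma> h) = 0)) \<and>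
           (dotp h (\<sigma> h) = 0 --> node X (proj_point h) (proj_point (\<sigma> h)))"
        by (rule node_local[OF X m h0])
      then have "good p (N, \<Omega>, \<sigma>)" unfolding good_def by simp
      then show ?thesis by blast
    qed simp
  qed
  from choice[OF this] obtain t where t: "\<forall>p. p \<in> \<Delta> --> good p (t p)" by (elim exE) (erule that)
  define N where "N p = fst (t p)" for p
  define \<Omega> where "\<Omega> p = fst (snd (t p))" for p
  define \<sigma> where "\<sigma> p = snd (snd (t p))" for p
  have g: "open (N p)" "p \<in> N p" "N p \<subseteq> S p" "open (\<Omega> p)" "h0 \<in> \<Omega> p" "0 \<notin> \<Omega> p" "holo_on (\<sigma> p) (\<Omega> p)" "proj_point (\<sigma> p h0) = p"
    "\<forall>h\<in>\<Omega> p. \<sigma> p h \<in> cone X \<and> proj_point (\<sigma> p h) \<in> N p \<and> (\<forall>k. dotp h (fd (\<sigma> p) h k) = 0) \<and>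
       (\<forall>q\<in>X. q \<in> N p --> ((\<forall>u\<in>tangent X q. dotp h u = 0) \<longleftrightarrow> q = proj_point (\<sigma> p h) \<and> dotp h (\<sigma> p h) = 0)) \<and>
       (dotp h (\<sigma> p h) = 0 --> node X (proj_point h) (proj_point (\<sigma> p h)))" if "p \<in> \<Delta>" for p
    using t[rule_format, OF that] unfolding good_def N_def \<Omega>_def \<sigma>_def by (auto simp: split_beta)
  have "open (\<Union>p\<in>\<Delta>. N p)" using g(1) by auto
  moreover have "sing_section X (proj_point h0) \<subseteq> (\<Union>p\<in>\<Delta>. N p)" using g(2) \<Delta>(1) by auto
  ultimately obtain \<epsilon>1 where \<epsilon>1: "0 < \<epsilon>1" "\<forall>h\<in>ball h0 \<epsilon>1. h \<noteq> 0 \<and> sing_section X (proj_point h) \<subseteq> (\<Union>p\<in>\<Delta>. N p)"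
    by (rule sing_section_near[OF X m h0])
  have "open (\<Inter>p\<in>\<Delta>. \<Omega> p)" using g(4) \<Delta>(2) by auto
  moreover have "h0 \<in> (\<Inter>p\<in>\<Delta>. \<Omega> p)" using g(5) by auto
  ultimately obtain \<epsilon>2 where \<epsilon>2: "0 < \<epsilon>2" "ball h0 \<epsilon>2 \<subseteq> (\<Inter>p\<in>\<Delta>. \<Omega> p)" by (rule openE)
  define \<epsilon> where "\<epsilon> = min \<epsilon>1 \<epsilon>2"
  have \<epsilon>: "0 < \<epsilon>" using \<epsilon>1 \<epsilon>2 by (simp add: \<epsilon>_def)
  have hD: "h \<noteq> 0" "sing_section X (proj_point h) \<subseteq> (\<Union>p\<in>\<Delta>. N p)" if "h \<in> ball h0 \<epsilon>" for h
    using that \<epsilon>1(2) by (auto simp: \<epsilon>_def)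
  have h\<Omega>: "h \<in> \<Omega> p" if "h \<in> ball h0 \<epsilon>" "p \<in> \<Delta>" for h p using that \<epsilon>2(2) by (auto simp: \<epsilon>_def)
  have pN: "proj_point (\<sigma> p h) \<in> N p" if "h \<in> ball h0 \<epsilon>" "p \<in> \<Delta>" for h p using g(9)[OF that(2)] h\<Omega>[OF that] by blast
  have pX: "\<sigma> p h \<in> cone X" "proj_point (\<sigma> p h) \<in> X" if "h \<in> ball h0 \<epsilon>" "p \<in> \<Delta>" for h p
    using g(9)[OF that(2)] h\<Omega>[OF that] by (auto simp: cone_def)
  have iff: "(\<forall>u\<in>tangent X q. dotp h u = 0) \<longleftrightarrow> q = proj_point (\<sigma> p h) \<and> dotp h (\<sigma> p h) = 0"
    if "h \<in> ball h0 \<epsilon>" "p \<in> \<Delta>" "q \<in> X" "q \<in> N p" for h p q using g(9)[OF that(2)] h\<Omega>[OF that(1,2)] that(3,4) by blast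
  have sing: "sing_section X (proj_point h) = (\<lambda>p. proj_point (\<sigma> p h)) ` {p \<in> \<Delta>. dotp h (\<sigma> p h) = 0}" if h: "h \<in> ball h0 \<epsilon>" for h
  proof (intro set_eqI iffI)
    fix q assume q: "q \<in> sing_section X (proj_point h)"
    then have qX: "q \<in> X" by (simp add: sing_section_def)
    obtain p where p: "p \<in> \<Delta>" "q \<in> N p" using q hD(2)[OF h] by blast
    have "\<forall>u\<in>tangent X q. dotp h u = 0" using sing_section_iff[OF X m hD(1)[OF h] qX] q by blast
    then have "q = proj_point (\<sigma> p h)" "dotp h (\<sigma> p h) = 0" using iff[OF h p(1) qX p(2)] by blast+
    then show "q \<in> (\<lambda>p. proj_point (\<sigma> p h)) ` {p \<in> \<Delta>. dotp h (\<sigma> p h) = 0}" using p by blast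
  next
    fix q assume "q \<in> (\<lambda>p. proj_point (\<sigma> p h)) ` {p \<in> \<Delta>. dotp h (\<sigma> p h) = 0}"
    then obtain p where p: "p \<in> \<Delta>" "dotp h (\<sigma> p h) = 0" "q = proj_point (\<sigma> p h)" by blast
    have "\<forall>u\<in>tangent X q. dotp h u = 0" using iff[OF h p(1) pX(2)[OF h p(1)] pN[OF h p(1)]] p by blast
    then show "q \<in> sing_section X (proj_point h)" using sing_section_iff[OF X m hD(1)[OF h]] pX(2)[OF h p(1)] p(3) by blast
  qed
  show ?thesis
  proof (rule that[of \<epsilon> \<sigma>], unfold node_data_def, intro conjI \<epsilon>)
    show "\<forall>p\<in>\<Delta>. holo_on (\<sigma> p) (ball h0 \<epsilon>) \<and> proj_point (\<sigma> p h0) = p"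
      using g(7,8) h\<Omega> by (auto intro!: holo_on_subset[OF g(7)])
    show "\<forall>h\<in>ball h0 \<epsilon>. h \<noteq> 0" using hD(1) by blast
    show "\<forall>h\<in>ball h0 \<epsilon>. \<forall>p\<in>\<Delta>. \<sigma> p h \<in> cone X \<and> (\<forall>k. dotp h (fd (\<sigma> p) h k) = 0)"
    proof (intro ballI)
      fix h p assume hp: "h \<in> ball h0 \<epsilon>" "p \<in> \<Delta>"
      then show "\<sigma> p h \<in> cone X \<and> (\<forall>k. dotp h (fd (\<sigma> p) h k) = 0)" using g(9)[OF hp(2)] h\<Omega>[OF hp] by blast
    qed
    show "\<forall>h\<in>ball h0 \<epsilon>. inj_on (\<lambda>p. proj_point (\<sigma> p h)) \<Delta>"
    proof (intro ballI inj_onI)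
      fix h p q assume h: "h \<in> ball h0 \<epsilon>" and pq: "p \<in> \<Delta>" "q \<in> \<Delta>" "proj_point (\<sigma> p h) = proj_point (\<sigma> q h)"
      have "proj_point (\<sigma> p h) \<in> S p \<inter> S q" using pN[OF h pq(1)] pN[OF h pq(2)] g(3) pq by auto
      then show "p = q" using S(2) pq by blast
    qed
    show "\<forall>h\<in>ball h0 \<epsilon>. sing_section X (proj_point h) = (\<lambda>p. proj_point (\<sigma> p h)) ` {p \<in> \<Delta>. dotp h (\<sigma> p h) = 0}"
      using sing by blast
    show "\<forall>h\<in>ball h0 \<epsilon>. \<forall>q\<in>sing_section X (proj_point h). node X (proj_point h) q"
    proof (intro ballI)
      fix h q assume h: "h \<in> ball h0 \<epsilon>" and "q \<in> sing_section X (proj_point h)"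
      then obtain p where "p \<in> \<Delta>" "dotp h (\<sigma> p h) = 0" "q = proj_point (\<sigma> p h)" using sing[OF h] by blast
      then show "node X (proj_point h) q" using g(9) h\<Omega>[OF h] by blast
    qed
    show "\<forall>p\<in>\<Delta>. \<exists>N. open N \<and> p \<in> N \<and> (\<forall>h\<in>ball h0 \<epsilon>. \<forall>q\<in>X. q \<in> N --> (\<forall>u\<in>tangent X q. dotp h u = 0) --> dotp h (\<sigma> p h) = 0)"
    proof
      fix p assume p: "p \<in> \<Delta>"
      show "\<exists>N. open N \<and> p \<in> N \<and> (\<forall>h\<in>ball h0 \<epsilon>. \<forall>q\<in>X. q \<in> N --> (\<forall>u\<in>tangent X q. dotp h u = 0) --> dotp h (\<sigma> p h) = 0)"
        using g(1,2)[OF p] iff[OF _ p] by (intro exI[of _ "N p"]) blast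
    qed
  qed
qed

section \<open>Independent conditions\<close>

lemma dotp_parallel:
  assumes v: "v \<noteq> 0" and z: "\<And>u. dotp u v = 0 ==> dotp u w = 0"
  shows "\<exists>k. w = k *s v"
proof -
  obtain i where i: "v $ i \<noteq> 0" using v by (auto simp: vec_eq_iff)
  have e: "w $ j = (w $ i / v $ i) * v $ j" for j
    using z[of "v $ i *s axis j 1 - v $ j *s axis i 1"] i by (simp add: field_simps)
  have "w = (w $ i / v $ i) *s v"
    by (rule vec_eq_iff[THEN iffD2], rule allI, subst vector_smult_component, rule e)
  then show ?thesis by blast
qed

lemma closedin_zariski_singleton: "closedin zariski {p :: 'n::finite proj}"
proof -
  obtain v where v: "v \<noteq> 0" "p = proj_point v" by (rule proj_cases)
  have "q = p" if q: "q \<in> zcl {p}" for q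
  proof -
    obtain w where w: "w \<noteq> 0" "q = proj_point w" by (rule proj_cases)
    have z: "dotp u w = 0" if "dotp u v = 0" for u
    proof -
      have "{p} \<subseteq> zeros (dotp u)" using in_zeros_iff[OF forms_dotp v(1), of u] that v(2) by simp
      then have "q \<in> zeros (dotp u)" using q forms_dotp[of u] unfolding zcl_def by blast
      then show ?thesis using in_zeros_iff[OF forms_dotp w(1), of u] w(2) by simp
    qed
    obtain k where k: "w = k *s v" using dotp_parallel[OF v(1) z] by blast
    then have "k \<noteq> 0" using w(1) by auto
    then show ?thesis using proj_point_scale[OF _ v(1)] v(2) w(2) k by simp
  qed
  moreover have "{p} \<subseteq> zcl {p}" by (auto simp: zcl_def)
  ultimately have "zcl {p} = {p}" by blast
  then show ?thesis using closedin_zcl[of "{p}"] by simp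
qed

lemma closedin_zariski_finite: "finite S ==> closedin zariski (S :: 'n::finite proj set)"
  using closedin_Union[of "(\<lambda>p. {p}) ` S" zariski] closedin_zariski_singleton by auto

section \<open>From the vanishing of cohomology to linear forms\<close>

lemma twisted_sections_form:
  assumes "f \<in> forms k" "openin (subtopology zariski X) W"
  shows "(\<lambda>v. if v \<in> cone W then f v else 0) \<in> twisted_sections X k W"
  unfolding twisted_sections_def
proof (intro CollectI conjI ballI allI impI)
  fix p assume "p \<in> W"
  then show "\<exists>W' d. \<exists>F\<in>forms (d + k). \<exists>G\<in>forms d. openin (subtopology zariski X) W' \<and> p \<in> W' \<and> W' \<subseteq> W \<and>
    (\<forall>v\<in>cone W'. G v \<noteq> 0 \<and> (if v \<in> cone W then f v else 0) = F v / G v)"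
    using assms by (intro exI[of _ W] exI[of _ 0] bexI[of _ f] bexI[of _ "\<lambda>_. 1"]) (auto intro: forms_const)
qed simp

lemma cone_Int: "cone (A \<inter> B) = cone A \<inter> cone B" by (auto simp: cone_def)

lemma cone_mono: "A \<subseteq> B ==> cone A \<subseteq> cone B" by (auto simp: cone_def)

lemma twisted_ideal_sectionsD:
  assumes "b \<in> twisted_ideal_sections X \<Delta> 1 A" "p \<in> A"
  obtains W d F G where "F \<in> forms (d + 1)" "G \<in> forms d" "openin (subtopology zariski X) W" "p \<in> W" "W \<subseteq> A"
    "\<forall>v\<in>cone W. G v \<noteq> 0 \<and> b v = F v / G v" "\<forall>v\<in>cone (W \<inter> \<Delta>). b v = 0"
proof -
  obtain W' a t where W': "openin (subtopology zariski X) W'" "p \<in> W'" "W' \<subseteq> A" and a: "a \<in> ideal_sections X \<Delta> W'"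
    and t: "t \<in> twisted_sections X 1 W'" and b: "\<forall>v\<in>cone W'. b v = a v * t v"
    using assms unfolding twisted_ideal_sections_def by blast
  obtain W1 d1 F1 G1 where 1: "F1 \<in> forms d1" "G1 \<in> forms d1" "openin (subtopology zariski X) W1" "p \<in> W1" "W1 \<subseteq> W'"
    "\<forall>v\<in>cone W1. G1 v \<noteq> 0 \<and> a v = F1 v / G1 v"
    using a W'(2) unfolding ideal_sections_def twisted_sections_def by auto
  obtain W2 d2 F2 G2 where 2: "F2 \<in> forms (d2 + 1)" "G2 \<in> forms d2" "openin (subtopology zariski X) W2" "p \<in> W2" "W2 \<subseteq> W'"
    "\<forall>v\<in>cone W2. G2 v \<noteq> 0 \<and> t v = F2 v / G2 v"
    using t W'(2) unfolding twisted_sections_def by auto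
  show ?thesis
  proof (rule that[of "\<lambda>x. F1 x * F2 x" "d1 + d2" "\<lambda>x. G1 x * G2 x" "W1 \<inter> W2"])
    show "(\<lambda>x. F1 x * F2 x) \<in> forms (d1 + d2 + 1)" using forms_mult[OF 1(1) 2(1)] by (simp add: add.assoc)
    show "\<forall>v\<in>cone (W1 \<inter> W2). G1 v * G2 v \<noteq> 0 \<and> b v = F1 v * F2 v / (G1 v * G2 v)"
      using 1(6) 2(6) b cone_mono[OF 1(5)] by (auto simp: cone_Int subset_iff)
    show "\<forall>v\<in>cone (W1 \<inter> W2 \<inter> \<Delta>). b v = 0"
    proof
      fix v assume v: "v \<in> cone (W1 \<inter> W2 \<inter> \<Delta>)"
      then have "v \<in> cone (W' \<inter> \<Delta>)" "v \<in> cone W'" using 1(5) by (auto simp: cone_def)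
      then show "b v = 0" using a b by (simp add: ideal_sections_def)
    qed
  qed (use 1 2 W' in auto)
qed

text \<open>The cocycle \<open>c\<close> is the coboundary of local sections \<open>t A\<close> of \<open>\<O>(1)\<close> that vanish at all points of
  \<open>\<Delta> - {p}\<close> and agree with \<open>l\<close> at \<open>p\<close>; splitting it in the twisted ideal sheaf glues them.\<close>

lemma independent_conditions:
  fixes X :: "'n::finite proj set"
  assumes cls: "complete_linear_system X" and H1: "H1_vanishes X (twisted_ideal_sections X \<Delta> 1)"
    and \<Delta>: "finite \<Delta>" "\<Delta> \<subseteq> X" and p: "p \<in> \<Delta>"
  obtains u where "\<forall>v. v \<noteq> 0 --> proj_point v = p --> dotp u v \<noteq> 0" "\<forall>v. v \<noteq> 0 --> proj_point v \<in> \<Delta> - {p} --> dotp u v = 0"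
proof -
  obtain v0 where v0: "v0 \<noteq> 0" "p = proj_point v0" by (rule proj_cases)
  obtain i where i: "v0 $ i \<noteq> 0" using v0(1) by (auto simp: vec_eq_iff)
  define l where "l = (dotp (axis i 1) :: complex ^ 'n option => complex)"
  have l1: "l \<in> forms 1" unfolding l_def by (rule forms_dotp)
  \<comment> \<open>Each member of the cover contains exactly one point of \<Delta>, so different
    members meet only outside \<Delta>.\<close>
  define U where "U q = X - (\<Delta> - {q})" for q
  define \<U> where "\<U> = U ` \<Delta>"
  have op: "openin (subtopology zariski X) (U q)" for q
  proof -
    have "openin zariski (- (\<Delta> - {q}))" using closedin_zariski_finite[of "\<Delta> - {q}"] \<Delta>(1) by (auto simp: closedin_def Compl_eq_Diff_UNIV)
    then have "openin (subtopology zariski X) (X \<inter> - (\<Delta> - {q}))" by (rule openin_subtopology_Int2)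
    then show ?thesis unfolding U_def by (simp add: Diff_eq)
  qed
  have op\<U>: "openin (subtopology zariski X) A" if "A \<in> \<U>" for A using that op by (auto simp: \<U>_def)
  have U\<Delta>: "q' = q" if "q' \<in> U q" "q' \<in> \<Delta>" for q q' using that by (auto simp: U_def)
  have cov: "zariski_cover X \<U>" unfolding zariski_cover_def
  proof (intro conjI ballI op\<U>)
    show "\<Union> \<U> = X" unfolding \<U>_def U_def using p by auto
  qed
  define t where "t A v = (if p \<in> A then l v else 0)" for A :: "'n proj set" and v
  have t1: "t A \<in> forms 1" for A unfolding t_def[abs_def] using l1 by (cases "p \<in> A") auto
  define c where "c A B v = (if v \<in> cone (A \<inter> B) then t B v - t A v else 0)" for A B :: "'n proj set" and v
  have coc: "cech_cocycle (twisted_ideal_sections X \<Delta> 1) \<U> c" unfolding cech_cocycle_def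
  proof (intro conjI ballI)
    fix A B :: "'n proj set" assume A: "A \<in> \<U>" and B: "B \<in> \<U>"
    have opAB: "openin (subtopology zariski X) (A \<inter> B)" by (rule openin_Int[OF op\<U>[OF A] op\<U>[OF B]])
    \<comment> \<open>The twisted ideal sheaf consists of local products. The factor in the ideal is
      this constant: it is 0 when \<open>A = B\<close>, and otherwise there is no point of \<Delta>
      in the overlap at which it would have to vanish.\<close>
    let ?e = "if (p \<in> A) = (p \<in> B) then 0 else 1 :: complex"
    let ?a = "\<lambda>v. if v \<in> cone (A \<inter> B) then ?e else 0" and ?t = "\<lambda>v. if v \<in> cone (A \<inter> B) then t B v - t A v else 0"
    have a: "?a \<in> twisted_sections X 0 (A \<inter> B)" by (rule twisted_sections_form[OF forms_const opAB])
    have t: "?t \<in> twisted_sections X 1 (A \<inter> B)" by (rule twisted_sections_form[OF forms_diff[OF t1 t1] opAB])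
    have "?a v = 0" if v: "v \<in> cone (A \<inter> B \<inter> \<Delta>)" for v
    proof -
      have "proj_point v \<in> A \<inter> B" "proj_point v \<in> \<Delta>" using v by (auto simp: cone_def)
      moreover obtain q q' where "A = U q" "B = U q'" using A B by (auto simp: \<U>_def)
      ultimately have "A = B" using U\<Delta> by blast
      then show ?thesis by simp
    qed
    then have a': "?a \<in> ideal_sections X \<Delta> (A \<inter> B)" using a unfolding ideal_sections_def by blast
    have e: "\<forall>v\<in>cone (A \<inter> B). c A B v = ?a v * ?t v" by (simp add: c_def t_def)
    show "c A B \<in> twisted_ideal_sections X \<Delta> 1 (A \<inter> B)" unfolding twisted_ideal_sections_def
    proof (intro CollectI conjI allI impI ballI)
      fix v assume "v \<notin> cone (A \<inter> B)" then show "c A B v = 0" by (simp add: c_def)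
    next
      fix q assume q: "q \<in> A \<inter> B"
      show "\<exists>W'. openin (subtopology zariski X) W' \<and> q \<in> W' \<and> W' \<subseteq> A \<inter> B \<and>
          (\<exists>a\<in>ideal_sections X \<Delta> W'. \<exists>t\<in>twisted_sections X 1 W'. \<forall>v\<in>cone W'. c A B v = a v * t v)"
        by (intro exI[of _ "A \<inter> B"] conjI opAB q subset_refl bexI[OF _ a'] bexI[OF _ t] e)
    qed
  next
    fix A B C :: "'n proj set" and v assume "v \<in> cone (A \<inter> B \<inter> C)"
    then have "v \<in> cone (A \<inter> B)" "v \<in> cone (B \<inter> C)" "v \<in> cone (A \<inter> C)" by (auto simp: cone_def)
    then show "c B C v - c A C v + c A B v = 0" by (simp add: c_def)
  qed
  obtain \<V> \<tau> b where V: "zariski_cover X \<V>" "\<forall>A\<in>\<V>. \<tau> A \<in> \<U> \<and> A \<subseteq> \<tau> A" "\<forall>A\<in>\<V>. b A \<in> twisted_ideal_sections X \<Delta> 1 A"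
    and b: "\<forall>A\<in>\<V>. \<forall>B\<in>\<V>. \<forall>v\<in>cone (A \<inter> B). c (\<tau> A) (\<tau> B) v = b B v - b A v"
    using H1[unfolded H1_vanishes_def, rule_format, OF conjI[OF cov coc]] by (elim exE conjE) (erule that)
  have "\<forall>q. q \<in> X --> (\<exists>A\<in>\<V>. q \<in> A)" using V(1) unfolding zariski_cover_def by blast
  then have "\<forall>q. \<exists>A. q \<in> X --> A \<in> \<V> \<and> q \<in> A" by blast
  from choice[OF this] obtain \<alpha> where \<alpha>: "\<forall>q. q \<in> X --> \<alpha> q \<in> \<V> \<and> q \<in> \<alpha> q" by (elim exE) (erule that)
  \<comment> \<open>The corrected local sections \<open>t (\<tau> A) - b A\<close> agree on overlaps
    and glue to a global section of \<O>(1).\<close>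
  define s where "s v = (if v \<in> cone X then t (\<tau> (\<alpha> (proj_point v))) v - b (\<alpha> (proj_point v)) v else 0)" for v
  have VX: "A \<subseteq> X" if "A \<in> \<V>" for A using V(1) that unfolding zariski_cover_def by blast
  have s: "s v = t (\<tau> A) v - b A v" if A: "A \<in> \<V>" and v: "v \<in> cone A" for A v
  proof -
    let ?B = "\<alpha> (proj_point v)"
    have vX: "v \<in> cone X" using v cone_mono[OF VX[OF A]] by blast
    then have B: "?B \<in> \<V>" "v \<in> cone ?B" using \<alpha> by (auto simp: cone_def)
    have vAB: "v \<in> cone (A \<inter> ?B)" using B v by (simp add: cone_Int)
    have "v \<in> cone (\<tau> A \<inter> \<tau> ?B)" using vAB V(2) A B(1) cone_mono[of "A \<inter> ?B" "\<tau> A \<inter> \<tau> ?B"] by blast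
    then have "t (\<tau> ?B) v - t (\<tau> A) v = b ?B v - b A v" using b[rule_format, OF A B(1) vAB] by (simp add: c_def)
    then show ?thesis using vX by (simp add: s_def algebra_simps)
  qed
  have "s \<in> twisted_sections X 1 X" unfolding twisted_sections_def
  proof (intro CollectI conjI allI impI ballI)
    fix v assume "v \<notin> cone X" then show "s v = 0" by (simp add: s_def)
  next
    fix q assume q: "q \<in> X"
    let ?A = "\<alpha> q"
    have A: "?A \<in> \<V>" "q \<in> ?A" using \<alpha> q by auto
    have bA: "b ?A \<in> twisted_ideal_sections X \<Delta> 1 ?A" using V(3) A(1) by blast
    obtain W d F G where W: "F \<in> forms (d + 1)" "G \<in> forms d" "openin (subtopology zariski X) W" "q \<in> W" "W \<subseteq> ?A"
      "\<forall>v\<in>cone W. G v \<noteq> 0 \<and> b ?A v = F v / G v" "\<forall>v\<in>cone (W \<inter> \<Delta>). b ?A v = 0"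
      by (rule twisted_ideal_sectionsD[OF bA A(2)])
    have F: "(\<lambda>x. G x * t (\<tau> ?A) x - F x) \<in> forms (d + 1)" by (rule forms_diff[OF forms_mult[OF W(2) t1] W(1)])
    have "G v \<noteq> 0 \<and> s v = (G v * t (\<tau> ?A) v - F v) / G v" if v: "v \<in> cone W" for v
    proof -
      have "v \<in> cone ?A" using v cone_mono[OF W(5)] by blast
      then have "s v = t (\<tau> ?A) v - b ?A v" by (rule s[OF A(1)])
      then show ?thesis using W(6) v by (simp add: field_simps)
    qed
    then show "\<exists>W' d. \<exists>F\<in>forms (d + 1). \<exists>G\<in>forms d. openin (subtopology zariski X) W' \<and> q \<in> W' \<and> W' \<subseteq> X \<and>
        (\<forall>v\<in>cone W'. G v \<noteq> 0 \<and> s v = F v / G v)"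
      using W(3,4) W(5) VX[OF A(1)] by (intro exI[of _ W] exI[of _ d] bexI[OF _ F] bexI[OF _ W(2)]) blast
  qed
  then have "s \<in> (\<lambda>l v. if v \<in> cone X then l v else 0) ` forms 1"
    using cls unfolding complete_linear_system_def bij_betw_def by simp
  then obtain f where f: "f \<in> forms 1" "s = (\<lambda>v. if v \<in> cone X then f v else 0)" by blast
  obtain u where u: "f = dotp u" by (rule forms_1E[OF f(1)])
  \<comment> \<open>At a point of \<Delta> the correction \<open>b\<close> vanishes, so the value is
    that of \<open>t\<close>; and \<open>\<tau> A\<close> contains no other point of
    \<Delta>.\<close>
  have val: "dotp u v = (if proj_point v = p then l v else 0)" if v: "v \<noteq> 0" "proj_point v \<in> \<Delta>" for v
  proof -
    let ?q = "proj_point v"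
    let ?A = "\<alpha> ?q"
    have q: "?q \<in> X" using v(2) \<Delta>(2) by blast
    have A: "?A \<in> \<V>" "?q \<in> ?A" using \<alpha> q by auto
    have bA: "b ?A \<in> twisted_ideal_sections X \<Delta> 1 ?A" using V(3) A(1) by blast
    obtain W d F G where W: "F \<in> forms (d + 1)" "G \<in> forms d" "openin (subtopology zariski X) W" "?q \<in> W" "W \<subseteq> ?A"
      "\<forall>v\<in>cone W. G v \<noteq> 0 \<and> b ?A v = F v / G v" "\<forall>v\<in>cone (W \<inter> \<Delta>). b ?A v = 0"
      by (rule twisted_ideal_sectionsD[OF bA A(2)])
    have "b ?A v = 0" using W(4,7) v by (simp add: cone_def)
    moreover have "s v = t (\<tau> ?A) v - b ?A v" by (rule s[OF A(1)]) (use A v in \<open>simp add: cone_def\<close>)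
    moreover have "s v = dotp u v" using f(2) u v(1) q by (simp add: cone_def)
    moreover have "p \<in> \<tau> ?A \<longleftrightarrow> ?q = p"
    proof -
      obtain r where r: "r \<in> \<Delta>" "\<tau> ?A = U r" using V(2) A(1) by (auto simp: \<U>_def)
      have "?q = r" using U\<Delta>[of ?q r] V(2) A r(2) v(2) by blast
      moreover have "p \<in> U r \<longleftrightarrow> p = r" using p \<Delta>(2) by (auto simp: U_def)
      ultimately show ?thesis using r(2) by auto
    qed
    ultimately show ?thesis by (auto simp: t_def)
  qed
  show ?thesis
  proof (rule that[of u]; intro allI impI)
    fix v assume v: "v \<noteq> 0" "proj_point v = p"
    then obtain k where "k \<noteq> 0" "v = k *s v0" using v0 by (metis proj_point_eq_iff)
    then show "dotp u v \<noteq> 0" using val[OF v(1)] v(2) p i by (simp add: l_def)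
  next
    fix v assume "v \<noteq> 0" "proj_point v \<in> \<Delta> - {p}"
    then show "dotp u v = 0" using val[of v] by auto
  qed
qed

lemma subspace_dotp_zero: "vec.subspace {w. dotp k w = 0}"
  by (rule vec.subspaceI) auto

lemma independent_image_dotp:
  fixes v :: "'p => complex ^ 'm::finite"
  assumes ind: "\<forall>p\<in>D. \<exists>u. dotp u (v p) \<noteq> 0 \<and> (\<forall>q\<in>D - {p}. dotp u (v q) = 0)"
  shows "vec.independent (v ` D)" "inj_on v D"
proof -
  show "inj_on v D"
  proof (rule inj_onI, rule ccontr)
    fix p q assume "p \<in> D" "q \<in> D" "v p = v q" "p \<noteq> q"
    then show False using ind by (metis DiffI singletonD)
  qed
  show "vec.independent (v ` D)" unfolding vec.dependent_def
  proof (rule notI, elim bexE)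
    fix a assume "a \<in> v ` D" and sp: "a \<in> vec.span (v ` D - {a})"
    then obtain p where p: "p \<in> D" "a = v p" by blast
    obtain u where u: "dotp u (v p) \<noteq> 0" "\<forall>q\<in>D - {p}. dotp u (v q) = 0" using ind p(1) by blast
    have "vec.span (v ` D - {a}) \<subseteq> {w. dotp u w = 0}"
      by (rule vec.span_minimal[OF _ subspace_dotp_zero]) (use p u(2) in auto)
    then show False using sp u(1) p(2) by blast
  qed
qed

text \<open>The lifts of the nodes are completed to a basis of the hyperplane annihilated by
  \<open>h0\<close>, indexed by the coordinates of the chart to be built. The transversal vector
  \<open>w\<close> fixes the scale of coefficient vectors.\<close>

lemma lift_basis:
  fixes h0 :: "complex ^ 'n::finite option" and v :: "'p => complex ^ 'n option"
  assumes h0: "h0 \<noteq> 0" and D: "\<forall>p\<in>D. dotp h0 (v p) = 0" and ind: "\<forall>p\<in>D. \<exists>u. dotp u (v p) \<noteq> 0 \<and> (\<forall>q\<in>D - {p}. dotp u (v q) = 0)"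
  obtains e :: "'n => complex ^ 'n option" and \<iota> w where "inj_on \<iota> D" "\<forall>p\<in>D. e (\<iota> p) = v p" "\<forall>j. dotp h0 (e j) = 0" "dotp h0 w = 1"
    "\<forall>k. (\<forall>j. dotp k (e j) = 0) --> dotp k w = 0 --> k = 0"
proof -
  let ?S = "{w. dotp h0 w = 0}"
  note indG = independent_image_dotp(1)[OF ind] and injv = independent_image_dotp(2)[OF ind]
  have GS: "v ` D \<subseteq> ?S" using D by auto
  obtain B where B: "v ` D \<subseteq> B" "B \<subseteq> ?S" "vec.independent B" "?S \<subseteq> vec.span B"
    by (rule vec.maximal_independent_subset_extend[OF GS indG])
  have "\<exists>x. dotp h0 x \<noteq> 0" using dotp_nondegenerate[of h0] h0 by blast
  then obtain x where x: "dotp h0 x \<noteq> 0" by blast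
  define w where "w = (1 / dotp h0 x) *s x"
  have w: "dotp h0 w = 1" using x by (simp add: w_def)
  have spB: "vec.span B \<subseteq> ?S" by (rule vec.span_minimal[OF B(2) subspace_dotp_zero])
  then have wB: "w \<notin> vec.span B" using w by auto
  have ind': "vec.independent (insert w B)" using B(3) wB by (simp add: vec.independent_insertI)
  have sp: "vec.span (insert w B) = UNIV"
  proof (intro set_eqI iffI UNIV_I)
    fix y
    have "y - dotp h0 y *s w \<in> vec.span B" using B(4) w by auto
    then have "y - dotp h0 y *s w \<in> vec.span (insert w B)" by (rule subsetD[OF vec.span_mono, rotated]) blast
    moreover have "dotp h0 y *s w \<in> vec.span (insert w B)" by (intro vec.span_scale vec.span_base) simp
    ultimately have "y - dotp h0 y *s w + dotp h0 y *s w \<in> vec.span (insert w B)" by (rule vec.span_add)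
    then show "y \<in> vec.span (insert w B)" by simp
  qed
  have finB: "finite B" using vec.finiteI_independent[OF B(3)] .
  have "card (insert w B) = vec.dim (UNIV :: (complex ^ 'n option) set)"
    using vec.dim_eq_card_independent[OF ind'] vec.dim_span[of "insert w B"] sp by simp
  also have "\<dots> = Suc CARD('n)" by (simp only: vec_dim_card card_option)
  finally have "card (insert w B) = Suc CARD('n)" .
  moreover have "w \<notin> B" using wB vec.span_base by blast
  ultimately have "card B = CARD('n)" using finB by simp
  then obtain e where e: "bij_betw e (UNIV :: 'n set) B" using finB finite_same_card_bij[of "UNIV :: 'n set" B] by auto
  define \<iota> where "\<iota> p = inv_into UNIV e (v p)" for p
  have e\<iota>: "e (\<iota> p) = v p" if "p \<in> D" for p unfolding \<iota>_def
    by (rule f_inv_into_f) (use e B(1) that in \<open>auto simp: bij_betw_def\<close>)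
  have eB: "e j \<in> B" for j using e by (auto simp: bij_betw_def)
  show ?thesis
  proof (rule that[of \<iota> e w])
    show "inj_on \<iota> D" using injv e\<iota> by (metis inj_on_def)
    show "\<forall>j. dotp h0 (e j) = 0" using eB B(2) by blast
    show "\<forall>k. (\<forall>j. dotp k (e j) = 0) --> dotp k w = 0 --> k = 0"
    proof (intro allI impI)
      fix k assume k: "\<forall>j. dotp k (e j) = 0" "dotp k w = 0"
      have "dotp k b = 0" if "b \<in> B" for b
      proof -
        from that e obtain j where "b = e j" by (auto simp: bij_betw_def)
        then show ?thesis using k(1) by simp
      qed
      then have "vec.span (insert w B) \<subseteq> {y. dotp k y = 0}"
        by (intro vec.span_minimal[OF _ subspace_dotp_zero]) (use k(2) in auto)
      then show "k = 0" using sp dotp_nondegenerate[of k] by blast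
    qed
  qed (use e\<iota> w in auto)
qed

section \<open>Coordinates adapted to the dual variety\<close>

text \<open>At \<open>h0\<close> the critical value of branch p has the derivative
  \<open>k \<mapsto> dotp k (e (\<iota> p))\<close>, the same as a linear coordinate. Replacing
  these linear coordinates by the critical values therefore keeps the differential invertible; the
  others stay linear, as the count of dimensions of components requires.\<close>

lemma nodal_chart:
  fixes h0 :: "complex ^ 'n::finite option" and e :: "'n => complex ^ 'n option" and \<sigma> :: "'p => complex ^ 'n option => complex ^ 'n option"
  assumes \<epsilon>: "0 < \<epsilon>" and \<sigma>: "\<forall>p\<in>D. holo_on (\<sigma> p) (ball h0 \<epsilon>)" "\<forall>p\<in>D. \<forall>k. dotp h0 (fd (\<sigma> p) h0 k) = 0"
    and \<iota>: "inj_on \<iota> D" "\<forall>p\<in>D. e (\<iota> p) = \<sigma> p h0" and e: "\<forall>j. dotp h0 (e j) = 0" "dotp h0 w = 1"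
    and ker: "\<forall>k. (\<forall>j. dotp k (e j) = 0) --> dotp k w = 0 --> k = 0"
  obtains U :: "'n proj set" and z s where "coord_chart U z s" "proj_point h0 \<in> U" "z (proj_point h0) = 0" "s 0 = h0"
    "\<forall>x\<in>z ` U. s x \<in> ball h0 \<epsilon>" "\<forall>x\<in>z ` U. \<forall>p\<in>D. x $ \<iota> p = dotp (s x) (\<sigma> p (s x))"
    "\<forall>x\<in>z ` U. \<forall>j. j \<notin> \<iota> ` D --> x $ j = dotp (s x) (e j)"
proof -
  \<comment> \<open>The index \<open>None\<close> carries the scale \<open>dotp h w\<close>; the
    inverse function theorem is applied on the vector space, and the chart is the slice where the
    scale is 1.\<close>
  define \<Theta> where "\<Theta> h = (\<chi> k. case k of None => dotp h w
    | Some j => if j \<in> \<iota> ` D then dotp h (\<sigma> (inv_into D \<iota> j) h) else dotp h (e j))" for h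
  have \<Theta>h: "holo_on \<Theta> (ball h0 \<epsilon>)" unfolding holo_on_iff
  proof
    fix k show "shol (\<lambda>h. \<Theta> h $ k) (ball h0 \<epsilon>)"
    proof (cases k)
      case None
      show ?thesis unfolding \<Theta>_def None using shol_dotp[OF holo_on_id holo_on_const] by simp
    next
      case (Some j)
      show ?thesis
      proof (cases "j \<in> \<iota> ` D")
        case True
        then have "inv_into D \<iota> j \<in> D" by (rule inv_into_into)
        then have "holo_on (\<sigma> (inv_into D \<iota> j)) (ball h0 \<epsilon>)" using \<sigma>(1) by blast
        from shol_dotp[OF holo_on_id this] show ?thesis using True Some by (simp add: \<Theta>_def)
      next
        case False
        then show ?thesis using Some shol_dotp[OF holo_on_id holo_on_const] by (simp add: \<Theta>_def)
      qed
    qed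
  qed
  have h0b: "h0 \<in> ball h0 \<epsilon>" using \<epsilon> by simp
  have der: "fd \<Theta> h0 k $ Some j = dotp k (e j)" "fd \<Theta> h0 k $ None = dotp k w" for k j
  proof -
    have lin: "fd (\<lambda>h. dotp h y) h0 k = dotp k y" for y
      using frechet_derivative_at[OF dotp_has_derivative[OF has_derivative_ident has_derivative_const[of y "at h0"]], symmetric] by simp
    show "fd \<Theta> h0 k $ None = dotp k w"
      unfolding fd_holo_component[OF \<Theta>h h0b] using lin[of w] by (simp add: \<Theta>_def)
    show "fd \<Theta> h0 k $ Some j = dotp k (e j)"
    proof (cases "j \<in> \<iota> ` D")
      case True
      define p where "p = inv_into D \<iota> j"
      have p: "p \<in> D" "\<iota> p = j" using True by (auto simp: p_def inv_into_into f_inv_into_f)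
      have "((\<lambda>h. dotp h (\<sigma> p h)) has_derivative (\<lambda>k. dotp h0 (fd (\<sigma> p) h0 k) + dotp k (\<sigma> p h0))) (at h0)"
        by (rule dotp_has_derivative[OF has_derivative_ident holo_on_has_derivative(1)[OF _ h0b]]) (use \<sigma>(1) p(1) in blast)
      from fun_cong[OF frechet_derivative_at[OF this, symmetric], of k]
      have "fd (\<lambda>h. dotp h (\<sigma> p h)) h0 k = dotp k (e j)" using \<sigma>(2) \<iota>(2) p by auto
      then show ?thesis unfolding fd_holo_component[OF \<Theta>h h0b] using True by (simp add: \<Theta>_def p_def)
    next
      case False
      then show ?thesis unfolding fd_holo_component[OF \<Theta>h h0b] using lin[of "e j"] by (simp add: \<Theta>_def)
    qed
  qed
  have injD: "k = 0" if "fd \<Theta> h0 k = 0" for k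
    using ker der[of k] that by simp
  obtain U1 W1 g where U1: "open U1" "U1 \<subseteq> ball h0 \<epsilon>" "h0 \<in> U1" "open W1" "\<Theta> h0 \<in> W1" and hom: "homeomorphism U1 W1 \<Theta> g" and g: "holo_on g W1"
    and "\<And>x. x \<in> U1 ==> bij (fd \<Theta> x)"
    and "\<And>x u. x \<in> U1 ==> fd g (\<Theta> x) (fd \<Theta> x u) = u"
    apply (rule holo_inverse[OF \<Theta>h open_ball h0b injD])
     apply assumption
    apply (rule that)
            prefer 6 apply assumption
           apply assumption+
    done
  have g\<Theta>: "\<Theta> h \<in> W1" "g (\<Theta> h) = h" if "h \<in> U1" for h using hom that by (auto simp: homeomorphism_def)
  have \<Theta>g: "g x \<in> U1" "\<Theta> (g x) = x" if "x \<in> W1" for x using hom that by (auto simp: homeomorphism_def)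
  define em where "em x = (\<chi> k. case k of None => 1 | Some j => x $ j)" for x :: "complex ^ 'n"
  have emh: "holo_on em V" for V unfolding holo_on_iff
  proof
    fix k show "shol (\<lambda>x. em x $ k) V" by (cases k) (auto simp: em_def)
  qed
  define V where "V = em -` W1"
  have Vo: "open V" unfolding V_def by (rule open_vimage[OF U1(4) holo_on_continuous[OF emh]])
  define s where "s x = g (em x)" for x
  define nm where "nm h = (1 / dotp h w) *s h" for h
  define C where "C = {h. dotp h w \<noteq> 0 \<and> nm h \<in> U1}"
  have nmh: "holo_on nm {h. dotp h w \<noteq> 0}" unfolding nm_def[abs_def]
    by (rule holo_on_scale[OF shol_divide[OF shol_const shol_dotp[OF holo_on_id holo_on_const]] holo_on_id]) simp
  have "continuous_on UNIV (\<lambda>h. dotp h w)" by (rule shol_continuous[OF shol_dotp[OF holo_on_id holo_on_const]])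
  then have op1: "open {h. dotp h w \<noteq> 0}" using open_vimage[of "- {0}" "\<lambda>h. dotp h w"] by (simp add: vimage_def open_Compl)
  have Co: "open C"
    using continuous_open_preimage[OF holo_on_continuous[OF nmh] op1 U1(1)] by (simp add: C_def Int_def vimage_def)
  have C0: "0 \<notin> C" by (simp add: C_def)
  define U where "U = (proj_point ` C :: 'n proj set)"
  have Uo: "open U" unfolding U_def by (rule open_proj_point_image[OF Co C0])
  have nmc: "nm (c *s h) = nm h" if "c \<noteq> 0" for c h using that by (simp add: nm_def vector_smult_assoc)
  have coneU: "h \<in> C" if h: "h \<in> cone U" for h
  proof -
    obtain h' where h': "h' \<in> C" "proj_point h = proj_point h'" "h \<noteq> 0" using h by (auto simp: cone_def U_def)
    moreover have "h' \<noteq> 0" using h'(1) C0 by metis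
    ultimately obtain c where c: "c \<noteq> 0" "h = c *s h'" by (metis proj_point_eq_iff)
    then show ?thesis using h'(1) nmc[OF c(1)] by (simp add: C_def)
  qed
  define zh where "zh h = (\<chi> j. \<Theta> (nm h) $ Some j)" for h
  \<comment> \<open>Any representative may be chosen, since \<open>nm\<close> normalises the scale
    to 1 and so does not depend on it.\<close>
  define z :: "'n proj => complex ^ 'n" where "z q = zh (SOME v. v \<noteq> 0 \<and> proj_point v = q)" for q
  have zz: "z (proj_point h) = zh h" if h: "h \<noteq> 0" for h
  proof -
    define v where "v = (SOME v. v \<noteq> 0 \<and> proj_point v = proj_point h)"
    have "v \<noteq> 0 \<and> proj_point v = proj_point h" unfolding v_def by (rule someI[of _ h]) (simp add: h)
    then obtain c where c: "c \<noteq> 0" "v = c *s h" using h by (metis proj_point_eq_iff)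
    have "z (proj_point h) = zh v" by (simp add: z_def v_def)
    then show ?thesis using nmc[OF c(1)] c(2) by (simp add: zh_def)
  qed
  have CD: "h \<noteq> 0" "dotp (nm h) w = 1" "em (zh h) = \<Theta> (nm h)" "zh h \<in> V" "s (zh h) = nm h" "proj_point (nm h) = proj_point h" if h: "h \<in> C" for h
  proof -
    show h0: "h \<noteq> 0" using h C0 by metis
    show d: "dotp (nm h) w = 1" using h by (simp add: nm_def C_def)
    show em: "em (zh h) = \<Theta> (nm h)" unfolding vec_eq_iff
    proof
      fix k show "em (zh h) $ k = \<Theta> (nm h) $ k" using d by (cases k) (simp_all add: em_def zh_def \<Theta>_def)
    qed
    show "zh h \<in> V" using g\<Theta>(1)[of "nm h"] h by (simp add: V_def em C_def)
    show "s (zh h) = nm h" using g\<Theta>(2)[of "nm h"] h by (simp add: s_def em C_def)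
    show "proj_point (nm h) = proj_point h" unfolding nm_def using h h0 by (intro proj_point_scale) (auto simp: C_def)
  qed
  have VD: "s x \<in> U1" "\<Theta> (s x) = em x" "dotp (s x) w = 1" "nm (s x) = s x" "s x \<in> C" "zh (s x) = x" if x: "x \<in> V" for x
  proof -
    have W: "em x \<in> W1" using x by (simp add: V_def)
    show u: "s x \<in> U1" using \<Theta>g(1)[OF W] by (simp add: s_def)
    show t: "\<Theta> (s x) = em x" using \<Theta>g(2)[OF W] by (simp add: s_def)
    show d: "dotp (s x) w = 1" using arg_cong[OF t, of "\<lambda>y. y $ None"] by (simp add: \<Theta>_def em_def)
    show n: "nm (s x) = s x" by (simp add: nm_def d)
    show "s x \<in> C" using u d n by (simp add: C_def)
    show "zh (s x) = x" by (simp add: zh_def n t em_def vec_eq_iff)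
  qed
  have zU: "z ` U = V"
  proof (intro set_eqI iffI)
    fix x assume "x \<in> z ` U" then show "x \<in> V" using CD(1,4) zz by (auto simp: U_def)
  next
    fix x assume x: "x \<in> V"
    have "proj_point (s x) \<in> U" using VD(5)[OF x] by (simp add: U_def)
    moreover have "z (proj_point (s x)) = x" using zz[OF CD(1)[OF VD(5)[OF x]]] VD(6)[OF x] by simp
    ultimately show "x \<in> z ` U" by (metis imageI)
  qed
  have cUo: "open (cone U)" using Uo by (simp add: open_proj_iff)
  have cc: "coord_chart U z s" unfolding coord_chart_def zU
  proof (intro conjI ballI Uo Vo)
    have h1: "holo_on (\<lambda>h. \<Theta> (nm h)) (cone U)"
      by (rule holo_on_compose[OF \<Theta>h holo_on_subset[OF nmh]]) (use coneU U1(2) in \<open>auto simp: C_def\<close>)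
    have "holo_on zh (cone U)" unfolding zh_def[abs_def] by (rule holo_on_lambda) (use h1 in \<open>auto simp: holo_on_iff\<close>)
    then show "holo_on (\<lambda>v. z (proj_point v)) (cone U)"
      by (rule holo_on_cong[OF _ cUo]) (simp add: zz cone_def)
    show "holo_on s V" unfolding s_def[abs_def] by (rule holo_on_compose[OF g emh]) (auto simp: V_def)
  next
    fix q assume "q \<in> U"
    then obtain h where h: "h \<in> C" "q = proj_point h" by (auto simp: U_def)
    have zq: "s (z q) = nm h" using zz[OF CD(1)[OF h(1)]] CD(5)[OF h(1)] h(2) by simp
    then show "proj_point (s (z q)) = q" using CD(6)[OF h(1)] h(2) by simp
    show "s (z q) \<noteq> 0" using zq CD(2)[OF h(1)] by auto
  qed
  have nm0: "nm h0 = h0" by (simp add: nm_def e(2))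
  have h0C: "h0 \<in> C" using U1(3) e(2) nm0 by (simp add: C_def)
  have \<Theta>0: "zh h0 = 0" unfolding vec_eq_iff
  proof
    fix j show "zh h0 $ j = 0 $ j"
    proof (cases "j \<in> \<iota> ` D")
      case True
      have p: "inv_into D \<iota> j \<in> D" "\<iota> (inv_into D \<iota> j) = j" using True by (auto simp: inv_into_into f_inv_into_f)
      have "\<sigma> (inv_into D \<iota> j) h0 = e j" using \<iota>(2) p by metis
      then show ?thesis using e(1) by (simp add: zh_def nm0 \<Theta>_def)
    next
      case False then show ?thesis using e(1) by (simp add: zh_def nm0 \<Theta>_def)
    qed
  qed
  show ?thesis
  proof (rule that[OF cc])
    show "proj_point h0 \<in> U" using h0C by (simp add: U_def)
    show "z (proj_point h0) = 0" using zz[OF CD(1)[OF h0C]] \<Theta>0 by simp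
    show "s 0 = h0" using CD(5)[OF h0C] \<Theta>0 nm0 by simp
    show "\<forall>x\<in>z ` U. s x \<in> ball h0 \<epsilon>" unfolding zU using VD(1) U1(2) by blast
    show "\<forall>x\<in>z ` U. \<forall>p\<in>D. x $ \<iota> p = dotp (s x) (\<sigma> p (s x))" unfolding zU
    proof (intro ballI)
      fix x p assume x: "x \<in> V" and p: "p \<in> D"
      have "em x $ Some (\<iota> p) = \<Theta> (s x) $ Some (\<iota> p)" using VD(2)[OF x] by simp
      then show "x $ \<iota> p = dotp (s x) (\<sigma> p (s x))" using p \<iota>(1) by (simp add: em_def \<Theta>_def inv_into_f_f)
    qed
    show "\<forall>x\<in>z ` U. \<forall>j. j \<notin> \<iota> ` D --> x $ j = dotp (s x) (e j)" unfolding zU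
    proof (intro ballI allI impI)
      fix x j assume x: "x \<in> V" and j: "j \<notin> \<iota> ` D"
      have "em x $ Some j = \<Theta> (s x) $ Some j" using VD(2)[OF x] by simp
      then show "x $ j = dotp (s x) (e j)" using j by (simp add: em_def \<Theta>_def)
    qed
  qed
qed

section \<open>Strata and divisors read off from coordinates\<close>

lemma coord_chart_restrict:
  assumes c: "coord_chart U z s" and V: "open V"
  shows "coord_chart (U \<inter> V) z s"
proof -
  note C = coord_chartD[OF c]
  have oc: "open (cone V)" using V by (simp add: open_proj_iff)
  have e: "z ` (U \<inter> V) = z ` U \<inter> s -` cone V"
  proof (intro set_eqI iffI)
    fix x assume "x \<in> z ` (U \<inter> V)" then show "x \<in> z ` U \<inter> s -` cone V" using C(5,6) by (auto simp: cone_def)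
  next
    fix x assume x: "x \<in> z ` U \<inter> s -` cone V"
    then have "proj_point (s x) \<in> U \<inter> V" "z (proj_point (s x)) = x" using C(8,9) by (auto simp: cone_def)
    then show "x \<in> z ` (U \<inter> V)" by (metis imageI)
  qed
  have "open (z ` (U \<inter> V))" unfolding e by (rule continuous_open_preimage[OF holo_on_continuous[OF C(4)] C(2) oc])
  moreover have "holo_on (\<lambda>v. z (proj_point v)) (cone (U \<inter> V))" by (rule holo_on_subset[OF C(3)]) (auto simp: cone_def)
  moreover have "holo_on s (z ` (U \<inter> V))" by (rule holo_on_subset[OF C(4)]) auto
  ultimately show ?thesis unfolding coord_chart_def using C(1,5,6) V by auto
qed

lemma coord_chart_translate:
  assumes c: "coord_chart U z s"
  shows "coord_chart U (\<lambda>q. z q - a) (\<lambda>x. s (x + a))"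
proof -
  note C = coord_chartD[OF c]
  have e: "(\<lambda>q. z q - a) ` U = (\<lambda>x. x + a) -` (z ` U)" by (auto simp: algebra_simps image_iff)
  have hp: "holo_on (\<lambda>x. x + a) V" for V :: "(complex ^ 'a) set" by (intro holo_on_add holo_on_id holo_on_const)
  have "open ((\<lambda>q. z q - a) ` U)" unfolding e by (rule open_vimage[OF C(2) holo_on_continuous[OF hp]])
  moreover have "holo_on (\<lambda>v. z (proj_point v) - a) (cone U)" using holo_on_add[OF C(3) holo_on_const[of "- a"]] by simp
  moreover have "holo_on (\<lambda>x. s (x + a)) ((\<lambda>q. z q - a) ` U)" by (rule holo_on_compose[OF C(4) hp]) auto
  ultimately show ?thesis unfolding coord_chart_def using C(1,5,6) by auto
qed

lemma open_coordinate_ball: "coordinate_ball B ==> open B"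
  unfolding coordinate_ball_def using chart_open[OF _ open_ball] by blast

lemma chart_nonzero_open:
  assumes "coord_chart U z s"
  shows "open {p \<in> U. \<forall>j\<in>J. z p $ j \<noteq> 0}"
proof -
  have "open {x :: complex ^ 'a. \<forall>j\<in>J. x $ j \<noteq> 0}"
  proof -
    have "{x :: complex ^ 'a. \<forall>j\<in>J. x $ j \<noteq> 0} = (\<Inter>j\<in>J. {x. x $ j \<noteq> 0})" by auto
    moreover have "open {x :: complex ^ 'a. x $ j \<noteq> 0}" for j
      using open_vimage[OF open_Compl[OF closed_singleton], of "\<lambda>x :: complex ^ 'a. x $ j" 0] by (simp add: vimage_def continuous_on_component)
    ultimately show ?thesis by (simp add: open_INT)
  qed
  from chart_open[OF assms this] show ?thesis by simp
qed

text \<open>Near \<open>q\<close> only the coordinates that vanish at \<open>q\<close> can vanish,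
  and there are r of them; so the condition that exactly r coordinates vanish becomes the vanishing
  of these r.\<close>

lemma adapted_of_coordinates:
  assumes c: "coord_chart U z s" and S: "S \<inter> U = {q \<in> U. card {j \<in> J. z q $ j = 0} = r}" and q: "q \<in> S" "q \<in> U" and B: "open B" "q \<in> B"
  obtains U' z' s' I where "adapted_chart S U' z' s' I" "q \<in> U'" "U' \<subseteq> B" "card (I :: 'n::finite set) = CARD('n) - r"
proof -
  define J' where "J' = {j \<in> J. z q $ j = 0}"
  define U' where "U' = U \<inter> (B \<inter> {p \<in> U. \<forall>j\<in>J - J'. z p $ j \<noteq> 0})"
  have cc: "coord_chart U' (\<lambda>p. z p - z q) (\<lambda>x. s (x + z q))" unfolding U'_def
    by (rule coord_chart_translate[OF coord_chart_restrict[OF c open_Int[OF B(1) chart_nonzero_open[OF c]]]])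
  have r: "card J' = r" unfolding J'_def using S q by blast
  have "p \<in> S \<longleftrightarrow> (\<forall>i. i \<notin> - J' --> (z p - z q) $ i = 0)" if p: "p \<in> U'" for p
  proof -
    have sub: "{j \<in> J. z p $ j = 0} \<subseteq> J'" using p by (auto simp: U'_def)
    have "p \<in> S \<longleftrightarrow> card {j \<in> J. z p $ j = 0} = card J'" using p S r by (auto simp: U'_def)
    also have "\<dots> \<longleftrightarrow> {j \<in> J. z p $ j = 0} = J'" using card_subset_eq[OF finite sub] by auto
    also have "\<dots> \<longleftrightarrow> (\<forall>j\<in>J'. z p $ j = 0)" using sub by (auto simp: J'_def)
    also have "\<dots> \<longleftrightarrow> (\<forall>i. i \<notin> - J' --> (z p - z q) $ i = 0)" by (auto simp: J'_def)
    finally show ?thesis .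
  qed
  then have "adapted_chart S U' (\<lambda>p. z p - z q) (\<lambda>x. s (x + z q)) (- J')" unfolding adapted_chart_def using cc by auto
  moreover have "q \<in> U'" using q B by (auto simp: U'_def J'_def)
  moreover have "U' \<subseteq> B" by (auto simp: U'_def)
  moreover have "card (- J') = CARD('n) - r" using r by (simp add: Compl_eq_Diff_UNIV card_Diff_subset)
  ultimately show ?thesis by (rule that)
qed

lemma smooth_of_coordinates:
  fixes U :: "'n::finite proj set"
  assumes c: "coord_chart U z s" and S: "S \<inter> U = {q \<in> U. card {j \<in> J. z q $ j = 0} = r}"
  shows "q \<in> S ==> q \<in> U ==> smooth_at S (CARD('n) - r) q"
    "open B ==> B \<subseteq> U ==> smooth_of_pure_dim (B \<inter> S) (CARD('n) - r)"
proof -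
  show "smooth_at S (CARD('n) - r) q" if q: "q \<in> S" "q \<in> U"
    by (rule adapted_of_coordinates[OF c S q open_UNIV UNIV_I]) (use q in \<open>auto simp: smooth_at_def\<close>)
  assume B: "open B" "B \<subseteq> U"
  show "smooth_of_pure_dim (B \<inter> S) (CARD('n) - r)" unfolding smooth_of_pure_dim_def
  proof
    fix q assume q: "q \<in> B \<inter> S"
    have qq: "q \<in> S" "q \<in> U" "q \<in> B" using q B(2) by auto
    obtain U' z' s' I where a: "adapted_chart S U' z' s' I" "q \<in> U'" "U' \<subseteq> B" "card (I :: 'n set) = CARD('n) - r"
      by (rule adapted_of_coordinates[OF c S qq(1,2) B(1) qq(3)])
    have "adapted_chart (B \<inter> S) U' z' s' I" using a(1,3) unfolding adapted_chart_def by blast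
    then show "smooth_at (B \<inter> S) (CARD('n) - r) q" unfolding smooth_at_def using q a by blast
  qed
qed

lemma normal_crossings_of_coordinates:
  fixes U :: "'n::finite proj set"
  assumes c: "coord_chart U z s" and S: "S \<inter> U = {q \<in> U. \<exists>j\<in>J. z q $ j = 0}" and B: "open B" "B \<subseteq> U"
  shows "normal_crossings_divisor B (B \<inter> S)"
  unfolding normal_crossings_divisor_def
proof (intro conjI ballI)
  fix q assume q: "q \<in> B"
  define J' where "J' = {j \<in> J. z q $ j = 0}"
  define U' where "U' = U \<inter> (B \<inter> {p \<in> U. \<forall>j\<in>J - J'. z p $ j \<noteq> 0})"
  have cc: "coord_chart U' (\<lambda>p. z p - z q) (\<lambda>x. s (x + z q))" unfolding U'_def
    by (rule coord_chart_translate[OF coord_chart_restrict[OF c open_Int[OF B(1) chart_nonzero_open[OF c]]]])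
  have qU: "q \<in> U'" "U' \<subseteq> B" using q B(2) by (auto simp: U'_def J'_def)
  have "p \<in> B \<inter> S \<longleftrightarrow> (\<exists>j\<in>J'. (z p - z q) $ j = 0)" if p: "p \<in> U'" for p
  proof -
    have "p \<in> B \<inter> S \<longleftrightarrow> (\<exists>j\<in>J. z p $ j = 0)" using p S by (auto simp: U'_def)
    also have "\<dots> \<longleftrightarrow> (\<exists>j\<in>J'. z p $ j = 0)" using p by (auto simp: U'_def J'_def)
    also have "\<dots> \<longleftrightarrow> (\<exists>j\<in>J'. (z p - z q) $ j = 0)" by (auto simp: J'_def)
    finally show ?thesis .
  qed
  then have e: "B \<inter> S \<inter> U' = {p \<in> U'. \<exists>j\<in>J'. (z p - z q) $ j = 0}" by blast
  show "\<exists>U z s J. coord_chart U z s \<and> q \<in> U \<and> U \<subseteq> B \<and> z q = 0 \<and> B \<inter> S \<inter> U = {p \<in> U. \<exists>j\<in>J. z p $ j = 0}"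
    by (intro exI[of _ U'] exI[of _ "\<lambda>p. z p - z q"] exI[of _ "\<lambda>x. s (x + z q)"] exI[of _ J'] conjI cc qU e) simp
qed blast

lemma coordinates_nonempty:
  fixes U :: "'n::finite proj set"
  assumes c: "coord_chart U z s" and S: "S \<inter> U = {q \<in> U. card {j \<in> J. z q $ j = 0} = r}" and r: "r \<le> card J"
    and B: "open B" "q \<in> B" "q \<in> U" "z q = 0"
  shows "B \<inter> S \<noteq> {}"
proof -
  note C = coord_chartD[OF c]
  have cc: "coord_chart (U \<inter> B) z s" by (rule coord_chart_restrict[OF c B(1)])
  have "0 \<in> z ` (U \<inter> B)" using B by (intro image_eqI[of _ _ q]) auto
  then obtain \<rho> where \<rho>: "\<rho> > 0" "ball 0 \<rho> \<subseteq> z ` (U \<inter> B)" using coord_chartD(2)[OF cc] by (meson open_contains_ball)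
  obtain J' where J': "J' \<subseteq> J" "card J' = r" using r by (metis obtain_subset_with_card_n)
  \<comment> \<open>The vector has exactly the r zero coordinates in \<open>J'\<close>; a small
    positive multiple brings it into the chart.\<close>
  define y :: "complex ^ 'n" where "y = (\<chi> j. if j \<in> J' then 0 else 1)"
  define \<eta> where "\<eta> = \<rho> / (2 * (norm y + 1))"
  have \<eta>: "\<eta> > 0" using \<rho>(1) norm_ge_zero[of y] by (simp add: \<eta>_def add_nonneg_pos)
  have "norm (complex_of_real \<eta> *s y) < \<rho>"
  proof -
    have "\<eta> * norm y \<le> \<eta> * (norm y + 1)" using \<eta> by simp
    also have "\<dots> = \<rho> / 2" using norm_ge_zero[of y] by (simp add: \<eta>_def field_simps add_nonneg_eq_0_iff)
    finally show ?thesis using \<rho>(1) \<eta> by simp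
  qed
  then have "complex_of_real \<eta> *s y \<in> z ` (U \<inter> B)" using \<rho>(2) by (auto simp: dist_norm)
  then obtain p where p: "p \<in> U \<inter> B" "z p = complex_of_real \<eta> *s y" by auto
  have "{j \<in> J. z p $ j = 0} = J'" using J'(1) \<eta> by (auto simp: p(2) y_def)
  then have "p \<in> S" using S p(1) J'(2) by auto
  then show ?thesis using p(1) by blast
qed

section \<open>Multiplicities along the dual variety\<close>

text \<open>Synthetic division determines the coefficients of \<open>R n\<close> from those of
  \<open>Q n\<close> from the top down, starting at the common degree bound. So they converge too,
  and the factor with root \<open>a n\<close> tends to one with root 0.\<close>

lemma peel_root:
  fixes Q R :: "nat => complex poly"
  assumes Q: "\<And>i. (\<lambda>n. coeff (Q n) i) \<longlonglongrightarrow> coeff Q0 i" and d: "\<And>n. degree (Q n) \<le> d" and a: "a \<longlonglongrightarrow> 0" and e: "\<And>n. Q n = [:- a n, 1:] * R n"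
  obtains R0 where "\<And>i. (\<lambda>n. coeff (R n) i) \<longlonglongrightarrow> coeff R0 i" "Q0 = [:0, 1:] * R0"
proof -
  have dR: "degree (R n) \<le> d" for n
  proof (cases "R n = 0")
    case False
    then have "degree (Q n) = degree [:- a n, 1:] + degree (R n)" unfolding e by (intro degree_mult_eq) auto
    then show ?thesis using d[of n] by simp
  qed simp
  have rec: "coeff (R n) j = coeff (Q n) (Suc j) + a n * coeff (R n) (Suc j)" for n j
    by (simp add: e)
  have lim: "(\<lambda>n. coeff (R n) j) \<longlonglongrightarrow> coeff Q0 (Suc j)" if "d < j + k" for j k
    using that
  proof (induction k arbitrary: j)
    case 0
    then have "coeff (R n) j = coeff (Q n) (Suc j)" for n
      using rec[of n j] coeff_eq_0[of "R n" "Suc j"] dR[of n] by simp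
    then show ?case using Q[of "Suc j"] by simp
  next
    case (Suc k)
    then have "(\<lambda>n. coeff (R n) (Suc j)) \<longlonglongrightarrow> coeff Q0 (Suc (Suc j))" by simp
    from tendsto_add[OF Q[of "Suc j"] tendsto_mult[OF a this]]
    show ?case unfolding rec[symmetric] by simp
  qed
  obtain c R0 where R0: "Q0 = pCons c R0" by (cases Q0)
  have l: "(\<lambda>n. coeff (R n) j) \<longlonglongrightarrow> coeff R0 j" for j using lim[of j "Suc d"] R0 by simp
  have "coeff (Q n) 0 = - a n * coeff (R n) 0" for n by (simp add: e)
  moreover have "(\<lambda>n. - a n * coeff (R n) 0) \<longlonglongrightarrow> - 0 * coeff R0 0" by (intro tendsto_mult tendsto_minus a l)
  ultimately have "(\<lambda>n. coeff (Q n) 0) \<longlonglongrightarrow> 0" by simp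
  then have "c = 0" using LIMSEQ_unique[OF Q[of 0]] R0 by simp
  then have "Q0 = [:0, 1:] * R0" using R0 by simp
  with l show ?thesis by (rule that)
qed

lemma degree_cofactor: "P \<noteq> 0 ==> degree (P * R) \<le> d ==> degree R \<le> d" for R :: "complex poly"
  by (cases "R = 0") (auto simp: degree_mult_eq)

lemma peel_power:
  fixes Q R :: "nat => complex poly"
  assumes "\<And>i. (\<lambda>n. coeff (Q n) i) \<longlonglongrightarrow> coeff Q0 i" "\<And>n. degree (Q n) \<le> d" "a \<longlonglongrightarrow> 0" "\<And>n. Q n = [:- a n, 1:] ^ m * R n"
  shows "\<exists>R0. (\<forall>i. (\<lambda>n. coeff (R n) i) \<longlonglongrightarrow> coeff R0 i) \<and> Q0 = [:0, 1:] ^ m * R0"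
  using assms
proof (induction m arbitrary: Q Q0)
  case 0
  then show ?case by (intro exI[of _ Q0]) simp
next
  case (Suc m)
  have e: "Q n = [:- a n, 1:] * ([:- a n, 1:] ^ m * R n)" for n unfolding Suc.prems(4) by (simp only: power_Suc mult.assoc)
  obtain S0 where S0: "\<And>i. (\<lambda>n. coeff ([:- a n, 1:] ^ m * R n) i) \<longlonglongrightarrow> coeff S0 i" "Q0 = [:0, 1:] * S0"
    by (rule peel_root[OF Suc.prems(1,2,3) e]) blast
  have dg: "degree ([:- a n, 1:] ^ m * R n) \<le> d" for n
    by (rule degree_cofactor[of "[:- a n, 1:]"]) (use Suc.prems(2)[of n] e[of n] in auto)
  obtain R0 where R0: "\<forall>i. (\<lambda>n. coeff (R n) i) \<longlonglongrightarrow> coeff R0 i" "S0 = [:0, 1:] ^ m * R0"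
    using Suc.IH[OF S0(1) dg Suc.prems(3) refl] by blast
  then show ?case using S0(2) by (intro exI[of _ R0]) (simp only: power_Suc mult.assoc simp_thms)
qed

lemma peel_prod:
  fixes Q R :: "nat => complex poly"
  assumes "finite D" "\<And>i. (\<lambda>n. coeff (Q n) i) \<longlonglongrightarrow> coeff Q0 i" "\<And>n. degree (Q n) \<le> d" "\<And>p. p \<in> D ==> a p \<longlonglongrightarrow> 0"
    "\<And>n. Q n = (\<Prod>p\<in>D. [:- a p n, 1:] ^ m) * R n"
  shows "\<exists>R0. (\<forall>i. (\<lambda>n. coeff (R n) i) \<longlonglongrightarrow> coeff R0 i) \<and> Q0 = [:0, 1:] ^ (m * card D) * R0"
  using assms
proof (induction D arbitrary: Q Q0 rule: finite_induct)
  case empty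
  then show ?case by (intro exI[of _ Q0]) simp
next
  case (insert p D)
  let ?S = "\<lambda>n. (\<Prod>p\<in>D. [:- a p n, 1:] ^ m) * R n"
  have e: "Q n = [:- a p n, 1:] ^ m * ?S n" for n unfolding insert.prems(4) prod.insert[OF insert.hyps] by (simp only: mult.assoc)
  have ap: "a p \<longlonglongrightarrow> 0" using insert.prems(3) by blast
  obtain S0 where S0: "\<forall>i. (\<lambda>n. coeff (?S n) i) \<longlonglongrightarrow> coeff S0 i" "Q0 = [:0, 1:] ^ m * S0"
    using peel_power[OF insert.prems(1,2) ap e] by blast
  have dg: "degree (?S n) \<le> d" for n
    by (rule degree_cofactor[of "[:- a p n, 1:] ^ m"]) (use insert.prems(2)[of n] e[of n] in auto)
  obtain R0 where R0: "\<forall>i. (\<lambda>n. coeff (R n) i) \<longlonglongrightarrow> coeff R0 i" "S0 = [:0, 1:] ^ (m * card D) * R0"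
    using insert.IH[OF _ dg _ refl, of S0] S0(1) insert.prems(3) by blast
  have "m * card (insert p D) = m + m * card D" using insert.hyps by simp
  then show ?case using S0(2) R0 by (intro exI[of _ R0]) (simp only: power_add mult.assoc simp_thms)
qed

lemma prod_roots_dvd:
  fixes Q :: "complex poly"
  assumes "finite D" "inj_on t D" "\<And>p. p \<in> D ==> [:- t p, 1:] ^ m dvd Q"
  shows "(\<Prod>p\<in>D. [:- t p, 1:] ^ m) dvd Q"
  using assms
proof (induction D rule: finite_induct)
  case (insert p D)
  let ?P = "\<Prod>p\<in>D. [:- t p, 1:] ^ m"
  have "?P dvd Q" using insert by auto
  then obtain R where R: "Q = ?P * R" by (elim dvdE)
  have "[:- t p, 1:] ^ m dvd R"
  proof (cases "Q = 0")
    case True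
    have "?P \<noteq> 0" using insert.hyps(1) by simp
    then show ?thesis using True R by auto
  next
    case False
    have "poly ?P (t p) \<noteq> 0" unfolding poly_prod using insert.hyps insert.prems(1) by (auto simp: inj_on_def)
    then have "order (t p) ?P = 0" by (rule order_0I)
    then have "order (t p) Q = order (t p) R" using order_mult[of ?P R "t p"] False R by simp
    moreover have "m \<le> order (t p) Q" using insert.prems(2)[of p] False order_divides[of "t p" m Q] by simp
    ultimately show ?thesis by (simp add: order_divides)
  qed
  then show ?case unfolding prod.insert[OF insert.hyps] R by (subst mult.commute) (intro mult_dvd_mono dvd_refl)
qed simp

text \<open>Each linear factor t - z with |z| \<ge> \<rho> satisfies |t - z| \<le> |z| (1 + |t| /
  \<rho>). Used as a Hurwitz theorem in bounded degree: polynomials without small roots whose values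
  at 0 tend to 0 tend to 0 everywhere.\<close>

lemma no_small_root_bound:
  fixes p :: "complex poly"
  assumes "degree p \<le> d" "0 < \<rho>" "\<And>t. norm t < \<rho> ==> poly p t \<noteq> 0"
  shows "norm (poly p t) \<le> norm (poly p 0) * (1 + norm t / \<rho>) ^ d"
  using assms
proof (induction d arbitrary: p)
  case 0
  then obtain c where "p = [:c:]" by (metis degree_eq_zeroE le_zero_eq)
  then show ?case by simp
next
  case (Suc d)
  have ge1: "1 \<le> (1 + norm t / \<rho>) ^ k" for k using Suc.prems(2) by (intro one_le_power) simp
  show ?case
  proof (cases "degree p = 0")
    case True
    then obtain c where "p = [:c:]" by (metis degree_eq_zeroE)
    then show ?thesis using mult_left_mono[OF ge1[of "Suc d"], of "norm c"] by simp
  next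
    case False
    have "coeff p 0 = 0 \<or> (\<exists>i\<in>{1..degree p}. coeff p i \<noteq> 0)"
      using False by (intro disjI2 bexI[of _ "degree p"]) auto
    then obtain z where "(\<Sum>i\<le>degree p. coeff p i * z ^ i) = 0" by (rule fundamental_theorem_of_algebra)
    then have z: "poly p z = 0" by (simp add: poly_altdef)
    then obtain q where q: "p = [:- z, 1:] * q" by (auto simp: poly_eq_0_iff_dvd elim: dvdE)
    have z\<rho>: "\<rho> \<le> norm z" using Suc.prems(3)[of z] z by (meson not_less)
    have "q \<noteq> 0" using False q by auto
    then have "degree p = 1 + degree q" unfolding q by (subst degree_mult_eq) auto
    then have "degree q \<le> d" using Suc.prems(1) by simp
    moreover have "poly q s \<noteq> 0" if "norm s < \<rho>" for s using Suc.prems(3)[OF that] q by auto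
    ultimately have IH: "norm (poly q t) \<le> norm (poly q 0) * (1 + norm t / \<rho>) ^ d" using Suc.IH Suc.prems(2) by blast
    have "norm (t - z) \<le> norm t + norm z" by (rule norm_triangle_ineq4)
    also have "norm t \<le> norm z * (norm t / \<rho>)"
      using mult_right_mono[OF z\<rho>, of "norm t / \<rho>"] Suc.prems(2) by simp
    finally have tz: "norm (t - z) \<le> norm z * (1 + norm t / \<rho>)" by (simp add: algebra_simps)
    have "norm (poly p t) = norm (t - z) * norm (poly q t)" by (simp add: q norm_mult[symmetric] algebra_simps)
    also have "\<dots> \<le> (norm z * (1 + norm t / \<rho>)) * (norm (poly q 0) * (1 + norm t / \<rho>) ^ d)"
      using Suc.prems(2) by (intro mult_mono[OF tz IH]) auto
    also have "\<dots> = norm (poly p 0) * (1 + norm t / \<rho>) ^ Suc d" by (simp add: q norm_mult)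
    finally show ?thesis .
  qed
qed

lemma poly_tendsto:
  fixes R :: "nat => complex poly"
  assumes R: "\<And>i. (\<lambda>n. coeff (R n) i) \<longlonglongrightarrow> coeff R0 i" and d: "\<And>n. degree (R n) \<le> d"
  shows "(\<lambda>n. poly (R n) t) \<longlonglongrightarrow> poly R0 t"
proof -
  have e: "poly p t = (\<Sum>i\<le>d. coeff p i * t ^ i)" if "\<And>i. d < i ==> coeff p i = 0" for p :: "complex poly"
  proof -
    have "degree p \<le> d" by (rule degree_le) (use that in blast)
    then show ?thesis unfolding poly_altdef by (intro sum.mono_neutral_left) (auto simp: coeff_eq_0)
  qed
  have R0: "coeff (R n) i = 0" if "d < i" for n i using d[of n] that by (intro coeff_eq_0) simp
  have "coeff R0 i = 0" if "d < i" for i using LIMSEQ_unique[OF R[of i]] R0[OF that] by simp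
  then have "poly R0 t = (\<Sum>i\<le>d. coeff R0 i * t ^ i)" by (rule e)
  moreover have "poly (R n) t = (\<Sum>i\<le>d. coeff (R n) i * t ^ i)" for n by (rule e[OF R0])
  ultimately show ?thesis using R by (auto intro!: tendsto_intros)
qed

section \<open>Zeros of a form along lines, and branches of a hypersurface\<close>

lemma lpoly_root_factor:
  fixes F :: "complex ^ 'm::finite => complex"
  assumes F: "F \<in> forms d" and 0: "\<forall>k<m. coeff (lpoly F (x + \<tau> *s u) u) k = 0"
  shows "\<exists>T. lpoly F x u = [:- \<tau>, 1:] ^ m * T \<and> poly T \<tau> = coeff (lpoly F (x + \<tau> *s u) u) m"
proof -
  have "monom 1 m dvd lpoly F (x + \<tau> *s u) u" using 0 by (simp add: monom_1_dvd_iff')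
  then obtain S where S: "lpoly F (x + \<tau> *s u) u = monom 1 m * S" by (elim dvdE)
  have "lpoly F x u = [:- \<tau>, 1:] ^ m * pcompose S [:- \<tau>, 1:]"
  proof (rule lpoly_unique)
    fix t
    have "poly (lpoly F (x + \<tau> *s u) u) (t - \<tau>) = F (x + \<tau> *s u + (t - \<tau>) *s u)" by (rule forms_lpoly(1)[OF F])
    also have "x + \<tau> *s u + (t - \<tau>) *s u = x + t *s u" by (simp add: vec_eq_iff algebra_simps)
    finally show "poly ([:- \<tau>, 1:] ^ m * pcompose S [:- \<tau>, 1:]) t = F (x + t *s u)"
      by (simp add: S poly_monom poly_pcompose)
  qed
  moreover have "coeff (lpoly F (x + \<tau> *s u) u) m = coeff S 0" by (simp add: S coeff_monom_mult)
  ultimately show ?thesis by (intro exI[of _ "pcompose S [:- \<tau>, 1:]"]) (simp add: poly_pcompose poly_0_coeff_0)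
qed

text \<open>The map \<open>\<Gamma>\<close> straightens \<open>\<phi>\<close> along \<open>u\<close>: it fixes the component complementary to \<open>u\<close> and takes
  the value of \<open>\<phi>\<close> as the component along \<open>u\<close>.\<close>

lemma implicit_root:
  fixes \<phi> :: "complex ^ 'm::finite => complex"
  assumes \<epsilon>: "0 < \<epsilon>" and \<phi>: "shol \<phi> (ball h0 \<epsilon>)" "\<phi> h0 = 0" "\<And>k. fd \<phi> h0 k = dotp k v" and u: "dotp u v \<noteq> 0"
  shows "\<exists>r t. 0 < r \<and> shol t (ball 0 r) \<and> t 0 = 0 \<and> (\<forall>w. fd t 0 w = - dotp w v / dotp u v) \<and>
    (\<forall>w\<in>ball 0 r. h0 + w + t w *s u \<in> ball h0 \<epsilon> \<and> \<phi> (h0 + w + t w *s u) = 0) \<and>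
    (\<forall>w\<in>ball 0 r. \<forall>\<tau>. norm \<tau> < r --> \<phi> (h0 + w + \<tau> *s u) = 0 --> \<tau> = t w)"
proof -
  \<comment> \<open>The component along \<open>u\<close> for the decomposition into the line of
    \<open>u\<close> and the tangent hyperplane of \<phi>; it is 1 at \<open>u\<close>.\<close>
  define lf where "lf x = dotp x v / dotp u v" for x
  have lf: "lf (x + y) = lf x + lf y" "lf (x - y) = lf x - lf y" "lf (c *s x) = c * lf x" "lf 0 = 0" "lf u = 1" for x y c
    using u by (simp_all add: lf_def add_divide_distrib diff_divide_distrib)
  have lf1: "lf = (\<lambda>x. (1 / dotp u v) * dotp v x)" by (simp add: lf_def[abs_def] dotp_commute)
  have lfs: "shol lf V" for V unfolding lf1 by (intro shol_mult shol_const shol_forms[OF forms_dotp])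
  define \<Gamma> where "\<Gamma> x = x + (\<phi> (h0 + x) - lf x) *s u" for x
  have hp: "holo_on (\<lambda>x. h0 + x) V" for V :: "(complex ^ 'm) set" by (intro holo_on_add holo_on_id holo_on_const)
  have imb: "(\<lambda>x. h0 + x) ` ball 0 \<epsilon> \<subseteq> ball h0 \<epsilon>" by (auto simp: dist_norm)
  have \<Gamma>h: "holo_on \<Gamma> (ball 0 \<epsilon>)" unfolding \<Gamma>_def[abs_def]
    by (intro holo_on_add holo_on_id holo_on_scale holo_on_const shol_diff lfs shol_compose[OF \<phi>(1) hp imb])
  have b0: "0 \<in> ball 0 \<epsilon>" "h0 \<in> ball h0 \<epsilon>" using \<epsilon> by simp_all
  have inj: "k = 0" if k: "fd \<Gamma> 0 k = 0" for k
  proof -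
    have d\<phi>: "(\<phi> has_derivative (\<lambda>k. dotp k v)) (at h0)" using shol_fd[OF \<phi>(1) b0(2)] unfolding ext[of "fd \<phi> h0" "\<lambda>k. dotp k v", OF \<phi>(3)] .
    have "((\<lambda>x. h0 + x) has_derivative (\<lambda>k. k)) (at 0)" by (auto intro!: derivative_eq_intros)
    from has_derivative_compose[OF this, of \<phi> "\<lambda>k. dotp k v"] d\<phi>
    have d1: "((\<lambda>x. \<phi> (h0 + x)) has_derivative (\<lambda>k. dotp k v)) (at 0)" by simp
    have "((\<lambda>x. dotp x v) has_derivative (\<lambda>k. dotp k v)) (at 0)"
      using dotp_has_derivative[OF has_derivative_ident has_derivative_const[of v "at 0"]] by simp
    from has_derivative_mult_right[OF this, of "1 / dotp u v"]
    have d2: "(lf has_derivative lf) (at 0)" by (simp add: lf_def[abs_def])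
    have "(\<Gamma> has_derivative (\<lambda>k. k + (dotp k v - lf k) *s u)) (at 0)" unfolding \<Gamma>_def[abs_def] has_derivative_vec_iff
    proof
      fix i
      show "((\<lambda>x. (x + (\<phi> (h0 + x) - lf x) *s u) $ i) has_derivative (\<lambda>k. (k + (dotp k v - lf k) *s u) $ i)) (at 0)"
        unfolding vector_add_component vector_smult_component
        by (intro has_derivative_add has_derivative_mult_left has_derivative_diff d1 d2
          bounded_linear_imp_has_derivative bounded_linear_vec_nth)
    qed
    then have e: "k + (dotp k v - lf k) *s u = 0" using trans[OF fun_cong[OF frechet_derivative_at, of \<Gamma> _ 0 k] k] by blast
    define s where "s = lf k - dotp k v"
    have ks: "k = s *s u"
    proof -
      have "k = - ((dotp k v - lf k) *s u)" using e by (rule eq_neg_iff_add_eq_0[THEN iffD2])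
      also have "\<dots> = s *s u" unfolding s_def by (simp add: vec_eq_iff algebra_simps)
      finally show ?thesis .
    qed
    have l: "lf k = s" unfolding ks by (simp add: lf)
    have dk: "dotp k v = s * dotp u v" unfolding ks by simp
    have "s = s - s * dotp u v" using s_def unfolding l dk .
    then have "s = 0" using u by simp
    then have "s *s u = 0" by simp
    then show ?thesis unfolding ks[symmetric] .
  qed
  obtain U W g where UW: "open U" "U \<subseteq> ball 0 \<epsilon>" "0 \<in> U" "open W" "\<Gamma> 0 \<in> W" and hom: "homeomorphism U W \<Gamma> g" and g: "holo_on g W"
    and "\<And>x. x \<in> U ==> bij (fd \<Gamma> x)"
    and "\<And>x u. x \<in> U ==> fd g (\<Gamma> x) (fd \<Gamma> x u) = u"
    apply (rule holo_inverse[OF \<Gamma>h open_ball b0(1) inj])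
     apply assumption
    apply (rule that)
            prefer 6 apply assumption
           apply assumption+
    done
  have g\<Gamma>: "g (\<Gamma> x) = x" if "x \<in> U" for x using hom that by (auto simp: homeomorphism_def)
  have \<Gamma>g: "g y \<in> U" "\<Gamma> (g y) = y" if "y \<in> W" for y using hom that by (auto simp: homeomorphism_def)
  have \<Gamma>0: "\<Gamma> 0 = 0" by (simp add: \<Gamma>_def \<phi>(2) lf)
  \<comment> \<open>Points of the zero set of \<phi> are those that \<Gamma> sends to vectors
    without component along \<open>u\<close>. Projecting \<open>w\<close> along \<open>u\<close> and
    applying the inverse of \<Gamma> thus finds the zero on the line through
    \<open>w\<close>.\<close>
  define \<pi> where "\<pi> w = w - lf w *s u" for w
  have \<pi>h: "holo_on \<pi> V" for V unfolding \<pi>_def[abs_def] by (intro holo_on_diff holo_on_id holo_on_scale holo_on_const lfs)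
  have "open (\<pi> -` W)" by (rule open_vimage[OF UW(4) holo_on_continuous[OF \<pi>h]])
  moreover have "0 \<in> \<pi> -` W" using UW(5) by (simp add: \<pi>_def lf \<Gamma>0)
  ultimately obtain r1 where r1: "r1 > 0" "ball 0 r1 \<subseteq> \<pi> -` W" by (meson open_contains_ball)
  obtain r2 where r2: "r2 > 0" "ball 0 r2 \<subseteq> U" using UW(1,3) by (meson open_contains_ball)
  define r where "r = min r1 (r2 / (1 + norm u))"
  have r: "r > 0" "ball 0 r \<subseteq> \<pi> -` W" using r1 r2(1) by (auto simp: r_def add_pos_nonneg)
  define t where "t w = lf (g (\<pi> w)) - lf w" for w
  have g\<pi>: "g (\<pi> w) = w + t w *s u" "\<phi> (h0 + w + t w *s u) = 0" "w + t w *s u \<in> U" if w: "w \<in> ball 0 r" for w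
  proof -
    let ?x = "g (\<pi> w)"
    have W: "\<pi> w \<in> W" using r(2) w by blast
    have e: "?x + (\<phi> (h0 + ?x) - lf ?x) *s u = w - lf w *s u" using \<Gamma>g(2)[OF W] by (simp add: \<Gamma>_def \<pi>_def)
    from arg_cong[OF e, of lf] have f0: "\<phi> (h0 + ?x) = 0" by (simp add: lf)
    show x: "?x = w + t w *s u" using e unfolding f0 by (simp add: t_def vec_eq_iff algebra_simps)
    show "\<phi> (h0 + w + t w *s u) = 0" using f0 unfolding x by (simp add: add.assoc)
    show "w + t w *s u \<in> U" using \<Gamma>g(1)[OF W] x by simp
  qed
  have ts: "shol t (ball 0 r)" unfolding t_def[abs_def]
    by (intro shol_diff lfs shol_compose[OF lfs holo_on_compose[OF g \<pi>h]]) (use r(2) in auto)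
  have inb: "h0 + w + t w *s u \<in> ball h0 \<epsilon>" if "w \<in> ball 0 r" for w
  proof -
    have "h0 + (w + t w *s u) \<in> ball h0 \<epsilon>" using g\<pi>(3)[OF that] UW(2) imb by blast
    then show ?thesis by (simp add: add.assoc)
  qed
  have t0: "t 0 = 0" using g\<Gamma>[OF UW(3)] by (simp add: t_def \<pi>_def lf \<Gamma>0)
  have r0: "0 \<in> ball 0 r" using r by simp
  have "fd t 0 w = - dotp w v / dotp u v" for w
  proof -
    have d1: "((\<lambda>w. h0 + w + t w *s u) has_derivative (\<lambda>k. k + fd t 0 k *s u)) (at 0)" unfolding has_derivative_vec_iff
    proof
      fix i
      have "((\<lambda>w. h0 $ i + w $ i + t w * u $ i) has_derivative (\<lambda>k. 0 + k $ i + fd t 0 k * u $ i)) (at 0)"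
        by (intro has_derivative_add has_derivative_const has_derivative_mult_left shol_fd[OF ts r0]
          bounded_linear_imp_has_derivative bounded_linear_vec_nth)
      then show "((\<lambda>w. (h0 + w + t w *s u) $ i) has_derivative (\<lambda>k. (k + fd t 0 k *s u) $ i)) (at 0)" by simp
    qed
    have "(\<phi> has_derivative fd \<phi> h0) (at (h0 + 0 + t 0 *s u))" using shol_fd[OF \<phi>(1) b0(2)] t0 by simp
    from has_derivative_compose[OF d1 this]
    have "((\<lambda>w. \<phi> (h0 + w + t w *s u)) has_derivative (\<lambda>k. dotp (k + fd t 0 k *s u) v)) (at 0)" unfolding \<phi>(3) .
    from fun_cong[OF frechet_derivative_at[OF this], of w]
    have "fd (\<lambda>w. \<phi> (h0 + w + t w *s u)) 0 w = dotp w v + fd t 0 w * dotp u v" by simp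
    moreover have "fd (\<lambda>w. \<phi> (h0 + w + t w *s u)) 0 = fd (\<lambda>w. 0) 0"
      by (rule fd_cong[OF shol_const open_ball r0]) (simp add: g\<pi>(2))
    ultimately have "dotp w v + fd t 0 w * dotp u v = 0" by (simp add: frechet_derivative_const)
    then show ?thesis using u by (simp add: field_simps eq_neg_iff_add_eq_0)
  qed
  moreover have "\<tau> = t w" if w: "w \<in> ball 0 r" and \<tau>: "norm \<tau> < r" and z: "\<phi> (h0 + w + \<tau> *s u) = 0" for w \<tau>
  proof -
    let ?x = "w + \<tau> *s u"
    have "norm ?x \<le> norm w + norm \<tau> * norm u" by (rule order_trans[OF norm_triangle_ineq]) simp
    also have "\<dots> < r + r * norm u"
      using w \<tau> by (intro add_less_le_mono mult_right_mono) (auto simp: dist_norm)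
    also have "\<dots> = r * (1 + norm u)" by (simp add: algebra_simps)
    also have "\<dots> \<le> r2 / (1 + norm u) * (1 + norm u)" by (intro mult_right_mono) (auto simp: r_def)
    also have "\<dots> = r2" using norm_ge_zero[of u] by (simp add: add_nonneg_eq_0_iff)
    finally have xU: "?x \<in> U" using r2(2) by (auto simp: dist_norm)
    have "h0 + ?x = h0 + w + \<tau> *s u" by (simp add: add.assoc)
    then have "\<Gamma> ?x = \<pi> w" using z by (simp add: \<Gamma>_def \<pi>_def lf vec_eq_iff algebra_simps)
    then have "g (\<pi> w) = ?x" using g\<Gamma>[OF xU] by simp
    then show ?thesis by (simp add: t_def lf)
  qed
  ultimately show ?thesis using r(1) ts t0 inb g\<pi>(2) by blast
qed

text \<open>Different branches are only asked to have different tangent hyperplanes. Multiplicities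
  are needed at every point of the nodal locus, where linear independence of the lifts of the nodes
  is not known.\<close>

definition branches :: "'n::finite proj set => complex ^ 'n option => 'p set => real =>
    ('p => complex ^ 'n option => complex) => ('p => complex ^ 'n option) => bool" where
  "branches S h0 D \<epsilon> \<phi> v \<longleftrightarrow> finite D \<and> 0 < \<epsilon> \<and>
     (\<forall>p\<in>D. shol (\<phi> p) (ball h0 \<epsilon>) \<and> \<phi> p h0 = 0 \<and> (\<forall>k. fd (\<phi> p) h0 k = dotp k (v p)) \<and> v p \<noteq> 0) \<and>
     (\<forall>p\<in>D. \<forall>q\<in>D. p \<noteq> q --> (\<exists>w. dotp w (v p) = 0 \<and> dotp w (v q) \<noteq> 0)) \<and>
     (\<forall>h\<in>ball h0 \<epsilon>. h \<noteq> 0 \<and> (proj_point h \<in> S \<longleftrightarrow> (\<exists>p\<in>D. \<phi> p h = 0)))"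

lemma poly_zero_near:
  fixes p :: "complex poly"
  assumes "0 < r" "\<And>t. 0 < norm t ==> norm t < r ==> poly p t = 0"
  shows "p = 0"
proof (rule poly_eqI)
  fix l
  have "coeff p l = 0" by (rule poly_small_coeff[OF assms(1), of p 0 "Suc l"]) (use assms(2) in auto)
  then show "coeff p l = coeff 0 l" by simp
qed

lemma branches_roots:
  fixes h0 :: "complex ^ 'n::finite option" and \<phi> :: "'p => complex ^ 'n option => complex"
  assumes B: "branches S h0 D \<epsilon> \<phi> v" and u: "\<forall>p\<in>D. dotp u (v p) \<noteq> 0"
  obtains r t where "0 < r" "r \<le> 1" "\<forall>p\<in>D. shol (t p) (ball 0 r) \<and> t p 0 = 0 \<and> (\<forall>w. fd (t p) 0 w = - dotp w (v p) / dotp u (v p))"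
    "\<forall>p\<in>D. \<forall>w\<in>ball 0 r. h0 + w + t p w *s u \<in> ball h0 \<epsilon> \<and> \<phi> p (h0 + w + t p w *s u) = 0"
    "\<forall>p\<in>D. \<forall>w\<in>ball 0 r. \<forall>\<tau>. norm \<tau> < r --> \<phi> p (h0 + w + \<tau> *s u) = 0 --> \<tau> = t p w"
    "\<forall>w\<in>ball 0 r. \<forall>\<tau>. norm \<tau> < r --> h0 + w + \<tau> *s u \<in> ball h0 \<epsilon>"
proof -
  have fin: "finite D" and \<epsilon>: "0 < \<epsilon>" using B by (auto simp: branches_def)
  define P where "P p r t \<longleftrightarrow> 0 < r \<and> shol t (ball 0 r) \<and> t 0 = 0 \<and> (\<forall>w. fd t 0 w = - dotp w (v p) / dotp u (v p)) \<and>
    (\<forall>w\<in>ball 0 r. h0 + w + t w *s u \<in> ball h0 \<epsilon> \<and> \<phi> p (h0 + w + t w *s u) = 0) \<and>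
    (\<forall>w\<in>ball 0 r. \<forall>\<tau>. norm \<tau> < r --> \<phi> p (h0 + w + \<tau> *s u) = 0 --> \<tau> = t w)" for p r t
  have "\<forall>p\<in>D. \<exists>r t. P p r t"
  proof
    fix p assume p: "p \<in> D"
    have \<phi>: "shol (\<phi> p) (ball h0 \<epsilon>)" "\<phi> p h0 = 0" "\<And>k. fd (\<phi> p) h0 k = dotp k (v p)" "dotp u (v p) \<noteq> 0"
      using B u p unfolding branches_def by blast+
    show "\<exists>r t. P p r t" unfolding P_def by (rule implicit_root[OF \<epsilon> \<phi>])
  qed
  from bchoice[OF this] obtain r where "\<forall>p\<in>D. \<exists>t. P p (r p) t" by (elim exE) (erule that)
  from bchoice[OF this] obtain t where t: "\<forall>p\<in>D. P p (r p) (t p)" by (elim exE) (erule that)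
  then have r: "\<forall>p\<in>D. 0 < r p" unfolding P_def by blast
  note t = t[unfolded P_def]
  define r0 where "r0 = Min (insert 1 (insert (\<epsilon> / (1 + norm u)) (r ` D)))"
  have nu: "1 + norm u > 0" using norm_ge_zero[of u] by linarith
  have r0: "r0 > 0" unfolding r0_def using fin r \<epsilon> nu by (subst Min_gr_iff) auto
  have fA: "finite (insert 1 (insert (\<epsilon> / (1 + norm u)) (r ` D)))" using fin by simp
  have le: "r0 \<le> 1" "r0 \<le> \<epsilon> / (1 + norm u)" "p \<in> D ==> r0 \<le> r p" for p unfolding r0_def by (rule Min_le[OF fA]; simp)+
  have sub: "ball 0 r0 \<subseteq> ball (0 :: complex ^ 'n option) (r p)" if "p \<in> D" for p using le(3)[OF that] by (rule subset_ball)
  have nt: "norm \<tau> < r p" if "norm \<tau> < r0" "p \<in> D" for \<tau> :: complex and p using that(1) le(3)[OF that(2)] by simp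
  have inb: "h0 + w + \<tau> *s u \<in> ball h0 \<epsilon>" if w: "w \<in> ball 0 r0" and \<tau>: "norm \<tau> < r0" for w \<tau>
  proof -
    have "norm (w + \<tau> *s u) \<le> norm w + norm \<tau> * norm u" by (rule order_trans[OF norm_triangle_ineq]) simp
    also have "\<dots> < r0 + r0 * norm u" using w \<tau> by (intro add_less_le_mono mult_right_mono) (auto simp: dist_norm)
    also have "\<dots> = r0 * (1 + norm u)" by (simp add: algebra_simps)
    also have "\<dots> \<le> \<epsilon> / (1 + norm u) * (1 + norm u)" by (rule mult_right_mono[OF le(2)]) (use nu in simp)
    also have "\<dots> = \<epsilon>" using nu by simp
    finally have "norm (w + \<tau> *s u) < \<epsilon>" .
    moreover have "h0 - (h0 + w + \<tau> *s u) = - (w + \<tau> *s u)" by simp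
    then have "dist h0 (h0 + w + \<tau> *s u) = norm (w + \<tau> *s u)" by (simp only: dist_norm norm_minus_cancel)
    ultimately show ?thesis by simp
  qed
  have sh: "shol (t p) (ball 0 r0)" if "p \<in> D" for p
  proof -
    have "shol (t p) (ball 0 (r p))" using t that by blast
    then show ?thesis using sub[OF that] unfolding shol_def by blast
  qed
  show ?thesis
  proof (rule that[OF r0 le(1)])
    show "\<forall>p\<in>D. shol (t p) (ball 0 r0) \<and> t p 0 = 0 \<and> (\<forall>w. fd (t p) 0 w = - dotp w (v p) / dotp u (v p))" using t sh by blast
    show "\<forall>p\<in>D. \<forall>w\<in>ball 0 r0. h0 + w + t p w *s u \<in> ball h0 \<epsilon> \<and> \<phi> p (h0 + w + t p w *s u) = 0" using t sub by blast
    show "\<forall>p\<in>D. \<forall>w\<in>ball 0 r0. \<forall>\<tau>. norm \<tau> < r0 --> \<phi> p (h0 + w + \<tau> *s u) = 0 --> \<tau> = t p w" using t sub nt by blast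
  qed (use inb in blast)
qed

text \<open>For generic small \<open>w\<close>, the line through \<open>h0 + w\<close> in the direction \<open>u\<close> meets the branches in distinct points,
  each a zero of order at least \<open>m\<close> of \<open>F\<close>; the conclusion results from letting \<open>w\<close> tend to \<open>0\<close>.\<close>

lemma branches_factor:
  fixes F :: "complex ^ 'n::finite option => complex" and \<phi> :: "'p => complex ^ 'n option => complex"
  assumes B: "branches S h0 D \<epsilon> \<phi> v" and F: "F \<in> forms d"
    and van: "\<And>h k u. h \<noteq> 0 ==> proj_point h \<in> S ==> k < m ==> coeff (lpoly F h u) k = 0"
    and u: "\<forall>p\<in>D. dotp u (v p) \<noteq> 0"
  obtains R0 where "lpoly F h0 u = [:0, 1:] ^ (m * card D) * R0"
    "(\<And>h. h \<noteq> 0 ==> F h = 0 ==> proj_point h \<in> S) ==>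
      (\<And>p \<rho>. p \<in> D ==> 0 < \<rho> ==> \<exists>h\<in>ball h0 \<rho>. \<phi> p h = 0 \<and> coeff (lpoly F h u) m \<noteq> 0) ==> coeff R0 0 \<noteq> 0"
proof -
  have fin: "finite D" and ne: "\<And>p q. p \<in> D ==> q \<in> D ==> p \<noteq> q ==> \<exists>w. dotp w (v p) = 0 \<and> dotp w (v q) \<noteq> 0"
    and S: "\<And>h. h \<in> ball h0 \<epsilon> ==> h \<noteq> 0" "\<And>h. h \<in> ball h0 \<epsilon> ==> proj_point h \<in> S \<longleftrightarrow> (\<exists>p\<in>D. \<phi> p h = 0)"
    using B by (auto simp: branches_def)
  obtain r t where r: "0 < r" "r \<le> 1" and t: "\<forall>p\<in>D. shol (t p) (ball 0 r) \<and> t p 0 = 0 \<and> (\<forall>w. fd (t p) 0 w = - dotp w (v p) / dotp u (v p))"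
    and tz: "\<forall>p\<in>D. \<forall>w\<in>ball 0 r. h0 + w + t p w *s u \<in> ball h0 \<epsilon> \<and> \<phi> p (h0 + w + t p w *s u) = 0"
    and tu: "\<forall>p\<in>D. \<forall>w\<in>ball 0 r. \<forall>\<tau>. norm \<tau> < r --> \<phi> p (h0 + w + \<tau> *s u) = 0 --> \<tau> = t p w"
    and inb: "\<forall>w\<in>ball 0 r. \<forall>\<tau>. norm \<tau> < r --> h0 + w + \<tau> *s u \<in> ball h0 \<epsilon>"
    by (rule branches_roots[OF B u])
  define a where "a p w = h0 + w + t p w *s u" for p w
  define c where "c p w = coeff (lpoly F (a p w) u) m" for p w
  \<comment> \<open>The branches near which the coefficient of order m does not vanish identically.
    The first conclusion is about all branches, the second will be in a situation where
    \<open>D'\<close> is all of \<open>D\<close>.\<close>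
  define D' where "D' = {p \<in> D. \<forall>\<rho>>0. \<exists>w\<in>ball 0 \<rho>. c p w \<noteq> 0}"
  have tsh: "shol (t p) (ball 0 r)" if "p \<in> D" for p using t that by blast
  have ah: "holo_on (a p) (ball 0 r)" if "p \<in> D" for p unfolding a_def[abs_def]
    by (intro holo_on_add holo_on_const holo_on_id holo_on_scale tsh that)
  have csh: "shol (c p) (ball 0 r)" if "p \<in> D" for p unfolding c_def[abs_def]
    by (rule shol_compose[OF shol_forms[OF forms_lpoly(3)[OF F]] ah[OF that] subset_UNIV])
  \<comment> \<open>Generic conditions on \<open>w\<close>: the roots on different branches are
    distinct, and on the branches in \<open>D'\<close> the order of vanishing is exactly m.\<close>
  define I where "I = Inl ` {(p, q) \<in> D \<times> D. p \<noteq> q} \<union> Inr ` D'"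
  define f where "f i w = (case i of Inl pq => t (fst pq) w - t (snd pq) w | Inr p => c p w)" for i :: "('p \<times> 'p) + 'p" and w
  have finI: "finite I" unfolding I_def D'_def using fin by (auto intro: finite_subset[of _ "D \<times> D"])
  have "\<exists>w\<in>ball 0 (r / Suc n). \<forall>i\<in>I. f i w \<noteq> 0" for n
  proof -
    let ?V = "ball (0 :: complex ^ 'n option) (r / Suc n)"
    have rn: "0 < r / Suc n" "r / Suc n \<le> r" using r by (auto simp: field_simps)
    have sub: "?V \<subseteq> ball 0 r" by (rule subset_ball[OF rn(2)])
    have fs: "shol (f i) ?V" if "i \<in> I" for i
    proof -
      have "shol (f i) (ball 0 r)"
      proof (cases i)
        case (Inl pq)
        then have "fst pq \<in> D" "snd pq \<in> D" using that by (auto simp: I_def)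
        then show ?thesis unfolding f_def[abs_def] Inl using tsh by (auto intro: shol_diff)
      next
        case (Inr p)
        then have "p \<in> D" using that by (auto simp: I_def D'_def)
        then show ?thesis unfolding f_def[abs_def] Inr using csh by simp
      qed
      then show ?thesis using sub unfolding shol_def by blast
    qed
    have fn: "\<exists>w\<in>?V \<inter> UNIV. f i w \<noteq> 0" if i: "i \<in> I" for i
    proof (cases i)
      case (Inr p)
      then have "p \<in> D'" using i by (auto simp: I_def)
      then show ?thesis using rn(1) Inr by (auto simp: D'_def f_def)
    next
      case (Inl pq)
      then obtain p q where pq: "pq = (p, q)" "p \<in> D" "q \<in> D" "p \<noteq> q" using i by (auto simp: I_def)
      show ?thesis
      proof (rule ccontr)
        assume "\<not> ?thesis"
        then have e: "\<And>w. w \<in> ?V ==> t p w = t q w" using Inl pq by (auto simp: f_def)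
        have z: "0 \<in> ?V" using rn(1) by simp
        have "shol (t p) ?V" using tsh[OF pq(2)] sub unfolding shol_def by blast
        from fd_cong[OF this open_ball z e] have fe: "fd (t q) 0 = fd (t p) 0" .
        \<comment> \<open>Different tangent hyperplanes give the two root functions different
          derivatives at 0, so they cannot coincide near 0.\<close>
        obtain w where w: "dotp w (v p) = 0" "dotp w (v q) \<noteq> 0" using ne pq by blast
        have "fd (t p) 0 w = 0" using t pq(2) w(1) by simp
        moreover have "fd (t q) 0 w \<noteq> 0" using t u pq(3) w(2) by simp
        ultimately show False using fe by simp
      qed
    qed
    have "\<exists>x\<in>?V \<inter> UNIV. \<forall>i\<in>I. f i x \<noteq> 0"
      by (rule shol_prod_nonzero[OF open_ball convex_ball _ _ finI fs fn]) (use rn(1) in auto)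
    then show ?thesis by blast
  qed
  then have "\<forall>n. \<exists>w. w \<in> ball 0 (r / Suc n) \<and> (\<forall>i\<in>I. f i w \<noteq> 0)" by blast
  from choice[OF this] obtain w where w: "\<forall>n. w n \<in> ball 0 (r / Suc n) \<and> (\<forall>i\<in>I. f i (w n) \<noteq> 0)" by (elim exE) (erule that)
  have wr: "w n \<in> ball 0 r" for n
  proof -
    have "r / Suc n \<le> r" using r by (simp add: field_simps)
    then show ?thesis using w subset_ball by blast
  qed
  have w0: "w \<longlonglongrightarrow> 0"
  proof (rule LIMSEQ_norm_0)
    fix n
    have "norm (w n) < r / Suc n" using w by (simp add: dist_norm)
    also have "\<dots> \<le> 1 / Suc n" using r by (intro divide_right_mono) auto
    finally show "norm (w n) < 1 / Suc n" .
  qed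
  have inj: "inj_on (\<lambda>p. t p (w n)) D" for n
  proof (rule inj_onI, rule ccontr)
    fix p q assume pq: "p \<in> D" "q \<in> D" "t p (w n) = t q (w n)" "p \<noteq> q"
    then have "Inl (p, q) \<in> I" by (auto simp: I_def)
    then have "f (Inl (p, q)) (w n) \<noteq> 0" using w by blast
    then show False using pq(3) by (simp add: f_def)
  qed
  have cn: "c p (w n) \<noteq> 0" if "p \<in> D'" for p n
  proof -
    have "Inr p \<in> I" using that by (simp add: I_def)
    then have "f (Inr p) (w n) \<noteq> 0" using w by blast
    then show ?thesis by (simp add: f_def)
  qed
  have tl: "(\<lambda>n. t p (w n)) \<longlonglongrightarrow> 0" if "p \<in> D" for p
  proof -
    have z: "0 \<in> ball 0 r" using r by simp
    have "isCont (t p) 0" by (rule has_derivative_continuous[OF shol_fd[OF tsh[OF that] z]])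
    from isCont_tendsto_compose[OF this w0] show ?thesis using t that by simp
  qed
  define Q where "Q n = lpoly F (h0 + w n) u" for n
  have Ql: "(\<lambda>n. coeff (Q n) i) \<longlonglongrightarrow> coeff (lpoly F h0 u) i" for i
  proof -
    have "isCont (\<lambda>x. coeff (lpoly F x u) i) h0"
      using forms_continuous[OF forms_lpoly(3)[OF F], of UNIV u i] by (simp add: continuous_on_eq_continuous_at)
    moreover have "(\<lambda>n. h0 + w n) \<longlonglongrightarrow> h0" using tendsto_add[OF tendsto_const w0, of h0] by simp
    ultimately show ?thesis unfolding Q_def by (rule isCont_tendsto_compose)
  qed
  have Qd: "degree (Q n) \<le> d" for n unfolding Q_def by (rule forms_lpoly(2)[OF F])
  have rf: "\<exists>T. Q n = [:- t p (w n), 1:] ^ m * T \<and> poly T (t p (w n)) = c p (w n)" if p: "p \<in> D" for p n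
  proof -
    have "a p (w n) \<in> ball h0 \<epsilon>" "\<phi> p (a p (w n)) = 0" using tz p wr unfolding a_def by blast+
    then have "a p (w n) \<noteq> 0" "proj_point (a p (w n)) \<in> S" using S p by blast+
    then have "\<forall>k<m. coeff (lpoly F (h0 + w n + t p (w n) *s u) u) k = 0" using van unfolding a_def by blast
    from lpoly_root_factor[OF F this] show ?thesis unfolding Q_def c_def a_def .
  qed
  have "\<exists>R. Q n = (\<Prod>p\<in>D. [:- t p (w n), 1:] ^ m) * R" for n
  proof -
    have "(\<Prod>p\<in>D. [:- t p (w n), 1:] ^ m) dvd Q n"
      by (rule prod_roots_dvd[OF fin inj]) (use rf in \<open>metis dvd_triv_left\<close>)
    then show ?thesis by (elim dvdE) blast
  qed
  then have "\<forall>n. \<exists>R. Q n = (\<Prod>p\<in>D. [:- t p (w n), 1:] ^ m) * R" by blast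
  from choice[OF this] obtain R where R: "\<forall>n. Q n = (\<Prod>p\<in>D. [:- t p (w n), 1:] ^ m) * R n" by (elim exE) (erule that)
  obtain R0 where R0: "\<forall>i. (\<lambda>n. coeff (R n) i) \<longlonglongrightarrow> coeff R0 i" "lpoly F h0 u = [:0, 1:] ^ (m * card D) * R0"
    using peel_prod[OF fin Ql Qd tl R[rule_format]] by blast
  have Rd: "degree (R n) \<le> d" for n
    by (rule degree_cofactor[of "\<Prod>p\<in>D. [:- t p (w n), 1:] ^ m"]) (use R Qd[of n] fin in auto)
  show ?thesis
  proof (rule that[OF R0(2)])
    assume FS: "\<And>h. h \<noteq> 0 ==> F h = 0 ==> proj_point h \<in> S"
      and gen: "\<And>p \<rho>. p \<in> D ==> 0 < \<rho> ==> \<exists>h\<in>ball h0 \<rho>. \<phi> p h = 0 \<and> coeff (lpoly F h u) m \<noteq> 0"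
    have D': "p \<in> D'" if p: "p \<in> D" for p unfolding D'_def
    proof (intro CollectI conjI p allI impI)
      fix \<rho> :: real assume \<rho>: "0 < \<rho>"
      then obtain h where h: "h \<in> ball h0 (min \<rho> r)" "\<phi> p h = 0" "coeff (lpoly F h u) m \<noteq> 0" using gen[OF p, of "min \<rho> r"] r(1) by auto
      define x where "x = h - h0"
      have x: "x \<in> ball 0 \<rho>" "x \<in> ball 0 r" using h(1) by (auto simp: x_def dist_norm norm_minus_commute)
      have "\<phi> p (h0 + x + 0 *s u) = 0" using h(2) by (simp add: x_def)
      moreover have "norm (0 :: complex) < r" using r(1) by simp
      ultimately have "0 = t p x" using tu p x(2) by blast
      then have "a p x = h" by (simp add: a_def x_def)
      then show "\<exists>w\<in>ball 0 \<rho>. c p w \<noteq> 0" using h(3) x(1) by (auto simp: c_def)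
    qed
    \<comment> \<open>A small root of the cofactor would be a zero of \<open>F\<close>, hence the
      root of some branch, and would raise its order there above m.\<close>
    have nz: "poly (R n) \<tau> \<noteq> 0" if \<tau>: "norm \<tau> < r" for n \<tau>
    proof
      assume z: "poly (R n) \<tau> = 0"
      then have "poly (Q n) \<tau> = 0" using R by simp
      then have "F (h0 + w n + \<tau> *s u) = 0" using forms_lpoly(1)[OF F] by (simp add: Q_def)
      moreover have hb: "h0 + w n + \<tau> *s u \<in> ball h0 \<epsilon>" using inb wr \<tau> by blast
      ultimately obtain p where p: "p \<in> D" "\<phi> p (h0 + w n + \<tau> *s u) = 0" using FS S by blast
      then have te: "\<tau> = t p (w n)" using tu wr \<tau> by blast
      obtain T where T: "Q n = [:- t p (w n), 1:] ^ m * T" "poly T (t p (w n)) = c p (w n)" using rf[OF p(1)] by blast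
      have "[:- t p (w n), 1:] ^ m * T = [:- t p (w n), 1:] ^ m * ((\<Prod>q\<in>D - {p}. [:- t q (w n), 1:] ^ m) * R n)"
        unfolding T(1)[symmetric] R[rule_format] by (subst prod.remove[OF fin p(1)]) (simp only: mult.assoc)
      then have "T = (\<Prod>q\<in>D - {p}. [:- t q (w n), 1:] ^ m) * R n" by (subst (asm) mult_cancel_left) auto
      then have "poly T (t p (w n)) = 0" using z te by simp
      then show False using T(2) cn[OF D'[OF p(1)]] by simp
    qed
    \<comment> \<open>If the limit cofactor vanished at 0, the absence of small roots would force it
      to be zero. Then \<open>F\<close> would vanish on the whole line through \<open>h0\<close>,
      which near \<open>h0\<close> meets the branches only in \<open>h0\<close>.\<close>
    show "coeff R0 0 \<noteq> 0"
    proof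
      assume z: "coeff R0 0 = 0"
      have l0: "(\<lambda>n. norm (poly (R n) 0)) \<longlonglongrightarrow> 0"
        using tendsto_norm[OF poly_tendsto[of R R0 d 0]] R0(1) Rd z by (simp add: poly_0_coeff_0)
      have "poly R0 \<tau> = 0" for \<tau>
      proof -
        have le: "norm (poly (R n) \<tau>) \<le> norm (poly (R n) 0) * (1 + norm \<tau> / r) ^ d" for n
          by (rule no_small_root_bound[OF Rd r(1) nz])
        have "(\<lambda>n. norm (poly (R n) 0) * (1 + norm \<tau> / r) ^ d) \<longlonglongrightarrow> 0" using tendsto_mult_left_zero[OF l0] .
        then have "(\<lambda>n. poly (R n) \<tau>) \<longlonglongrightarrow> 0" by (rule Lim_null_comparison[OF always_eventually[OF allI[OF le]]])
        from LIMSEQ_unique[OF poly_tendsto[of R R0 d \<tau>, OF R0(1)[rule_format] Rd] this] show ?thesis .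
      qed
      then have "R0 = 0" by (intro poly_zero_near[of 1]) auto
      then have L0: "lpoly F h0 u = 0" using R0(2) by simp
      define \<tau> where "\<tau> = complex_of_real (r / 2)"
      have \<tau>: "norm \<tau> < r" "\<tau> \<noteq> 0" using r(1) by (auto simp: \<tau>_def)
      have z: "0 \<in> ball 0 r" using r by simp
      have "F (h0 + 0 + \<tau> *s u) = 0" using forms_lpoly(1)[OF F, of h0 u \<tau>] L0 by simp
      moreover have "h0 + 0 + \<tau> *s u \<in> ball h0 \<epsilon>" using inb z \<tau>(1) by blast
      ultimately obtain p where p: "p \<in> D" "\<phi> p (h0 + 0 + \<tau> *s u) = 0" using FS S by blast
      then have "\<tau> = t p 0" using tu z \<tau>(1) by blast
      then show False using t p(1) \<tau>(2) by simp
    qed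
  qed
qed

section \<open>Spreading a relation from one branch to the dual variety\<close>

lemma forms_compose:
  fixes L :: "complex ^ 'a::finite => complex ^ 'b::finite"
  assumes "G \<in> forms d" and L: "\<And>i. (\<lambda>x. L x $ i) \<in> forms k"
  shows "(\<lambda>x. G (L x)) \<in> forms (d * k)"
  using assms(1)
proof (induction rule: forms_induct)
  case (const c)
  then show ?case using forms_const by simp
next
  case (coord d f i)
  then show ?case using forms_mult[OF L[of i] coord(2)] by simp
qed (rule forms_add)

lemma grad_component_forms: "f \<in> forms e ==> (\<lambda>x. grad f x $ i) \<in> forms (e - 1)"
  using forms_lpoly(3)[of f e "axis i 1" 1] by (simp add: grad_def)

text \<open>If \<open>f0\<close> and \<open>f1\<close> vanish on \<open>X\<close> and have gradients \<open>h0\<close> at \<open>v\<close> and \<open>h1\<close> at \<open>v1\<close>, the hyperplanes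
  \<open>grad f0 w + t *s grad f1 w\<close> are tangent to \<open>X\<close> at \<open>w\<close>; this connects the branch at \<open>h0\<close> with \<open>h1\<close>.\<close>

lemma branch_form_vanish:
  fixes X :: "'n::finite proj set"
  assumes X: "smooth_projective_variety X" and m: "krull_dim zariski X = enat m"
    and v: "v \<in> cone X" "\<And>y. y \<in> tangent X (proj_point v) ==> dotp h0 y = 0"
    and G: "G \<in> forms d" and O: "open O'" "v \<in> O'" "0 < \<epsilon>"
    and van: "\<And>h w. h \<in> ball h0 \<epsilon> ==> w \<in> O' ==> w \<in> cone X ==> (\<And>y. y \<in> tangent X (proj_point w) ==> dotp h y = 0) ==> G h = 0"
    and v1: "v1 \<in> cone X" "\<And>y. y \<in> tangent X (proj_point v1) ==> dotp h1 y = 0"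
  shows "G h1 = 0"
proof -
  have vX: "v \<noteq> 0" "proj_point v \<in> X" "v1 \<noteq> 0" "proj_point v1 \<in> X" using v(1) v1(1) by (auto simp: cone_def)
  obtain e0 f0 where f0: "f0 \<in> forms e0" "X \<subseteq> zeros f0" "grad f0 v = h0" by (rule conormal_gradient[OF vX(1,2) v(2)])
  obtain e1 f1 where f1: "f1 \<in> forms e1" "X \<subseteq> zeros f1" "grad f1 v1 = h1" by (rule conormal_gradient[OF vX(3,4) v1(2)])
  have c0: "continuous_on UNIV (grad f0)"
  proof -
    have "continuous_on UNIV (\<lambda>x. \<chi> i. grad f0 x $ i)"
      by (rule continuous_on_vec_lambda) (rule forms_continuous[OF grad_component_forms[OF f0(1)]])
    then show ?thesis by (simp only: vec_nth_inverse)
  qed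
  define V where "V = O' \<inter> grad f0 -` ball h0 (\<epsilon> / 2)"
  have V: "open V" "v \<in> V" unfolding V_def using O open_vimage[OF open_ball c0] f0(3) by auto
  have "G (grad f1 w) = 0" if w: "w \<in> cone X" "w \<in> V" for w
  proof -
    let ?a = "grad f0 w" and ?b = "grad f1 w"
    have w0: "w \<noteq> 0" using w(1) by (simp add: cone_def)
    define K where "K = 1 + norm ?b"
    define r where "r = \<epsilon> / 2 / K"
    have nb: "K > 0" using norm_ge_zero[of ?b] unfolding K_def by linarith
    have r: "0 < r" using O(3) nb by (simp add: r_def)
    have z: "G (?a + t *s ?b) = 0" if t: "norm t < r" for t
    proof (rule van[OF _ _ w(1)])
      have "norm t * norm ?b \<le> norm t * K" unfolding K_def by (intro mult_left_mono) auto
      also have "\<dots> \<le> r * K" using t nb by (intro mult_right_mono) auto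
      also have "\<dots> = \<epsilon> / 2" using nb by (simp add: r_def)
      finally have "norm (t *s ?b) \<le> \<epsilon> / 2" by simp
      moreover have "norm (?a - h0) < \<epsilon> / 2" using w(2) by (simp add: V_def dist_norm norm_minus_commute)
      ultimately have "norm (?a - h0 + t *s ?b) < \<epsilon>" using norm_triangle_ineq[of "?a - h0" "t *s ?b"] by linarith
      then show "?a + t *s ?b \<in> ball h0 \<epsilon>" by (simp add: dist_norm norm_minus_commute[of h0] algebra_simps)
      show "w \<in> O'" using w(2) by (simp add: V_def)
      fix y assume "y \<in> tangent X (proj_point w)"
      then have "dotp ?a y = 0" "dotp ?b y = 0" unfolding tangent_grad[OF w0] using f0(1,2) f1(1,2) by blast+
      then show "dotp (?a + t *s ?b) y = 0" by simp
    qed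
    have "lpoly G ?a ?b = 0" by (rule poly_zero_near[OF r]) (simp add: forms_lpoly(1)[OF G] z)
    then have all: "G (?a + t *s ?b) = 0" for t using forms_lpoly(1)[OF G, of ?a ?b t] by simp
    \<comment> \<open>By homogeneity the vanishing on all ?a + t ?b gives vanishing on ?b + t ?a for
      t \<noteq> 0, and a polynomial in t that is zero there is zero at t = 0 as well. So
      \<open>G\<close> vanishes at \<open>?b\<close> itself, which may be far from
      \<open>h0\<close>.\<close>
    have "lpoly G ?b ?a = 0"
    proof (rule poly_zero_near[of 1])
      fix t :: complex assume "0 < norm t"
      then have e: "?b + t *s ?a = t *s (?a + (1 / t) *s ?b)" by (simp add: vec_eq_iff field_simps)
      have "G (?b + t *s ?a) = t ^ d * G (?a + (1 / t) *s ?b)" unfolding e by (rule forms_homogeneous[OF G])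
      then show "poly (lpoly G ?b ?a) t = 0" unfolding forms_lpoly(1)[OF G] all by simp
    qed simp
    then show ?thesis using forms_lpoly(1)[OF G, of ?b ?a 0] by simp
  qed
  then have "X \<subseteq> zeros (\<lambda>x. G (grad f1 x))"
    by (intro smooth_identity[OF X m v(1) forms_compose[OF G grad_component_forms[OF f1(1)]] V]) auto
  then show ?thesis using in_zeros_iff[OF forms_compose[OF G grad_component_forms[OF f1(1)]] vX(3)] vX(4) f1(3) by auto
qed

text \<open>The derivative of the degree-M part at \<open>u\<close> along \<open>w\<close> is the
  mixed Taylor coefficient of order M - 1 in \<open>u\<close> and 1 in \<open>w\<close>, which is
  zero by assumption for every \<open>u\<close>. Hence this part is constant along lines in the
  direction \<open>w\<close>.\<close>

lemma directional_multiplicity: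
  fixes F :: "complex ^ 'm::finite => complex"
  assumes F: "F \<in> forms d" and M: "0 < M" and w: "\<And>u. coeff (lpoly (\<lambda>x. coeff (lpoly F x u) (M - 1)) h0 w) 1 = 0"
  shows "coeff (lpoly F h0 (u + s *s w)) M = coeff (lpoly F h0 u) M"
proof -
  let ?L = "\<lambda>u. coeff (lpoly F h0 u) M"
  have L: "?L \<in> forms M" by (rule forms_lpoly(4)[OF F])
  have "coeff (lpoly ?L u w) 1 = 0" for u
  proof -
    \<comment> \<open>Expansion of F(h0 + a w + t u) in two variables: \<open>C j\<close> is the
      coefficient of t^j as a polynomial in a. Putting a = t s and collecting t^M leaves
      \<open>C (M - 1)\<close> responsible for the part linear in s.\<close>
    define C where "C j = lpoly (\<lambda>x. coeff (lpoly F x u) j) h0 w" for j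
    have C: "poly (C j) a = coeff (lpoly F (h0 + a *s w) u) j" for j a unfolding C_def by (rule forms_lpoly(1)[OF forms_lpoly(3)[OF F]])
    have e: "lpoly F h0 (u + s *s w) = (\<Sum>j\<le>d. monom 1 j * pcompose (C j) [:0, s:])" for s
    proof (rule lpoly_unique)
      fix t
      have "F (h0 + t *s (u + s *s w)) = F (h0 + (t * s) *s w + t *s u)"
        by (simp add: vector_add_ldistrib vector_smult_assoc algebra_simps)
      also have "\<dots> = poly (lpoly F (h0 + (t * s) *s w) u) t" by (simp add: forms_lpoly(1)[OF F])
      also have "\<dots> = (\<Sum>j\<le>degree (lpoly F (h0 + (t * s) *s w) u). coeff (lpoly F (h0 + (t * s) *s w) u) j * t ^ j)" by (rule poly_altdef)
      also have "\<dots> = (\<Sum>j\<le>d. coeff (lpoly F (h0 + (t * s) *s w) u) j * t ^ j)"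
        by (rule sum.mono_neutral_left) (use forms_lpoly(2)[OF F] in \<open>auto simp: coeff_eq_0\<close>)
      also have "\<dots> = (\<Sum>j\<le>d. poly (C j) (t * s) * t ^ j)" by (simp add: C)
      also have "\<dots> = poly (\<Sum>j\<le>d. monom 1 j * pcompose (C j) [:0, s:]) t"
        by (simp add: poly_sum poly_monom poly_pcompose mult.commute)
      finally show "poly (\<Sum>j\<le>d. monom 1 j * pcompose (C j) [:0, s:]) t = F (h0 + t *s (u + s *s w))" by simp
    qed
    have Lp: "lpoly ?L u w = (\<Sum>j\<le>d. if j \<le> M then monom (coeff (C j) (M - j)) (M - j) else 0)"
    proof (rule lpoly_unique)
      fix s
      show "poly (\<Sum>j\<le>d. if j \<le> M then monom (coeff (C j) (M - j)) (M - j) else 0) s = ?L (u + s *s w)"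
        unfolding e by (auto simp: poly_sum coeff_sum coeff_monom_mult coeff_pcompose_linear poly_monom intro!: sum.cong)
    qed
    have "coeff (if j \<le> M then monom (coeff (C j) (M - j)) (M - j) else 0) 1 = 0" for j
      using w[of u] M by (cases "j = M - 1") (auto simp: C_def)
    then show ?thesis unfolding Lp coeff_sum by (rule sum.neutral[OF ballI])
  qed
  then have "fd ?L x w = 0" for x using forms_frechet[OF L] by simp
  then have "((\<lambda>s. ?L (u + s *s w)) has_field_derivative 0) (at s)" for s
    using shol_line_field_derivative[OF shol_forms[OF L] UNIV_I, where x = u and t = s and u = w] by simp
  then have "\<exists>c. \<forall>s\<in>UNIV. ?L (u + s *s w) = c"
    by (intro has_field_derivative_zero_constant) auto
  then obtain c where "\<And>s. ?L (u + s *s w) = c" by auto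
  from this[of s] this[of 0] show ?thesis by simp
qed

section \<open>Orders of vanishing on the nodal loci\<close>

lemma nodes_branches:
  fixes X :: "'n::finite proj set"
  assumes X: "smooth_projective_variety X" and m: "krull_dim zariski X = enat m"
    and \<Delta>: "\<Delta> = sing_section X (proj_point h0)" "finite \<Delta>" and nd: "node_data X \<Delta> h0 \<epsilon> \<sigma>"
  shows "branches (dual_variety X) h0 \<Delta> \<epsilon> (\<lambda>p h. dotp h (\<sigma> p h)) (\<lambda>p. \<sigma> p h0)"
proof -
  note \<epsilon> = node_dataD(1)[OF nd] and \<sigma> = node_dataD(2)[OF nd] and nz = node_dataD(3)[OF nd]
    and \<sigma>X = node_dataD(4)[OF nd] and sing = node_dataD(6)[OF nd]
  have b0: "h0 \<in> ball h0 \<epsilon>" using \<epsilon> by simp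
  have v0: "\<sigma> p h0 \<noteq> 0" if "p \<in> \<Delta>" for p using \<sigma>X b0 that by (auto simp: cone_def)
  show ?thesis unfolding branches_def
  proof (intro conjI ballI impI allI \<Delta>(2) \<epsilon>)
    fix p assume p: "p \<in> \<Delta>"
    have h: "holo_on (\<sigma> p) (ball h0 \<epsilon>)" using \<sigma> p by blast
    show "shol (\<lambda>h. dotp h (\<sigma> p h)) (ball h0 \<epsilon>)" by (rule shol_dotp[OF holo_on_id h])
    have "\<Delta> = (\<lambda>p. proj_point (\<sigma> p h0)) ` {p \<in> \<Delta>. dotp h0 (\<sigma> p h0) = 0}" using sing b0 \<Delta>(1) by blast
    then obtain q where "q \<in> \<Delta>" "dotp h0 (\<sigma> q h0) = 0" "p = proj_point (\<sigma> q h0)" using p by blast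
    then show "dotp h0 (\<sigma> p h0) = 0" using \<sigma> by auto
    show "\<sigma> p h0 \<noteq> 0" by (rule v0[OF p])
    fix k
    have "((\<lambda>h. dotp h (\<sigma> p h)) has_derivative (\<lambda>k. dotp h0 (fd (\<sigma> p) h0 k) + dotp k (\<sigma> p h0))) (at h0)"
      by (rule dotp_has_derivative[OF has_derivative_ident holo_on_has_derivative(1)[OF h b0]])
    from fun_cong[OF frechet_derivative_at[OF this, symmetric], of k]
    show "fd (\<lambda>h. dotp h (\<sigma> p h)) h0 k = dotp k (\<sigma> p h0)" using \<sigma>X b0 p by simp
  next
    fix p q assume p: "p \<in> \<Delta>" and q: "q \<in> \<Delta>" and pq: "p \<noteq> q"
    show "\<exists>w. dotp w (\<sigma> p h0) = 0 \<and> dotp w (\<sigma> q h0) \<noteq> 0"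
    proof (rule ccontr)
      assume "\<not> ?thesis"
      then obtain k where k: "\<sigma> q h0 = k *s \<sigma> p h0" using dotp_parallel[OF v0[OF p], of "\<sigma> q h0"] by blast
      then have "k \<noteq> 0" using v0[OF q] by auto
      then have "proj_point (\<sigma> q h0) = proj_point (\<sigma> p h0)" unfolding k by (rule proj_point_scale[OF _ v0[OF p]])
      then show False using \<sigma> p q pq by auto
    qed
  next
    fix h assume h: "h \<in> ball h0 \<epsilon>"
    show hn: "h \<noteq> 0" using nz h by blast
    show "proj_point h \<in> dual_variety X \<longleftrightarrow> (\<exists>p\<in>\<Delta>. dotp h (\<sigma> p h) = 0)"
      unfolding dual_variety_iff[OF X m hn] using sing h by auto
  qed
qed

lemma generic_direction:
  fixes v :: "'p => complex ^ 'm::finite"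
  assumes D: "finite D" "\<And>p. p \<in> D ==> v p \<noteq> 0" and g: "g \<in> forms k" "g u0 \<noteq> 0"
  obtains u where "g u \<noteq> 0" "\<forall>p\<in>D. dotp u (v p) \<noteq> 0"
proof -
  define f where "f i = (case i of None => g | Some p => dotp (v p))" for i
  have fs: "shol (f i) UNIV \<and> (\<exists>x\<in>UNIV \<inter> UNIV. f i x \<noteq> 0)" if i: "i \<in> insert None (Some ` D)" for i
  proof (cases i)
    case None
    then show ?thesis using g shol_forms by (auto simp: f_def)
  next
    case (Some p)
    then have "\<exists>x. dotp (v p) x \<noteq> 0" using dotp_nondegenerate[of "v p"] D(2)[of p] i by blast
    then show ?thesis using Some shol_forms[OF forms_dotp] by (simp add: f_def)
  qed
  have fD: "finite (insert None (Some ` D))" using D(1) by simp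
  have "\<exists>x\<in>UNIV \<inter> UNIV. \<forall>i\<in>insert None (Some ` D). f i x \<noteq> 0"
    by (rule shol_prod_nonzero[OF open_UNIV convex_UNIV UNIV_I _ fD fs[THEN conjunct1] fs[THEN conjunct2]]) auto
  then obtain u where u: "\<forall>i\<in>insert None (Some ` D). f i u \<noteq> 0" by blast
  show ?thesis
  proof (rule that)
    show "g u \<noteq> 0" using u by (auto simp: f_def)
    show "\<forall>p\<in>D. dotp u (v p) \<noteq> 0"
    proof
      fix p assume "p \<in> D"
      then have "f (Some p) u \<noteq> 0" using u by blast
      then show "dotp u (v p) \<noteq> 0" by (simp add: f_def dotp_commute)
    qed
  qed
qed

lemma coeff_X_power_mult: "coeff ([:0, 1:] ^ n * p) k = (if k < n then 0 else coeff p (k - n))" for p :: "complex poly"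
proof -
  have "[:0, 1:] ^ n = monom (1 :: complex) n" by (simp add: monom_altdef)
  then show ?thesis by (simp add: coeff_monom_mult)
qed

text \<open>The factorisation along lines is applied at the branches of \<open>h\<close> itself. It
  requires a direction transversal to all branches, and a nonzero coefficient stays nonzero in a
  generic direction.\<close>

lemma nodal_multiplicity:
  fixes X :: "'n::finite proj set"
  assumes X: "smooth_projective_variety X" and m: "krull_dim zariski X = enat m" and F: "F \<in> forms d"
    and van: "\<And>h k u. h \<noteq> 0 ==> proj_point h \<in> dual_variety X ==> k < m0 ==> coeff (lpoly F h u) k = 0"
    and h: "h \<noteq> 0" "proj_point h \<in> nodal_locus X \<delta>" and k: "k < m0 * \<delta>"
  shows "coeff (lpoly F h u) k = 0"
proof (rule ccontr)
  assume ne: "coeff (lpoly F h u) k \<noteq> 0"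
  let ?\<Delta> = "sing_section X (proj_point h)"
  have fin: "finite ?\<Delta>" "\<forall>p\<in>?\<Delta>. node X (proj_point h) p" "card ?\<Delta> = \<delta>" using h(2) unfolding nodal_locus_def by blast+
  obtain \<epsilon> \<sigma> where nd: "node_data X ?\<Delta> h \<epsilon> \<sigma>" by (rule nodes_local[OF X m h(1) refl fin(1,2)])
  note n = node_dataD[OF nd]
  note B = nodes_branches[OF X m refl fin(1) nd]
  have v: "\<sigma> p h \<noteq> 0" if "p \<in> ?\<Delta>" for p using B that unfolding branches_def by blast
  obtain u' where u': "coeff (lpoly F h u') k \<noteq> 0" "\<forall>p\<in>?\<Delta>. dotp u' (\<sigma> p h) \<noteq> 0"
    by (rule generic_direction[OF fin(1) v forms_lpoly(4)[OF F, of h k] ne])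
  obtain R0 where "lpoly F h u' = [:0, 1:] ^ (m0 * card ?\<Delta>) * R0"
    by (rule branches_factor[OF B F van u'(2)])
  then have "coeff (lpoly F h u') k = 0" using k fin(3) by (simp add: coeff_X_power_mult)
  then show False using u'(1) by blast
qed

text \<open>The least order occurring at the zeros of \<open>F\<close>. It exists because the
  restriction of \<open>F\<close> to a line towards a point where \<open>F\<close> is nonzero is a
  nonzero polynomial, and it is positive because the constant term vanishes.\<close>

lemma generic_multiplicity:
  fixes F :: "complex ^ 'n::finite option => complex"
  assumes F: "F \<in> forms d" "F \<noteq> (\<lambda>_. 0)" and q: "q \<in> zeros F"
  obtains m h1 u1 where "0 < m" "h1 \<noteq> 0" "proj_point h1 \<in> zeros F" "coeff (lpoly F h1 u1) m \<noteq> 0"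
    "\<And>h k u. h \<noteq> 0 ==> proj_point h \<in> zeros F ==> k < m ==> coeff (lpoly F h u) k = 0"
proof -
  define P where "P k = (\<exists>h u. h \<noteq> 0 \<and> proj_point h \<in> zeros F \<and> coeff (lpoly F h u) k \<noteq> 0)" for k
  obtain h1 where h1: "h1 \<noteq> 0" "q = proj_point h1" by (rule proj_cases)
  obtain x where x: "F x \<noteq> 0" using F(2) by auto
  have "poly (lpoly F h1 (x - h1)) 1 = F x" using forms_lpoly(1)[OF F(1), of h1 "x - h1" 1] by simp
  then have "lpoly F h1 (x - h1) \<noteq> 0" using x by auto
  then obtain k where "coeff (lpoly F h1 (x - h1)) k \<noteq> 0" by (auto simp: poly_eq_iff)
  then have Pk: "P k" unfolding P_def using h1 q by blast
  define m where "m = (LEAST k. P k)"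
  have Pm: "P m" unfolding m_def by (rule LeastI[of P k, OF Pk])
  have least: "\<not> P j" if "j < m" for j using not_less_Least that unfolding m_def by blast
  have "\<not> P 0" unfolding P_def using in_zeros_iff[OF F(1)] forms_lpoly_0[OF F(1)] by auto
  then have "0 < m" using Pm by (cases m) auto
  moreover obtain h u where "h \<noteq> 0" "proj_point h \<in> zeros F" "coeff (lpoly F h u) m \<noteq> 0" using Pm unfolding P_def by blast
  moreover have "coeff (lpoly F h u) k = 0" if "h \<noteq> 0" "proj_point h \<in> zeros F" "k < m" for h k u
    using least[OF that(3)] that(1,2) unfolding P_def by blast
  ultimately show ?thesis by (rule that)
qed

text \<open>A direction in the tangent hyperplane of branch p is the velocity of a curve inside the
  branch. On this curve \<open>F\<close> is zero, and dividing by s^M and letting s tend to 0 leaves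
  the leading form.\<close>

lemma leading_form_vanish:
  fixes F :: "complex ^ 'n::finite option => complex"
  assumes B: "branches S h0 D \<epsilon> \<phi> v" and F: "F \<in> forms d" and FS: "\<And>h. h \<noteq> 0 ==> proj_point h \<in> S ==> F h = 0"
    and low: "\<And>u k. k < M ==> coeff (lpoly F h0 u) k = 0" and p: "p \<in> D" and u: "dotp u (v p) = 0"
  shows "coeff (lpoly F h0 u) M = 0"
proof (cases "M \<le> d")
  case False
  then show ?thesis using forms_lpoly(2)[OF F, of h0 u] by (intro coeff_eq_0) simp
next
  case True
  have fin: "finite D" and v: "\<And>p. p \<in> D ==> v p \<noteq> 0" and bS: "\<And>h. h \<in> ball h0 \<epsilon> ==> h \<noteq> 0 \<and> (proj_point h \<in> S \<longleftrightarrow> (\<exists>p\<in>D. \<phi> p h = 0))"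
    using B by (auto simp: branches_def)
  obtain u' where u': "(1 :: complex) \<noteq> 0" "\<forall>p\<in>D. dotp u' (v p) \<noteq> 0"
    by (rule generic_direction[OF fin v forms_const[of 1]]) auto
  obtain r t where r: "0 < r" "r \<le> 1" and t: "\<forall>p\<in>D. shol (t p) (ball 0 r) \<and> t p 0 = 0 \<and> (\<forall>w. fd (t p) 0 w = - dotp w (v p) / dotp u' (v p))"
    and tz: "\<forall>p\<in>D. \<forall>w\<in>ball 0 r. h0 + w + t p w *s u' \<in> ball h0 \<epsilon> \<and> \<phi> p (h0 + w + t p w *s u') = 0"
    and "\<forall>p\<in>D. \<forall>w\<in>ball 0 r. \<forall>\<tau>. norm \<tau> < r --> \<phi> p (h0 + w + \<tau> *s u') = 0 --> \<tau> = t p w"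
    and "\<forall>w\<in>ball 0 r. \<forall>\<tau>. norm \<tau> < r --> h0 + w + \<tau> *s u' \<in> ball h0 \<epsilon>"
    by (rule branches_roots[OF B u'(2)])
  have tsh: "shol (t p) (ball 0 r)" and t0: "t p 0 = 0" and tD: "fd (t p) 0 u = 0" using t p u by auto
  have z: "(0 :: complex ^ 'n option) + (0 :: complex) *s u \<in> ball 0 r" using r by simp
  have "((\<lambda>s. t p (0 + s *s u)) has_field_derivative fd (t p) (0 + 0 *s u) u) (at 0)"
    by (rule shol_line_field_derivative[OF tsh z])
  then have "((\<lambda>s. t p (s *s u)) has_field_derivative 0) (at 0)" using tD by simp
  then have q: "((\<lambda>s. t p (s *s u) / s) \<longlongrightarrow> 0) (at 0)" unfolding DERIV_def using t0 by simp
  \<comment> \<open>\<open>h0 + s *s U s\<close> runs in the branch. The correction along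
    \<open>u'\<close> is of smaller order than s, because the derivative of the root function along
    \<open>u\<close> is 0; so \<open>U s\<close> tends to \<open>u\<close>.\<close>
  define U where "U s = u + (t p (s *s u) / s) *s u'" for s
  have Ul: "(U \<longlongrightarrow> u) (at 0)"
  proof -
    have "((\<lambda>s. U s $ i) \<longlongrightarrow> u $ i) (at 0)" for i
      using tendsto_add[OF tendsto_const tendsto_mult[OF q tendsto_const], of "u $ i" "u' $ i"] by (simp add: U_def)
    then show ?thesis by (rule vec_tendstoI)
  qed
  \<comment> \<open>Since the lower coefficients vanish, this is F(h0 + s x) / s^M for s \<noteq> 0,
    written so that it makes sense at s = 0.\<close>
  define A where "A x s = (\<Sum>k=M..d. coeff (lpoly F h0 x) k * s ^ (k - M))" for x s

  have "eventually (\<lambda>s. s *s u \<in> ball 0 r) (at (0::complex))"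
  proof -
    have "((\<lambda>s::complex. norm s * norm u) \<longlongrightarrow> norm (0::complex) * norm u) (at 0)"
      by (rule tendsto_mult[OF tendsto_norm[OF tendsto_ident_at] tendsto_const])
    then have "eventually (\<lambda>s. norm s * norm u < r) (at (0::complex))" using r(1) by (intro order_tendstoD(2)) auto
    then show ?thesis by (simp add: dist_norm)
  qed
  moreover have "eventually (\<lambda>s. s \<noteq> 0) (at (0::complex))" by (simp add: eventually_at_filter)
  ultimately have ev: "eventually (\<lambda>s. A (U s) s = 0) (at 0)"
  proof eventually_elim
    case (elim s)
    have hs: "h0 + s *s u + t p (s *s u) *s u' = h0 + s *s U s" using elim(2) by (simp add: U_def vec_eq_iff field_simps)
    have "h0 + s *s U s \<in> ball h0 \<epsilon> \<and> \<phi> p (h0 + s *s U s) = 0" using tz p elim(1) unfolding hs[symmetric] by blast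
    then have "F (h0 + s *s U s) = 0" using FS bS p by blast
    then have "poly (lpoly F h0 (U s)) s = 0" by (simp add: forms_lpoly(1)[OF F])
    also have "poly (lpoly F h0 (U s)) s = (\<Sum>k\<le>d. coeff (lpoly F h0 (U s)) k * s ^ k)" unfolding poly_altdef
      by (rule sum.mono_neutral_left) (use forms_lpoly(2)[OF F] in \<open>auto simp: coeff_eq_0\<close>)
    also have "\<dots> = (\<Sum>k=M..d. coeff (lpoly F h0 (U s)) k * s ^ k)"
      by (rule sum.mono_neutral_right) (auto simp: low)
    also have "\<dots> = s ^ M * A (U s) s" unfolding A_def sum_distrib_left
      by (rule sum.cong) (simp_all add: power_add[symmetric] mult.left_commute)
    finally show ?case using elim(2) by simp
  qed
  have "((\<lambda>s. A (U s) s) \<longlongrightarrow> A u 0) (at 0)" unfolding A_def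
  proof (intro tendsto_sum tendsto_mult tendsto_power tendsto_ident_at)
    fix k
    have "isCont (\<lambda>x. coeff (lpoly F h0 x) k) u"
      using forms_continuous[OF forms_lpoly(4)[OF F], of UNIV h0 k] by (simp add: continuous_on_eq_continuous_at)
    then show "((\<lambda>s. coeff (lpoly F h0 (U s)) k) \<longlongrightarrow> coeff (lpoly F h0 u) k) (at 0)" by (rule isCont_tendsto_compose[OF _ Ul])
  qed
  moreover have "((\<lambda>s. A (U s) s) \<longlongrightarrow> 0) (at 0)" using tendsto_eventually[OF ev] .
  ultimately have "A u 0 = 0" by (rule tendsto_unique[OF trivial_limit_at])
  moreover have "A u 0 = coeff (lpoly F h0 u) M"
  proof -
    have "A u 0 = (\<Sum>k\<in>{M..d}. if k = M then coeff (lpoly F h0 u) M else 0)" unfolding A_def by (rule sum.cong) auto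
    then show ?thesis using True by (simp add: sum.delta)
  qed
  ultimately show ?thesis by simp
qed

section \<open>Components of the nodal locus through the given hyperplane\<close>

lemma dim_annihilator:
  fixes v :: "'p => complex ^ 'm::finite"
  assumes ind: "\<forall>p\<in>D. \<exists>u. dotp u (v p) \<noteq> 0 \<and> (\<forall>q\<in>D - {p}. dotp u (v q) = 0)" and T: "\<And>w p. w \<in> T ==> p \<in> D ==> dotp w (v p) = 0"
  shows "vec.dim T + card D \<le> CARD('m)"
proof -
  obtain J b where b: "\<forall>i. i \<notin> J --> b i \<in> v ` D" "\<forall>j\<in>J. b j = axis j 1" "\<forall>u. (\<forall>i. dotp (b i) u = 0) --> u = 0"
    "\<forall>r\<in>v ` D. \<exists>c. r = (\<Sum>i\<in>-J. c i *s b i)" and dim: "vec.dim {u. \<forall>r\<in>v ` D. dotp r u = 0} = card J"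
    by (rule row_basis)
  have "v ` D \<subseteq> vec.span (b ` (- J))"
  proof
    fix r assume "r \<in> v ` D"
    then obtain c where r: "r = (\<Sum>i\<in>-J. c i *s b i)" using b(4) by blast
    show "r \<in> vec.span (b ` (- J))" unfolding r
      by (rule vec.span_sum, rule vec.span_scale, rule vec.span_base, rule imageI)
  qed
  then have "card (v ` D) \<le> card (b ` (- J))"
    using vec.independent_span_bound[OF _ independent_image_dotp(1)[OF ind]] by simp
  also have "\<dots> \<le> card (- J)" by (rule card_image_le) simp
  finally have "card D \<le> CARD('m) - card J"
    using card_image[OF independent_image_dotp(2)[OF ind]] by (simp add: Compl_eq_Diff_UNIV card_Diff_subset)
  moreover have "vec.dim T \<le> card J" unfolding dim[symmetric]
    by (rule vec.dim_subset) (use T in \<open>auto simp: dotp_commute\<close>)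
  moreover have "card J \<le> CARD('m)" by (rule card_mono) auto
  ultimately show ?thesis by linarith
qed

lemma nodal_component_dim:
  fixes X :: "'n::finite proj set"
  assumes X: "smooth_projective_variety X" and m: "krull_dim zariski X = enat m" and hs: "hypersurface (dual_variety X)"
    and h0: "h0 \<noteq> 0" "proj_point h0 \<in> dual_variety X" and \<Delta>: "\<Delta> = sing_section X (proj_point h0)" "finite \<Delta>"
    and nd: "node_data X \<Delta> h0 \<epsilon> \<sigma>" and ind: "\<forall>p\<in>\<Delta>. \<exists>u. dotp u (\<sigma> p h0) \<noteq> 0 \<and> (\<forall>q\<in>\<Delta> - {p}. dotp u (\<sigma> q h0) = 0)"
    and Z: "irreducible_in zariski Z" "Z \<subseteq> nodal_locus X (card \<Delta>)" "proj_point h0 \<in> Z"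
  shows "krull_dim zariski Z \<le> enat (CARD('n) - card \<Delta>)"
proof -
  obtain d F where F: "F \<in> forms d" "F \<noteq> (\<lambda>_. 0)" and XF: "dual_variety X = zeros F" using hs unfolding hypersurface_def by blast
  obtain m0 h1 u1 where m0: "0 < m0" "h1 \<noteq> 0" "proj_point h1 \<in> zeros F" "coeff (lpoly F h1 u1) m0 \<noteq> 0"
    and van: "\<And>h k u. h \<noteq> 0 ==> proj_point h \<in> zeros F ==> k < m0 ==> coeff (lpoly F h u) k = 0"
    by (rule generic_multiplicity[OF F h0(2)[unfolded XF]]) blast
  note n = node_dataD[OF nd]
  note B = nodes_branches[OF X m \<Delta>(1,2) nd]
  have b0: "h0 \<in> ball h0 \<epsilon>" using n(1) by simp
  have v: "\<sigma> p h0 \<noteq> 0" "\<sigma> p h0 \<in> cone X" if "p \<in> \<Delta>" for p using n(4) b0 that by (auto simp: cone_def)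
  define M where "M = m0 * card \<Delta>"
  have "\<Delta> \<noteq> {}" using h0 dual_variety_iff[OF X m h0(1)] \<Delta>(1) by blast
  then have M: "0 < M" using m0(1) \<Delta>(2) by (simp add: M_def card_gt_0_iff)
  have low: "coeff (lpoly F h u) k = 0" if "h \<noteq> 0" "proj_point h \<in> nodal_locus X (card \<Delta>)" "k < M" for h u k
    by (rule nodal_multiplicity[OF X m F(1) _ that(1,2) that(3)[unfolded M_def]]) (use van XF in blast)
  \<comment> \<open>One direction with two properties: it detects the exact multiplicity
    \<open>m0\<close> at \<open>h1\<close>, and it is transversal to every branch at
    \<open>h0\<close>.\<close>
  obtain u where u: "coeff (lpoly F h1 u) m0 \<noteq> 0" "\<forall>p\<in>\<Delta>. dotp u (\<sigma> p h0) \<noteq> 0"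
    by (rule generic_direction[OF \<Delta>(2) v(1) forms_lpoly(4)[OF F(1)] m0(4)])
  have Lu: "coeff (lpoly F h0 u) M \<noteq> 0"
  proof (rule branches_factor[OF B[unfolded XF] F(1) van u(2)])
    fix R0 assume R0: "lpoly F h0 u = [:0, 1:] ^ (m0 * card \<Delta>) * R0"
      "(\<And>h. h \<noteq> 0 ==> F h = 0 ==> proj_point h \<in> zeros F) ==>
        (\<And>p \<rho>. p \<in> \<Delta> ==> 0 < \<rho> ==> \<exists>h\<in>ball h0 \<rho>. dotp h (\<sigma> p h) = 0 \<and> coeff (lpoly F h u) m0 \<noteq> 0) ==> coeff R0 0 \<noteq> 0"
    have "coeff R0 0 \<noteq> 0"
    proof (rule R0(2))
      fix h assume "h \<noteq> 0" "F h = 0" then show "proj_point h \<in> zeros F" using in_zeros_iff[OF F(1)] by blast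
    next
      fix p and \<rho> :: real assume p: "p \<in> \<Delta>" and \<rho>: "0 < \<rho>"
      show "\<exists>h\<in>ball h0 \<rho>. dotp h (\<sigma> p h) = 0 \<and> coeff (lpoly F h u) m0 \<noteq> 0"
      proof (rule ccontr)
        assume no: "\<not> ?thesis"
        obtain N where N: "open N" "p \<in> N" "\<forall>h\<in>ball h0 \<epsilon>. \<forall>q\<in>X. q \<in> N --> (\<forall>u\<in>tangent X q. dotp h u = 0) --> dotp h (\<sigma> p h) = 0"
          using n(8) p by blast
        have pX: "p \<in> X" using p unfolding \<Delta>(1) sing_section_def by blast
        have sp: "proj_point (\<sigma> p h0) = p" using n(2) p by blast
        have tp: "dotp h0 y = 0" if "y \<in> tangent X (proj_point (\<sigma> p h0))" for y
          using sing_section_iff[OF X m h0(1) pX] p that unfolding sp \<Delta>(1) by blast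
        obtain q where q: "q \<in> X" "tangent X q \<subseteq> hyp (proj_point h1)" using m0(3) unfolding XF[symmetric] dual_variety_def by blast
        obtain v1 where v1: "v1 \<noteq> 0" "q = proj_point v1" by (rule proj_cases)
        have v1c: "v1 \<in> cone X" using v1 q(1) by (simp add: cone_def)
        have t1: "dotp h1 y = 0" if "y \<in> tangent X (proj_point v1)" for y
          using q(2) that unfolding v1(2) hyp_proj_point[OF m0(2)] by blast
        have oN: "open (cone N)" "\<sigma> p h0 \<in> cone N" using N(1,2) sp v(1)[OF p] by (simp_all add: open_proj_iff cone_def)
        \<comment> \<open>If the coefficient of order \<open>m0\<close> along \<open>u\<close>
          vanished on the branch near \<open>h0\<close>, it would vanish on all hyperplanes tangent
          to \<open>X\<close>, among them \<open>h1\<close>, against the choice of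
          \<open>u\<close>.\<close>
        have "coeff (lpoly F h1 u) m0 = 0"
        proof (rule branch_form_vanish[OF X m v(2)[OF p] tp forms_lpoly(3)[OF F(1)] oN _ _ v1c t1])
          show "0 < min \<epsilon> \<rho>" using n(1) \<rho> by simp
          fix h w assume h: "h \<in> ball h0 (min \<epsilon> \<rho>)" and w: "w \<in> cone N" "w \<in> cone X" and t: "\<And>y. y \<in> tangent X (proj_point w) ==> dotp h y = 0"
          have "proj_point w \<in> X" "proj_point w \<in> N" "h \<in> ball h0 \<epsilon>" "h \<in> ball h0 \<rho>" using w h by (auto simp: cone_def)
          moreover from this have "dotp h (\<sigma> p h) = 0" using N(3) t by blast
          ultimately show "coeff (lpoly F h u) m0 = 0" using no by blast
        qed
        then show False using u(1) by blast
      qed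
    qed
    then show "coeff (lpoly F h0 u) M \<noteq> 0" unfolding R0(1) M_def by (simp add: coeff_X_power_mult)
  qed
  have zero: "F h = 0" if "h \<noteq> 0" "proj_point h \<in> dual_variety X" for h
    using that in_zeros_iff[OF F(1) that(1)] unfolding XF by blast
  have h0n: "proj_point h0 \<in> nodal_locus X (card \<Delta>)" using Z by blast
  \<comment> \<open>Translating \<open>u\<close> along \<open>w\<close> does not change the leading
    form. If \<open>w\<close> were transversal to branch p, some translate of \<open>u\<close> would
    lie in its tangent hyperplane, where the leading form vanishes, contradicting
    \<open>Lu\<close>.\<close>
  have perp: "dotp w (\<sigma> p h0) = 0" if w: "w \<in> tangent (zcl Z) (proj_point h0)" and p: "p \<in> \<Delta>" for w p
  proof (rule ccontr)
    assume ne: "dotp w (\<sigma> p h0) \<noteq> 0"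
    have "coeff (lpoly (\<lambda>x. coeff (lpoly F x u') (M - 1)) h0 w) 1 = 0" for u'
    proof -
      let ?g = "\<lambda>x. coeff (lpoly F x u') (M - 1)"
      have g: "?g \<in> forms (d - (M - 1))" by (rule forms_lpoly(3)[OF F(1)])
      have "Z \<subseteq> zeros ?g"
      proof
        fix q assume q: "q \<in> Z"
        obtain h where h: "h \<noteq> 0" "q = proj_point h" by (rule proj_cases)
        have "?g h = 0" by (rule low[OF h(1)]) (use q h(2) Z(2) M in auto)
        then show "q \<in> zeros ?g" using in_zeros_iff[OF g h(1)] h(2) by blast
      qed
      then have "zcl Z \<subseteq> zeros ?g" using zcl_subset_zeros[OF g] by blast
      then show ?thesis using w g unfolding tangent_proj_point[OF h0(1)] by blast
    qed
    from directional_multiplicity[OF F(1) M this]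
    have a: "coeff (lpoly F h0 (u + s *s w)) M = coeff (lpoly F h0 u) M" for s .
    have "coeff (lpoly F h0 (u + (- dotp u (\<sigma> p h0) / dotp w (\<sigma> p h0)) *s w)) M = 0"
      by (rule leading_form_vanish[OF B F(1) zero low[OF h0(1) h0n] p]) (use ne in auto)
    then show False using Lu unfolding a by blast
  qed
  \<comment> \<open>Here independence of the lifts of the nodes enters: one linear condition for
    each node lowers the dimension by \<open>card \<Delta>\<close>.\<close>
  have dim: "vec.dim (tangent (zcl Z) (proj_point h0)) + card \<Delta> \<le> Suc CARD('n)"
    using dim_annihilator[OF ind perp] by (simp add: card_option)
  have hZ: "h0 \<in> cone (zcl Z)"
  proof -
    have "Z \<subseteq> zcl Z" by (auto simp: zcl_def)
    then show ?thesis using h0(1) Z(3) by (auto simp: cone_def)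
  qed
  show ?thesis
  proof (rule krull_dim_le)
    fix k Y assume Y: "achain Y k" "Y k \<subseteq> zcl Z"
    show "k \<le> CARD('n) - card \<Delta>" using krull_chain_tangent[OF irreducible_zcl[OF Z(1)] hZ Y] dim by linarith
  qed
qed

text \<open>Zorn's lemma: in a union of a chain, two sets not contained in two given zero sets lie
  in a common member, so the union is irreducible again.\<close>

lemma irreducible_component_exists:
  fixes S :: "'n::finite proj set"
  assumes "irreducible_in zariski T" "T \<subseteq> S"
  obtains Z where "Z \<in> irreducible_components zariski S" "T \<subseteq> Z"
proof -
  define \<A> where "\<A> = {Z. T \<subseteq> Z \<and> Z \<subseteq> S \<and> irreducible_in zariski Z}"
  have "\<exists>M\<in>\<A>. \<forall>Y\<in>\<A>. M \<subseteq> Y --> Y = M"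
  proof (rule subset_Zorn_nonempty)
    show "\<A> \<noteq> {}" using assms unfolding \<A>_def by blast
    fix \<C> assume ne: "\<C> \<noteq> {}" and ch: "subset.chain \<A> \<C>"
    have sub: "\<C> \<subseteq> \<A>" and lin: "\<And>A B. A \<in> \<C> ==> B \<in> \<C> ==> A \<subseteq> B \<or> B \<subseteq> A"
      using ch by (auto simp: subset.chain_def)
    have "irreducible_in zariski (\<Union>\<C>)" unfolding irreducible_iff
    proof (intro conjI allI ballI impI)
      show "\<Union>\<C> \<noteq> {}" using ne sub assms(1) unfolding \<A>_def irreducible_iff by blast
      fix d e and f g :: "complex ^ 'n option => complex" assume f: "f \<in> forms d" and g: "g \<in> forms e" and fg: "\<Union>\<C> \<subseteq> zeros f \<union> zeros g"
      show "\<Union>\<C> \<subseteq> zeros f \<or> \<Union>\<C> \<subseteq> zeros g"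
      proof (rule ccontr)
        assume "\<not> ?thesis"
        then obtain A B where AB: "A \<in> \<C>" "\<not> A \<subseteq> zeros f" "B \<in> \<C>" "\<not> B \<subseteq> zeros g" by blast
        obtain C where C: "C \<in> \<C>" "A \<subseteq> C" "B \<subseteq> C" using lin[OF AB(1,3)] AB(1,3) by blast
        have "irreducible_in zariski C" using C(1) sub unfolding \<A>_def by blast
        moreover have "C \<subseteq> zeros f \<union> zeros g" using C(1) fg by blast
        ultimately have "C \<subseteq> zeros f \<or> C \<subseteq> zeros g" using f g unfolding irreducible_iff by blast
        then show False using AB C by blast
      qed
    qed
    then show "\<Union>\<C> \<in> \<A>" using ne sub unfolding \<A>_def by blast
  qed
  then obtain M where M: "M \<in> \<A>" "\<forall>Y\<in>\<A>. M \<subseteq> Y --> Y = M" by blast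
  have "M \<in> irreducible_components zariski S" using M unfolding irreducible_components_def \<A>_def by blast
  moreover have "T \<subseteq> M" using M(1) unfolding \<A>_def by blast
  ultimately show ?thesis by (rule that)
qed

text \<open>A flag of coordinate subspaces inside the stratum gives irreducible sets. Consecutive
  ones are separated by linear forms, because the coordinates outside \<open>J\<close> are linear in
  the lift \<open>s\<close>.\<close>

lemma component_of_coordinates:
  fixes U :: "'n::finite proj set"
  assumes c: "coord_chart U z s" and S: "S \<inter> U = {q \<in> U. card {j \<in> J. z q $ j = 0} = card J}" and H: "H \<in> U" "z H = 0"
    and e: "\<forall>x\<in>z ` U. \<forall>j. j \<notin> J --> x $ j = dotp (s x) (e j)"
  obtains Z where "Z \<in> irreducible_components zariski S" "H \<in> Z" "enat (CARD('n) - card J) \<le> krull_dim zariski Z"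
proof -
  note C = coord_chartD[OF c]
  have "0 \<in> z ` U" using H by (metis imageI)
  then obtain \<rho> where \<rho>: "\<rho> > 0" "ball 0 \<rho> \<subseteq> z ` U" using C(2) by (meson open_contains_ball)
  define n where "n = CARD('n) - card J"
  have n: "card (- J) = n" by (simp add: n_def Compl_eq_Diff_UNIV card_Diff_subset)
  obtain f where f: "bij_betw f {0..<n} (- J)" using ex_bij_betw_nat_finite[of "- J"] n by auto
  have fJ: "f i \<notin> J" if "i < n" for i using f that by (auto simp: bij_betw_def)
  have finj: "f i \<noteq> f j" if ij: "j < i" "i < n" for i j
  proof
    assume "f i = f j"
    then have "i = j" by (rule inj_onD[OF bij_betw_imp_inj_on[OF f]]) (use ij in auto)
    then show False using ij by simp
  qed
  define L where "L i = {x :: complex ^ 'n. \<forall>j. j \<notin> f ` {..<i} --> x $ j = 0}" for i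
  define T where "T i = (\<lambda>y. proj_point (s y)) ` (ball 0 \<rho> \<inter> L i)" for i
  have sh: "holo_on s (ball 0 \<rho>)" "\<And>y. y \<in> ball 0 \<rho> ==> s y \<noteq> 0" using holo_on_subset[OF C(4) \<rho>(2)] C(7) \<rho>(2) by blast+
  have irr: "irreducible_in zariski (T i)" for i unfolding T_def
  proof (rule irreducible_image[OF open_ball convex_ball _ _ sh])
    have "0 \<in> ball 0 \<rho> \<inter> L i" using \<rho>(1) by (simp add: L_def)
    then show "ball 0 \<rho> \<inter> L i \<noteq> {}" by blast
  qed (auto simp: L_def)
  have TS: "T i \<subseteq> S" if i: "i \<le> n" for i
  proof
    fix q assume "q \<in> T i"
    then obtain y where y: "y \<in> ball 0 \<rho>" "y \<in> L i" "q = proj_point (s y)" by (auto simp: T_def)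
    have yU: "y \<in> z ` U" using y(1) \<rho>(2) by blast
    have "y $ j = 0" if j: "j \<in> J" for j
    proof -
      have "j \<notin> f ` {..<i}" using fJ i j by auto
      then show ?thesis using y(2) by (simp add: L_def)
    qed
    then have "{j \<in> J. z q $ j = 0} = J" using C(9)[OF yU] y(3) by auto
    then show "q \<in> S" using S C(8)[OF yU] y(3) by auto
  qed
  have "L i \<subseteq> L (Suc i)" for i by (auto simp: L_def lessThan_Suc)
  then have mono: "T i \<subseteq> T (Suc i)" for i unfolding T_def by blast
  have HT: "H \<in> T n"
  proof -
    have "0 \<in> ball 0 \<rho> \<inter> L n" using \<rho>(1) by (simp add: L_def)
    moreover have "proj_point (s 0) = H" using C(6)[OF H(1)] H(2) by simp
    ultimately show ?thesis unfolding T_def by (metis (no_types, lifting) imageI)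
  qed
  have ls: "\<exists>k. \<exists>l\<in>forms k. T i \<subseteq> zeros l \<and> \<not> T (Suc i) \<subseteq> zeros l" if i: "i < n" for i
  proof (intro exI bexI conjI)
    let ?l = "dotp (e (f i))"
    show l: "?l \<in> forms 1" by (rule forms_dotp)
    have val: "proj_point (s y) \<in> zeros ?l \<longleftrightarrow> y $ f i = 0" if y: "y \<in> ball 0 \<rho>" for y
    proof -
      have "y \<in> z ` U" using y \<rho>(2) by blast
      then have "y $ f i = dotp (e (f i)) (s y)" using e fJ[OF i] dotp_commute by metis
      then show ?thesis using in_zeros_iff[OF l sh(2)[OF y]] by simp
    qed
    have "f i \<notin> f ` {..<i}" using finj i by fastforce
    then show "T i \<subseteq> zeros ?l" using val by (auto simp: T_def L_def)
    define y :: "complex ^ 'n" where "y = axis (f i) (complex_of_real (\<rho> / 2))"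
    have "norm y = \<rho> / 2" using \<rho>(1) by (simp add: y_def norm_axis_1 norm_vec_def L2_set_def axis_def if_distrib[of norm] if_distrib[of "\<lambda>x. x ^ 2"] cong: if_cong)
    then have yb: "y \<in> ball 0 \<rho>" using \<rho>(1) by (simp add: dist_norm)
    moreover have "y \<in> L (Suc i)" by (auto simp: L_def y_def axis_def)
    ultimately have "proj_point (s y) \<in> T (Suc i)" by (simp add: T_def)
    moreover have "y $ f i \<noteq> 0" using \<rho>(1) by (simp add: y_def axis_def)
    then have "proj_point (s y) \<notin> zeros ?l" using val[OF yb] by blast
    ultimately show "\<not> T (Suc i) \<subseteq> zeros ?l" by blast
  qed
  obtain Z where Z: "Z \<in> irreducible_components zariski S" "T n \<subseteq> Z" by (rule irreducible_component_exists[OF irr TS[OF order_refl]])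
  have TZ: "T i \<subseteq> Z" if "i \<le> n" for i using lift_Suc_mono_le[of T, OF mono that] Z(2) by blast
  have "enat n \<le> krull_dim zariski Z" by (rule krull_dim_ge[of n T Z, OF irr TZ mono ls])
  with Z(1) show ?thesis using that HT Z(2) unfolding n_def by blast
qed

text \<open>A single chart carries all local assertions: in it the dual variety is the union of the
  coordinate hyperplanes with index in \<open>J\<close>, and the r-nodal locus consists of the
  points on exactly r of them.\<close>

theorem theorem3p2:
  fixes X :: "('n::finite) proj set" and H :: "'n proj" and N n \<delta> :: nat
  assumes "CARD('n) = N"
    and "smooth_projective_variety X"
    and "krull_dim zariski X = enat (2 * n)"
    and "complete_linear_system X"
    and "hypersurface (dual_variety X)"
    and "H \<in> dual_variety X"
    and "finite (sing_section X H)"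
    and "card (sing_section X H) = \<delta>"
    and "\<forall>p\<in>sing_section X H. node X H p"
    and "H1_vanishes X (twisted_ideal_sections X (sing_section X H) 1)"
  shows "(\<exists>U. open U \<and> H \<in> U \<and>
            (\<forall>B. coordinate_ball B \<and> H \<in> B \<and> B \<subseteq> U \<longrightarrow>
               normal_crossings_divisor B (B \<inter> dual_variety X) \<and>
               (\<forall>r. 1 \<le> r \<and> r \<le> \<delta> \<longrightarrow>
                  B \<inter> nodal_locus X r \<noteq> {} \<and>
                  smooth_of_pure_dim (B \<inter> nodal_locus X r) (N - r)))) \<and>
         smooth_at (nodal_locus X \<delta>) (N - \<delta>) H \<and>
         expected_dimension_at X \<delta> H"
proof -
  note X = assms(2) and m = assms(3)
  obtain h0 where h0: "h0 \<noteq> 0" "H = proj_point h0" by (rule proj_cases)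
  define \<Delta> where "\<Delta> = sing_section X H"
  have \<Delta>: "\<Delta> = sing_section X (proj_point h0)" "finite \<Delta>" "\<forall>p\<in>\<Delta>. node X (proj_point h0) p" "card \<Delta> = \<delta>" "\<Delta> \<subseteq> X"
    using assms(7,8,9) h0(2) by (auto simp: \<Delta>_def sing_section_def)
  have Hd: "proj_point h0 \<in> dual_variety X" using assms(6) h0(2) by simp
  have \<delta>: "1 \<le> \<delta>" using Hd dual_variety_iff[OF X m h0(1)] \<Delta> by (metis One_nat_def Suc_leI card_gt_0_iff)
  obtain \<epsilon> \<sigma> where nd: "node_data X \<Delta> h0 \<epsilon> \<sigma>" by (rule nodes_local[OF X m h0(1) \<Delta>(1,2,3)])
  note n = node_dataD[OF nd]
  note B = nodes_branches[OF X m \<Delta>(1,2) nd]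
  have b0: "h0 \<in> ball h0 \<epsilon>" using n(1) by simp
  have v: "\<sigma> p h0 \<noteq> 0" "dotp h0 (\<sigma> p h0) = 0" if "p \<in> \<Delta>" for p using B that unfolding branches_def by blast+
  \<comment> \<open>The vanishing of cohomology enters here, as linear forms that single out one
    node.\<close>
  have ind: "\<forall>p\<in>\<Delta>. \<exists>u. dotp u (\<sigma> p h0) \<noteq> 0 \<and> (\<forall>q\<in>\<Delta> - {p}. dotp u (\<sigma> q h0) = 0)"
  proof
    fix p assume p: "p \<in> \<Delta>"
    obtain u where "\<forall>v. v \<noteq> 0 \<longrightarrow> proj_point v = p \<longrightarrow> dotp u v \<noteq> 0" "\<forall>v. v \<noteq> 0 \<longrightarrow> proj_point v \<in> \<Delta> - {p} \<longrightarrow> dotp u v = 0"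
      by (rule independent_conditions[OF assms(4) assms(10)[folded \<Delta>_def] \<Delta>(2,5) p])
    then show "\<exists>u. dotp u (\<sigma> p h0) \<noteq> 0 \<and> (\<forall>q\<in>\<Delta> - {p}. dotp u (\<sigma> q h0) = 0)" using v(1) n(2) p by (intro exI[of _ u]) auto
  qed
  have vz: "\<forall>p\<in>\<Delta>. dotp h0 (\<sigma> p h0) = 0" using v(2) by blast
  obtain e :: "'n \<Rightarrow> complex ^ 'n option" and \<iota> w where e: "inj_on \<iota> \<Delta>" "\<forall>p\<in>\<Delta>. e (\<iota> p) = \<sigma> p h0" "\<forall>j. dotp h0 (e j) = 0" "dotp h0 w = 1"
    "\<forall>k. (\<forall>j. dotp k (e j) = 0) \<longrightarrow> dotp k w = 0 \<longrightarrow> k = 0"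
    by (rule lift_basis[OF h0(1) vz ind])
  have \<sigma>h: "\<forall>p\<in>\<Delta>. holo_on (\<sigma> p) (ball h0 \<epsilon>)" "\<forall>p\<in>\<Delta>. \<forall>k. dotp h0 (fd (\<sigma> p) h0 k) = 0"
    using n(2,4) b0 by blast+
  obtain U :: "'n proj set" and z s where c: "coord_chart U z s" and U: "proj_point h0 \<in> U" "z (proj_point h0) = 0" "s 0 = h0"
    "\<forall>x\<in>z ` U. s x \<in> ball h0 \<epsilon>" "\<forall>x\<in>z ` U. \<forall>p\<in>\<Delta>. x $ \<iota> p = dotp (s x) (\<sigma> p (s x))"
    "\<forall>x\<in>z ` U. \<forall>j. j \<notin> \<iota> ` \<Delta> \<longrightarrow> x $ j = dotp (s x) (e j)"
    by (rule nodal_chart[OF n(1) \<sigma>h e])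
  define J where "J = \<iota> ` \<Delta>"
  have cJ: "card J = \<delta>" using card_image[OF e(1)] \<Delta>(4) by (simp add: J_def)
  note C = coord_chartD[OF c]
  have pt: "s (z q) \<in> ball h0 \<epsilon>" "proj_point (s (z q)) = q" "\<forall>p\<in>\<Delta>. z q $ \<iota> p = dotp (s (z q)) (\<sigma> p (s (z q)))" if "q \<in> U" for q
    using U(4,5) C(6) that by blast+
  have BD: "proj_point h \<in> dual_variety X \<longleftrightarrow> (\<exists>p\<in>\<Delta>. dotp h (\<sigma> p h) = 0)" if h: "h \<in> ball h0 \<epsilon>" for h
  proof -
    have "h \<noteq> 0" using n(3) h by blast
    then show ?thesis unfolding dual_variety_iff[OF X m \<open>h \<noteq> 0\<close>] bspec[OF n(6) h] by blast
  qed
  have dualU: "dual_variety X \<inter> U = {q \<in> U. \<exists>j\<in>J. z q $ j = 0}"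
  proof -
    have "q \<in> dual_variety X \<longleftrightarrow> (\<exists>j\<in>J. z q $ j = 0)" if q: "q \<in> U" for q
    proof -
      have "proj_point (s (z q)) \<in> dual_variety X \<longleftrightarrow> (\<exists>p\<in>\<Delta>. dotp (s (z q)) (\<sigma> p (s (z q))) = 0)"
        by (rule BD[OF pt(1)[OF q]])
      also have "\<dots> \<longleftrightarrow> (\<exists>j\<in>J. z q $ j = 0)" unfolding J_def using pt(3)[OF q] by simp
      finally show ?thesis unfolding pt(2)[OF q] .
    qed
    then show ?thesis by blast
  qed
  \<comment> \<open>The coordinate of index \<open>\<iota> p\<close> is zero exactly when node p
    persists, so counting singular points counts zero coordinates. For r = 0 this would fail, since
    the nodal locus is taken inside the dual variety.\<close>
  have nodU: "nodal_locus X r \<inter> U = {q \<in> U. card {j \<in> J. z q $ j = 0} = r}" if r: "1 \<le> r" for r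
  proof -
    have "q \<in> nodal_locus X r \<longleftrightarrow> card {j \<in> J. z q $ j = 0} = r" if q: "q \<in> U" for q
    proof -
      let ?h = "s (z q)"
      let ?D = "{p \<in> \<Delta>. dotp ?h (\<sigma> p ?h) = 0}"
      have sg: "sing_section X q = (\<lambda>p. proj_point (\<sigma> p ?h)) ` ?D" using bspec[OF n(6) pt(1)[OF q]] unfolding pt(2)[OF q] .
      have "inj_on (\<lambda>p. proj_point (\<sigma> p ?h)) ?D" by (rule inj_on_subset[OF bspec[OF n(5) pt(1)[OF q]]]) blast
      then have "card (sing_section X q) = card ?D" unfolding sg by (rule card_image)
      also have "?D = {p \<in> \<Delta>. z q $ \<iota> p = 0}" using pt(3)[OF q] by auto
      also have "card \<dots> = card (\<iota> ` {p \<in> \<Delta>. z q $ \<iota> p = 0})"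
        by (rule card_image[symmetric]) (rule inj_on_subset[OF e(1)], blast)
      also have "\<iota> ` {p \<in> \<Delta>. z q $ \<iota> p = 0} = {j \<in> J. z q $ j = 0}" by (auto simp: J_def)
      finally have cs: "card (sing_section X q) = card {j \<in> J. z q $ j = 0}" .
      have "finite (sing_section X q)" unfolding sg using \<Delta>(2) by simp
      moreover have "\<forall>p\<in>sing_section X q. node X q p" using bspec[OF n(7) pt(1)[OF q]] unfolding pt(2)[OF q] .
      moreover have "q \<in> dual_variety X" if cr: "card {j \<in> J. z q $ j = 0} = r"
      proof -
        have "{j \<in> J. z q $ j = 0} \<noteq> {}" using cr r by (metis card.empty not_one_le_zero)
        then show ?thesis using dualU q by blast
      qed
      ultimately show ?thesis unfolding nodal_locus_def using cs by auto
    qed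
    then show ?thesis by blast
  qed
  have HU: "H \<in> U" "z H = 0" using U(1,2) h0(2) by simp_all
  have near: "normal_crossings_divisor B (B \<inter> dual_variety X) \<and>
      (\<forall>r. 1 \<le> r \<and> r \<le> \<delta> \<longrightarrow> B \<inter> nodal_locus X r \<noteq> {} \<and> smooth_of_pure_dim (B \<inter> nodal_locus X r) (N - r))"
    if b: "coordinate_ball B" "H \<in> B" "B \<subseteq> U" for B
  proof (intro conjI allI impI)
    have Bo: "open B" by (rule open_coordinate_ball[OF b(1)])
    show "normal_crossings_divisor B (B \<inter> dual_variety X)" by (rule normal_crossings_of_coordinates[OF c dualU Bo b(3)])
    fix r assume r: "1 \<le> r \<and> r \<le> \<delta>"
    show "B \<inter> nodal_locus X r \<noteq> {}"
      by (rule coordinates_nonempty[OF c nodU _ Bo b(2) HU]) (use r cJ in auto)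
    show "smooth_of_pure_dim (B \<inter> nodal_locus X r) (N - r)"
      using smooth_of_coordinates(2)[OF c nodU Bo b(3)] r assms(1) by simp
  qed
  have Hn: "H \<in> nodal_locus X \<delta>" unfolding nodal_locus_def using assms(6-9) by simp
  have sm: "smooth_at (nodal_locus X \<delta>) (N - \<delta>) H"
    using smooth_of_coordinates(1)[OF c nodU[OF \<delta>] Hn HU(1)] assms(1) by simp
  have up: "krull_dim zariski Z \<le> enat (CARD('n) - \<delta>)" if Z: "Z \<in> irreducible_components zariski (nodal_locus X \<delta>)" "H \<in> Z" for Z
    using nodal_component_dim[OF X m assms(5) h0(1) Hd \<Delta>(1,2) nd ind, of Z] Z h0(2) \<Delta>(4) unfolding irreducible_components_def by auto
  have nodJ: "nodal_locus X \<delta> \<inter> U = {q \<in> U. card {j \<in> J. z q $ j = 0} = card J}" unfolding cJ by (rule nodU[OF \<delta>])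
  \<comment> \<open>The component containing the coordinate flag has at least the expected
    dimension, and \<open>up\<close> excludes more.\<close>
  obtain Z where Z: "Z \<in> irreducible_components zariski (nodal_locus X \<delta>)" "H \<in> Z" "enat (CARD('n) - card J) \<le> krull_dim zariski Z"
    by (rule component_of_coordinates[OF c nodJ HU U(6)[folded J_def]])
  have "krull_dim zariski Z = enat (CARD('n) - \<delta>)" using Z(3) up[OF Z(1,2)] cJ by simp
  then have ed: "expected_dimension_at X \<delta> H" unfolding expected_dimension_at_def using Z(1,2) up by blast
  show ?thesis using C(1) HU(1) near sm ed by blast
qed

end
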